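(* Let $c>1$ be an integer coprime to $6$ and $\mathscr S$ the set of primes dividing $c$. The cochain $\boldsymbol{DR}_{\mathscr S}=d^0\tilde E$ (defined in the context) is a cocycle in $Z^1(G_{\mathscr S},\mathcal{D}'(V_{\mathbb{A}}^{\mathscr S},\mathbb{Z}))$, and it is the unique element of $Z^1(G_{\mathscr S},\mathcal{D}'(V_{\mathbb{A}}^{\mathscr S},\mathbb{Z}))$ satisfying, for all $f\in\mathcal{S}(V_{\mathbb{A}}^{\mathscr S})'$: (1) $\boldsymbol{DR}_{\mathscr S}(\mathrm{Id},\gamma)=0$ for every $\gamma\in T_{\mathscr S}$; (2) $\boldsymbol{DR}_{\mathscr S}(\mathrm{Id},T)(f)=-\tfrac12(\mathbb{B}_2\otimes\mathbb{B}_0)_c(f|T)+\Psi(f|T)-\Psi(f)$; (3) $\boldsymbol{DR}_{\mathscr S}(\mathrm{Id},S)(f)=(\mathbb{B}_1\otimes\mathbb{B}_1)_c(f)+\Psi(f|S)-\Psi(f)$, where $T=\begin{bmatrix}1&1\\0&1\end{bmatrix}$ and $S=\begin{bmatrix}0&-1\\1&0\end{bmatrix}$.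
   Context: $V=\mathbb{Q}^2$ (row vectors). For a prime $\ell$, $\mathcal{S}(V_\ell)$: locally constant compactly supported $\mathbb{Z}$-valued functions on $\mathbb{Q}_\ell^2$; $f^0_\ell=$ characteristic function of $\mathbb{Z}_\ell^2$. $\mathcal{S}(V_{\mathbb{A}}^{\mathscr S})=\bigotimes'_{\ell\notin\mathscr S}\mathcal{S}(V_\ell)$ (restricted w.r.t. $f_\ell^0$), $\mathcal{S}(V_{\mathbb{A}}^{\mathscr S})'$ the functions vanishing at $0$, $\mathcal{D}'(V_{\mathbb{A}}^{\mathscr S},A)=\mathrm{Hom}(\mathcal{S}(V_{\mathbb{A}}^{\mathscr S})',A)$. $\mathbb{Z}_{\mathscr S}$: rationals integral at the primes dividing $c$; $G_{\mathscr S}=\mathrm{GL}_2^+(\mathbb{Z}_{\mathscr S})$; $T_{\mathscr S}$ its diagonal matrices. $\mathrm{GL}_2(\mathbb{Q})$ acts by $(f|\gamma)(v)=f(v\gamma^{-1})$ componentwise and on distributions with values in a right module by $(\gamma*\mu)(f)=\mu(f|\gamma)|\gamma^{-1}$; on $\mathcal{O}_{\mathcal H}$ (holomorphic functions on the upper half plane) $(F|\gamma)(\tau)=F(\gamma\tau)$, on $\mathbb{Z},\mathbb{Q}$ trivially. For $(a,b)\in\mathbb{Z}_{\mathscr S}^2$, $[(a,b)+\mathbb{Z}^2]:=\bigotimes_{\ell\notin\mathscr S}[(a,b)+\mathbb{Z}_\ell^2]$. All distributions below are invariant under the scalar matrices $\mathrm{diag}(t,t)$, $t\in\mathbb{Z}_{\mathscr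 S}^\times$, and are thereby determined by their values on $f=[(a,b)+\mathbb{Z}^2]$, $(a,b)\in\mathbb{Z}_{\mathscr S}^2\setminus\mathbb{Z}^2$, which are as follows. Write $\{x\}$ for the fractional part, $B_1(x)=\{x\}-\frac12$, $\mathbb{B}_1(x)=\{x\}-\frac12$ if $x\notin\mathbb{Z}$ and $0$ if $x\in\mathbb{Z}$, $B_2(x)=x^2-x+\frac16$, $\delta_0(x)=1$ if $x\in\mathbb{Z}$ and $0$ otherwise. For a distribution $\mu$ (written additively) with such values, $\mu_c(f):=c^2\mu([(a,b)+\mathbb{Z}^2])-\mu([(ca,cb)+\mathbb{Z}^2])$ (multiplicatively: $\mu(\cdot)^{c^2}/\mu([(ca,cb)+\mathbb{Z}^2])$). Values: $(\mathbb{B}_2\otimes\mathbb{B}_0)(f)=B_2(\{a\})$; $(\mathbb{B}_1\otimes\mathbb{B}_1)(f)=\mathbb{B}_1(a)\mathbb{B}_1(b)$; $(\delta_0\otimes\mathbb{B}_1)(f)=\delta_0(a)\mathbb{B}_1(b)$; $(\delta_0\otimes\mathrm{Clog})(f)=\delta_0(a)\log(1-e^{2\pi ib})$ with $\log(1-x)=-\sum_{n\ge1}x^n/n$; $\pi_c(f)=B_1(bc)\,(cB_1(a)-B_1(ac))$; $\Psi=\pi_c+\frac12(\delta_0\otimes\mathbb{B}_1)_c$; $u(f)(\tau)=\prod_{y>0,\,y\equiv a\ (\mathbb{Z})}(1-e^{2\pi i(y\tau+b)})\prod_{y<0,\,y\equiv a\ (\mathbb{Z})}(1-e^{2\pi i(-y\tau-b)})$,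 a nowhere vanishing holomorphic function of $\tau$. Define $\tilde E\in\mathcal{D}'(V_{\mathbb{A}}^{\mathscr S},\mathcal{O}_{\mathcal H})$ by $\tilde E(f)(\tau)=\frac{\tau}{2}(\mathbb{B}_2\otimes\mathbb{B}_0)_c(f)+\pi_c(f)+\frac{1}{2\pi i}(\delta_0\otimes\mathrm{Clog})_c(f)+\frac{1}{2\pi i}\int_{i\infty}^{\tau}\mathrm{dlog}(u_c(f))$, and the homogeneous cochain $\boldsymbol{DR}_{\mathscr S}(\gamma_0,\gamma_1)=\gamma_1*\tilde E-\gamma_0*\tilde E$ for $\gamma_0,\gamma_1\in G_{\mathscr S}$; thus $\boldsymbol{DR}_{\mathscr S}(\mathrm{Id},\gamma)(f)(\tau)=\tilde E(f|\gamma)(\gamma^{-1}\tau)-\tilde E(f)(\tau)$.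
   Formalization: Condition (1) is stated only for diagonal matrices with positive entries, and invariance under diag(t,t) is required only for t>0: by (3) and S²=−Id, DR(Id,−Id)(f)=Ψ(f|−Id)−Ψ(f), which is −(c−1)/2 at f=[(1/N,0)+Z²] (N>c prime to c), so (1) fails at −Id. *)

theory Defs
  imports "HOL-Complex_Analysis.Complex_Analysis"
begin

section \<open>The fields \<open>\<rat>\<^sub>\<ell>\<close>\<close>

definition padic_abs :: "nat \<Rightarrow> rat \<Rightarrow> real" where
  "padic_abs l x = (if x = 0 then 0 else
     real l powi (int (multiplicity (int l) (snd (quotient_of x)))
                - int (multiplicity (int l) (fst (quotient_of x)))))"

definition padic_Cauchy :: "nat \<Rightarrow> (nat \<Rightarrow> rat) set" where
  "padic_Cauchy l = {x. \<forall>e>0. \<exists>N. \<forall>m\<ge>N. \<forall>n\<ge>N. padic_abs l (x m - x n) < e}"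

definition padic_rel :: "nat \<Rightarrow> ((nat \<Rightarrow> rat) \<times> (nat \<Rightarrow> rat)) set" where
  "padic_rel l = {(x, y). x \<in> padic_Cauchy l \<and> y \<in> padic_Cauchy l \<and>
     (\<lambda>n. padic_abs l (x n - y n)) \<longlonglongrightarrow> 0}"

type_synonym padic = "(nat \<Rightarrow> rat) set"

text \<open>\<open>\<rat>\<^sub>\<ell>\<close> is the completion of \<open>\<rat>\<close> for the \<open>\<ell>\<close>-adic absolute value, as classes of Cauchy sequences.\<close>

definition Qp :: "nat \<Rightarrow> padic set" where
  "Qp l = padic_Cauchy l // padic_rel l"

definition padic_of_rat :: "nat \<Rightarrow> rat \<Rightarrow> padic" where
  "padic_of_rat l r = padic_rel l `` {\<lambda>_. r}"

definition padic_add :: "nat \<Rightarrow> padic \<Rightarrow> padic \<Rightarrow> padic" where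
  "padic_add l X Y = (\<Union>x\<in>X. \<Union>y\<in>Y. padic_rel l `` {\<lambda>n. x n + y n})"

definition padic_mult :: "nat \<Rightarrow> padic \<Rightarrow> padic \<Rightarrow> padic" where
  "padic_mult l X Y = (\<Union>x\<in>X. \<Union>y\<in>Y. padic_rel l `` {\<lambda>n. x n * y n})"

definition padic_dist :: "nat \<Rightarrow> padic \<Rightarrow> padic \<Rightarrow> real" where
  "padic_dist l X Y = (if X \<in> Qp l \<and> Y \<in> Qp l then
     (THE d. \<forall>x\<in>X. \<forall>y\<in>Y. (\<lambda>n. padic_abs l (x n - y n)) \<longlonglongrightarrow> d) else 0)"

definition Zp :: "nat \<Rightarrow> padic set" where
  "Zp l = {X \<in> Qp l. padic_dist l X (padic_of_rat l 0) \<le> 1}"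

definition Vp_topology :: "nat \<Rightarrow> (padic \<times> padic) topology" where
  "Vp_topology l = prod_topology (Metric_space.mtopology (Qp l) (padic_dist l))
                                 (Metric_space.mtopology (Qp l) (padic_dist l))"

section \<open>Test functions\<close>

text \<open>Functions on \<open>\<rat>\<^sub>\<ell>\<^sup>2\<close>, on the adelic space, and on the upper half plane are extended by \<open>0\<close> to the
  whole type, so that equality of functions is equality on the domain.\<close>

definition schwartz_loc :: "nat \<Rightarrow> (padic \<times> padic \<Rightarrow> int) set" where
  "schwartz_loc l = {f. (\<forall>v. v \<notin> Qp l \<times> Qp l \<longrightarrow> f v = 0) \<and>
     (\<forall>v \<in> Qp l \<times> Qp l. \<exists>U. openin (Vp_topology l) U \<and> v \<in> U \<and> (\<forall>w\<in>U. f w = f v)) \<and>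
     (\<exists>K. compactin (Vp_topology l) K \<and> (\<forall>v. v \<notin> K \<longrightarrow> f v = 0))}"

definition coset_loc :: "rat \<Rightarrow> rat \<Rightarrow> nat \<Rightarrow> padic \<times> padic \<Rightarrow> int" where
  "coset_loc a b l = indicator ((padic_add l (padic_of_rat l a) ` Zp l) \<times>
                                (padic_add l (padic_of_rat l b) ` Zp l))"

definition places :: "nat set \<Rightarrow> nat set" where
  "places S = {l. prime l \<and> l \<notin> S}"

type_synonym adele2 = "nat \<Rightarrow> padic \<times> padic"

definition VA :: "nat set \<Rightarrow> adele2 set" where
  "VA S = {v \<in> places S \<rightarrow>\<^sub>E UNIV. (\<forall>l\<in>places S. v l \<in> Qp l \<times> Qp l) \<and>
     finite {l \<in> places S. v l \<notin> Zp l \<times> Zp l}}"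

definition VA_zero :: "nat set \<Rightarrow> adele2" where
  "VA_zero S = (\<lambda>l\<in>places S. (padic_of_rat l 0, padic_of_rat l 0))"

text \<open>For a restricted family \<open>F\<close> and \<open>v\<close> in the restricted product, all but finitely many factors
  \<open>F l (v l)\<close> equal \<open>1\<close>.\<close>

definition pure_tensor :: "nat set \<Rightarrow> (nat \<Rightarrow> padic \<times> padic \<Rightarrow> int) \<Rightarrow> adele2 \<Rightarrow> int" where
  "pure_tensor S F v =
     (if v \<in> VA S then (\<Prod>l\<in>{l \<in> places S. F l (v l) \<noteq> 1}. F l (v l)) else 0)"

definition restricted_families :: "nat set \<Rightarrow> (nat \<Rightarrow> padic \<times> padic \<Rightarrow> int) set" where
  "restricted_families S = {F. (\<forall>l\<in>places S. F l \<in> schwartz_loc l) \<and>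
     finite {l \<in> places S. F l \<noteq> coset_loc 0 0 l}}"

text \<open>The restricted tensor product of the \<open>\<S>(V\<^sub>\<ell>)\<close>, realised (faithfully) as the \<open>\<int>\<close>-span of the
  pure tensors among the functions on the restricted product of the \<open>\<rat>\<^sub>\<ell>\<^sup>2\<close>.\<close>

definition schwartz :: "nat set \<Rightarrow> (adele2 \<Rightarrow> int) set" where
  "schwartz S = {f. \<exists>(n::nat) k F. (\<forall>i<n. F i \<in> restricted_families S) \<and>
     f = (\<lambda>v. \<Sum>i<n. k i * pure_tensor S (F i) v)}"

definition schwartz' :: "nat set \<Rightarrow> (adele2 \<Rightarrow> int) set" where
  "schwartz' S = {f \<in> schwartz S. f (VA_zero S) = 0}"

definition coset_fun :: "nat set \<Rightarrow> rat \<Rightarrow> rat \<Rightarrow> adele2 \<Rightarrow> int" where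
  "coset_fun S a b = pure_tensor S (coset_loc a b)"

section \<open>Groups and actions\<close>

definition Z_S :: "nat set \<Rightarrow> rat set" where
  "Z_S S = {x. \<forall>l\<in>S. padic_abs l x \<le> 1}"

definition Z_S_units :: "nat set \<Rightarrow> rat set" where
  "Z_S_units S = {x. x \<noteq> 0 \<and> x \<in> Z_S S \<and> inverse x \<in> Z_S S}"

definition G_S :: "nat set \<Rightarrow> (rat^2^2) set" where
  "G_S S = {g. (\<forall>i j. g $ i $ j \<in> Z_S S) \<and> det g \<in> Z_S_units S \<and> det g > 0}"

definition T_S :: "nat set \<Rightarrow> (rat^2^2) set" where
  "T_S S = {g \<in> G_S S. g $ 1 $ 2 = 0 \<and> g $ 2 $ 1 = 0}"

text \<open>\<open>T_S\<close> contains \<open>-1\<close>, on which the cochain \<open>DR\<close> below is nonzero: as \<open>S\<^sup>2 = -1\<close>, the formula for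
  \<open>DR (1, S)\<close> gives \<open>DR (1, -1) f = \<Psi> (f | -1) - \<Psi> f\<close>, which is \<open>(1 - c) / 2\<close> at
  \<open>f = [(1/N, 0) + \<int>\<^sup>2]\<close> for \<open>N > c\<close> prime to \<open>c\<close>. Vanishing on the torus can therefore
  only be asserted for diagonal matrices with positive entries.\<close>

definition mat_T :: "rat^2^2" where
  "mat_T = vector [vector [1, 1], vector [0, 1]]"

definition mat_S :: "rat^2^2" where
  "mat_S = vector [vector [0, -1], vector [1, 0]]"

definition row_mult :: "nat \<Rightarrow> padic \<times> padic \<Rightarrow> rat^2^2 \<Rightarrow> padic \<times> padic" where
  "row_mult l v g =
     (padic_add l (padic_mult l (fst v) (padic_of_rat l (g $ 1 $ 1)))
                  (padic_mult l (snd v) (padic_of_rat l (g $ 2 $ 1))),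
      padic_add l (padic_mult l (fst v) (padic_of_rat l (g $ 1 $ 2)))
                  (padic_mult l (snd v) (padic_of_rat l (g $ 2 $ 2))))"

definition slash :: "nat set \<Rightarrow> (adele2 \<Rightarrow> int) \<Rightarrow> rat^2^2 \<Rightarrow> adele2 \<Rightarrow> int" where
  "slash S f g v =
     (if v \<in> VA S then f (\<lambda>l\<in>places S. row_mult l (v l) (matrix_inv g)) else 0)"

definition upper_half :: "complex set" where
  "upper_half = {z. Im z > 0}"

definition moebius :: "rat^2^2 \<Rightarrow> complex \<Rightarrow> complex" where
  "moebius g z = (of_rat (g $ 1 $ 1) * z + of_rat (g $ 1 $ 2)) /
                 (of_rat (g $ 2 $ 1) * z + of_rat (g $ 2 $ 2))"

definition O_slash :: "(complex \<Rightarrow> complex) \<Rightarrow> rat^2^2 \<Rightarrow> complex \<Rightarrow> complex" where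
  "O_slash F g z = (if z \<in> upper_half then F (moebius g z) else 0)"

definition O_units :: "(complex \<Rightarrow> complex) set" where
  "O_units = {F. F holomorphic_on upper_half \<and> (\<forall>z\<in>upper_half. F z \<noteq> 0) \<and>
     (\<forall>z. z \<notin> upper_half \<longrightarrow> F z = 0)}"

section \<open>Distributions\<close>

text \<open>Distributions, too, take the neutral value outside \<open>\<S>(V)'\<close>.\<close>

definition distributions :: "nat set \<Rightarrow> ((adele2 \<Rightarrow> int) \<Rightarrow> 'a::ab_group_add) set" where
  "distributions S = {\<mu>. (\<forall>f. f \<notin> schwartz' S \<longrightarrow> \<mu> f = 0) \<and>
     (\<forall>f\<in>schwartz' S. \<forall>g\<in>schwartz' S. \<mu> (\<lambda>v. f v + g v) = \<mu> f + \<mu> g)}"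

definition mult_distributions :: "nat set \<Rightarrow> ((adele2 \<Rightarrow> int) \<Rightarrow> complex \<Rightarrow> complex) set" where
  "mult_distributions S = {\<mu>. (\<forall>f. f \<notin> schwartz' S \<longrightarrow> \<mu> f = (\<lambda>_. 1)) \<and>
     (\<forall>f\<in>schwartz' S. \<mu> f \<in> O_units) \<and>
     (\<forall>f\<in>schwartz' S. \<forall>g\<in>schwartz' S. \<mu> (\<lambda>v. f v + g v) = (\<lambda>z. \<mu> f z * \<mu> g z))}"

text \<open>Invariance is required for the positive scalars only: they already suffice to determine a
  distribution from its values on cosets of \<open>\<int>\<^sup>2\<close>, while \<open>-1\<close> has to be excluded because the values
  of, for instance, \<open>\<delta>\<^sub>0 \<otimes> B\<^sub>1\<close> are not even in \<open>(a, b)\<close>. Scalars act trivially on all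
  the coefficient modules used, so the slash on values is omitted.\<close>

definition scalar_invariant :: "nat set \<Rightarrow> ((adele2 \<Rightarrow> int) \<Rightarrow> 'a) \<Rightarrow> bool" where
  "scalar_invariant S \<mu> \<longleftrightarrow>
     (\<forall>t\<in>Z_S_units S. t > 0 \<longrightarrow> (\<forall>f\<in>schwartz' S. \<mu> (slash S f (mat t)) = \<mu> f))"

definition has_coset_values ::
  "nat set \<Rightarrow> (rat \<Rightarrow> rat \<Rightarrow> 'a) \<Rightarrow> ((adele2 \<Rightarrow> int) \<Rightarrow> 'a) \<Rightarrow> bool" where
  "has_coset_values S val \<mu> \<longleftrightarrow>
     (\<forall>a\<in>Z_S S. \<forall>b\<in>Z_S S. \<not> (a \<in> \<int> \<and> b \<in> \<int>) \<longrightarrow> \<mu> (coset_fun S a b) = val a b)"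

definition the_dist ::
  "nat set \<Rightarrow> (rat \<Rightarrow> rat \<Rightarrow> 'a) \<Rightarrow> (adele2 \<Rightarrow> int) \<Rightarrow> 'a::ab_group_add" where
  "the_dist S val =
     (THE \<mu>. \<mu> \<in> distributions S \<and> scalar_invariant S \<mu> \<and> has_coset_values S val \<mu>)"

definition the_mult_dist ::
  "nat set \<Rightarrow> (rat \<Rightarrow> rat \<Rightarrow> complex \<Rightarrow> complex) \<Rightarrow> (adele2 \<Rightarrow> int) \<Rightarrow> complex \<Rightarrow> complex" where
  "the_mult_dist S val =
     (THE \<mu>. \<mu> \<in> mult_distributions S \<and> scalar_invariant S \<mu> \<and> has_coset_values S val \<mu>)"

definition smooth ::
  "nat set \<Rightarrow> nat \<Rightarrow> ((adele2 \<Rightarrow> int) \<Rightarrow> 'a::comm_ring_1) \<Rightarrow> (adele2 \<Rightarrow> int) \<Rightarrow> 'a" where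
  "smooth S c \<mu> = the_dist S (\<lambda>a b. of_nat (c ^ 2) * \<mu> (coset_fun S a b)
                                    - \<mu> (coset_fun S (of_nat c * a) (of_nat c * b)))"

definition mult_smooth ::
  "nat set \<Rightarrow> nat \<Rightarrow> ((adele2 \<Rightarrow> int) \<Rightarrow> complex \<Rightarrow> complex) \<Rightarrow> (adele2 \<Rightarrow> int) \<Rightarrow> complex \<Rightarrow> complex" where
  "mult_smooth S c \<mu> = the_mult_dist S (\<lambda>a b z. \<mu> (coset_fun S a b) z ^ (c ^ 2)
                                    / \<mu> (coset_fun S (of_nat c * a) (of_nat c * b)) z)"

definition bern1 :: "rat \<Rightarrow> rat" where
  "bern1 x = frac x - 1 / 2"

definition bern1' :: "rat \<Rightarrow> rat" where
  "bern1' x = (if x \<in> \<int> then 0 else frac x - 1 / 2)"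

definition bern2 :: "rat \<Rightarrow> rat" where
  "bern2 x = x ^ 2 - x + 1 / 6"

definition delta0 :: "rat \<Rightarrow> 'a::zero_neq_one" where
  "delta0 x = (if x \<in> \<int> then 1 else 0)"

definition ee :: "complex \<Rightarrow> complex" where
  "ee z = exp (2 * of_real pi * \<i> * z)"

definition log_one_minus :: "complex \<Rightarrow> complex" where
  "log_one_minus x = - (\<Sum>n. x ^ Suc n / of_nat (Suc n))"

definition B2_B0 :: "nat set \<Rightarrow> (adele2 \<Rightarrow> int) \<Rightarrow> rat" where
  "B2_B0 S = the_dist S (\<lambda>a b. bern2 (frac a))"

definition B1_B1 :: "nat set \<Rightarrow> (adele2 \<Rightarrow> int) \<Rightarrow> rat" where
  "B1_B1 S = the_dist S (\<lambda>a b. bern1' a * bern1' b)"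

definition delta0_B1 :: "nat set \<Rightarrow> (adele2 \<Rightarrow> int) \<Rightarrow> rat" where
  "delta0_B1 S = the_dist S (\<lambda>a b. delta0 a * bern1' b)"

definition delta0_Clog :: "nat set \<Rightarrow> (adele2 \<Rightarrow> int) \<Rightarrow> complex" where
  "delta0_Clog S = the_dist S (\<lambda>a b. delta0 a * log_one_minus (ee (of_rat b)))"

definition pi_c :: "nat set \<Rightarrow> nat \<Rightarrow> (adele2 \<Rightarrow> int) \<Rightarrow> rat" where
  "pi_c S c = the_dist S (\<lambda>a b.
     bern1 (b * of_nat c) * (of_nat c * bern1 a - bern1 (a * of_nat c)))"

definition Psi :: "nat set \<Rightarrow> nat \<Rightarrow> (adele2 \<Rightarrow> int) \<Rightarrow> rat" where
  "Psi S c f = pi_c S c f + 1 / 2 * smooth S c (delta0_B1 S) f"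

text \<open>The positive \<open>y \<equiv> a\<close> modulo \<open>\<int>\<close> are the positive ones among \<open>frac a + n\<close>, \<open>n \<ge> 0\<close>; the negative
  ones are the \<open>frac a - 1 - n\<close>, \<open>n \<ge> 0\<close>.\<close>

definition u_val :: "rat \<Rightarrow> rat \<Rightarrow> complex \<Rightarrow> complex" where
  "u_val a b z = (if z \<in> upper_half then
     (\<Prod>n. let y = frac a + of_nat n in
        if y > 0 then 1 - ee (of_rat y * z + of_rat b) else 1) *
     (\<Prod>n. let y = frac a - 1 - of_nat n in
        1 - ee (- of_rat y * z - of_rat b))
     else 0)"

definition u_dist :: "nat set \<Rightarrow> (adele2 \<Rightarrow> int) \<Rightarrow> complex \<Rightarrow> complex" where
  "u_dist S = the_mult_dist S u_val"

section \<open>The cochain\<close>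

definition dlog_integral :: "(complex \<Rightarrow> complex) \<Rightarrow> complex \<Rightarrow> complex" where
  "dlog_integral F z = Lim at_top (\<lambda>Y::real.
     contour_integral (linepath (Complex (Re z) Y) z) (\<lambda>w. deriv F w / F w))"

definition E_tilde :: "nat set \<Rightarrow> nat \<Rightarrow> (adele2 \<Rightarrow> int) \<Rightarrow> complex \<Rightarrow> complex" where
  "E_tilde S c f z = (if f \<in> schwartz' S \<and> z \<in> upper_half then
       z / 2 * of_rat (smooth S c (B2_B0 S) f)
     + of_rat (pi_c S c f)
     + 1 / (2 * of_real pi * \<i>) * smooth S c (delta0_Clog S) f
     + 1 / (2 * of_real pi * \<i>) * dlog_integral (mult_smooth S c (u_dist S) f) z
     else 0)"

text \<open>The left action on distributions with values in a right module whose action is \<open>act\<close>.\<close>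

definition dist_act ::
  "nat set \<Rightarrow> ('a \<Rightarrow> rat^2^2 \<Rightarrow> 'a) \<Rightarrow> rat^2^2 \<Rightarrow> ((adele2 \<Rightarrow> int) \<Rightarrow> 'a) \<Rightarrow> (adele2 \<Rightarrow> int) \<Rightarrow> 'a" where
  "dist_act S act g \<mu> f =
     (if f \<in> schwartz' S then act (\<mu> (slash S f g)) (matrix_inv g) else \<mu> f)"

definition DR ::
  "nat set \<Rightarrow> nat \<Rightarrow> rat^2^2 \<Rightarrow> rat^2^2 \<Rightarrow> (adele2 \<Rightarrow> int) \<Rightarrow> complex \<Rightarrow> complex" where
  "DR S c g0 g1 f z =
     dist_act S O_slash g1 (E_tilde S c) f z - dist_act S O_slash g0 (E_tilde S c) f z"

text \<open>Homogeneous 1-cocycles of \<open>G\<^sub>S\<close> in the distributions with values in \<open>\<int>\<close> (trivial action),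
  extended by \<open>0\<close> off \<open>G\<^sub>S \<times> G\<^sub>S\<close>.\<close>

definition Z1 :: "nat set \<Rightarrow> (rat^2^2 \<Rightarrow> rat^2^2 \<Rightarrow> (adele2 \<Rightarrow> int) \<Rightarrow> int) set" where
  "Z1 S = {\<Phi>.
     (\<forall>g0 g1. \<not> (g0 \<in> G_S S \<and> g1 \<in> G_S S) \<longrightarrow> \<Phi> g0 g1 = (\<lambda>_. 0)) \<and>
     (\<forall>g0\<in>G_S S. \<forall>g1\<in>G_S S. \<Phi> g0 g1 \<in> distributions S) \<and>
     (\<forall>g\<in>G_S S. \<forall>g0\<in>G_S S. \<forall>g1\<in>G_S S.
        \<Phi> (g ** g0) (g ** g1) = dist_act S (\<lambda>x _. x) g (\<Phi> g0 g1)) \<and>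
     (\<forall>g0\<in>G_S S. \<forall>g1\<in>G_S S. \<forall>g2\<in>G_S S. \<forall>f.
        \<Phi> g1 g2 f - \<Phi> g0 g2 f + \<Phi> g0 g1 f = 0)}"

end

theory Submission
  imports Defs "HOL-Number_Theory.Cong"
begin

text \<open>
  A test function is a combination of scaled cosets of \<open>\<int>\<^sup>2\<close>, so a distribution invariant under positive
  scalars amounts to a function of \<open>(a, b)\<close> that is periodic and satisfies
  \<open>\<Sum>\<^sub>i \<Sum>\<^sub>j val ((a + i) / K) ((b + j) / K) = val a b\<close>; identities between distributions reduce to such values.
  On cosets \<open>E\<close> becomes, up to the term \<open>\<pi>\<^sub>c\<close>, the smoothing of \<open>(\<tau> / 2) B\<^sub>2(a)\<close> plus a logarithm of a
  Siegel unit, chosen as a sum of convergent Lambert series; the integral of \<open>dlog\<close> merely selects this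
  branch. Under \<open>T\<close> and positive diagonal matrices these series transform termwise. Under \<open>S\<close> they
  transform by integrating \<open>e(a \<tau> w) e(b w) / (w (1 - e(\<tau> w)) (1 - e(w)))\<close> over growing rectangles: the
  residues at the poles off \<open>0\<close> sum up to the two logarithms, and the residue at \<open>0\<close> gives the Bernoulli
  polynomials. The defects are constant in \<open>\<tau>\<close>, and smoothing makes them integral because
  \<open>12\<close> divides \<open>c\<^sup>2 - 1\<close> and \<open>c\<close> is odd. Finally \<open>S\<close>, \<open>T\<close> and the positive diagonal matrices generate
  \<open>G\<^sub>S\<close>, since adding a multiple of the second row to the first makes the upper left entry a unit;
  this gives integrality on all of \<open>G\<^sub>S\<close>, and uniqueness.\<close>

text \<open>Integrality rests on one fact: \<open>Kc a\<close> = c B_1(a) - B_1(ca) is an integer,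
  as c is odd. Inserting c B_1(x) = Kc(x) + B_1(cx) into the smoothed product B_1(a) B_1(b) leaves
  integers and mixed terms; the change of \<open>pi_c\<close> under S removes the mixed ones, and
  under T it cancels the fractional parts left by the smoothed B_2. The values of E are sums of
  logarithms, so each relation must hold exactly and not only modulo 2 pi i. Power series are
  therefore compared instead of principal branches; the logarithms become additive distributions,
  and exponentiating them gives the multiplicative ones. The delicate cosets have a or b integral.
  For integral a the product u lacks the factor with y = 0, and Clog supplies its logarithm at a
  point of the unit circle. The completed sum is continuous up to the boundary of the parameter
  square, so inversion is proved for 0 < a, b < 1 and carried over by a limit. Rectangles are used
  only for imaginary \<tau>, where the two families of poles lie on the two axes; the identity
  theorem does the rest.\<close>

no_notation fps_nth (infixl \<open>$\<close> 75)

section \<open>The \<open>\<ell>\<close>-adic absolute value\<close>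

lemma rat_as_quotient:
  obtains a b :: int where "b > 0" "(x::rat) = of_int a / of_int b" "coprime a b"
    "quotient_of x = (a, b)"
proof -
  obtain p q where pq: "quotient_of x = (p, q)" by force
  show ?thesis
    using that[of q p] pq quotient_of_denom_pos[OF pq] quotient_of_div[OF pq]
      quotient_of_coprime[OF pq] by simp
qed

lemma padic_abs_0 [simp]: "padic_abs l 0 = 0"
  by (simp add: padic_abs_def)

lemma padic_abs_nonneg [simp]: "padic_abs l x \<ge> 0"
  by (simp add: padic_abs_def)

context
  fixes l :: nat
  assumes l: "prime l"
begin

lemma l_gt_1: "real l > 1"
  using prime_gt_1_nat[OF l] by simp

lemma l_powi_le_iff: "real l powi m \<le> real l powi n \<longleftrightarrow> m \<le> n"
  using power_int_increasing[of m n "real l"] power_int_strict_increasing[of n m "real l"] l_gt_1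
  by (cases "m \<le> n") auto

text \<open>The definition goes through the reduced fraction; additivity of multiplicities frees it
  from coprimality.\<close>

lemma padic_abs_divide_int:
  assumes "a \<noteq> 0" "b \<noteq> 0"
  shows "padic_abs l (of_int a / of_int b) =
           real l powi (int (multiplicity (int l) b) - int (multiplicity (int l) a))"
proof -
  obtain p q where q: "q > 0" and e: "of_int a / of_int b = (of_int p / of_int q :: rat)"
    and pq: "quotient_of (of_int a / of_int b) = (p, q)"
    by (rule rat_as_quotient[of "of_int a / of_int b"])
  have "of_int (a * q) = (of_int (p * b) :: rat)"
    using e q assms by (simp add: field_simps)
  then have eq: "a * q = p * b" by (simp only: of_int_eq_iff)
  have p0: "p \<noteq> 0" using e assms q by auto
  have pe: "prime_elem (int l)" using l by simp
  have "multiplicity (int l) (a * q) = multiplicity (int l) (p * b)" using eq by simp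
  then have "multiplicity (int l) a + multiplicity (int l) q =
      multiplicity (int l) p + multiplicity (int l) b"
    using prime_elem_multiplicity_mult_distrib[OF pe] p0 q assms by simp
  then have "int (multiplicity (int l) q) - int (multiplicity (int l) p) =
      int (multiplicity (int l) b) - int (multiplicity (int l) a)" by linarith
  then show ?thesis using pq assms by (simp add: padic_abs_def)
qed

lemma padic_abs_of_int:
  "a \<noteq> 0 \<Longrightarrow> padic_abs l (of_int a) = real l powi (- int (multiplicity (int l) a))"
  using padic_abs_divide_int[of a 1] by simp

lemma padic_abs_eq_0_iff [simp]: "padic_abs l x = 0 \<longleftrightarrow> x = 0"
  using l_gt_1 by (simp add: padic_abs_def)

lemma padic_abs_pos: "x \<noteq> 0 \<Longrightarrow> padic_abs l x > 0"
  using padic_abs_nonneg[of l x] padic_abs_eq_0_iff[of x] by linarith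

lemma padic_abs_mult: "padic_abs l (x * y) = padic_abs l x * padic_abs l y"
proof (cases "x = 0 \<or> y = 0")
  case False
  obtain a b where x: "b > 0" "x = of_int a / of_int b" by (rule rat_as_quotient)
  obtain p q where y: "q > 0" "y = of_int p / of_int q" by (rule rat_as_quotient)
  have nz: "a \<noteq> 0" "b \<noteq> 0" "p \<noteq> 0" "q \<noteq> 0" using False x y by auto
  have pe: "prime_elem (int l)" using l by simp
  have "x * y = of_int (a * p) / of_int (b * q)" using x y by simp
  then have "padic_abs l (x * y) = real l powi (int (multiplicity (int l) (b * q))
      - int (multiplicity (int l) (a * p)))"
    using nz by (simp only: padic_abs_divide_int mult_eq_0_iff simp_thms not_False_eq_True)
  also have "\<dots> = real l powi ((int (multiplicity (int l) b) - int (multiplicity (int l) a)) +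
     (int (multiplicity (int l) q) - int (multiplicity (int l) p)))"
    using prime_elem_multiplicity_mult_distrib[OF pe] nz by (simp add: algebra_simps)
  also have "\<dots> = padic_abs l x * padic_abs l y"
    using x y nz l_gt_1 by (simp add: padic_abs_divide_int power_int_add)
  finally show ?thesis .
qed auto

lemma padic_abs_1 [simp]: "padic_abs l 1 = 1"
  using padic_abs_of_int[of 1] by simp

lemma padic_abs_minus [simp]: "padic_abs l (- x) = padic_abs l x"
proof -
  have "padic_abs l (- 1) = 1"
    using padic_abs_of_int[of "-1"] multiplicity_unit_right[of "- 1" "int l"] by simp
  then show ?thesis using padic_abs_mult[of "-1" x] by simp
qed

lemma padic_abs_diff_commute: "padic_abs l (x - y) = padic_abs l (y - x)"
  using padic_abs_minus[of "x - y"] by simp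

lemma padic_abs_inverse: "padic_abs l (inverse x) = inverse (padic_abs l x)"
proof (cases "x = 0")
  case False
  then show ?thesis using padic_abs_mult[of x "inverse x"] padic_abs_pos[OF False]
    by (simp add: field_simps)
qed simp

lemma padic_abs_divide: "padic_abs l (x / y) = padic_abs l x / padic_abs l y"
  using padic_abs_mult[of x "inverse y"] by (simp add: padic_abs_inverse divide_inverse)

lemma padic_abs_of_int_le_1: "padic_abs l (of_int a) \<le> 1"
proof (cases "a = 0")
  case False
  then show ?thesis
    using l_gt_1 by (simp add: padic_abs_of_int power_int_minus inverse_le_1_iff)
qed simp

lemma padic_abs_of_nat_le_1: "padic_abs l (of_nat n) \<le> 1"
  using padic_abs_of_int_le_1[of "int n"] by simp

lemma padic_abs_of_int_le_iff: "padic_abs l (of_int a) \<le> real l powi (- int k) \<longleftrightarrow> int l ^ k dvd a"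
proof (cases "a = 0")
  case False
  have "int l ^ k dvd a \<longleftrightarrow> k \<le> multiplicity (int l) a"
    using False l by (subst power_dvd_iff_le_multiplicity) auto
  then show ?thesis using False l_gt_1 by (simp add: padic_abs_of_int l_powi_le_iff)
qed (use l_gt_1 in simp)

lemma padic_abs_l_power: "padic_abs l (of_nat l ^ k) = real l powi (- int k)"
  using padic_abs_of_int[of "int l ^ k"] l l_gt_1 by simp

lemma padic_abs_add_int: "padic_abs l (of_int a + of_int b)
    \<le> max (padic_abs l (of_int a)) (padic_abs l (of_int b))"
proof (cases "a = 0 \<or> b = 0")
  case False
  define k where "k = min (multiplicity (int l) a) (multiplicity (int l) b)"
  have "int l ^ k dvd a" "int l ^ k dvd b" by (auto simp: k_def intro: multiplicity_dvd')
  then have "int l ^ k dvd a + b" by simp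
  then have "padic_abs l (of_int (a + b)) \<le> real l powi (- int k)"
    by (simp only: padic_abs_of_int_le_iff)
  also have "\<dots> = max (padic_abs l (of_int a)) (padic_abs l (of_int b))"
    using False l_gt_1 by (auto simp: padic_abs_of_int k_def min_def max_def l_powi_le_iff)
  finally show ?thesis by simp
qed auto

text \<open>Over a common denominator the claim becomes the one for integers, where it says that a
  common power of \<open>l\<close> divides the sum.\<close>

lemma padic_abs_add: "padic_abs l (x + y) \<le> max (padic_abs l x) (padic_abs l y)"
proof -
  obtain a b where x: "b > 0" "x = of_int a / of_int b" by (rule rat_as_quotient)
  obtain p q where y: "q > 0" "y = of_int p / of_int q" by (rule rat_as_quotient)
  have d: "padic_abs l (of_int (b * q)) > 0" using x y by (intro padic_abs_pos) auto
  have xy: "x = of_int (a * q) / of_int (b * q)" "y = of_int (p * b) / of_int (b * q)"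
     "x + y = (of_int (a * q) + of_int (p * b)) / of_int (b * q)"
    using x y by (simp_all add: field_simps)
  have "padic_abs l (x + y) = padic_abs l (of_int (a * q) + of_int (p * b)) / padic_abs l (of_int (b * q))"
    unfolding xy(3) padic_abs_divide ..
  also have "\<dots> \<le> max (padic_abs l (of_int (a * q))) (padic_abs l (of_int (p * b))) / padic_abs l (of_int (b * q))"
    using padic_abs_add_int[of "a * q" "p * b"] d by (intro divide_right_mono) auto
  also have "\<dots> = max (padic_abs l x) (padic_abs l y)"
    unfolding xy(1,2) padic_abs_divide using d by (auto simp: max_def divide_le_cancel)
  finally show ?thesis .
qed

lemma padic_abs_diff: "padic_abs l (x - y) \<le> max (padic_abs l x) (padic_abs l y)"
  using padic_abs_add[of x "-y"] by simp

lemma padic_abs_triangle: "padic_abs l (x - z) \<le> max (padic_abs l (x - y)) (padic_abs l (y - z))"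
  using padic_abs_add[of "x - y" "y - z"] by simp

lemma padic_abs_diff_real: "\<bar>padic_abs l x - padic_abs l y\<bar> \<le> padic_abs l (x - y)"
proof -
  have "padic_abs l x - padic_abs l y \<le> padic_abs l (x - y)" for x y
    using padic_abs_add[of "x - y" y] padic_abs_nonneg[of l "x - y"] padic_abs_nonneg[of l y]
    unfolding diff_add_cancel max_def by (smt (verit))
  from this[of x y] this[of y x] show ?thesis using padic_abs_diff_commute[of x y] by linarith
qed

text \<open>The bridge from absolute values to denominators: it makes the set of bad primes of a
  rational finite and recognises integers by local conditions.\<close>

lemma padic_abs_le_1_iff: "padic_abs l x \<le> 1 \<longleftrightarrow> \<not> int l dvd snd (quotient_of x)"
proof -
  obtain a b where x: "b > 0" "x = of_int a / of_int b" "coprime a b" "quotient_of x = (a, b)"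
    by (rule rat_as_quotient)
  have pl: "prime (int l)" using l by simp
  show ?thesis
  proof (cases "int l dvd b")
    case True
    then have na: "\<not> int l dvd a" using x pl
      by (meson coprime_common_divisor not_prime_unit)
    then have "a \<noteq> 0" by auto
    have "multiplicity (int l) a = 0" using na by (simp add: not_dvd_imp_multiplicity_0)
    moreover have "multiplicity (int l) b > 0" using True x pl by (simp add: prime_multiplicity_gt_zero_iff)
    ultimately have "padic_abs l x = real l powi int (multiplicity (int l) b)"
      using \<open>a \<noteq> 0\<close> x by (simp add: padic_abs_divide_int)
    also have "\<dots> > 1" using l_gt_1 \<open>multiplicity (int l) b > 0\<close> by (simp add: one_less_power)
    finally show ?thesis using True x by simp
  next
    case False
    have "padic_abs l (of_int b) = 1" using False x
      by (simp add: padic_abs_of_int not_dvd_imp_multiplicity_0)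
    then have "padic_abs l x \<le> 1" using x padic_abs_of_int_le_1[of a] by (simp add: padic_abs_divide)
    then show ?thesis using False x by simp
  qed
qed

lemma padic_abs_of_nat_coprime: "coprime l n \<Longrightarrow> padic_abs l (of_nat n) = 1"
proof -
  assume "coprime l n"
  then have "\<not> l dvd n" using l by (metis coprime_absorb_left not_prime_unit)
  then have "\<not> int l dvd int n" by simp
  moreover have "n \<noteq> 0" using \<open>\<not> l dvd n\<close> by (metis dvd_0_right)
  ultimately show ?thesis
    using padic_abs_of_int[of "int n"] by (simp add: not_dvd_imp_multiplicity_0)
qed

text \<open>Density of the integers in the local integers, with a bounded representative: the
  denominator is prime to \<open>l\<close>, hence invertible modulo \<open>l ^ k\<close>.\<close>

lemma padic_integer_approx:
  assumes "padic_abs l s \<le> 1"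
  obtains i :: nat where "i < l ^ k" "padic_abs l (s - of_nat i) \<le> real l powi (- int k)"
proof -
  obtain p q where x: "q > 0" "s = of_int p / of_int q" "coprime p q" "quotient_of s = (p, q)"
    by (rule rat_as_quotient)
  have nq: "\<not> int l dvd q" using assms x by (simp add: padic_abs_le_1_iff)
  then have q1: "padic_abs l (of_int q) = 1" using x
      by (simp add: padic_abs_of_int not_dvd_imp_multiplicity_0)
  have "coprime (int l) q" using nq l by (intro prime_imp_coprime) auto
  then have "coprime q (int l ^ k)" by (simp add: coprime_commute)
  then obtain r where r: "[q * r = 1] (mod int l ^ k)" using cong_solve_coprime_int by blast
  define i where "i = nat ((p * r) mod int l ^ k)"
  have pos: "int l ^ k > 0" using prime_gt_0_nat[OF l] by simp
  have "int i = (p * r) mod int l ^ k" using pos by (simp add: i_def)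
  then have "[int i = p * r] (mod int l ^ k)" by (simp add: cong_def)
  then have "[q * int i = q * (p * r)] (mod int l ^ k)" by (rule cong_scalar_left)
  also have "[q * (p * r) = p * 1] (mod int l ^ k)"
    using cong_scalar_left[OF r, of p] by (simp add: algebra_simps)
  finally have "int l ^ k dvd p - q * int i" by (simp add: cong_iff_dvd_diff dvd_diff_commute)
  then have "padic_abs l (of_int (p - q * int i)) \<le> real l powi (- int k)"
    by (simp only: padic_abs_of_int_le_iff)
  moreover have "s - of_nat i = of_int (p - q * int i) / of_int q" using x by (simp add: field_simps)
  ultimately have "padic_abs l (s - of_nat i) \<le> real l powi (- int k)"
    using q1 by (simp add: padic_abs_divide)
  moreover have "i < l ^ k" using pos unfolding i_def
    by (metis nat_less_iff of_nat_power pos_mod_bound pos_mod_sign)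
  ultimately show ?thesis using that by blast
qed

section \<open>The completion \<open>\<rat>\<^sub>\<ell>\<close>\<close>

lemma padic_CauchyD:
  "x \<in> padic_Cauchy l \<Longrightarrow> e > 0 \<Longrightarrow> \<exists>N. \<forall>m\<ge>N. \<forall>n\<ge>N. padic_abs l (x m - x n) < e"
  by (simp add: padic_Cauchy_def)

lemma padic_Cauchy_const [simp]: "(\<lambda>_. r) \<in> padic_Cauchy l"
  by (simp add: padic_Cauchy_def)

lemma padic_Cauchy_add:
  assumes "x \<in> padic_Cauchy l" "y \<in> padic_Cauchy l"
  shows "(\<lambda>n. x n + y n) \<in> padic_Cauchy l"
  unfolding padic_Cauchy_def mem_Collect_eq
proof (intro allI impI)
  fix e :: real assume "e > 0"
  obtain M N where MN: "\<forall>m\<ge>M. \<forall>n\<ge>M. padic_abs l (x m - x n) < e"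
     "\<forall>m\<ge>N. \<forall>n\<ge>N. padic_abs l (y m - y n) < e"
    using assms[THEN padic_CauchyD, OF \<open>e > 0\<close>] by blast
  show "\<exists>N. \<forall>m\<ge>N. \<forall>n\<ge>N. padic_abs l (x m + y m - (x n + y n)) < e"
  proof (intro exI[of _ "max M N"] allI impI)
    fix m n assume "max M N \<le> m" "max M N \<le> n"
    then have "padic_abs l (x m - x n) < e" "padic_abs l (y m - y n) < e" using MN by auto
    then show "padic_abs l (x m + y m - (x n + y n)) < e"
      using padic_abs_add[of "x m - x n" "y m - y n"] by (simp add: algebra_simps)
  qed
qed

lemma padic_Cauchy_bounded:
  assumes "x \<in> padic_Cauchy l"
  obtains B where "B > 0" "\<And>n. padic_abs l (x n) \<le> B"
proof -
  obtain N where N: "\<forall>m\<ge>N. \<forall>n\<ge>N. padic_abs l (x m - x n) < 1"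
    using padic_CauchyD[OF assms, of 1] by auto
  define B where "B = 1 + (\<Sum>n\<le>N. padic_abs l (x n))"
  have le: "n \<le> N \<Longrightarrow> padic_abs l (x n) \<le> (\<Sum>n\<le>N. padic_abs l (x n))" for n
    by (rule member_le_sum) auto
  have "padic_abs l (x n) \<le> B" for n
  proof (cases "n \<le> N")
    case True then show ?thesis using le B_def by fastforce
  next
    case False
    then have "padic_abs l (x n - x N) < 1" using N by simp
    then show ?thesis using padic_abs_add[of "x n - x N" "x N"] le[of N] padic_abs_nonneg[of l "x N"]
      unfolding B_def by (simp only: diff_add_cancel max_def split: if_splits) linarith+
  qed
  moreover have "B > 0" unfolding B_def
    by (metis add_pos_nonneg padic_abs_nonneg sum_nonneg zero_less_one)
  ultimately show ?thesis using that by blast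
qed

lemma padic_Cauchy_mult:
  assumes "x \<in> padic_Cauchy l" "y \<in> padic_Cauchy l"
  shows "(\<lambda>n. x n * y n) \<in> padic_Cauchy l"
  unfolding padic_Cauchy_def mem_Collect_eq
proof (intro allI impI)
  fix e :: real assume "e > 0"
  obtain A where A: "A > 0" "\<And>n. padic_abs l (x n) \<le> A" by (rule padic_Cauchy_bounded[OF assms(1)]) blast
  obtain B where B: "B > 0" "\<And>n. padic_abs l (y n) \<le> B" by (rule padic_Cauchy_bounded[OF assms(2)]) blast
  obtain M N where MN: "\<forall>m\<ge>M. \<forall>n\<ge>M. padic_abs l (x m - x n) < e / B"
     "\<forall>m\<ge>N. \<forall>n\<ge>N. padic_abs l (y m - y n) < e / A"
    using padic_CauchyD[OF assms(1), of "e / B"] padic_CauchyD[OF assms(2), of "e / A"]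
      A B \<open>e > 0\<close> by (metis divide_pos_pos)
  show "\<exists>N. \<forall>m\<ge>N. \<forall>n\<ge>N. padic_abs l (x m * y m - x n * y n) < e"
  proof (intro exI[of _ "max M N"] allI impI)
    fix m n assume "max M N \<le> m" "max M N \<le> n"
    then have 1: "padic_abs l (x m - x n) < e / B" "padic_abs l (y m - y n) < e / A" using MN by auto
    have "padic_abs l ((x m - x n) * y m) \<le> padic_abs l (x m - x n) * B"
      using B by (simp add: padic_abs_mult mult_left_mono)
    also have "\<dots> < e" using 1 B by (simp add: field_simps)
    finally have 2: "padic_abs l ((x m - x n) * y m) < e" .
    have "padic_abs l (x n * (y m - y n)) \<le> A * padic_abs l (y m - y n)"
      using A by (simp add: padic_abs_mult mult_right_mono)
    also have "\<dots> < e" using 1 A by (simp add: field_simps)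
    finally have 3: "padic_abs l (x n * (y m - y n)) < e" .
    show "padic_abs l (x m * y m - x n * y n) < e"
      using padic_abs_add[of "(x m - x n) * y m" "x n * (y m - y n)"] 2 3
      by (simp add: algebra_simps)
  qed
qed

lemma padic_relI:
  "x \<in> padic_Cauchy l \<Longrightarrow> y \<in> padic_Cauchy l \<Longrightarrow> (\<lambda>n. padic_abs l (x n - y n)) \<longlonglongrightarrow> 0 \<Longrightarrow>
    (x, y) \<in> padic_rel l"
  by (simp add: padic_rel_def)

lemma padic_tendsto_0_le:
  assumes "(\<lambda>n. padic_abs l (x n)) \<longlonglongrightarrow> 0" "\<And>n. padic_abs l (y n) \<le> B * padic_abs l (x n)"
  shows "(\<lambda>n. padic_abs l (y n)) \<longlonglongrightarrow> 0"
proof (rule tendsto_sandwich[OF _ _ tendsto_const])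
  show "(\<lambda>n. B * padic_abs l (x n)) \<longlonglongrightarrow> 0" using tendsto_mult_right_zero[OF assms(1)] .
qed (use assms(2) in auto)

lemma padic_tendsto_0_add:
  assumes "(\<lambda>n. padic_abs l (x n)) \<longlonglongrightarrow> 0" "(\<lambda>n. padic_abs l (y n)) \<longlonglongrightarrow> 0"
  shows "(\<lambda>n. padic_abs l (x n + y n)) \<longlonglongrightarrow> 0"
proof (rule tendsto_sandwich[OF _ _ tendsto_const])
  show "(\<lambda>n. max (padic_abs l (x n)) (padic_abs l (y n))) \<longlonglongrightarrow> 0"
    using tendsto_max[OF assms] by simp
qed (use padic_abs_add in auto)

lemma equiv_padic_rel: "equiv (padic_Cauchy l) (padic_rel l)"
proof (rule equivI)
  show "padic_rel l \<subseteq> padic_Cauchy l \<times> padic_Cauchy l" by (auto simp: padic_rel_def)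
  show "refl_on (padic_Cauchy l) (padic_rel l)" by (auto simp: refl_on_def padic_rel_def)
  show "sym (padic_rel l)"
    by (auto simp: sym_def padic_rel_def padic_abs_diff_commute)
  show "trans (padic_rel l)"
  proof (rule transI)
    fix x y z assume "(x, y) \<in> padic_rel l" "(y, z) \<in> padic_rel l"
    then show "(x, z) \<in> padic_rel l"
      using padic_tendsto_0_add[of "\<lambda>n. x n - y n" "\<lambda>n. y n - z n"]
      by (auto simp: padic_rel_def)
  qed
qed

definition padic_class :: "(nat \<Rightarrow> rat) \<Rightarrow> padic" where
  "padic_class x = padic_rel l `` {x}"

lemma padic_class_in [simp, intro]: "x \<in> padic_Cauchy l \<Longrightarrow> padic_class x \<in> Qp l"
  by (simp add: padic_class_def Qp_def quotientI)

lemma Qp_cases: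
  assumes "X \<in> Qp l" obtains x where "x \<in> padic_Cauchy l" "X = padic_class x"
  using assms unfolding Qp_def padic_class_def by (auto elim: quotientE)

lemma padic_of_rat_eq: "padic_of_rat l r = padic_class (\<lambda>_. r)"
  by (simp add: padic_of_rat_def padic_class_def)

lemma padic_of_rat_in [simp, intro]: "padic_of_rat l r \<in> Qp l"
  by (simp add: padic_of_rat_eq padic_class_in)

lemma mem_padic_class: "y \<in> padic_class x \<longleftrightarrow> (x, y) \<in> padic_rel l"
  by (simp add: padic_class_def)

lemma padic_class_eq_iff:
  "x \<in> padic_Cauchy l \<Longrightarrow> y \<in> padic_Cauchy l \<Longrightarrow> padic_class x = padic_class y \<longleftrightarrow> (x, y) \<in> padic_rel l"
  unfolding padic_class_def using eq_equiv_class_iff[OF equiv_padic_rel] by blast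

lemma padic_class_self: "x \<in> padic_Cauchy l \<Longrightarrow> x \<in> padic_class x"
  by (simp add: mem_padic_class padic_rel_def)

lemma padic_add_class:
  assumes "x \<in> padic_Cauchy l" "y \<in> padic_Cauchy l"
  shows "padic_add l (padic_class x) (padic_class y) = padic_class (\<lambda>n. x n + y n)"
proof -
  have "padic_rel l `` {\<lambda>n. x' n + y' n} = padic_class (\<lambda>n. x n + y n)"
    if "x' \<in> padic_class x" "y' \<in> padic_class y" for x' y'
  proof -
    have r: "(x, x') \<in> padic_rel l" "(y, y') \<in> padic_rel l" using that by (auto simp: mem_padic_class)
    then have "((\<lambda>n. x n + y n), (\<lambda>n. x' n + y' n)) \<in> padic_rel l"
      using padic_tendsto_0_add[of "\<lambda>n. x n - x' n" "\<lambda>n. y n - y' n"]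
      by (intro padic_relI padic_Cauchy_add) (auto simp: padic_rel_def algebra_simps)
    then show ?thesis unfolding padic_class_def
      by (rule equiv_class_eq[OF equiv_padic_rel, symmetric])
  qed
  then show ?thesis unfolding padic_add_def
    using padic_class_self[OF assms(1)] padic_class_self[OF assms(2)] by blast
qed

lemma padic_mult_class:
  assumes "x \<in> padic_Cauchy l" "y \<in> padic_Cauchy l"
  shows "padic_mult l (padic_class x) (padic_class y) = padic_class (\<lambda>n. x n * y n)"
proof -
  have "padic_rel l `` {\<lambda>n. x' n * y' n} = padic_class (\<lambda>n. x n * y n)"
    if "x' \<in> padic_class x" "y' \<in> padic_class y" for x' y'
  proof -
    have r: "(x, x') \<in> padic_rel l" "(y, y') \<in> padic_rel l" using that by (auto simp: mem_padic_class)
    then have c: "x' \<in> padic_Cauchy l" "y' \<in> padic_Cauchy l" by (auto simp: padic_rel_def)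
    obtain A where A: "A > 0" "\<And>n. padic_abs l (x' n) \<le> A" by (rule padic_Cauchy_bounded[OF c(1)]) blast
    obtain B where B: "B > 0" "\<And>n. padic_abs l (y n) \<le> B" by (rule padic_Cauchy_bounded[OF assms(2)]) blast
    have "(\<lambda>n. padic_abs l ((x n - x' n) * y n)) \<longlonglongrightarrow> 0"
    proof (rule padic_tendsto_0_le[of "\<lambda>n. x n - x' n" _ B])
      show "padic_abs l ((x n - x' n) * y n) \<le> B * padic_abs l (x n - x' n)" for n
        using mult_right_mono[OF B(2)[of n] padic_abs_nonneg[of l "x n - x' n"]]
        by (simp add: padic_abs_mult mult.commute)
    qed (use r in \<open>auto simp: padic_rel_def\<close>)
    moreover have "(\<lambda>n. padic_abs l (x' n * (y n - y' n))) \<longlonglongrightarrow> 0"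
    proof (rule padic_tendsto_0_le[of "\<lambda>n. y n - y' n" _ A])
      show "padic_abs l (x' n * (y n - y' n)) \<le> A * padic_abs l (y n - y' n)" for n
        using mult_right_mono[OF A(2)[of n] padic_abs_nonneg[of l "y n - y' n"]]
        by (simp add: padic_abs_mult)
    qed (use r in \<open>auto simp: padic_rel_def\<close>)
    ultimately have "(\<lambda>n. padic_abs l ((x n - x' n) * y n + x' n * (y n - y' n))) \<longlonglongrightarrow> 0"
      by (rule padic_tendsto_0_add)
    then have "((\<lambda>n. x n * y n), (\<lambda>n. x' n * y' n)) \<in> padic_rel l"
      using assms c by (intro padic_relI padic_Cauchy_mult) (auto simp: algebra_simps)
    then show ?thesis unfolding padic_class_def
      by (rule equiv_class_eq[OF equiv_padic_rel, symmetric])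
  qed
  then show ?thesis unfolding padic_mult_def
    using padic_class_self[OF assms(1)] padic_class_self[OF assms(2)] by blast
qed

text \<open>Justifies the definite description in \<open>padic_dist\<close>: the real sequence is
  Cauchy by the reverse triangle inequality, and another choice of representatives changes it by a
  null sequence. All later facts about the distance are limits of facts about
  \<open>padic_abs\<close>.\<close>

lemma padic_dist_tendsto:
  assumes x: "x \<in> padic_Cauchy l" and y: "y \<in> padic_Cauchy l"
  shows "(\<lambda>n. padic_abs l (x n - y n)) \<longlonglongrightarrow> padic_dist l (padic_class x) (padic_class y)"
proof -
  have "Cauchy (\<lambda>n. padic_abs l (x n - y n))"
  proof (rule metric_CauchyI)
    fix e :: real assume "e > 0"
    obtain M N where MN: "\<forall>m\<ge>M. \<forall>n\<ge>M. padic_abs l (x m - x n) < e"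
       "\<forall>m\<ge>N. \<forall>n\<ge>N. padic_abs l (y m - y n) < e"
      using padic_CauchyD[OF x \<open>e > 0\<close>] padic_CauchyD[OF y \<open>e > 0\<close>] by blast
    show "\<exists>N. \<forall>m\<ge>N. \<forall>n\<ge>N. dist (padic_abs l (x m - y m)) (padic_abs l (x n - y n)) < e"
    proof (intro exI[of _ "max M N"] allI impI)
      fix m n assume "max M N \<le> m" "max M N \<le> n"
      then have "padic_abs l (x m - x n) < e" "padic_abs l (y m - y n) < e" using MN by auto
      moreover have "dist (padic_abs l (x m - y m)) (padic_abs l (x n - y n)) \<le>
          padic_abs l ((x m - x n) - (y m - y n))"
        using padic_abs_diff_real[of "x m - y m" "x n - y n"]
        by (simp add: dist_real_def algebra_simps)
      ultimately show "dist (padic_abs l (x m - y m)) (padic_abs l (x n - y n)) < e"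
        using padic_abs_diff[of "x m - x n" "y m - y n"] by linarith
    qed
  qed
  then obtain d where d: "(\<lambda>n. padic_abs l (x n - y n)) \<longlonglongrightarrow> d"
    using Cauchy_convergent_iff convergent_def by blast
  have all: "(\<lambda>n. padic_abs l (x' n - y' n)) \<longlonglongrightarrow> d" if "x' \<in> padic_class x" "y' \<in> padic_class y" for x' y'
  proof -
    have "(\<lambda>n. padic_abs l (x' n - x n)) \<longlonglongrightarrow> 0" "(\<lambda>n. padic_abs l (y n - y' n)) \<longlonglongrightarrow> 0"
      using that by (auto simp: mem_padic_class padic_rel_def padic_abs_diff_commute)
    then have *: "(\<lambda>n. padic_abs l ((x' n - x n) + (y n - y' n))) \<longlonglongrightarrow> 0"
      by (rule padic_tendsto_0_add)
    have "(\<lambda>n. padic_abs l (x' n - y' n) - padic_abs l (x n - y n)) \<longlonglongrightarrow> 0"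
    proof (rule tendsto_rabs_zero_cancel, rule tendsto_sandwich[OF _ _ tendsto_const *])
      show "\<forall>\<^sub>F n in sequentially. \<bar>padic_abs l (x' n - y' n) - padic_abs l (x n - y n)\<bar>
         \<le> padic_abs l ((x' n - x n) + (y n - y' n))"
      proof (intro always_eventually allI)
        fix n
        show "\<bar>padic_abs l (x' n - y' n) - padic_abs l (x n - y n)\<bar>
         \<le> padic_abs l ((x' n - x n) + (y n - y' n))"
          using padic_abs_diff_real[of "x' n - y' n" "x n - y n"] by (simp add: algebra_simps)
      qed
    qed auto
    from tendsto_add[OF this d] show ?thesis by simp
  qed
  have "(THE d. \<forall>x'\<in>padic_class x. \<forall>y'\<in>padic_class y. (\<lambda>n. padic_abs l (x' n - y' n)) \<longlonglongrightarrow> d) = d"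
  proof (rule the_equality)
    fix d' assume "\<forall>x'\<in>padic_class x. \<forall>y'\<in>padic_class y. (\<lambda>n. padic_abs l (x' n - y' n)) \<longlonglongrightarrow> d'"
    then have "(\<lambda>n. padic_abs l (x n - y n)) \<longlonglongrightarrow> d'" using padic_class_self x y by blast
    then show "d' = d" using d LIMSEQ_unique by blast
  qed (use all in blast)
  then show ?thesis using d x y by (simp add: padic_dist_def)
qed

lemma padic_dist_of_rat: "padic_dist l (padic_of_rat l a) (padic_of_rat l b) = padic_abs l (a - b)"
  using padic_dist_tendsto[of "\<lambda>_. a" "\<lambda>_. b"] LIMSEQ_unique[OF _ tendsto_const]
  by (simp add: padic_of_rat_eq LIMSEQ_const_iff)

lemma padic_dist_commute: "padic_dist l X Y = padic_dist l Y X"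
proof (cases "X \<in> Qp l \<and> Y \<in> Qp l")
  case True
  then obtain x y where "x \<in> padic_Cauchy l" "X = padic_class x" "y \<in> padic_Cauchy l" "Y = padic_class y"
    by (metis Qp_cases)
  then show ?thesis using padic_dist_tendsto[of x y] padic_dist_tendsto[of y x]
    by (simp add: padic_abs_diff_commute LIMSEQ_unique)
qed (auto simp: padic_dist_def)

lemma padic_dist_ultra:
  assumes "X \<in> Qp l" "Y \<in> Qp l" "Z \<in> Qp l"
  shows "padic_dist l X Z \<le> max (padic_dist l X Y) (padic_dist l Y Z)"
proof -
  obtain x y z where c: "x \<in> padic_Cauchy l" "X = padic_class x" "y \<in> padic_Cauchy l" "Y = padic_class y"
    "z \<in> padic_Cauchy l" "Z = padic_class z"
    using assms by (metis Qp_cases)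
  show ?thesis unfolding c
    using padic_dist_tendsto[OF c(1,5)]
      tendsto_max[OF padic_dist_tendsto[OF c(1,3)] padic_dist_tendsto[OF c(3,5)]]
    by (rule LIMSEQ_le) (use padic_abs_triangle in blast)
qed

lemma padic_dist_nonneg: "padic_dist l X Y \<ge> 0"
proof (cases "X \<in> Qp l \<and> Y \<in> Qp l")
  case True
  then obtain x y where c: "x \<in> padic_Cauchy l" "X = padic_class x" "y \<in> padic_Cauchy l" "Y = padic_class y"
    by (metis Qp_cases)
  show ?thesis unfolding c using padic_dist_tendsto[OF c(1,3)]
    by (rule LIMSEQ_le_const) auto
qed (auto simp: padic_dist_def)

lemma padic_dist_eq_0_iff: "X \<in> Qp l \<Longrightarrow> Y \<in> Qp l \<Longrightarrow> padic_dist l X Y = 0 \<longleftrightarrow> X = Y"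
proof -
  assume "X \<in> Qp l" "Y \<in> Qp l"
  then obtain x y where c: "x \<in> padic_Cauchy l" "X = padic_class x" "y \<in> padic_Cauchy l" "Y = padic_class y"
    by (metis Qp_cases)
  show ?thesis
    using padic_dist_tendsto[OF c(1,3)] LIMSEQ_unique
    by (auto simp: c padic_class_eq_iff padic_rel_def)
qed

lemma Metric_space_Qp: "Metric_space (Qp l) (padic_dist l)"
proof
  fix X Y Z
  show "0 \<le> padic_dist l X Y" by (rule padic_dist_nonneg)
  show "padic_dist l X Y = padic_dist l Y X" by (rule padic_dist_commute)
  assume "X \<in> Qp l" "Y \<in> Qp l"
  then show "padic_dist l X Y = 0 \<longleftrightarrow> X = Y" by (rule padic_dist_eq_0_iff)
  assume "Z \<in> Qp l"
  then show "padic_dist l X Z \<le> padic_dist l X Y + padic_dist l Y Z"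
    using padic_dist_ultra[OF \<open>X \<in> Qp l\<close> \<open>Y \<in> Qp l\<close> \<open>Z \<in> Qp l\<close>]
      padic_dist_nonneg[of X Y] padic_dist_nonneg[of Y Z] by linarith
qed

lemma padic_add_in: "X \<in> Qp l \<Longrightarrow> Y \<in> Qp l \<Longrightarrow> padic_add l X Y \<in> Qp l"
  by (elim Qp_cases) (auto simp: padic_add_class padic_Cauchy_add)

lemma padic_mult_in: "X \<in> Qp l \<Longrightarrow> Y \<in> Qp l \<Longrightarrow> padic_mult l X Y \<in> Qp l"
  by (elim Qp_cases) (auto simp: padic_mult_class padic_Cauchy_mult)

lemma padic_add_of_rat: "padic_add l (padic_of_rat l a) (padic_of_rat l b) = padic_of_rat l (a + b)"
  by (simp add: padic_of_rat_eq padic_add_class)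

lemma padic_mult_of_rat: "padic_mult l (padic_of_rat l a) (padic_of_rat l b) = padic_of_rat l (a * b)"
  by (simp add: padic_of_rat_eq padic_mult_class)

lemma padic_dist_add:
  assumes "X \<in> Qp l" "Y \<in> Qp l" "X' \<in> Qp l" "Y' \<in> Qp l"
  shows "padic_dist l (padic_add l X Y) (padic_add l X' Y') \<le> max (padic_dist l X X') (padic_dist l Y Y')"
proof -
  obtain x y x' y' where c: "x \<in> padic_Cauchy l" "X = padic_class x" "y \<in> padic_Cauchy l" "Y = padic_class y"
    "x' \<in> padic_Cauchy l" "X' = padic_class x'" "y' \<in> padic_Cauchy l" "Y' = padic_class y'"
    using assms by (metis Qp_cases)
  have "padic_dist l (padic_class (\<lambda>n. x n + y n)) (padic_class (\<lambda>n. x' n + y' n)) \<le>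
     max (padic_dist l X X') (padic_dist l Y Y')"
    unfolding c
    using padic_dist_tendsto[OF padic_Cauchy_add[OF c(1,3)] padic_Cauchy_add[OF c(5,7)]]
      tendsto_max[OF padic_dist_tendsto[OF c(1,5)] padic_dist_tendsto[OF c(3,7)]]
  proof (rule LIMSEQ_le, intro exI[of _ 0] allI impI)
    fix n
    show "padic_abs l (x n + y n - (x' n + y' n)) \<le> max (padic_abs l (x n - x' n)) (padic_abs l (y n - y' n))"
      using padic_abs_add[of "x n - x' n" "y n - y' n"] by (simp add: algebra_simps)
  qed
  then show ?thesis using c by (simp add: padic_add_class)
qed

lemma padic_dist_mult_rat:
  assumes "X \<in> Qp l" "Y \<in> Qp l"
  shows "padic_dist l (padic_mult l X (padic_of_rat l r)) (padic_mult l Y (padic_of_rat l r)) =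
    padic_abs l r * padic_dist l X Y"
proof -
  obtain x y where c: "x \<in> padic_Cauchy l" "X = padic_class x" "y \<in> padic_Cauchy l" "Y = padic_class y"
    using assms by (metis Qp_cases)
  have "(\<lambda>n. padic_abs l (x n * r - y n * r)) \<longlonglongrightarrow> padic_dist l (padic_class (\<lambda>n. x n * r)) (padic_class (\<lambda>n. y n * r))"
    using c by (intro padic_dist_tendsto padic_Cauchy_mult) auto
  moreover have "(\<lambda>n. padic_abs l r * padic_abs l (x n - y n)) \<longlonglongrightarrow> padic_abs l r * padic_dist l X Y"
    unfolding c using c by (intro tendsto_mult_left padic_dist_tendsto)
  moreover have "padic_abs l (x n * r - y n * r) = padic_abs l r * padic_abs l (x n - y n)" for n
    using padic_abs_mult[of r "x n - y n"] by (simp add: algebra_simps)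
  ultimately show ?thesis using c LIMSEQ_unique
    by (simp add: padic_mult_class padic_of_rat_eq)
qed

lemma padic_dense:
  assumes "X \<in> Qp l" "e > 0" obtains r where "padic_dist l X (padic_of_rat l r) < e"
proof -
  obtain x where c: "x \<in> padic_Cauchy l" "X = padic_class x" using assms by (metis Qp_cases)
  \<comment> \<open>A strict bound survives the limit only as a weak one; halving keeps the final
    inequality strict.\<close>
  have "e / 2 > 0" using assms by simp
  then obtain N where N: "\<forall>m\<ge>N. \<forall>n\<ge>N. padic_abs l (x m - x n) < e / 2"
    using padic_CauchyD[OF c(1)] by blast
  have "padic_dist l X (padic_of_rat l (x N)) \<le> e / 2"
    unfolding c padic_of_rat_eq using padic_dist_tendsto[OF c(1) padic_Cauchy_const]
    by (rule LIMSEQ_le_const2) (use N less_imp_le in blast)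
  then show ?thesis using that[of "x N"] assms by linarith
qed

section \<open>Balls\<close>

text \<open>Centres are rational, which by density still reaches every ball of positive radius.
  Balls are closed, so that radius 1 around 0 gives the local integers.\<close>

definition padic_ball :: "rat \<Rightarrow> real \<Rightarrow> padic set" where
  "padic_ball a r = {X \<in> Qp l. padic_dist l X (padic_of_rat l a) \<le> r}"

lemma Zp_eq_ball: "Zp l = padic_ball 0 1"
  by (simp add: Zp_def padic_ball_def)

lemma padic_coset_eq_ball: "padic_add l (padic_of_rat l a) ` Zp l = padic_ball a 1"
proof (rule antisym; rule subsetI)
  fix Y assume "Y \<in> padic_add l (padic_of_rat l a) ` Zp l"
  then obtain X where X: "X \<in> Qp l" "padic_dist l X (padic_of_rat l 0) \<le> 1"
    "Y = padic_add l (padic_of_rat l a) X" by (auto simp: Zp_def)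
  have "padic_dist l Y (padic_add l (padic_of_rat l a) (padic_of_rat l 0)) \<le> 1"
    unfolding X using padic_dist_add[of "padic_of_rat l a" X "padic_of_rat l a" "padic_of_rat l 0"] X
    by (simp add: padic_dist_of_rat)
  then show "Y \<in> padic_ball a 1" using X by (simp add: padic_ball_def padic_add_of_rat padic_add_in)
next
  fix Y assume Y: "Y \<in> padic_ball a 1"
  then obtain y where y: "y \<in> padic_Cauchy l" "Y = padic_class y"
    by (auto simp: padic_ball_def elim: Qp_cases)
  define X where "X = padic_add l (padic_of_rat l (- a)) Y"
  have "padic_add l (padic_of_rat l a) X = Y"
    using y padic_Cauchy_add[OF padic_Cauchy_const, of y "- a"]
    by (simp add: X_def padic_of_rat_eq padic_add_class)
  moreover have "padic_dist l X (padic_add l (padic_of_rat l (- a)) (padic_of_rat l a)) \<le> 1"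
    unfolding X_def using padic_dist_add[of "padic_of_rat l (- a)" Y "padic_of_rat l (- a)" "padic_of_rat l a"] Y
    unfolding padic_dist_of_rat padic_ball_def max_def by (auto split: if_splits)
  moreover have "X \<in> Qp l" using Y by (simp add: X_def padic_add_in padic_ball_def)
  ultimately show "Y \<in> padic_add l (padic_of_rat l a) ` Zp l"
    by (auto simp: Zp_def padic_add_of_rat)
qed

text \<open>In an ultrametric every point of a closed ball is a centre of it, so the ball contains
  an open ball of the same radius around each of its points.\<close>

lemma padic_cball_openin:
  assumes "r > 0" "X \<in> Qp l"
  shows "openin (Metric_space.mtopology (Qp l) (padic_dist l)) {Y \<in> Qp l. padic_dist l Y X \<le> r}"
proof -
  interpret Metric_space "Qp l" "padic_dist l" by (rule Metric_space_Qp)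
  show ?thesis unfolding openin_mtopology
  proof (intro conjI allI impI)
    fix Y assume Y: "Y \<in> {Y \<in> Qp l. padic_dist l Y X \<le> r}"
    have "mball Y r \<subseteq> {Y \<in> Qp l. padic_dist l Y X \<le> r}"
    proof
      fix Z assume "Z \<in> mball Y r"
      then have "padic_dist l Y Z < r" "Z \<in> Qp l" by auto
      then show "Z \<in> {Y \<in> Qp l. padic_dist l Y X \<le> r}"
        using Y assms padic_dist_ultra[of Z Y X] padic_dist_commute[of Y Z] by auto
    qed
    then show "\<exists>r'>0. mball Y r' \<subseteq> {Y \<in> Qp l. padic_dist l Y X \<le> r}" using assms by blast
  qed auto
qed

lemma padic_ball_openin:
  "r > 0 \<Longrightarrow> openin (Metric_space.mtopology (Qp l) (padic_dist l)) (padic_ball a r)"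
  unfolding padic_ball_def by (rule padic_cball_openin) auto

text \<open>One subdivision step: \<open>l\<close> balls of the next smaller radius cover, one for
  each leading digit. The exponent is an arbitrary integer because supports may have radius above
  1.\<close>

lemma padic_ball_split:
  assumes "X \<in> padic_ball a (real l powi (- k))"
  obtains i where "i < l" "X \<in> padic_ball (a + of_nat i * of_nat l powi k) (real l powi (- (k + 1)))"
proof -
  have X: "X \<in> Qp l" using assms by (simp add: padic_ball_def)
  have pos: "real l powi m > 0" for m using l_gt_1 by simp
  have lk: "padic_abs l (of_nat l powi k) = real l powi (- k)"
  proof (cases k)
    case (nonneg n) then show ?thesis by (simp add: padic_abs_l_power)
  next
    case (neg n)
    then show ?thesis using padic_abs_l_power[of "Suc n"]
      by (simp only: power_int_minus power_int_of_nat padic_abs_inverse inverse_inverse_eq minus_minus)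
  qed
  obtain r where r: "padic_dist l X (padic_of_rat l r) < real l powi (- (k + 1))"
    using padic_dense[OF X pos] by blast
  have le: "real l powi (- (k + 1)) \<le> real l powi (- k)" using l_gt_1 by (simp add: l_powi_le_iff)
  have "padic_abs l (r - a) \<le> real l powi (- k)"
    using padic_dist_ultra[OF _ X, of "padic_of_rat l r" "padic_of_rat l a"] r le assms
      padic_dist_commute[of X "padic_of_rat l r"]
    unfolding padic_dist_of_rat padic_ball_def mem_Collect_eq max_def by (auto split: if_splits)
  then have "padic_abs l ((r - a) / of_nat l powi k) \<le> 1"
    using lk pos by (simp add: padic_abs_divide)
  then obtain i where i: "i < l ^ 1" "padic_abs l ((r - a) / of_nat l powi k - of_nat i) \<le> real l powi (- int 1)"
    by (rule padic_integer_approx)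
  have l0: "(of_nat l powi k :: rat) \<noteq> 0" using l_gt_1 by simp
  have "r - (a + of_nat i * of_nat l powi k) = ((r - a) / of_nat l powi k - of_nat i) * of_nat l powi k"
    using l0 by (simp add: field_simps)
  then have "padic_abs l (r - (a + of_nat i * of_nat l powi k)) \<le> real l powi (- int 1) * real l powi (- k)"
    using i(2) pos by (simp add: padic_abs_mult lk mult_right_mono)
  also have "\<dots> = real l powi (- (k + 1))"
    using l_gt_1 by (subst power_int_add[symmetric]) (auto simp: algebra_simps)
  finally have "X \<in> padic_ball (a + of_nat i * of_nat l powi k) (real l powi (- (k + 1)))"
    using X r padic_dist_ultra[OF X, of "padic_of_rat l r" "padic_of_rat l (a + of_nat i * of_nat l powi k)"]
    by (simp add: padic_dist_of_rat padic_ball_def)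
  then show ?thesis using i that by simp
qed

lemma real_l_powi_tendsto: "(\<lambda>n. real l powi (- (k + int n))) \<longlonglongrightarrow> 0"
proof -
  have "(\<lambda>n. real l powi (- k) * (1 / real l) ^ n) \<longlonglongrightarrow> 0"
    using l_gt_1 by (intro tendsto_mult_right_zero LIMSEQ_power_zero) auto
  moreover have "real l powi (- k) * (1 / real l) ^ n = real l powi (- (k + int n))" for n
  proof -
    have "(1 / real l) ^ n = real l powi (- int n)" by (simp add: power_int_minus divide_inverse power_inverse)
    then show ?thesis using l_gt_1 by (simp flip: power_int_add)
  qed
  ultimately show ?thesis by simp
qed

text \<open>Were there an open cover of a ball without finite subcover, repeated subdivision would give a
  Cauchy sequence of centres of balls with the same defect, and its limit lies in one member of the
  cover.\<close>

lemma padic_ball_compactin: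
  "compactin (Metric_space.mtopology (Qp l) (padic_dist l)) (padic_ball a (real l powi (- k)))"
proof -
  interpret Metric_space "Qp l" "padic_dist l" by (rule Metric_space_Qp)
  define B where "B = (\<lambda>a n. padic_ball a (real l powi (- (k + int n))))"
  show ?thesis unfolding compactin_def
  proof (intro conjI allI impI)
    fix \<U> assume U: "Ball \<U> (openin mtopology) \<and> padic_ball a (real l powi (- k)) \<subseteq> \<Union> \<U>"
    define bad where "bad = (\<lambda>A. \<not> (\<exists>\<F>. finite \<F> \<and> \<F> \<subseteq> \<U> \<and> A \<subseteq> \<Union> \<F>))"
    have step: "\<exists>b. bad (B b (Suc n)) \<and> padic_abs l (b - a) \<le> real l powi (- (k + int n))"
      if "bad (B a n)" for a n
    proof (rule ccontr)
      assume *: "\<not> ?thesis"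
      define b where "b = (\<lambda>i. a + of_nat i * of_nat l powi (k + int n))"
      have "\<not> bad (B (b i) (Suc n))" for i
      proof -
        have "padic_abs l (of_nat l powi (k + int n)) = real l powi (- (k + int n))"
        proof (cases "k + int n")
          case (nonneg n) then show ?thesis by (simp add: padic_abs_l_power)
        next
          case (neg m)
          then show ?thesis using padic_abs_l_power[of "Suc m"]
            by (simp only: power_int_minus power_int_of_nat padic_abs_inverse inverse_inverse_eq minus_minus)
        qed
        then have "padic_abs l (b i - a) \<le> real l powi (- (k + int n))"
          using padic_abs_of_nat_le_1[of i] l_gt_1
          by (simp add: b_def padic_abs_mult mult_le_cancel_right1)
        then show ?thesis using * by blast
      qed
      then obtain F where F: "\<And>i. finite (F i) \<and> F i \<subseteq> \<U> \<and> B (b i) (Suc n) \<subseteq> \<Union> (F i)"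
        unfolding bad_def by metis
      have "B a n \<subseteq> (\<Union>i<l. B (b i) (Suc n))"
      proof
        fix X assume "X \<in> B a n"
        then have "X \<in> padic_ball a (real l powi (- (k + int n)))" by (simp add: B_def)
        then obtain i where i: "i < l"
          and Xi: "X \<in> padic_ball (a + of_nat i * of_nat l powi (k + int n)) (real l powi (- (k + int n + 1)))"
          by (rule padic_ball_split)
        have "X \<in> B (b i) (Suc n)" using Xi unfolding B_def b_def
            by (metis add.assoc add.commute of_nat_Suc)
        then show "X \<in> (\<Union>i<l. B (b i) (Suc n))" using i by blast
      qed
      also have "\<dots> \<subseteq> \<Union> (\<Union>i<l. F i)"
      proof (rule UN_least)
        fix i assume "i \<in> {..<l}"
        then have "\<Union> (F i) \<subseteq> \<Union> (\<Union>i<l. F i)" by (intro Union_mono) blast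
        then show "B (b i) (Suc n) \<subseteq> \<Union> (\<Union>i<l. F i)" using F[of i] by (meson subset_trans)
      qed
      finally have "\<exists>\<F>. finite \<F> \<and> \<F> \<subseteq> \<U> \<and> B a n \<subseteq> \<Union> \<F>"
        using F by (intro exI[of _ "\<Union>i<l. F i"]) auto
      then show False using that unfolding bad_def by blast
    qed
    show "\<exists>\<F>. finite \<F> \<and> \<F> \<subseteq> \<U> \<and> padic_ball a (real l powi (- k)) \<subseteq> \<Union> \<F>"
    proof (rule ccontr)
      assume "\<not> ?thesis"
      then have "bad (B a 0)" by (simp add: bad_def B_def)
      \<comment> \<open>Dependent choice builds the sequence of centres; the clause on
        \<open>n = 0\<close> makes it start at \<open>a\<close>, so that its limit lies in the
        original ball.\<close>
      then have "\<exists>s. \<forall>n. (bad (B (s n) n) \<and> (n = 0 \<longrightarrow> s n = a)) \<and>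
          padic_abs l (s (Suc n) - s n) \<le> real l powi (- (k + int n))"
        by (intro dependent_nat_choice) (use step in auto)
      then obtain s where s0: "s 0 = a" and s: "\<And>n. bad (B (s n) n)"
        "\<And>n. padic_abs l (s (Suc n) - s n) \<le> real l powi (- (k + int n))" by blast
      have close: "padic_abs l (s (n + m) - s n) \<le> real l powi (- (k + int n))" for n m
      proof (induction m)
        case (Suc m)
        have "padic_abs l (s (n + Suc m) - s (n + m)) \<le> real l powi (- (k + int (n + m)))"
          using s(2)[of "n + m"] by simp
        also have "\<dots> \<le> real l powi (- (k + int n))" using l_gt_1 by (simp add: l_powi_le_iff)
        finally show ?case
          using Suc padic_abs_triangle[of "s (n + Suc m)" "s n" "s (n + m)"] by linarith
      qed (use l_gt_1 in simp)
      have close': "padic_abs l (s m - s n) \<le> real l powi (- (k + int N))" if "m \<ge> N" "n \<ge> N" for m n N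
        using close[of N "m - N"] close[of N "n - N"] that
          padic_abs_diff[of "s m - s N" "s n - s N"] by simp
      have cs: "s \<in> padic_Cauchy l" unfolding padic_Cauchy_def mem_Collect_eq
      proof (intro allI impI)
        fix e :: real assume "e > 0"
        then obtain N where "real l powi (- (k + int N)) < e"
          using order_tendstoD(2)[OF real_l_powi_tendsto \<open>e > 0\<close>]
          unfolding eventually_sequentially by blast
        then show "\<exists>N. \<forall>m\<ge>N. \<forall>n\<ge>N. padic_abs l (s m - s n) < e"
          using close'[of N] by (intro exI[of _ N] allI impI) (rule le_less_trans)
      qed
      define X where "X = padic_class s"
      have XQ: "X \<in> Qp l" using cs by (simp add: X_def)
      have dX: "padic_dist l X (padic_of_rat l (s n)) \<le> real l powi (- (k + int n))" for n
        unfolding X_def padic_of_rat_eq using padic_dist_tendsto[OF cs padic_Cauchy_const]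
        by (rule LIMSEQ_le_const2) (use close' in blast)
      have "X \<in> padic_ball a (real l powi (- k))" using dX[of 0] XQ s0 by (simp add: padic_ball_def)
      then obtain V where V: "V \<in> \<U>" "X \<in> V" using U by blast
      then obtain e where e: "e > 0" "mball X e \<subseteq> V" using U unfolding openin_mtopology by blast
      obtain N where N: "real l powi (- (k + int N)) < e"
        using order_tendstoD(2)[OF real_l_powi_tendsto \<open>e > 0\<close>]
        unfolding eventually_sequentially by blast
      have "B (s N) N \<subseteq> mball X e"
      proof
        fix Y assume "Y \<in> B (s N) N"
        then have "Y \<in> Qp l" "padic_dist l Y (padic_of_rat l (s N)) \<le> real l powi (- (k + int N))"
          by (auto simp: B_def padic_ball_def)
        then have "padic_dist l X Y \<le> real l powi (- (k + int N))"
          using dX[of N] padic_dist_ultra[OF XQ, of "padic_of_rat l (s N)" Y]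
            padic_dist_commute[of Y "padic_of_rat l (s N)"] by simp
        then show "Y \<in> mball X e" using N XQ \<open>Y \<in> Qp l\<close> by simp
      qed
      then have "\<not> bad (B (s N) N)"
        unfolding bad_def not_not using e V by (intro exI[of _ "{V}"]) auto
      then show False using s by blast
    qed
  qed (auto simp: padic_ball_def)
qed

end

section \<open>Local test functions\<close>

lemma padic_abs_eq_powi:
  assumes "prime l" "t \<noteq> 0" obtains k where "padic_abs l t = real l powi (- k)"
proof -
  have "padic_abs l t = real l powi (- (- (int (multiplicity (int l) (snd (quotient_of t)))
                - int (multiplicity (int l) (fst (quotient_of t))))))"
    using assms by (simp add: padic_abs_def)
  then show ?thesis using that by blast
qed

lemma topspace_Vp: "prime l \<Longrightarrow> topspace (Vp_topology l) = Qp l \<times> Qp l"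
  using Metric_space.topspace_mtopology[OF Metric_space_Qp] by (simp add: Vp_topology_def)

text \<open>The ball is open, and compact in a Hausdorff space, hence closed; so its indicator is
  locally constant. Writing the radius as \<open>padic_abs l t\<close> makes it a power of
  \<open>l\<close>, and later lets a single rational \<open>t\<close> prescribe the radius at all
  places.\<close>

lemma indicator_ball_in_schwartz_loc:
  assumes l: "prime l" and t: "t \<noteq> 0"
  shows "(indicator (padic_ball l a (padic_abs l t) \<times> padic_ball l b (padic_abs l t)) :: _ \<Rightarrow> int)
    \<in> schwartz_loc l"
proof -
  define B where "B = padic_ball l a (padic_abs l t) \<times> padic_ball l b (padic_abs l t)"
  obtain k where k: "padic_abs l t = real l powi (- k)" using padic_abs_eq_powi[OF l t] .
  have pos: "padic_abs l t > 0" using padic_abs_pos[OF l t] .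
  have op: "openin (Vp_topology l) B"
    unfolding B_def Vp_topology_def using padic_ball_openin[OF l pos] by (simp add: openin_prod_Times_iff)
  have co: "compactin (Vp_topology l) B"
    unfolding B_def Vp_topology_def using padic_ball_compactin[OF l] by (simp add: compactin_Times k)
  have "Hausdorff_space (Vp_topology l)" unfolding Vp_topology_def
    using Metric_space.Hausdorff_space_mtopology[OF Metric_space_Qp[OF l]]
    by (simp add: Hausdorff_space_prod_topology)
  then have cl: "closedin (Vp_topology l) B" using co by (rule compactin_imp_closedin)
  have sub: "B \<subseteq> Qp l \<times> Qp l" unfolding B_def by (auto simp: padic_ball_def[OF l])
  have "\<exists>U. openin (Vp_topology l) U \<and> v \<in> U \<and> (\<forall>w\<in>U. indicator B w = (indicator B v :: int))"
    if v: "v \<in> Qp l \<times> Qp l" for v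
  proof (cases "v \<in> B")
    case True then show ?thesis using op by (intro exI[of _ B]) auto
  next
    case False
    have "openin (Vp_topology l) (Qp l \<times> Qp l - B)"
      using cl by (simp add: closedin_def topspace_Vp[OF l])
    then show ?thesis using False v by (intro exI[of _ "Qp l \<times> Qp l - B"]) auto
  qed
  then show ?thesis unfolding B_def[symmetric] schwartz_loc_def using co sub
    by (auto simp: indicator_def)
qed

text \<open>Compactness makes local constancy uniform. Finitely many boxes cover the support, and by
  the ultrametric inequality a point close to a member of a box lies in that box, so the smallest
  radius serves everywhere. The same \<open>n\<close> also bounds the support.\<close>

lemma schwartz_loc_level:
  assumes l: "prime l" and g: "g \<in> schwartz_loc l"
  obtains n :: nat where
    "\<And>v w. v \<in> Qp l \<times> Qp l \<Longrightarrow> w \<in> Qp l \<times> Qp l \<Longrightarrow>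
       padic_dist l (fst v) (fst w) \<le> real l powi (- int n) \<Longrightarrow>
       padic_dist l (snd v) (snd w) \<le> real l powi (- int n) \<Longrightarrow> g v = g w"
    "\<And>v. v \<in> Qp l \<times> Qp l \<Longrightarrow> g v \<noteq> 0 \<Longrightarrow> padic_dist l (fst v) (padic_of_rat l 0) \<le> real l powi int n
       \<and> padic_dist l (snd v) (padic_of_rat l 0) \<le> real l powi int n"
proof -
  let ?d = "padic_dist l" and ?O = "padic_of_rat l 0"
  interpret Metric_space "Qp l" "padic_dist l" by (rule Metric_space_Qp[OF l])
  have l1: "real l > 1" using l_gt_1[OF l] .
  obtain K where K: "compactin (Vp_topology l) K" "\<And>v. v \<notin> K \<Longrightarrow> g v = 0"
    using g by (auto simp: schwartz_loc_def)
  have KQ: "K \<subseteq> Qp l \<times> Qp l" using compactin_subset_topspace[OF K(1)] topspace_Vp[OF l] by simp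
  define Bx where "Bx = (\<lambda>v n. {Y \<in> Qp l. ?d Y (fst v) \<le> real l powi (- int n)} \<times>
                                {Y \<in> Qp l. ?d Y (snd v) \<le> real l powi (- int n)})"
  have ex: "\<exists>n. (\<forall>w\<in>Bx v n. g w = g v) \<and> ?d (fst v) ?O \<le> real l powi int n \<and> ?d (snd v) ?O \<le> real l powi int n"
    if v: "v \<in> K" for v
  proof -
    have vQ: "v \<in> Qp l \<times> Qp l" using v KQ by blast
    then obtain U where U: "openin (Vp_topology l) U" "v \<in> U" "\<forall>w\<in>U. g w = g v"
      using g unfolding schwartz_loc_def by blast
    then obtain V W where VW: "openin mtopology V" "openin mtopology W" "fst v \<in> V" "snd v \<in> W" "V \<times> W \<subseteq> U"
      unfolding Vp_topology_def openin_prod_topology_alt by (metis prod.collapse)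
    obtain e1 where e1: "e1 > 0" "mball (fst v) e1 \<subseteq> V" using VW unfolding openin_mtopology by blast
    obtain e2 where e2: "e2 > 0" "mball (snd v) e2 \<subseteq> W" using VW unfolding openin_mtopology by blast
    have lim: "(\<lambda>n. real l powi (- int n)) \<longlonglongrightarrow> 0" using real_l_powi_tendsto[OF l, of 0] by simp
    have "eventually (\<lambda>n. real l powi (- int n) < e1) sequentially"
      using order_tendstoD(2)[OF lim] e1 by blast
    moreover have "eventually (\<lambda>n. real l powi (- int n) < e2) sequentially"
      using order_tendstoD(2)[OF lim] e2 by blast
    moreover have "eventually (\<lambda>n. M \<le> real l powi int n) sequentially" for M
    proof -
      obtain n where "M < real l ^ n" using real_arch_pow[OF l1] by blast
      then have "M \<le> real l powi int m" if "m \<ge> n" for m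
        using power_increasing[OF that, of "real l"] l1 unfolding power_int_of_nat by linarith
      then show ?thesis unfolding eventually_sequentially by blast
    qed
    ultimately have "eventually (\<lambda>n. real l powi (- int n) < e1 \<and> real l powi (- int n) < e2 \<and>
       ?d (fst v) ?O \<le> real l powi int n \<and> ?d (snd v) ?O \<le> real l powi int n) sequentially"
      by (intro eventually_conj)
    then obtain n where n: "real l powi (- int n) < e1" "real l powi (- int n) < e2"
       "?d (fst v) ?O \<le> real l powi int n" "?d (snd v) ?O \<le> real l powi int n"
      using eventually_happens'[OF sequentially_bot] by blast
    have "Bx v n \<subseteq> V \<times> W"
    proof
      fix w assume "w \<in> Bx v n"
      then have "fst w \<in> mball (fst v) e1" "snd w \<in> mball (snd v) e2"
        using n vQ padic_dist_commute[OF l, of "fst v" "fst w"] padic_dist_commute[OF l, of "snd v" "snd w"]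
        by (auto simp: Bx_def mem_Times_iff)
      then show "w \<in> V \<times> W" using e1 e2 by (auto simp: mem_Times_iff)
    qed
    then show ?thesis using n U VW by blast
  qed
  then obtain N where N: "\<And>v. v \<in> K \<Longrightarrow> (\<forall>w\<in>Bx v (N v). g w = g v) \<and>
      ?d (fst v) ?O \<le> real l powi int (N v) \<and> ?d (snd v) ?O \<le> real l powi int (N v)" by metis
  have opB: "openin (Vp_topology l) (Bx v n)" if "v \<in> K" for v n
    unfolding Vp_topology_def Bx_def openin_prod_Times_iff using that KQ l1
    by (intro disjI2 conjI padic_cball_openin[OF l]) auto
  have mem: "v \<in> Bx v n" if "v \<in> K" for v n
    using that KQ l1 padic_dist_eq_0_iff[OF l] by (fastforce simp: Bx_def mem_Times_iff)
  have "\<exists>\<F>. finite \<F> \<and> \<F> \<subseteq> (\<lambda>v. Bx v (N v)) ` K \<and> K \<subseteq> \<Union> \<F>"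
    by (rule compactinD[OF K(1)]) (use opB mem in blast)+
  then obtain FF where FF: "finite FF" "FF \<subseteq> (\<lambda>v. Bx v (N v)) ` K" "K \<subseteq> \<Union> FF" by blast
  obtain F where "F \<subseteq> K" "finite F" "FF = (\<lambda>v. Bx v (N v)) ` F"
    using finite_subset_image[OF FF(1,2)] by blast
  then have F: "finite F" "F \<subseteq> K" "K \<subseteq> (\<Union>v\<in>F. Bx v (N v))" using FF by auto
  \<comment> \<open>The sum is used as a common upper bound of finitely many natural
    numbers.\<close>
  define n where "n = (\<Sum>v\<in>F. N v)"
  have le: "N v \<le> n" if "v \<in> F" for v unfolding n_def using F that by (intro member_le_sum) auto
  have le1: "real l powi (- int n) \<le> real l powi (- int (N v))" "real l powi int (N v) \<le> real l powi int n"
    if "v \<in> F" for v using le[OF that] unfolding l_powi_le_iff[OF l] by auto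
  have *: "g v = g w" if v: "v \<in> K" and w: "w \<in> Qp l \<times> Qp l" and d: "?d (fst v) (fst w) \<le> real l powi (- int n)"
    "?d (snd v) (snd w) \<le> real l powi (- int n)" for v w
  proof -
    obtain u where u: "u \<in> F" "v \<in> Bx u (N u)" using F v by blast
    have q: "fst u \<in> Qp l" "snd u \<in> Qp l" "fst v \<in> Qp l" "snd v \<in> Qp l" using u F v KQ by auto
    have "w \<in> Bx u (N u)"
      using u w d le1[OF u(1)] q padic_dist_ultra[OF l, of "fst w" "fst v" "fst u"]
        padic_dist_ultra[OF l, of "snd w" "snd v" "snd u"] padic_dist_commute[OF l, of "fst v" "fst w"]
        padic_dist_commute[OF l, of "snd v" "snd w"]
      unfolding Bx_def mem_Times_iff mem_Collect_eq by linarith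
    moreover have "u \<in> K" using u F by blast
    ultimately show ?thesis using N[of u] u(2) by simp
  qed
  show ?thesis
  proof (rule that[of n])
    fix v w assume a: "v \<in> Qp l \<times> Qp l" "w \<in> Qp l \<times> Qp l" "?d (fst v) (fst w) \<le> real l powi (- int n)"
     "?d (snd v) (snd w) \<le> real l powi (- int n)"
    show "g v = g w"
    proof (cases "v \<in> K")
      case True then show ?thesis using * a by blast
    next
      case False
      then show ?thesis using *[of w v] a K(2) padic_dist_commute[OF l, of "fst v" "fst w"]
        padic_dist_commute[OF l, of "snd v" "snd w"] by (cases "w \<in> K") auto
    qed
  next
    fix v assume v: "v \<in> Qp l \<times> Qp l" "g v \<noteq> 0"
    then have "v \<in> K" using K(2) by blast
    then obtain u where u: "u \<in> F" "v \<in> Bx u (N u)" using F by blast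
    have q: "fst u \<in> Qp l" "snd u \<in> Qp l" using u F KQ by auto
    have "real l powi (- int (N u)) \<le> real l powi int (N u)" unfolding l_powi_le_iff[OF l] by simp
    then show "?d (fst v) ?O \<le> real l powi int n \<and> ?d (snd v) ?O \<le> real l powi int n"
      using u(2) v q N[of u] subsetD[OF F(2) u(1)] le1[OF u(1)] padic_of_rat_in[OF l, of 0]
        padic_dist_ultra[OF l, of "fst v" "fst u" ?O] padic_dist_ultra[OF l, of "snd v" "snd u" ?O]
      unfolding Bx_def mem_Times_iff mem_Collect_eq by linarith
  qed
qed

section \<open>Congruences of adelic vectors\<close>

definition rat_pt :: "nat set \<Rightarrow> rat \<Rightarrow> rat \<Rightarrow> adele2" where
  "rat_pt S a b = (\<lambda>l\<in>places S. (padic_of_rat l a, padic_of_rat l b))"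

text \<open>Congruence modulo t times the integral adeles away from \<open>S\<close>. With
  \<open>t = 1 / N\<close> it expresses a bounded denominator, with \<open>t = N\<close> a
  period.\<close>

definition adele_cong :: "nat set \<Rightarrow> rat \<Rightarrow> adele2 \<Rightarrow> adele2 \<Rightarrow> bool" where
  "adele_cong S t v w \<longleftrightarrow> (\<forall>l\<in>places S. padic_dist l (fst (v l)) (fst (w l)) \<le> padic_abs l t \<and>
      padic_dist l (snd (v l)) (snd (w l)) \<le> padic_abs l t)"

text \<open>The characteristic function of a coset of t times the integral lattice. Scalar matrices
  change only \<open>t\<close> and the centre, so \<open>coset_fun\<close> and its scalings all have
  this form.\<close>

definition adic_coset :: "nat set \<Rightarrow> rat \<Rightarrow> rat \<Rightarrow> rat \<Rightarrow> adele2 \<Rightarrow> int" where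
  "adic_coset S t a b v = (if v \<in> VA S \<and> adele_cong S t v (rat_pt S a b) then 1 else 0)"

lemma places_prime: "l \<in> places S \<Longrightarrow> prime l"
  by (simp add: places_def)

lemma VA_zero_eq: "VA_zero S = rat_pt S 0 0"
  by (simp add: VA_zero_def rat_pt_def)

lemma VA_D: "v \<in> VA S \<Longrightarrow> l \<in> places S \<Longrightarrow> fst (v l) \<in> Qp l \<and> snd (v l) \<in> Qp l"
  by (auto simp: VA_def)

lemma int_dvd_pos_iff: "b > 0 \<Longrightarrow> int l dvd b \<longleftrightarrow> l dvd nat b"
  using int_dvd_int_iff[of l "nat b"] by simp

lemma finite_primes_padic_abs_gt_1: "finite {l. prime l \<and> \<not> padic_abs l x \<le> 1}"
proof -
  obtain a b where x: "b > 0" "x = of_int a / of_int b" "quotient_of x = (a, b)" by (rule rat_as_quotient)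
  have "{l. prime l \<and> \<not> padic_abs l x \<le> 1} \<subseteq> {l. l dvd nat b}"
    using x by (auto simp: padic_abs_le_1_iff int_dvd_pos_iff)
  then show ?thesis using x by (auto intro: finite_subset)
qed

lemma rat_pt_in_VA [simp]: "rat_pt S a b \<in> VA S"
proof -
  have "{l \<in> places S. rat_pt S a b l \<notin> Zp l \<times> Zp l} \<subseteq>
     {l. prime l \<and> \<not> padic_abs l a \<le> 1} \<union> {l. prime l \<and> \<not> padic_abs l b \<le> 1}"
    by (auto simp: rat_pt_def Zp_def padic_dist_of_rat places_prime padic_of_rat_in)
  then have "finite {l \<in> places S. rat_pt S a b l \<notin> Zp l \<times> Zp l}"
    using finite_primes_padic_abs_gt_1 by (auto intro: finite_subset)
  then show ?thesis by (auto simp: VA_def rat_pt_def padic_of_rat_in places_prime)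
qed

lemma adele_cong_sym: "adele_cong S t v w \<Longrightarrow> adele_cong S t w v"
  by (auto simp: adele_cong_def padic_dist_commute places_prime)

lemma adele_cong_trans:
  assumes "adele_cong S t u v" "adele_cong S t v w" "u \<in> VA S" "v \<in> VA S" "w \<in> VA S"
  shows "adele_cong S t u w"
  unfolding adele_cong_def
proof
  fix l assume l: "l \<in> places S"
  show "padic_dist l (fst (u l)) (fst (w l)) \<le> padic_abs l t \<and>
      padic_dist l (snd (u l)) (snd (w l)) \<le> padic_abs l t"
    using assms(1,2) l VA_D[OF assms(3) l] VA_D[OF assms(4) l] VA_D[OF assms(5) l]
      padic_dist_ultra[OF places_prime[OF l], of "fst (u l)" "fst (v l)" "fst (w l)"]
      padic_dist_ultra[OF places_prime[OF l], of "snd (u l)" "snd (v l)" "snd (w l)"]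
    unfolding adele_cong_def by (meson max.boundedI order_trans)
qed

lemma adele_cong_mono:
  "adele_cong S t v w \<Longrightarrow> (\<And>l. l \<in> places S \<Longrightarrow> padic_abs l t \<le> padic_abs l t') \<Longrightarrow> adele_cong S t' v w"
  unfolding adele_cong_def by (meson order_trans)

lemma adele_cong_rat_pt:
  "adele_cong S t (rat_pt S a b) (rat_pt S a' b') \<longleftrightarrow>
    (\<forall>l\<in>places S. padic_abs l (a - a') \<le> padic_abs l t \<and> padic_abs l (b - b') \<le> padic_abs l t)"
  by (auto simp: adele_cong_def rat_pt_def padic_dist_of_rat places_prime)

lemma pure_tensor_balls:
  assumes "t \<noteq> 0"
    and F: "\<And>l. l \<in> places S \<Longrightarrow>
      F l = indicator (padic_ball l a (padic_abs l t) \<times> padic_ball l b (padic_abs l t))"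
  shows "F \<in> restricted_families S" "pure_tensor S F = adic_coset S t a b"
proof -
  have co: "coset_loc 0 0 l = indicator (Zp l \<times> Zp l)" if "l \<in> places S" for l
    using padic_coset_eq_ball[OF places_prime[OF that]] Zp_eq_ball[OF places_prime[OF that]]
    by (simp add: coset_loc_def)
  have ball_eq: "padic_ball l a (padic_abs l t) = Zp l"
    if l: "l \<in> places S" and "padic_abs l a \<le> 1" "padic_abs l t = 1" for l a
  proof -
    have "padic_dist l X (padic_of_rat l a) \<le> 1 \<longleftrightarrow> padic_dist l X (padic_of_rat l 0) \<le> 1" if "X \<in> Qp l" for X
      using that padic_dist_ultra[OF places_prime[OF l], of X "padic_of_rat l a" "padic_of_rat l 0"]
        padic_dist_ultra[OF places_prime[OF l], of X "padic_of_rat l 0" "padic_of_rat l a"]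
        \<open>padic_abs l a \<le> 1\<close> places_prime[OF l]
      by (auto simp: padic_dist_of_rat padic_of_rat_in)
    then show ?thesis using \<open>padic_abs l t = 1\<close>
      by (auto simp: padic_ball_def[OF places_prime[OF l]] Zp_def)
  qed
  \<comment> \<open>Outside these finitely many primes \<open>a\<close> and \<open>b\<close> are
    integral and \<open>t\<close> is a unit, so that the local ball is the standard lattice.\<close>
  let ?bad = "{l. prime l \<and> \<not> padic_abs l a \<le> 1} \<union> {l. prime l \<and> \<not> padic_abs l b \<le> 1} \<union>
     {l. prime l \<and> \<not> padic_abs l t \<le> 1} \<union> {l. prime l \<and> \<not> padic_abs l (inverse t) \<le> 1}"
  have fin: "finite ?bad" using finite_primes_padic_abs_gt_1 by blast
  have Feq: "F l = indicator (Zp l \<times> Zp l)" if l: "l \<in> places S" "l \<notin> ?bad" for l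
  proof -
    have a: "padic_abs l a \<le> 1" "padic_abs l b \<le> 1" "padic_abs l t \<le> 1" "padic_abs l (inverse t) \<le> 1"
      using l places_prime[OF l(1)] by auto
    have "padic_abs l t = 1"
      using a(3,4) padic_abs_pos[OF places_prime[OF l(1)] assms(1)]
      by (simp add: padic_abs_inverse[OF places_prime[OF l(1)]] inverse_le_1_iff)
    then show ?thesis using F[OF l(1)] ball_eq[OF l(1)] a by simp
  qed
  have "{l \<in> places S. F l \<noteq> coset_loc 0 0 l} \<subseteq> ?bad" using Feq co by force
  then have "finite {l \<in> places S. F l \<noteq> coset_loc 0 0 l}" using fin finite_subset by blast
  then show "F \<in> restricted_families S"
    unfolding restricted_families_def
    using F indicator_ball_in_schwartz_loc[OF places_prime assms(1)] by auto
  show "pure_tensor S F = adic_coset S t a b"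
  proof
    fix v
    show "pure_tensor S F v = adic_coset S t a b v"
    proof (cases "v \<in> VA S")
      case True
      let ?X = "{l \<in> places S. F l (v l) \<noteq> 1}"
      have "?X \<subseteq> ?bad \<union> {l \<in> places S. v l \<notin> Zp l \<times> Zp l}"
        using Feq by (force simp: indicator_def split: if_splits)
      moreover have "finite {l \<in> places S. v l \<notin> Zp l \<times> Zp l}" using True by (simp add: VA_def)
      ultimately have finX: "finite ?X" using fin by (meson finite_Un finite_subset)
      have 01: "F l (v l) = (if padic_dist l (fst (v l)) (padic_of_rat l a) \<le> padic_abs l t \<and>
         padic_dist l (snd (v l)) (padic_of_rat l b) \<le> padic_abs l t then 1 else 0)" if "l \<in> places S" for l
        using VA_D[OF True that] by (auto simp: F[OF that] indicator_def padic_ball_def[OF places_prime[OF that]] mem_Times_iff)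
      have "?X = {} \<longleftrightarrow> adele_cong S t v (rat_pt S a b)"
        using 01 by (auto simp: adele_cong_def rat_pt_def split: if_splits)
      moreover have "(\<Prod>l\<in>?X. F l (v l)) = 0" if "?X \<noteq> {}"
        using finX that 01 by (auto simp: prod_zero_iff split: if_splits)
      ultimately show ?thesis using True by (auto simp: pure_tensor_def adic_coset_def simp del: prod_zero_iff)
    qed (simp add: pure_tensor_def adic_coset_def)
  qed
qed

lemma coset_fun_eq: "coset_fun S a b = adic_coset S 1 a b"
  unfolding coset_fun_def
  by (rule pure_tensor_balls(2)) (auto simp: coset_loc_def padic_coset_eq_ball places_prime)

lemma sum_in_schwartz:
  assumes "finite I" "\<And>i. i \<in> I \<Longrightarrow> F i \<in> restricted_families S"
  shows "(\<lambda>v. \<Sum>i\<in>I. k i * pure_tensor S (F i) v) \<in> schwartz S"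
proof -
  obtain h where h: "bij_betw h {..<card I} I" using ex_bij_betw_nat_finite[OF assms(1)]
    by (auto simp: atLeast0LessThan)
  have "(\<lambda>v. \<Sum>i\<in>I. k i * pure_tensor S (F i) v) = (\<lambda>v. \<Sum>i<card I. k (h i) * pure_tensor S (F (h i)) v)"
    using sum.reindex_bij_betw[OF h, symmetric] by blast
  then show ?thesis unfolding schwartz_def mem_Collect_eq
    using assms(2) bij_betwE[OF h]
    by (intro exI[of _ "card I"] exI[of _ "k \<circ> h"] exI[of _ "F \<circ> h"]) auto
qed


section \<open>Levels\<close>

text \<open>\<open>f\<close> has period N and its support has denominator N, so it is determined by
  its values at the finitely many rational points (i/N, j/N) modulo N.\<close>

definition level :: "nat set \<Rightarrow> nat \<Rightarrow> (adele2 \<Rightarrow> int) \<Rightarrow> bool" where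
  "level S N f \<longleftrightarrow> (\<forall>v. v \<notin> VA S \<longrightarrow> f v = 0) \<and>
     (\<forall>v\<in>VA S. \<forall>w\<in>VA S. adele_cong S (of_nat N) v w \<longrightarrow> f v = f w) \<and>
     (\<forall>v\<in>VA S. f v \<noteq> 0 \<longrightarrow> adele_cong S (1 / of_nat N) v (VA_zero S))"

lemma padic_abs_of_nat_dvd:
  assumes "prime l" "M dvd N" shows "padic_abs l (of_nat N) \<le> padic_abs l (of_nat M)"
proof -
  obtain k where "N = M * k" using assms(2) by blast
  then show ?thesis using padic_abs_of_nat_le_1[OF assms(1), of k]
    by (simp add: padic_abs_mult[OF assms(1)] mult_left_le)
qed

lemma level_mono:
  assumes "level S M f" "M dvd N" "N > 0" shows "level S N f"
proof -
  have "padic_abs l (1 / of_nat M) \<le> padic_abs l (1 / of_nat N)" if "l \<in> places S" for l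
  proof -
    have p: "prime l" using that by (rule places_prime)
    have "padic_abs l (of_nat N) > 0" using p assms by (intro padic_abs_pos) auto
    then show ?thesis using padic_abs_of_nat_dvd[OF p assms(2)] p
      by (simp add: padic_abs_divide divide_left_mono frac_le)
  qed
  then show ?thesis using assms(1) padic_abs_of_nat_dvd[OF places_prime assms(2)] adele_cong_mono
    unfolding level_def by meson
qed

lemma pure_tensor_nonzero:
  assumes "F \<in> restricted_families S" "pure_tensor S F v \<noteq> 0" "l \<in> places S"
  shows "F l (v l) \<noteq> 0"
proof -
  have v: "v \<in> VA S" using assms(2) by (simp add: pure_tensor_def split: if_splits)
  have "{l \<in> places S. F l (v l) \<noteq> 1} \<subseteq> {l \<in> places S. F l \<noteq> coset_loc 0 0 l} \<union>
     {l \<in> places S. v l \<notin> Zp l \<times> Zp l}"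
    using padic_coset_eq_ball[OF places_prime] Zp_eq_ball[OF places_prime]
    by (auto simp: coset_loc_def indicator_def split: if_splits)
  moreover have "finite ({l \<in> places S. F l \<noteq> coset_loc 0 0 l} \<union> {l \<in> places S. v l \<notin> Zp l \<times> Zp l})"
    using assms(1) v by (simp add: restricted_families_def VA_def)
  \<comment> \<open>Finiteness is essential: a product over an infinite index set is 1 by convention
    and would hide a vanishing factor.\<close>
  ultimately have "finite {l \<in> places S. F l (v l) \<noteq> 1}" by (rule finite_subset)
  then show ?thesis using assms(2,3) v by (auto simp: pure_tensor_def split: if_splits)
qed

section \<open>Integers at \<open>S\<close>, strong approximation, and the description of test
  functions by levels\<close>

locale smoothing =
  fixes c :: nat and S :: "nat set"
  assumes c_gt_1: "c > 1" and c_coprime_6: "coprime c 6"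
    and S_eq: "S = {l. prime l \<and> l dvd c}"
begin

lemma places_iff: "l \<in> places S \<longleftrightarrow> prime l \<and> \<not> l dvd c"
  by (auto simp: places_def S_eq)

lemma prime_cases: "prime l \<Longrightarrow> l \<in> places S \<or> l \<in> S"
  by (auto simp: places_def)

lemma padic_abs_coprime_S: "l \<in> S \<Longrightarrow> coprime N c \<Longrightarrow> padic_abs l (of_nat N) = 1"
  using coprime_divisors[of l c N N] padic_abs_of_nat_coprime[of l N]
  by (simp add: S_eq coprime_commute)

text \<open>At the primes in \<open>S\<close> the number \<open>N\<close> is a unit, so the bound
  holds there automatically and divisibility can be tested prime by prime.\<close>

lemma dvd_if_padic_abs_le:
  assumes "coprime N c" "N > 0" "\<And>l. l \<in> places S \<Longrightarrow> padic_abs l (of_int m) \<le> padic_abs l (of_nat N)"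
  shows "int N dvd m"
proof (cases "m = 0")
  case False
  have "multiplicity p (int N) \<le> multiplicity p m" if p: "prime p" for p :: int
  proof -
    define l where "l = nat p"
    have l: "p = int l" "prime l" using p prime_int_nat_transfer[of p] by (simp_all only: l_def nat_0_le)
    have "padic_abs l (of_int m) \<le> padic_abs l (of_nat N)"
      using prime_cases[OF l(2)] assms(3) padic_abs_coprime_S[OF _ assms(1)]
        padic_abs_of_int_le_1[OF l(2), of m] by auto
    then have "real l powi (- int (multiplicity (int l) m)) \<le> real l powi (- int (multiplicity (int l) (int N)))"
      using padic_abs_of_int[OF l(2) False] padic_abs_of_int[OF l(2), of "int N"] assms(2) by simp
    then show ?thesis using l by (simp add: l_powi_le_iff)
  qed
  then show ?thesis using multiplicity_le_imp_dvd[of "int N" m] assms(2) by simp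
qed simp

lemma int_if_padic_abs_le_1:
  assumes "x \<in> Z_S S" "\<And>l. l \<in> places S \<Longrightarrow> padic_abs l x \<le> 1" shows "x \<in> \<int>"
proof -
  obtain a b where x: "b > 0" "x = of_int a / of_int b" "quotient_of x = (a, b)" by (rule rat_as_quotient)
  have "\<not> l dvd nat b" if "prime l" for l
  proof -
    have "padic_abs l x \<le> 1" using prime_cases[OF that] assms by (auto simp: Z_S_def)
    then show ?thesis using x padic_abs_le_1_iff[OF that] by (simp add: int_dvd_pos_iff)
  qed
  then have "nat b = 1" using prime_factor_nat by blast
  then have "b = 1" using x by simp
  then show ?thesis using x by simp
qed

lemma Z_S_cases:
  assumes "x \<in> Z_S S" obtains a :: int and N :: nat where "N > 0" "coprime N c" "x = of_int a / of_nat N"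
proof -
  obtain a b where x: "b > 0" "x = of_int a / of_int b" "quotient_of x = (a, b)" by (rule rat_as_quotient)
  have "coprime (nat b) c"
  proof (rule ccontr)
    assume "\<not> coprime (nat b) c"
    then have "gcd (nat b) c \<noteq> 1" by (simp add: coprime_iff_gcd_eq_1)
    then obtain l where l: "prime l" "l dvd gcd (nat b) c" using prime_factor_nat by blast
    then have l: "prime l" "l dvd nat b" "l dvd c" by auto
    then have "padic_abs l x \<le> 1" using assms by (auto simp: Z_S_def S_eq)
    then show False using x l padic_abs_le_1_iff[OF l(1), of x] by (simp add: int_dvd_pos_iff)
  qed
  then show ?thesis using that[of "nat b" a] x by simp
qed

lemma Z_S_of_int: "of_int a \<in> Z_S S"
  using padic_abs_of_int_le_1 by (auto simp: Z_S_def S_eq)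

lemma Z_S_add: "x \<in> Z_S S \<Longrightarrow> y \<in> Z_S S \<Longrightarrow> x + y \<in> Z_S S"
  unfolding Z_S_def S_eq using order_trans[OF padic_abs_add] by simp

lemma Z_S_minus: "x \<in> Z_S S \<Longrightarrow> - x \<in> Z_S S"
  by (auto simp: Z_S_def S_eq)

lemma Z_S_mult: "x \<in> Z_S S \<Longrightarrow> y \<in> Z_S S \<Longrightarrow> x * y \<in> Z_S S"
  by (auto simp: Z_S_def S_eq padic_abs_mult mult_le_one)

lemma Z_S_inverse_nat: "coprime N c \<Longrightarrow> 1 / of_nat N \<in> Z_S S"
  using padic_abs_coprime_S by (auto simp: Z_S_def S_eq padic_abs_divide)

lemma Z_S_divide_nat: "x \<in> Z_S S \<Longrightarrow> coprime N c \<Longrightarrow> x / of_nat N \<in> Z_S S"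
  using Z_S_mult[OF _ Z_S_inverse_nat, of x N] by simp

text \<open>Approximation at the primes dividing \<open>K\<close> by density, then the Chinese remainder theorem.\<close>

lemma strong_approximation:
  assumes X: "\<And>l. l \<in> places S \<Longrightarrow> X l \<in> Qp l \<and> padic_dist l (X l) (padic_of_rat l a) \<le> padic_abs l s"
    and s: "s \<noteq> 0" and K: "K > 0"
  obtains i where "i < K" "\<And>l. l \<in> places S \<Longrightarrow>
    padic_dist l (X l) (padic_of_rat l (a + s * of_nat i)) \<le> padic_abs l (s * of_nat K)"
proof -
  \<comment> \<open>Only the primes dividing \<open>K\<close> constrain \<open>i\<close>; at the
    other places \<open>K\<close> is a unit and every integer is close enough.\<close>
  define P where "P = {l \<in> places S. l dvd K}"
  have finP: "finite P" unfolding P_def by (rule finite_subset[OF _ finite_divisors_nat[OF K]]) auto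
  define m where "m = (\<lambda>l. l ^ multiplicity (int l) (int K))"
  have absK: "padic_abs l (of_nat K) = real l powi (- int (multiplicity (int l) (int K)))" if "prime l" for l
    using padic_abs_of_int[OF that, of "int K"] K by simp
  have "\<exists>i. padic_dist l (X l) (padic_of_rat l (a + s * of_nat i)) \<le> padic_abs l (s * of_nat K)"
    if l: "l \<in> places S" for l
  proof -
    have p: "prime l" using l by (rule places_prime)
    have pos: "padic_abs l (s * of_nat K) > 0" using s K by (intro padic_abs_pos[OF p]) auto
    obtain r where r: "padic_dist l (X l) (padic_of_rat l r) < padic_abs l (s * of_nat K)"
      using padic_dense[OF p conjunct1[OF X[OF l]] pos] .
    have "padic_abs l (s * of_nat K) \<le> padic_abs l s"
      using padic_abs_of_nat_le_1[OF p, of K] by (simp add: padic_abs_mult[OF p] mult_left_le)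
    then have "padic_abs l (r - a) \<le> padic_abs l s"
      using r X[OF l] padic_dist_ultra[OF p, of "padic_of_rat l r" "X l" "padic_of_rat l a"]
        padic_dist_commute[OF p, of "X l" "padic_of_rat l r"]
      by (auto simp: padic_dist_of_rat[OF p] padic_of_rat_in[OF p])
    then have "padic_abs l ((r - a) / s) \<le> 1"
      using padic_abs_pos[OF p s] by (simp add: padic_abs_divide[OF p])
    then obtain i where i: "padic_abs l ((r - a) / s - of_nat i) \<le> real l powi (- int (multiplicity (int l) (int K)))"
      using padic_integer_approx[OF p] by blast
    have "r - (a + s * of_nat i) = s * ((r - a) / s - of_nat i)" using s by (simp add: field_simps)
    then have "padic_abs l (r - (a + s * of_nat i)) \<le> padic_abs l (s * of_nat K)"
      using i by (simp add: padic_abs_mult[OF p] absK[OF p] mult_left_mono)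
    then show ?thesis
      using r X[OF l] padic_dist_ultra[OF p, of "X l" "padic_of_rat l r" "padic_of_rat l (a + s * of_nat i)"]
      by (intro exI[of _ i]) (auto simp: padic_dist_of_rat[OF p] padic_of_rat_in[OF p])
  qed
  then obtain u where u: "\<And>l. l \<in> places S \<Longrightarrow>
      padic_dist l (X l) (padic_of_rat l (a + s * of_nat (u l))) \<le> padic_abs l (s * of_nat K)" by metis
  have "\<forall>i\<in>P. \<forall>j\<in>P. i \<noteq> j \<longrightarrow> coprime (m i) (m j)"
    by (auto simp: P_def m_def places_prime primes_coprime)
  then obtain x where x: "\<And>l. l \<in> P \<Longrightarrow> [x = u l] (mod m l)"
    using chinese_remainder_nat[OF finP, of m u] by blast
  define i where "i = x mod K"
  show ?thesis
  proof (rule that[of i])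
    show "i < K" using K by (simp add: i_def)
    fix l assume l: "l \<in> places S"
    have p: "prime l" using l by (rule places_prime)
    have "padic_abs l (of_nat (u l) - of_nat i) \<le> padic_abs l (of_nat K)"
    proof (cases "l dvd K")
      case True
      then have "[x = u l] (mod m l)" using x l by (simp add: P_def)
      moreover have "[i = x] (mod m l)" unfolding i_def
      proof (rule cong_dvd_modulus_nat[of _ _ K])
        have "int (m l) dvd int K" unfolding m_def of_nat_power by (rule multiplicity_dvd)
        then show "m l dvd K" by simp
      qed (simp add: cong_def)
      ultimately have "[i = u l] (mod m l)" using cong_trans by blast
      then have "[int (u l) = int i] (mod int (m l))" by (simp add: cong_int_iff cong_sym_eq)
      then have "int l ^ multiplicity (int l) (int K) dvd int (u l) - int i" by (simp add: cong_iff_dvd_diff m_def)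
      then show ?thesis using padic_abs_of_int_le_iff[OF p, of "int (u l) - int i"] absK[OF p] by simp
    next
      case False
      then have "padic_abs l (of_nat K) = 1"
        using p by (intro padic_abs_of_nat_coprime[OF p]) (simp add: prime_imp_coprime)
      then show ?thesis using padic_abs_of_int_le_1[OF p, of "int (u l) - int i"] by simp
    qed
    then have "padic_abs l (s * (of_nat (u l) - of_nat i)) \<le> padic_abs l (s * of_nat K)"
      by (simp add: padic_abs_mult[OF p] mult_left_mono)
    then have "padic_dist l (padic_of_rat l (a + s * of_nat (u l))) (padic_of_rat l (a + s * of_nat i))
        \<le> padic_abs l (s * of_nat K)"
      by (simp add: padic_dist_of_rat[OF p] algebra_simps)
    then show "padic_dist l (X l) (padic_of_rat l (a + s * of_nat i)) \<le> padic_abs l (s * of_nat K)"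
      using u[OF l] X[OF l] padic_dist_ultra[OF p, of "X l" "padic_of_rat l (a + s * of_nat (u l))"
          "padic_of_rat l (a + s * of_nat i)"] padic_of_rat_in[OF p] by auto
  qed
qed

lemma residue_unique:
  assumes "coprime K c" "i < K" "j < K"
    "\<And>l. l \<in> places S \<Longrightarrow> padic_abs l (of_nat i - of_nat j) \<le> padic_abs l (of_nat K)"
  shows "i = j"
proof -
  have "int K dvd int i - int j"
    using assms by (intro dvd_if_padic_abs_le) auto
  then show ?thesis using assms(2,3)
    by (metis cong_iff_dvd_diff cong_int_iff cong_less_modulus_unique_nat)
qed

text \<open>Both coordinates are treated separately: strong approximation gives a residue modulo
  \<open>K\<close>, and it is unique because \<open>K\<close> is prime to \<open>c\<close>, so that
  the places outside \<open>S\<close> detect divisibility by \<open>K\<close>.\<close>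

lemma adele_cong_residue_ex1:
  assumes v: "v \<in> VA S" "adele_cong S s v (rat_pt S a b)" and s: "s \<noteq> 0" and K: "K > 0" "coprime K c"
  obtains i j where "i < K" "j < K"
    "\<And>i' j'. i' < K \<Longrightarrow> j' < K \<Longrightarrow>
       adele_cong S (s * of_nat K) v (rat_pt S (a + s * of_nat i') (b + s * of_nat j')) \<longleftrightarrow> i' = i \<and> j' = j"
proof -
  have vQ: "fst (v l) \<in> Qp l" "snd (v l) \<in> Qp l" if "l \<in> places S" for l using VA_D[OF v(1) that] by auto
  have vc: "padic_dist l (fst (v l)) (padic_of_rat l a) \<le> padic_abs l s"
     "padic_dist l (snd (v l)) (padic_of_rat l b) \<le> padic_abs l s" if "l \<in> places S" for l
    using v(2) that by (auto simp: adele_cong_def rat_pt_def)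
  obtain i where i: "i < K" "\<And>l. l \<in> places S \<Longrightarrow>
    padic_dist l (fst (v l)) (padic_of_rat l (a + s * of_nat i)) \<le> padic_abs l (s * of_nat K)"
    using strong_approximation[of "\<lambda>l. fst (v l)" a s K] vQ vc s K by blast
  obtain j where j: "j < K" "\<And>l. l \<in> places S \<Longrightarrow>
    padic_dist l (snd (v l)) (padic_of_rat l (b + s * of_nat j)) \<le> padic_abs l (s * of_nat K)"
    using strong_approximation[of "\<lambda>l. snd (v l)" b s K] vQ vc s K by blast
  have cij: "adele_cong S (s * of_nat K) v (rat_pt S (a + s * of_nat i) (b + s * of_nat j))"
    using i j by (auto simp: adele_cong_def rat_pt_def)
  have uniq: "i' = i'' \<and> j' = j''" if "i' < K" "j' < K" "i'' < K" "j'' < K"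
    and cong: "adele_cong S (s * of_nat K) (rat_pt S (a + s * of_nat i') (b + s * of_nat j'))
      (rat_pt S (a + s * of_nat i'') (b + s * of_nat j''))" for i' i'' j' j''
  proof -
    have "padic_abs l (of_nat i' - of_nat i'') \<le> padic_abs l (of_nat K) \<and>
          padic_abs l (of_nat j' - of_nat j'') \<le> padic_abs l (of_nat K)" if l: "l \<in> places S" for l
    proof -
      have p: "prime l" using l by (rule places_prime)
      have "padic_abs l (s * (of_nat i' - of_nat i'')) \<le> padic_abs l (s * of_nat K)"
        "padic_abs l (s * (of_nat j' - of_nat j'')) \<le> padic_abs l (s * of_nat K)"
        using cong l unfolding adele_cong_rat_pt by (auto simp: algebra_simps)
      then show ?thesis using padic_abs_pos[OF p s] by (simp add: padic_abs_mult[OF p])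
    qed
    then show ?thesis using residue_unique[OF K(2)] that by blast
  qed
  show ?thesis
  proof (rule that[OF i(1) j(1)])
    fix i' j' assume "i' < K" "j' < K"
    then show "adele_cong S (s * of_nat K) v (rat_pt S (a + s * of_nat i') (b + s * of_nat j')) \<longleftrightarrow> i' = i \<and> j' = j"
      using uniq[of i' j' i j] i(1) j(1) cij adele_cong_trans[OF adele_cong_sym cij _ v(1)] by auto
  qed
qed

text \<open>The identity between test functions that forces the distribution relation on coset
  values.\<close>

lemma adic_coset_split:
  assumes s: "s \<noteq> 0" and K: "K > 0" "coprime K c"
  shows "adic_coset S s a b v =
    (\<Sum>i<K. \<Sum>j<K. adic_coset S (s * of_nat K) (a + s * of_nat i) (b + s * of_nat j) v)"
proof (cases "v \<in> VA S \<and> adele_cong S s v (rat_pt S a b)")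
  case True
  then obtain i j where ij: "i < K" "j < K"
    "\<And>i' j'. i' < K \<Longrightarrow> j' < K \<Longrightarrow>
       adele_cong S (s * of_nat K) v (rat_pt S (a + s * of_nat i') (b + s * of_nat j')) \<longleftrightarrow> i' = i \<and> j' = j"
    using adele_cong_residue_ex1[OF _ _ s K] by metis
  have "(\<Sum>i<K. \<Sum>j<K. adic_coset S (s * of_nat K) (a + s * of_nat i) (b + s * of_nat j) v) =
      (\<Sum>i'<K. \<Sum>j'<K. if i' = i \<and> j' = j then 1 else 0)"
    using True ij by (intro sum.cong refl) (auto simp: adic_coset_def)
  also have "\<dots> = (\<Sum>i'<K. if i' = i then 1 else 0)"
    using ij by (intro sum.cong refl) auto
  also have "\<dots> = 1" using ij by simp
  finally show ?thesis using True by (simp add: adic_coset_def)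
next
  case False
  have "adic_coset S (s * of_nat K) (a + s * of_nat i) (b + s * of_nat j) v = 0" for i j
  proof (cases "v \<in> VA S")
    case True
    have "\<not> adele_cong S (s * of_nat K) v (rat_pt S (a + s * of_nat i) (b + s * of_nat j))"
    proof
      assume "adele_cong S (s * of_nat K) v (rat_pt S (a + s * of_nat i) (b + s * of_nat j))"
      then have "adele_cong S s v (rat_pt S (a + s * of_nat i) (b + s * of_nat j))"
        by (rule adele_cong_mono)
           (simp add: places_prime padic_abs_mult padic_abs_of_nat_le_1 mult_left_le)
      moreover have "adele_cong S s (rat_pt S (a + s * of_nat i) (b + s * of_nat j)) (rat_pt S a b)"
        by (auto simp: adele_cong_rat_pt places_prime padic_abs_mult padic_abs_of_nat_le_1 mult_left_le)
      ultimately show False using adele_cong_trans False True rat_pt_in_VA by blast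
    qed
    then show ?thesis by (simp add: adic_coset_def)
  qed (simp add: adic_coset_def)
  then show ?thesis using False by (auto simp: adic_coset_def)
qed

text \<open>The support lies in the coset of modulus 1/N around 0. Splitting it with K = N^2 gives
  cosets of modulus N, and on each of them \<open>f\<close> is constant.\<close>

lemma level_decompose:
  assumes f: "level S N f" and N: "N > 0" "coprime N c"
  shows "f v = (\<Sum>i<N^2. \<Sum>j<N^2. f (rat_pt S (of_nat i / of_nat N) (of_nat j / of_nat N)) *
     adic_coset S (of_nat N) (of_nat i / of_nat N) (of_nat j / of_nat N) v)"
proof -
  have eq: "(1 / of_nat N) * of_nat (N^2) = (of_nat N :: rat)" using N by (simp add: power2_eq_square)
  have "f v = f v * adic_coset S (1 / of_nat N) 0 0 v"
    using f unfolding level_def VA_zero_eq adic_coset_def by auto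
  also have "\<dots> = f v * (\<Sum>i<N^2. \<Sum>j<N^2. adic_coset S (of_nat N) (of_nat i / of_nat N) (of_nat j / of_nat N) v)"
    using adic_coset_split[of "1 / of_nat N" "N^2" 0 0 v] N unfolding eq by simp
  also have "\<dots> = (\<Sum>i<N^2. \<Sum>j<N^2. f v * adic_coset S (of_nat N) (of_nat i / of_nat N) (of_nat j / of_nat N) v)"
    by (simp add: sum_distrib_left)
  also have "\<dots> = (\<Sum>i<N^2. \<Sum>j<N^2. f (rat_pt S (of_nat i / of_nat N) (of_nat j / of_nat N)) *
     adic_coset S (of_nat N) (of_nat i / of_nat N) (of_nat j / of_nat N) v)"
    using f by (intro sum.cong refl) (auto simp: adic_coset_def level_def)
  finally show ?thesis .
qed

text \<open>\<open>N\<close> is the product of the local levels at the exceptional places. These lie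
  outside \<open>S\<close>, whence \<open>N\<close> is prime to \<open>c\<close>; at all other
  places the factor is the standard one and both conditions have modulus 1.\<close>

lemma pure_tensor_level:
  assumes F: "F \<in> restricted_families S"
  shows "\<exists>N>0. coprime N c \<and> level S N (pure_tensor S F)"
proof -
  define B where "B = {l \<in> places S. F l \<noteq> coset_loc 0 0 l}"
  have finB: "finite B" using F by (simp add: B_def restricted_families_def)
  have "\<exists>n::nat. (\<forall>v\<in>Qp l \<times> Qp l. \<forall>w\<in>Qp l \<times> Qp l.
       padic_dist l (fst v) (fst w) \<le> real l powi (- int n) \<longrightarrow>
       padic_dist l (snd v) (snd w) \<le> real l powi (- int n) \<longrightarrow> F l v = F l w) \<and>
    (\<forall>v \<in> Qp l \<times> Qp l. F l v \<noteq> 0 \<longrightarrow> padic_dist l (fst v) (padic_of_rat l 0) \<le> real l powi int n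
       \<and> padic_dist l (snd v) (padic_of_rat l 0) \<le> real l powi int n)" if "l \<in> B" for l
  proof -
    have "prime l" using that places_prime unfolding B_def by blast
    moreover have "F l \<in> schwartz_loc l" using that F by (auto simp: B_def restricted_families_def)
    ultimately show ?thesis by (rule schwartz_loc_level) blast
  qed
  then obtain n where n: "\<And>l v w. l \<in> B \<Longrightarrow> v\<in>Qp l \<times> Qp l \<Longrightarrow> w\<in>Qp l \<times> Qp l \<Longrightarrow>
       padic_dist l (fst v) (fst w) \<le> real l powi (- int (n l)) \<Longrightarrow>
       padic_dist l (snd v) (snd w) \<le> real l powi (- int (n l)) \<Longrightarrow> F l v = F l w"
    "\<And>l v. l \<in> B \<Longrightarrow> v \<in> Qp l \<times> Qp l \<Longrightarrow> F l v \<noteq> 0 \<Longrightarrow>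
       padic_dist l (fst v) (padic_of_rat l 0) \<le> real l powi int (n l)
       \<and> padic_dist l (snd v) (padic_of_rat l 0) \<le> real l powi int (n l)" by metis
  define N where "N = (\<Prod>l\<in>B. l ^ n l)"
  have pB: "prime l" if "l \<in> B" for l using that places_prime unfolding B_def by blast
  have N0: "N > 0" using pB finB prime_gt_0_nat by (auto simp: N_def intro!: prod_pos)
  have Nc: "coprime N c" unfolding N_def using pB
    by (auto intro!: prod_coprime_left simp: prime_imp_coprime B_def places_iff)
  have dv: "l ^ n l dvd N" if "l \<in> B" for l unfolding N_def using that finB by (rule dvd_prodI[rotated])
  have aN: "padic_abs l (of_nat N) \<le> real l powi (- int (n l))" if "l \<in> B" for l
    using padic_abs_of_nat_dvd[OF pB[OF that] dv[OF that]] padic_abs_l_power[OF pB[OF that]] by simp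
  have aN1: "padic_abs l (of_nat N) = 1" if "l \<in> places S" "l \<notin> B" for l
  proof (rule padic_abs_of_nat_coprime)
    show "prime l" using that places_prime by blast
    show "coprime l N" unfolding N_def using that pB places_prime
      by (intro prod_coprime_right) (metis coprime_power_right_iff primes_coprime)
  qed
  have Fout: "F l = coset_loc 0 0 l" if "l \<in> places S" "l \<notin> B" for l using that by (simp add: B_def)
  have co: "coset_loc 0 0 l v = (if v \<in> Qp l \<times> Qp l \<and> padic_dist l (fst v) (padic_of_rat l 0) \<le> 1 \<and>
      padic_dist l (snd v) (padic_of_rat l 0) \<le> 1 then 1 else 0)" if "l \<in> places S" for l v
    unfolding coset_loc_def padic_coset_eq_ball[OF places_prime[OF that]] padic_ball_def[OF places_prime[OF that]]
    by (auto simp: indicator_def mem_Times_iff)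
  have "level S N (pure_tensor S F)" unfolding level_def
  proof (intro conjI allI impI ballI)
    show "pure_tensor S F v = 0" if "v \<notin> VA S" for v using that by (simp add: pure_tensor_def)
  next
    fix v w assume v: "v \<in> VA S" and w: "w \<in> VA S" and vw: "adele_cong S (of_nat N) v w"
    have "F l (v l) = F l (w l)" if l: "l \<in> places S" for l
    proof -
      have p: "prime l" using l by (rule places_prime)
      have d: "padic_dist l (fst (v l)) (fst (w l)) \<le> padic_abs l (of_nat N)"
        "padic_dist l (snd (v l)) (snd (w l)) \<le> padic_abs l (of_nat N)"
        using vw l by (auto simp: adele_cong_def)
      have q: "v l \<in> Qp l \<times> Qp l" "w l \<in> Qp l \<times> Qp l" using v w l by (auto simp: VA_def)
      show ?thesis
      proof (cases "l \<in> B")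
        case True
        show ?thesis by (rule n(1)[OF True q]) (use d aN[OF True] in auto)
      next
        case False
        have O: "padic_of_rat l 0 \<in> Qp l" using padic_of_rat_in[OF p] .
        have qq: "fst (v l) \<in> Qp l" "snd (v l) \<in> Qp l" "fst (w l) \<in> Qp l" "snd (w l) \<in> Qp l" using q by auto
        have "padic_dist l (fst (v l)) (fst (w l)) \<le> 1" "padic_dist l (snd (v l)) (snd (w l)) \<le> 1"
          using d aN1[OF l False] by auto
        then have "padic_dist l (fst (v l)) (padic_of_rat l 0) \<le> 1 \<longleftrightarrow> padic_dist l (fst (w l)) (padic_of_rat l 0) \<le> 1"
           "padic_dist l (snd (v l)) (padic_of_rat l 0) \<le> 1 \<longleftrightarrow> padic_dist l (snd (w l)) (padic_of_rat l 0) \<le> 1"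
          using padic_dist_ultra[OF p qq(1,3) O] padic_dist_ultra[OF p qq(3,1) O]
            padic_dist_ultra[OF p qq(2,4) O] padic_dist_ultra[OF p qq(4,2) O]
            padic_dist_commute[OF p, of "fst (v l)" "fst (w l)"] padic_dist_commute[OF p, of "snd (v l)" "snd (w l)"]
          by auto
        then show ?thesis using Fout[OF l False] co[OF l] q by auto
      qed
    qed
    then have "{l \<in> places S. F l (v l) \<noteq> 1} = {l \<in> places S. F l (w l) \<noteq> 1}"
      "\<And>l. l \<in> {l \<in> places S. F l (w l) \<noteq> 1} \<Longrightarrow> F l (v l) = F l (w l)" by auto
    then show "pure_tensor S F v = pure_tensor S F w"
      using v w by (simp add: pure_tensor_def)
  next
    fix v assume v: "v \<in> VA S" "pure_tensor S F v \<noteq> 0"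
    show "adele_cong S (1 / of_nat N) v (VA_zero S)"
      unfolding adele_cong_def
    proof
      fix l assume l: "l \<in> places S"
      have p: "prime l" using l by (rule places_prime)
      have nz: "F l (v l) \<noteq> 0" using pure_tensor_nonzero[OF F v(2) l] .
      have q: "v l \<in> Qp l \<times> Qp l" using v l by (auto simp: VA_def)
      have aN0: "padic_abs l (of_nat N) > 0" using N0 by (intro padic_abs_pos[OF p]) auto
      have z: "VA_zero S l = (padic_of_rat l 0, padic_of_rat l 0)" using l by (simp add: VA_zero_def)
      show "padic_dist l (fst (v l)) (fst (VA_zero S l)) \<le> padic_abs l (1 / of_nat N) \<and>
         padic_dist l (snd (v l)) (snd (VA_zero S l)) \<le> padic_abs l (1 / of_nat N)"
      proof (cases "l \<in> B")
        case True
        have "real l powi int (n l) = 1 / real l powi (- int (n l))"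
          by (simp only: power_int_minus inverse_eq_divide) simp
        also have "\<dots> \<le> 1 / padic_abs l (of_nat N)" using aN[OF True] aN0 by (intro divide_left_mono) auto
        finally show ?thesis using n(2)[OF True q nz] z p by (auto simp: padic_abs_divide)
      next
        case False
        then show ?thesis using nz Fout[OF l False] co[OF l] aN1[OF l False] z p
          by (auto simp: padic_abs_divide split: if_splits)
      qed
    qed
  qed
  then show ?thesis using N0 Nc by blast
qed

text \<open>Replaces the span of pure tensors by a condition that is visibly stable under sums and
  under the action of the group.\<close>

theorem schwartz_iff_level: "f \<in> schwartz S \<longleftrightarrow> (\<exists>N>0. coprime N c \<and> level S N f)"
proof
  assume "f \<in> schwartz S"
  then obtain n :: nat and k F where F: "\<forall>i<n. F i \<in> restricted_families S"
    and f: "f = (\<lambda>v. \<Sum>i<n. k i * pure_tensor S (F i) v)" by (auto simp: schwartz_def)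
  have "\<exists>N. i < n \<longrightarrow> N > 0 \<and> coprime N c \<and> level S N (pure_tensor S (F i))" for i
    using pure_tensor_level F by blast
  then obtain M where M: "\<And>i. i < n \<Longrightarrow> M i > 0 \<and> coprime (M i) c \<and> level S (M i) (pure_tensor S (F i))"
    by metis
  define N where "N = (\<Prod>i<n. M i)"
  have N0: "N > 0" using M by (auto simp: N_def intro!: prod_pos)
  have Nc: "coprime N c" using M by (auto simp: N_def intro!: prod_coprime_left)
  have lev: "level S N (pure_tensor S (F i))" if "i < n" for i
  proof (rule level_mono)
    show "level S (M i) (pure_tensor S (F i))" using M[OF that] by blast
    show "M i dvd N" unfolding N_def using that by (intro dvd_prodI) auto
  qed (rule N0)
  have "level S N f" unfolding level_def
  proof (intro conjI allI ballI impI)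
    show "f v = 0" if "v \<notin> VA S" for v
    proof -
      have "pure_tensor S (F i) v = 0" for i using that by (simp add: pure_tensor_def)
      then show ?thesis by (simp add: f)
    qed
    show "f v = f w" if "v \<in> VA S" "w \<in> VA S" "adele_cong S (of_nat N) v w" for v w
    proof -
      have "pure_tensor S (F i) v = pure_tensor S (F i) w" if "i < n" for i
        using lev[OF that] \<open>v \<in> VA S\<close> \<open>w \<in> VA S\<close> \<open>adele_cong S (of_nat N) v w\<close> unfolding level_def by blast
      then show ?thesis by (simp add: f)
    qed
    fix v assume v: "v \<in> VA S" "f v \<noteq> 0"
    have "\<exists>i<n. pure_tensor S (F i) v \<noteq> 0"
    proof (rule ccontr)
      assume "\<not> ?thesis"
      then have "f v = 0" unfolding f by (intro sum.neutral) auto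
      then show False using v by blast
    qed
    then obtain i where "i < n" "pure_tensor S (F i) v \<noteq> 0" by blast
    then show "adele_cong S (1 / of_nat N) v (VA_zero S)" using lev[of i] v by (simp add: level_def)
  qed
  then show "\<exists>N>0. coprime N c \<and> level S N f" using N0 Nc by blast
next
  assume "\<exists>N>0. coprime N c \<and> level S N f"
  then obtain N where N: "N > 0" "coprime N c" "level S N f" by blast
  define F where "F = (\<lambda>(i::nat, j::nat) l. indicator (padic_ball l (of_nat i / of_nat N) (padic_abs l (of_nat N)) \<times>
     padic_ball l (of_nat j / of_nat N) (padic_abs l (of_nat N))) :: padic \<times> padic \<Rightarrow> int)"
  have F: "F (i, j) \<in> restricted_families S"
    "pure_tensor S (F (i, j)) = adic_coset S (of_nat N) (of_nat i / of_nat N) (of_nat j / of_nat N)" for i j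
    using pure_tensor_balls[of "of_nat N" S "F (i, j)" "of_nat i / of_nat N" "of_nat j / of_nat N"] N(1)
    by (simp_all add: F_def)
  have "f = (\<lambda>v. \<Sum>x\<in>{..<N^2} \<times> {..<N^2}.
     f (rat_pt S (of_nat (fst x) / of_nat N) (of_nat (snd x) / of_nat N)) * pure_tensor S (F x) v)"
  proof
    fix v
    show "f v = (\<Sum>x\<in>{..<N^2} \<times> {..<N^2}.
       f (rat_pt S (of_nat (fst x) / of_nat N) (of_nat (snd x) / of_nat N)) * pure_tensor S (F x) v)"
      using level_decompose[OF N(3,1,2), of v]
      unfolding sum.cartesian_product F(2)[symmetric] case_prod_unfold prod.collapse .
  qed
  also have "\<dots> \<in> schwartz S" using F(1) by (intro sum_in_schwartz) auto
  finally show "f \<in> schwartz S" .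
qed

end

section \<open>Matrices\<close>

definition mat2 :: "rat \<Rightarrow> rat \<Rightarrow> rat \<Rightarrow> rat \<Rightarrow> rat^2^2" where
  "mat2 p q r s = vector [vector [p, q], vector [r, s]]"

lemma mat2_nth [simp]: "mat2 p q r s $ 1 $ 1 = p" "mat2 p q r s $ 1 $ 2 = q"
  "mat2 p q r s $ 2 $ 1 = r" "mat2 p q r s $ 2 $ 2 = s"
  by (simp_all add: mat2_def)

lemma mat2_collapse:
  fixes g :: "rat^2^2"
  shows "mat2 (g $ 1 $ 1) (g $ 1 $ 2) (g $ 2 $ 1) (g $ 2 $ 2) = g"
  by (simp add: vec_eq_iff forall_2)

lemma mat2_cases: obtains p q r s where "g = mat2 p q r s"
  using mat2_collapse[of g] by metis

lemma mat2_eq_iff: "mat2 p q r s = mat2 p' q' r' s' \<longleftrightarrow> p = p' \<and> q = q' \<and> r = r' \<and> s = s'"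
  by (auto simp: vec_eq_iff forall_2)

lemma mat2_mult: "mat2 p q r s ** mat2 p' q' r' s' =
    mat2 (p * p' + q * r') (p * q' + q * s') (r * p' + s * r') (r * q' + s * s')"
  by (simp add: vec_eq_iff forall_2 matrix_matrix_mult_def sum_2)

lemma mat_eq_mat2: "mat t = mat2 t 0 0 t"
  by (simp add: vec_eq_iff forall_2 mat_def)

lemma mat_T_eq: "mat_T = mat2 1 1 0 1" and mat_S_eq: "mat_S = mat2 0 (-1) 1 0"
  by (simp_all add: mat_T_def mat_S_def mat2_def)

lemma det_mat2: "det (mat2 p q r s) = p * s - q * r"
  by (simp add: det_2)

lemma matrix_inv_eqI:
  fixes A B :: "rat^2^2"
  assumes "A ** B = mat 1" "B ** A = mat 1" shows "matrix_inv A = B"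
proof -
  have i: "A ** matrix_inv A = mat 1 \<and> matrix_inv A ** A = mat 1"
    unfolding matrix_inv_def by (rule someI[of _ B]) (use assms in auto)
  have "matrix_inv A = matrix_inv A ** (A ** B)" using assms by simp
  also have "\<dots> = (matrix_inv A ** A) ** B" by (rule matrix_mul_assoc)
  finally show ?thesis using i by simp
qed

lemma matrix_inv_mat2:
  assumes "p * s = d + q * r" "d \<noteq> 0"
  shows "matrix_inv (mat2 p q r s) = mat2 (s / d) (- q / d) (- r / d) (p / d)"
proof (rule matrix_inv_eqI)
  have "s * p = d + q * r" "r * q = q * r" using assms(1) by (simp_all add: mult.commute)
  then show "mat2 p q r s ** mat2 (s / d) (- q / d) (- r / d) (p / d) = mat 1"
    "mat2 (s / d) (- q / d) (- r / d) (p / d) ** mat2 p q r s = mat 1"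
    using assms unfolding mat2_mult mat_eq_mat2 mat2_eq_iff
    by (simp_all add: add_divide_distrib)
qed

lemma matrix_inv_mult_self:
  fixes g :: "rat^2^2" assumes "det g \<noteq> 0"
  shows "g ** matrix_inv g = mat 1" "matrix_inv g ** g = mat 1"
proof -
  have "\<exists>h. g ** h = mat 1 \<and> h ** g = mat 1"
    using assms invertible_det_nz[of g] unfolding invertible_def by blast
  then obtain h where "g ** h = mat 1" "h ** g = mat 1" by blast
  then show "g ** matrix_inv g = mat 1" "matrix_inv g ** g = mat 1" using matrix_inv_eqI by auto
qed

lemma matrix_inv_mult:
  fixes g h :: "rat^2^2" assumes "det g \<noteq> 0" "det h \<noteq> 0"
  shows "matrix_inv (g ** h) = matrix_inv h ** matrix_inv g"
proof (rule matrix_inv_eqI)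
  have "(g ** h) ** (matrix_inv h ** matrix_inv g) = g ** (h ** matrix_inv h) ** matrix_inv g"
    by (simp add: matrix_mul_assoc)
  then show "(g ** h) ** (matrix_inv h ** matrix_inv g) = mat 1"
    using matrix_inv_mult_self[OF assms(1)] matrix_inv_mult_self[OF assms(2)] by simp
  have "(matrix_inv h ** matrix_inv g) ** (g ** h) = matrix_inv h ** (matrix_inv g ** g) ** h"
    by (simp add: matrix_mul_assoc)
  then show "(matrix_inv h ** matrix_inv g) ** (g ** h) = mat 1"
    using matrix_inv_mult_self[OF assms(1)] matrix_inv_mult_self[OF assms(2)] by simp
qed

lemma matrix_inv_mat_1 [simp]: "matrix_inv (mat 1 :: rat^2^2) = mat 1"
  by (rule matrix_inv_eqI) simp_all

lemma matrix_inv_mat: "t \<noteq> 0 \<Longrightarrow> matrix_inv (mat t :: rat^2^2) = mat (1 / t)"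
  by (rule matrix_inv_eqI) (simp_all add: mat_eq_mat2 mat2_mult)

lemma mat_commute: "mat t ** (g :: rat^2^2) = g ** (mat t :: rat^2^2)"
  by (rule mat2_cases[of g]) (simp add: mat_eq_mat2 mat2_mult mult.commute)

lemma det_mat_nz: "t \<noteq> 0 \<Longrightarrow> det (mat t :: rat^2^2) \<noteq> 0"
  by (simp add: mat_eq_mat2 det_mat2)

section \<open>The action on adelic vectors\<close>

context
  fixes l :: nat and v :: "padic \<times> padic"
  assumes l: "prime l" and v: "v \<in> Qp l \<times> Qp l"
begin

lemma row_mult_in: "row_mult l v g \<in> Qp l \<times> Qp l"
  using v unfolding row_mult_def mem_Times_iff fst_conv snd_conv
  by (intro conjI padic_add_in[OF l] padic_mult_in[OF l] padic_of_rat_in[OF l]) auto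

lemma row_mult_assoc: "row_mult l (row_mult l v g) h = row_mult l v (g ** h)"
proof -
  obtain x y where xy: "x \<in> padic_Cauchy l" "y \<in> padic_Cauchy l" "v = (padic_class l x, padic_class l y)"
    using v Qp_cases[OF l] by (metis mem_Times_iff prod.collapse)
  have c: "(\<lambda>n. x n * a) \<in> padic_Cauchy l" "(\<lambda>n. y n * a) \<in> padic_Cauchy l"
    "(\<lambda>n. x n * a + y n * b) \<in> padic_Cauchy l" "(\<lambda>n. (x n * a + y n * b) * d) \<in> padic_Cauchy l" for a b d
    using xy by (auto intro!: padic_Cauchy_add[OF l] padic_Cauchy_mult[OF l] simp: padic_Cauchy_const[OF l])
  have m: "padic_mult l (padic_class l u) (padic_class l (\<lambda>_. a)) = padic_class l (\<lambda>n. u n * a)"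
    if "u \<in> padic_Cauchy l" for u a
    using padic_mult_class[OF l that padic_Cauchy_const[OF l]] .
  obtain p q r s where g: "g = mat2 p q r s" by (rule mat2_cases)
  obtain p' q' r' s' where h: "h = mat2 p' q' r' s'" by (rule mat2_cases)
  show ?thesis unfolding g h
    by (simp add: row_mult_def xy mat2_mult padic_of_rat_eq[OF l] m c padic_add_class[OF l])
       (simp add: algebra_simps)
qed

lemma row_mult_mat_1: "row_mult l v (mat 1) = v"
proof -
  obtain x y where xy: "x \<in> padic_Cauchy l" "y \<in> padic_Cauchy l" "v = (padic_class l x, padic_class l y)"
    using v Qp_cases[OF l] by (metis mem_Times_iff prod.collapse)
  then show ?thesis
    by (simp add: row_mult_def mat_eq_mat2 padic_of_rat_eq[OF l] padic_mult_class[OF l]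
        padic_add_class[OF l] padic_Cauchy_const[OF l])
qed

lemma row_mult_dist:
  fixes g :: "rat^2^2"
  assumes w: "w \<in> Qp l \<times> Qp l"
    and d: "padic_dist l (fst v) (fst w) \<le> r" "padic_dist l (snd v) (snd w) \<le> r"
    and g: "\<And>i j. padic_abs l (g $ i $ j) \<le> B"
  shows "padic_dist l (fst (row_mult l v g)) (fst (row_mult l w g)) \<le> B * r"
    "padic_dist l (snd (row_mult l v g)) (snd (row_mult l w g)) \<le> B * r"
proof -
  have Q: "fst v \<in> Qp l" "snd v \<in> Qp l" "fst w \<in> Qp l" "snd w \<in> Qp l" using v w by auto
  have B: "B \<ge> 0" using order_trans[OF padic_abs_nonneg g[of 1 1]] .
  have *: "padic_dist l (padic_mult l X (padic_of_rat l a)) (padic_mult l Y (padic_of_rat l a)) \<le> B * r"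
    if "X \<in> Qp l" "Y \<in> Qp l" "padic_dist l X Y \<le> r" "padic_abs l a \<le> B" for X Y a
    unfolding padic_dist_mult_rat[OF l that(1,2)] using that padic_dist_nonneg[OF l] B
    by (intro mult_mono) auto
  have **: "padic_dist l (padic_add l (padic_mult l (fst v) (padic_of_rat l a)) (padic_mult l (snd v) (padic_of_rat l b)))
     (padic_add l (padic_mult l (fst w) (padic_of_rat l a)) (padic_mult l (snd w) (padic_of_rat l b))) \<le> B * r"
    if "padic_abs l a \<le> B" "padic_abs l b \<le> B" for a b
    by (rule order_trans[OF padic_dist_add[OF l]])
       (use that Q d in \<open>auto intro!: * padic_mult_in[OF l] padic_of_rat_in[OF l]\<close>)
  show "padic_dist l (fst (row_mult l v g)) (fst (row_mult l w g)) \<le> B * r"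
    "padic_dist l (snd (row_mult l v g)) (snd (row_mult l w g)) \<le> B * r"
    unfolding row_mult_def fst_conv snd_conv by (rule **; rule g)+
qed

end

lemma row_mult_of_rat:
  "prime l \<Longrightarrow> row_mult l (padic_of_rat l a, padic_of_rat l b) g =
    (padic_of_rat l (a * g $ 1 $ 1 + b * g $ 2 $ 1), padic_of_rat l (a * g $ 1 $ 2 + b * g $ 2 $ 2))"
  by (simp add: row_mult_def padic_mult_of_rat padic_add_of_rat)

definition adele_mult :: "nat set \<Rightarrow> adele2 \<Rightarrow> rat^2^2 \<Rightarrow> adele2" where
  "adele_mult S v g = (\<lambda>l\<in>places S. row_mult l (v l) g)"

lemma slash_eq: "slash S f g v = (if v \<in> VA S then f (adele_mult S v (matrix_inv g)) else 0)"
  by (simp add: slash_def adele_mult_def)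

lemma adele_mult_rat_pt:
  "adele_mult S (rat_pt S a b) g = rat_pt S (a * g $ 1 $ 1 + b * g $ 2 $ 1) (a * g $ 1 $ 2 + b * g $ 2 $ 2)"
  by (auto simp: adele_mult_def rat_pt_def row_mult_of_rat places_prime restrict_def)

lemma VA_Times: "v \<in> VA S \<Longrightarrow> l \<in> places S \<Longrightarrow> v l \<in> Qp l \<times> Qp l"
  by (auto simp: VA_def)

lemma adele_mult_cong:
  fixes g :: "rat^2^2"
  assumes "v \<in> VA S" "w \<in> VA S" "adele_cong S t v w"
    and g: "\<And>l i j. l \<in> places S \<Longrightarrow> padic_abs l (g $ i $ j) \<le> padic_abs l s"
  shows "adele_cong S (s * t) (adele_mult S v g) (adele_mult S w g)"
  unfolding adele_cong_def
proof
  fix l assume l: "l \<in> places S"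
  have p: "prime l" using l by (rule places_prime)
  have d: "padic_dist l (fst (v l)) (fst (w l)) \<le> padic_abs l t" "padic_dist l (snd (v l)) (snd (w l)) \<le> padic_abs l t"
    using assms(3) l by (auto simp: adele_cong_def)
  show "padic_dist l (fst (adele_mult S v g l)) (fst (adele_mult S w g l)) \<le> padic_abs l (s * t) \<and>
     padic_dist l (snd (adele_mult S v g l)) (snd (adele_mult S w g l)) \<le> padic_abs l (s * t)"
    using row_mult_dist[OF p VA_Times[OF assms(1) l] VA_Times[OF assms(2) l] d, of g "padic_abs l s"] g[OF l] l
    by (simp add: adele_mult_def padic_abs_mult[OF p])
qed

lemma adele_mult_in_VA:
  fixes g :: "rat^2^2"
  assumes v: "v \<in> VA S" shows "adele_mult S v g \<in> VA S"
proof -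
  let ?bad = "(\<Union>i. \<Union>j. {l. prime l \<and> \<not> padic_abs l (g $ i $ j) \<le> 1}) \<union> {l \<in> places S. v l \<notin> Zp l \<times> Zp l}"
  have fin: "finite ?bad" using v finite_primes_padic_abs_gt_1
    by (intro finite_UnI finite_UN_I) (auto simp: VA_def)
  have "{l \<in> places S. adele_mult S v g l \<notin> Zp l \<times> Zp l} \<subseteq> ?bad"
  proof (rule subsetI, rule ccontr)
    fix l assume "l \<in> {l \<in> places S. adele_mult S v g l \<notin> Zp l \<times> Zp l}" and nb: "l \<notin> ?bad"
    then have l: "l \<in> places S" and nz: "adele_mult S v g l \<notin> Zp l \<times> Zp l" by auto
    have p: "prime l" using l by (rule places_prime)
    have g1: "padic_abs l (g $ i $ j) \<le> 1" for i j using nb p by blast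
    have vZ: "v l \<in> Zp l \<times> Zp l" using nb l by blast
    let ?O = "(padic_of_rat l 0, padic_of_rat l 0)"
    have O: "?O \<in> Qp l \<times> Qp l" using padic_of_rat_in[OF p] by simp
    have d: "padic_dist l (fst (v l)) (fst ?O) \<le> 1" "padic_dist l (snd (v l)) (snd ?O) \<le> 1"
      using vZ by (auto simp: Zp_def)
    have "row_mult l ?O g = ?O" using row_mult_of_rat[OF p, of 0 0 g] by simp
    then have "adele_mult S v g l \<in> Zp l \<times> Zp l"
      using row_mult_dist[OF p VA_Times[OF v l] O d, of g 1] g1 row_mult_in[OF p VA_Times[OF v l], of g] l
      by (simp add: adele_mult_def Zp_def mem_Times_iff)
    then show False using nz by blast
  qed
  then have "finite {l \<in> places S. adele_mult S v g l \<notin> Zp l \<times> Zp l}" using fin by (rule finite_subset)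
  then show ?thesis
    using row_mult_in[OF places_prime VA_Times[OF v]] by (auto simp: VA_def adele_mult_def)
qed

lemma adele_mult_assoc: "v \<in> VA S \<Longrightarrow> adele_mult S (adele_mult S v g) h = adele_mult S v (g ** h)"
  by (auto simp: adele_mult_def restrict_def fun_eq_iff row_mult_assoc[OF places_prime VA_Times])

lemma adele_mult_mat_1: "v \<in> VA S \<Longrightarrow> adele_mult S v (mat 1) = v"
  by (rule ext) (auto simp: adele_mult_def restrict_def row_mult_mat_1[OF places_prime VA_Times] VA_def
      PiE_def extensional_def)

lemma slash_mult:
  assumes "det g \<noteq> 0" "det h \<noteq> 0" shows "slash S (slash S f g) h = slash S f (g ** h)"
  by (rule ext) (simp add: slash_eq matrix_inv_mult[OF assms] adele_mult_in_VA adele_mult_assoc)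

lemma slash_mat_1: "(\<And>v. v \<notin> VA S \<Longrightarrow> f v = 0) \<Longrightarrow> slash S f (mat 1) = f"
  by (rule ext) (simp add: slash_eq adele_mult_mat_1)

lemma slash_rat_pt: "slash S f g (rat_pt S a b) =
   f (rat_pt S (a * matrix_inv g $ 1 $ 1 + b * matrix_inv g $ 2 $ 1) (a * matrix_inv g $ 1 $ 2 + b * matrix_inv g $ 2 $ 2))"
  by (simp add: slash_eq adele_mult_rat_pt)

lemma slash_add: "slash S (\<lambda>v. f v + g v) h = (\<lambda>v. slash S f h v + slash S g h v)"
  by (rule ext) (simp add: slash_eq)

text \<open>The two bounds say that g/s and its inverse are integral at every place outside
  \<open>S\<close>, so \<open>g\<close> carries the lattice of modulus \<open>t\<close> onto the one
  of modulus \<open>s * t\<close>.\<close>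

lemma slash_adic_coset:
  fixes g :: "rat^2^2"
  assumes "det g \<noteq> 0" and s: "s \<noteq> 0"
    and g: "\<And>l i j. l \<in> places S \<Longrightarrow> padic_abs l (g $ i $ j) \<le> padic_abs l s"
    and g': "\<And>l i j. l \<in> places S \<Longrightarrow> padic_abs l (matrix_inv g $ i $ j) \<le> padic_abs l (1 / s)"
  shows "slash S (adic_coset S t a b) g =
    adic_coset S (s * t) (a * g $ 1 $ 1 + b * g $ 2 $ 1) (a * g $ 1 $ 2 + b * g $ 2 $ 2)"
proof
  fix v
  have inv: "adele_mult S (adele_mult S v (matrix_inv g)) g = v" if "v \<in> VA S"
    using that by (simp add: adele_mult_assoc matrix_inv_mult_self[OF assms(1)] adele_mult_mat_1)
  have inv': "adele_mult S (adele_mult S (rat_pt S a b) g) (matrix_inv g) = rat_pt S a b"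
    by (subst adele_mult_assoc) (simp_all add: matrix_inv_mult_self[OF assms(1)] adele_mult_mat_1)
  have "adele_cong S t (adele_mult S v (matrix_inv g)) (rat_pt S a b) \<longleftrightarrow>
     adele_cong S (s * t) v (adele_mult S (rat_pt S a b) g)" if v: "v \<in> VA S"
  proof
    assume "adele_cong S t (adele_mult S v (matrix_inv g)) (rat_pt S a b)"
    from adele_mult_cong[OF adele_mult_in_VA[OF v] rat_pt_in_VA this, of g s] g
    show "adele_cong S (s * t) v (adele_mult S (rat_pt S a b) g)" by (simp add: inv[OF v])
  next
    assume "adele_cong S (s * t) v (adele_mult S (rat_pt S a b) g)"
    from adele_mult_cong[OF v adele_mult_in_VA[OF rat_pt_in_VA] this, of "matrix_inv g" "1 / s"] g'
    show "adele_cong S t (adele_mult S v (matrix_inv g)) (rat_pt S a b)" using s by (simp add: inv')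
  qed
  then show "slash S (adic_coset S t a b) g v =
     adic_coset S (s * t) (a * g $ 1 $ 1 + b * g $ 2 $ 1) (a * g $ 1 $ 2 + b * g $ 2 $ 2) v"
    by (simp add: slash_eq adic_coset_def adele_mult_in_VA adele_mult_rat_pt)
qed

lemma slash_mat_adic_coset:
  assumes "t \<noteq> 0" shows "slash S (adic_coset S s a b) (mat t) = adic_coset S (t * s) (a * t) (b * t)"
proof -
  have *: "padic_abs l (mat r $ i $ j) \<le> padic_abs l r" if "l \<in> places S" for l r and i j :: 2
    by (simp add: mat_def)
  show ?thesis
    using slash_adic_coset[OF det_mat_nz[OF assms] assms, of S s a b] * matrix_inv_mat[OF assms]
    by (simp add: mat_eq_mat2)
qed

section \<open>The group \<open>G_S\<close> and generators of the space of test functions\<close>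

context smoothing
begin

lemma G_S_det_nz: "g \<in> G_S S \<Longrightarrow> det g \<noteq> 0"
  by (auto simp: G_S_def)

lemma Z_S_units_mult: "x \<in> Z_S_units S \<Longrightarrow> y \<in> Z_S_units S \<Longrightarrow> x * y \<in> Z_S_units S"
  by (auto simp: Z_S_units_def intro: Z_S_mult)

lemma Z_S_units_inverse: "x \<in> Z_S_units S \<Longrightarrow> inverse x \<in> Z_S_units S"
  by (auto simp: Z_S_units_def)

lemma Z_S_0 [simp]: "0 \<in> Z_S S" and Z_S_1 [simp]: "1 \<in> Z_S S" and Z_S_of_nat [simp]: "of_nat n \<in> Z_S S"
  using Z_S_of_int[of 0] Z_S_of_int[of 1] Z_S_of_int[of "int n"] by auto

lemma G_S_mat2: "mat2 p q r s \<in> G_S S \<longleftrightarrow>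
   p \<in> Z_S S \<and> q \<in> Z_S S \<and> r \<in> Z_S S \<and> s \<in> Z_S S \<and> p * s - q * r \<in> Z_S_units S \<and> p * s - q * r > 0"
  by (auto simp: G_S_def forall_2 det_mat2)

lemma G_S_mult:
  assumes "g \<in> G_S S" "h \<in> G_S S" shows "g ** h \<in> G_S S"
proof -
  have "det (g ** h) \<in> Z_S_units S" "det (g ** h) > 0"
    using assms by (auto simp: G_S_def det_mul intro: Z_S_units_mult)
  then show ?thesis using assms
    by (auto simp: G_S_def matrix_matrix_mult_def sum_2 intro!: Z_S_add Z_S_mult)
qed

lemma G_S_1 [simp]: "mat 1 \<in> G_S S"
  by (simp add: mat_eq_mat2 G_S_mat2 Z_S_units_def)

lemma G_S_inv: assumes "g \<in> G_S S" shows "matrix_inv g \<in> G_S S"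
proof -
  obtain p q r s where g: "g = mat2 p q r s" by (rule mat2_cases)
  define d where "d = p * s - q * r"
  have a: "p \<in> Z_S S" "q \<in> Z_S S" "r \<in> Z_S S" "s \<in> Z_S S" "d \<in> Z_S_units S" "d > 0"
    using assms by (simp_all add: g G_S_mat2 d_def)
  then have i: "inverse d \<in> Z_S S" by (simp add: Z_S_units_def)
  have eq: "matrix_inv g = mat2 (s / d) (- q / d) (- r / d) (p / d)"
    unfolding g using a(6) by (intro matrix_inv_mat2) (auto simp: d_def)
  have "s / d * (p / d) - - q / d * (- r / d) = (p * s - q * r) / (d * d)"
    by (simp add: diff_divide_distrib mult.commute)
  also have "\<dots> = inverse d" using a(6) by (simp add: d_def[symmetric] field_simps)
  finally have det: "s / d * (p / d) - - q / d * (- r / d) = inverse d" .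
  show ?thesis unfolding eq G_S_mat2 det
    using a i Z_S_units_inverse by (auto simp: divide_inverse intro!: Z_S_mult Z_S_minus)
qed

lemma G_S_mat: "t \<in> Z_S_units S \<Longrightarrow> mat t \<in> G_S S"
  by (auto simp: mat_eq_mat2 G_S_mat2 Z_S_units_mult) (auto simp: Z_S_units_def zero_less_mult_iff)

lemma Z_S_units_of_nat: "N > 0 \<Longrightarrow> coprime N c \<Longrightarrow> of_nat N \<in> Z_S_units S"
  using Z_S_inverse_nat by (simp add: Z_S_units_def inverse_eq_divide)

lemma Z_S_common_denominator:
  assumes "finite A" "A \<subseteq> Z_S S"
  shows "\<exists>K>0. coprime K c \<and> (\<forall>x\<in>A. \<forall>l\<in>places S. padic_abs l x \<le> padic_abs l (1 / of_nat K))"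
  using assms
proof (induction rule: finite_induct)
  case empty then show ?case by (intro exI[of _ 1]) auto
next
  case (insert x A)
  then obtain K where K: "K > 0" "coprime K c" "\<forall>x\<in>A. \<forall>l\<in>places S. padic_abs l x \<le> padic_abs l (1 / of_nat K)" by auto
  have "x \<in> Z_S S" using insert by auto
  then obtain a N where N: "N > 0" "coprime N c" "x = of_int a / of_nat N" by (rule Z_S_cases)
  have le: "padic_abs l (1 / of_nat M) \<le> padic_abs l (1 / of_nat (K * N))"
    if "l \<in> places S" "M dvd K * N" "M > 0" for l M
  proof -
    have p: "prime l" using that places_prime by blast
    have "padic_abs l (of_nat (K * N)) > 0" using K N by (intro padic_abs_pos[OF p]) simp
    then show ?thesis using padic_abs_of_nat_dvd[OF p that(2)] unfolding padic_abs_divide[OF p] padic_abs_1[OF p]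
      by (intro divide_left_mono) (auto intro!: mult_pos_pos)
  qed
  have "padic_abs l x \<le> padic_abs l (1 / of_nat N)" if "l \<in> places S" for l
  proof -
    have p: "prime l" using that places_prime by blast
    show ?thesis using padic_abs_of_int_le_1[OF p, of a]
      unfolding N(3) padic_abs_divide[OF p] padic_abs_1[OF p] by (simp add: divide_right_mono)
  qed
  then have "\<forall>y\<in>insert x A. \<forall>l\<in>places S. padic_abs l y \<le> padic_abs l (1 / of_nat (K * N))"
    using order_trans[OF _ le[of _ K]] order_trans[OF _ le[of _ N]] K N by simp
  then show ?case using K N by (intro exI[of _ "K * N"]) auto
qed

lemma slash_level:
  fixes g :: "rat^2^2"
  assumes f: "level S N f" "N > 0" "coprime N c" and g: "g \<in> G_S S"
  shows "\<exists>M>0. coprime M c \<and> level S M (slash S f g)"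
proof -
  let ?g = "matrix_inv g"
  have det: "det g \<noteq> 0" using g by (rule G_S_det_nz)
  \<comment> \<open>Both matrices enter: the inverse controls the period of the translated function,
    \<open>g\<close> itself its support.\<close>
  let ?A = "{g $ 1 $ 1, g $ 1 $ 2, g $ 2 $ 1, g $ 2 $ 2, ?g $ 1 $ 1, ?g $ 1 $ 2, ?g $ 2 $ 1, ?g $ 2 $ 2}"
  have "g $ i $ j \<in> Z_S S" for i j using g unfolding G_S_def by blast
  moreover have "?g $ i $ j \<in> Z_S S" for i j using G_S_inv[OF g] unfolding G_S_def by blast
  ultimately have "?A \<subseteq> Z_S S" by simp
  then obtain K where K: "K > 0" "coprime K c" "\<forall>x\<in>?A. \<forall>l\<in>places S. padic_abs l x \<le> padic_abs l (1 / of_nat K)"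
    using Z_S_common_denominator[of ?A] by auto
  have gK: "padic_abs l (g $ i $ j) \<le> padic_abs l (1 / of_nat K)"
    "padic_abs l (?g $ i $ j) \<le> padic_abs l (1 / of_nat K)" if "l \<in> places S" for l i j
    using K(3) that exhaust_2[of i] exhaust_2[of j] by auto
  have "level S (N * K) (slash S f g)" unfolding level_def
  proof (intro conjI allI ballI impI)
    show "slash S f g v = 0" if "v \<notin> VA S" for v using that by (simp add: slash_eq)
    fix v assume v: "v \<in> VA S"
    {
      fix w assume w: "w \<in> VA S" and vw: "adele_cong S (of_nat (N * K)) v w"
      have "adele_cong S (1 / of_nat K * of_nat (N * K)) (adele_mult S v ?g) (adele_mult S w ?g)"
        by (rule adele_mult_cong[OF v w vw]) (rule gK)
      then have "adele_cong S (of_nat N) (adele_mult S v ?g) (adele_mult S w ?g)" using K by simp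
      then show "slash S f g v = slash S f g w"
        using f v w unfolding level_def by (simp add: slash_eq adele_mult_in_VA)
    next
      assume "slash S f g v \<noteq> 0"
      then have "adele_cong S (1 / of_nat N) (adele_mult S v ?g) (VA_zero S)"
        using f v unfolding level_def by (simp add: slash_eq adele_mult_in_VA)
      then have "adele_cong S (1 / of_nat K * (1 / of_nat N)) (adele_mult S (adele_mult S v ?g) g) (adele_mult S (VA_zero S) g)"
        using gK(1) by (intro adele_mult_cong adele_mult_in_VA v) (auto simp: VA_zero_eq)
      moreover have "adele_mult S (VA_zero S) g = VA_zero S" by (simp add: VA_zero_eq adele_mult_rat_pt)
      ultimately show "adele_cong S (1 / of_nat (N * K)) v (VA_zero S)"
        using v by (simp add: adele_mult_assoc matrix_inv_mult_self[OF det] adele_mult_mat_1 mult.commute)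
    }
  qed
  then show ?thesis using K f by (intro exI[of _ "N * K"]) auto
qed

lemma slash_zero: "slash S f g (VA_zero S) = f (VA_zero S)"
  by (simp add: VA_zero_eq slash_rat_pt)

lemma slash_schwartz': "f \<in> schwartz' S \<Longrightarrow> g \<in> G_S S \<Longrightarrow> slash S f g \<in> schwartz' S"
  using slash_level unfolding schwartz'_def mem_Collect_eq schwartz_iff_level slash_zero by blast

lemma schwartz'_outside: "f \<in> schwartz' S \<Longrightarrow> v \<notin> VA S \<Longrightarrow> f v = 0"
  unfolding schwartz'_def schwartz_iff_level level_def by blast

lemma slash_1: "f \<in> schwartz' S \<Longrightarrow> slash S f (mat 1) = f"
  by (rule slash_mat_1) (rule schwartz'_outside)

lemma schwartz'_level:
  assumes "f \<in> schwartz' S" obtains N where "N > 0" "coprime N c" "level S N f"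
  using assms unfolding schwartz'_def schwartz_iff_level by blast

lemma schwartz'_common_level:
  assumes "f \<in> schwartz' S" "g \<in> schwartz' S"
  obtains N where "N > 0" "coprime N c" "level S N f" "level S N g"
proof -
  obtain M where M: "M > 0" "coprime M c" "level S M f" using assms(1) by (rule schwartz'_level)
  obtain N where N: "N > 0" "coprime N c" "level S N g" using assms(2) by (rule schwartz'_level)
  show ?thesis using that[of "M * N"] level_mono[OF M(3), of "M * N"] level_mono[OF N(3), of "M * N"] M N by simp
qed

lemma level_add: "level S N f \<Longrightarrow> level S N g \<Longrightarrow> level S N (\<lambda>v. f v + g v)"
proof -
  assume f: "level S N f" and g: "level S N g"
  show ?thesis unfolding level_def
  proof (intro conjI ballI allI impI)
    show "f v + g v = 0" if "v \<notin> VA S" for v using f g that by (simp add: level_def)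
    show "f v + g v = f w + g w" if "v \<in> VA S" "w \<in> VA S" "adele_cong S (of_nat N) v w" for v w
    proof -
      have "f v = f w" using f that unfolding level_def by blast
      moreover have "g v = g w" using g that unfolding level_def by blast
      ultimately show ?thesis by simp
    qed
    show "adele_cong S (1 / of_nat N) v (VA_zero S)" if "v \<in> VA S" "f v + g v \<noteq> 0" for v
    proof -
      have "f v \<noteq> 0 \<or> g v \<noteq> 0" using that by auto
      then show ?thesis using f g that unfolding level_def by blast
    qed
  qed
qed

lemma schwartz'_add:
  assumes "f \<in> schwartz' S" "g \<in> schwartz' S" shows "(\<lambda>v. f v + g v) \<in> schwartz' S"
proof -
  obtain N where "N > 0" "coprime N c" "level S N f" "level S N g"
    using schwartz'_common_level[OF assms] .
  then have "(\<lambda>v. f v + g v) \<in> schwartz S" using level_add unfolding schwartz_iff_level by blast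
  then show ?thesis using assms by (simp add: schwartz'_def)
qed

lemma schwartz'_uminus: "f \<in> schwartz' S \<Longrightarrow> (\<lambda>v. - f v) \<in> schwartz' S"
  unfolding schwartz'_def schwartz_iff_level level_def by simp

lemma schwartz'_0: "(\<lambda>_. 0) \<in> schwartz' S"
  unfolding schwartz'_def schwartz_iff_level level_def using coprime_1_left[of c] by auto

lemma schwartz'_sum: "(\<And>i. i \<in> I \<Longrightarrow> f i \<in> schwartz' S) \<Longrightarrow> (\<lambda>v. \<Sum>i\<in>I. f i v) \<in> schwartz' S"
  by (induction I rule: infinite_finite_induct) (auto intro: schwartz'_0 schwartz'_add)

lemma coset_fun_schwartz':
  assumes "a \<in> Z_S S" "b \<in> Z_S S" "\<not> (a \<in> \<int> \<and> b \<in> \<int>)"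
  shows "coset_fun S a b \<in> schwartz' S"
proof -
  let ?F = "\<lambda>l. indicator (padic_ball l a (padic_abs l 1) \<times> padic_ball l b (padic_abs l 1)) :: _ \<Rightarrow> int"
  have "(\<lambda>v. \<Sum>i\<in>{()}. 1 * pure_tensor S ?F v) \<in> schwartz S"
    by (rule sum_in_schwartz) (auto intro: pure_tensor_balls(1)[of 1])
  moreover have "pure_tensor S ?F = coset_fun S a b"
    unfolding coset_fun_eq by (rule pure_tensor_balls(2)) auto
  ultimately have "coset_fun S a b \<in> schwartz S" by simp
  moreover have "\<not> adele_cong S 1 (rat_pt S 0 0) (rat_pt S a b)"
  proof
    assume "adele_cong S 1 (rat_pt S 0 0) (rat_pt S a b)"
    then have "padic_abs l a \<le> 1 \<and> padic_abs l b \<le> 1" if "l \<in> places S" for l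
      using that by (auto simp: adele_cong_rat_pt places_prime)
    then show False using int_if_padic_abs_le_1 assms by blast
  qed
  ultimately show ?thesis by (simp add: schwartz'_def coset_fun_eq adic_coset_def VA_zero_eq)
qed

lemma scaled_coset_schwartz':
  assumes "a \<in> Z_S S" "b \<in> Z_S S" "\<not> (a \<in> \<int> \<and> b \<in> \<int>)" "N > 0" "coprime N c"
  shows "slash S (coset_fun S a b) (mat (of_nat N)) \<in> schwartz' S"
  using assms by (intro slash_schwartz' coset_fun_schwartz' G_S_mat Z_S_units_of_nat)

lemma quotient_not_both_int:
  assumes "i < M" "j < M" "\<not> (i = 0 \<and> j = 0)"
  shows "\<not> ((of_nat i / of_nat M :: rat) \<in> \<int> \<and> (of_nat j / of_nat M :: rat) \<in> \<int>)"
proof -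
  have "i = 0" if "i < M" "(of_nat i / of_nat M :: rat) \<in> \<int>" for i
  proof -
    obtain k :: int where k: "(of_nat i / of_nat M :: rat) = of_int k" using \<open>_ \<in> \<int>\<close> by (auto elim: Ints_cases)
    have "0 \<le> (of_nat i / of_nat M :: rat)" "(of_nat i / of_nat M :: rat) < 1" using that by auto
    then have "k = 0" unfolding k by simp
    then show ?thesis using k that by simp
  qed
  then show ?thesis using assms by blast
qed

text \<open>In the decomposition at level N the coset of the origin has coefficient f(0) = 0. Every
  other coset of modulus N is a coset of the standard lattice at (i/N^2, j/N^2), scaled by N; this
  scaling is why invariance under positive scalars suffices.\<close>

lemma schwartz'_induct [consumes 1, case_names zero add minus coset]:
  assumes f: "f \<in> schwartz' S"
    and zero: "P (\<lambda>_. 0)"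
    and add: "\<And>f g. f \<in> schwartz' S \<Longrightarrow> g \<in> schwartz' S \<Longrightarrow> P f \<Longrightarrow> P g \<Longrightarrow> P (\<lambda>v. f v + g v)"
    and minus: "\<And>f. f \<in> schwartz' S \<Longrightarrow> P f \<Longrightarrow> P (\<lambda>v. - f v)"
    and coset: "\<And>a b N. a \<in> Z_S S \<Longrightarrow> b \<in> Z_S S \<Longrightarrow> \<not> (a \<in> \<int> \<and> b \<in> \<int>) \<Longrightarrow> N > 0 \<Longrightarrow> coprime N c \<Longrightarrow>
        P (slash S (coset_fun S a b) (mat (of_nat N)))"
  shows "P f"
proof -
  define Q where "Q = (\<lambda>f. f \<in> schwartz' S \<and> P f)"
  have Q0: "Q (\<lambda>_. 0)" using zero schwartz'_0 by (simp add: Q_def)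
  have Qadd: "Q (\<lambda>v. f v + g v)" if "Q f" "Q g" for f g
    using that add schwartz'_add by (simp add: Q_def)
  have Qminus: "Q (\<lambda>v. - f v)" if "Q f" for f
    using that minus schwartz'_uminus by (simp add: Q_def)
  have Qnat: "Q (\<lambda>v. int n * f v)" if "Q f" for f n
  proof (induction n)
    case (Suc n) then show ?case using Qadd[OF that Suc] by (simp add: algebra_simps)
  qed (simp add: Q0)
  have Qint: "Q (\<lambda>v. k * f v)" if "Q f" for f k
    by (cases k rule: int_cases2) (use Qnat[OF that] Qminus[OF Qnat[OF that]] in auto)
  have Qsum: "Q (\<lambda>v. \<Sum>i\<in>I. F i v)" if "\<And>i. i \<in> I \<Longrightarrow> Q (F i)" for F and I :: "nat set"
    using that by (induction I rule: infinite_finite_induct) (auto intro: Q0 Qadd)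
  obtain N where N: "N > 0" "coprime N c" "level S N f" using f by (rule schwartz'_level)
  have f0: "f (rat_pt S 0 0) = 0" using f by (simp add: schwartz'_def VA_zero_eq)
  let ?pt = "\<lambda>i j. rat_pt S (of_nat i / of_nat N) (of_nat j / of_nat N)"
  have tm: "Q (\<lambda>v. f (?pt i j) * adic_coset S (of_nat N) (of_nat i / of_nat N) (of_nat j / of_nat N) v)"
    if "i < N^2" "j < N^2" for i j
  proof (cases "i = 0 \<and> j = 0")
    case True then show ?thesis using f0 Q0 by simp
  next
    case False
    have Z: "of_nat i / of_nat (N^2) \<in> Z_S S" for i
      using N by (intro Z_S_divide_nat) auto
    have eq: "slash S (coset_fun S (of_nat i / of_nat (N^2)) (of_nat j / of_nat (N^2))) (mat (of_nat N)) =
      adic_coset S (of_nat N) (of_nat i / of_nat N) (of_nat j / of_nat N)"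
      using N by (simp add: coset_fun_eq slash_mat_adic_coset power2_eq_square)
    have "Q (adic_coset S (of_nat N) (of_nat i / of_nat N) (of_nat j / of_nat N))"
      unfolding Q_def eq[symmetric]
      using coset[OF Z Z quotient_not_both_int[OF that False]]
        scaled_coset_schwartz'[OF Z Z quotient_not_both_int[OF that False]] N by simp
    then show ?thesis by (rule Qint)
  qed
  have eq: "f = (\<lambda>v. \<Sum>i<N^2. \<Sum>j<N^2. f (?pt i j) * adic_coset S (of_nat N) (of_nat i / of_nat N) (of_nat j / of_nat N) v)"
    by (rule ext) (rule level_decompose[OF N(3,1,2)])
  have "Q f" by (subst eq) (use tm in \<open>auto intro!: Qsum\<close>)
  then show ?thesis by (simp add: Q_def)
qed

end

section \<open>Distributions\<close>

lemma sum_multiples: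
  fixes g :: "nat \<Rightarrow> 'a::comm_monoid_add"
  assumes "K > 0" "\<And>i. \<not> K dvd i \<Longrightarrow> g i = 0"
  shows "(\<Sum>i<M * K. g i) = (\<Sum>i<M. g (K * i))"
proof -
  have "(\<Sum>i<M * K. g i) = (\<Sum>i\<in>(\<lambda>i. K * i) ` {..<M}. g i)"
  proof (rule sum.mono_neutral_right)
    show "(\<lambda>i. K * i) ` {..<M} \<subseteq> {..<M * K}" using assms(1) by (auto simp: mult.commute)
    show "\<forall>i\<in>{..<M * K} - (\<lambda>i. K * i) ` {..<M}. g i = 0"
    proof
      fix i assume i: "i \<in> {..<M * K} - (\<lambda>i. K * i) ` {..<M}"
      have "\<not> K dvd i"
      proof
        assume "K dvd i"
        then obtain k where k: "i = K * k" by blast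
        then have "k < M" using i by (simp add: mult.commute)
        then show False using i k by blast
      qed
      then show "g i = 0" by (rule assms(2))
    qed
  qed simp
  also have "\<dots> = (\<Sum>i<M. g (K * i))"
    using assms(1) by (subst sum.reindex) (auto simp: inj_on_def)
  finally show ?thesis .
qed

lemma sum_blocks:
  fixes g :: "nat \<Rightarrow> 'a::comm_monoid_add"
  shows "(\<Sum>i<M * K. g i) = (\<Sum>i<M. \<Sum>r<K. g (i + M * r))"
proof -
  have "(\<Sum>i<M * K. g i) = (\<Sum>i<K * M. g i)" by (simp add: mult.commute)
  also have "\<dots> = (\<Sum>r<K. sum g {r * M..<r * M + M})" by (rule sum.nat_group[symmetric])
  also have "\<dots> = (\<Sum>r<K. \<Sum>i<M. g (i + M * r))"
  proof (rule sum.cong[OF refl])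
    fix r
    have "sum g {0 + r * M..<M + r * M} = (\<Sum>i\<in>{0..<M}. g (i + r * M))"
      by (rule sum.shift_bounds_nat_ivl)
    then show "sum g {r * M..<r * M + M} = (\<Sum>i<M. g (i + M * r))"
      by (simp add: add.commute mult.commute atLeast0LessThan)
  qed
  also have "\<dots> = (\<Sum>i<M. \<Sum>r<K. g (i + M * r))" by (rule sum.swap)
  finally show ?thesis .
qed

text \<open>An affine map with unit slope permutes residues. It is applied with slope
  \<open>c\<close> for smoothing, -1 for the reflection of (a, b), and 1 for a change of
  representative.\<close>

lemma sum_periodic_reindex:
  fixes g :: "int \<Rightarrow> 'a::comm_monoid_add"
  assumes per: "\<And>x. g (x + int K) = g x" and K: "K > 0" and d: "coprime d (int K)"
  shows "(\<Sum>i<K. g (d * int i + e)) = (\<Sum>i<K. g (int i))"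
proof -
  have per': "g (x + int K * k) = g x" for x k
  proof (induction k rule: int_induct[where k = 0])
    case (step1 i) then show ?case using per[of "x + int K * i"] by (simp add: algebra_simps)
  next
    case (step2 i) then show ?case using per[of "x + int K * (i - 1)"] by (simp add: algebra_simps)
  qed simp
  have pm: "g (x mod int K) = g x" for x
    using per'[of "x mod int K" "x div int K"] by simp
  define h where "h = (\<lambda>i::nat. nat ((d * int i + e) mod int K))"
  have ih: "int (h i) = (d * int i + e) mod int K" for i using K by (simp add: h_def)
  have "h ` {..<K} \<subseteq> {..<K}"
  proof
    fix x assume "x \<in> h ` {..<K}"
    then obtain i where "x = h i" by blast
    then have "int x < int K" using ih[of i] K by simp
    then show "x \<in> {..<K}" by simp
  qed
  moreover have "inj_on h {..<K}"
  proof (rule inj_onI)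
    fix i j assume ij: "i \<in> {..<K}" "j \<in> {..<K}" "h i = h j"
    then have "[d * int i + e = d * int j + e] (mod int K)" using ih[of i] ih[of j] by (simp add: cong_def)
    then have "[d * int i = d * int j] (mod int K)" by (rule cong_add_rcancel[THEN iffD1])
    then have "[int i = int j] (mod int K)" using d cong_mult_lcancel[of d "int K"] by blast
    then show "i = j" using ij by (simp add: cong_int_iff cong_less_modulus_unique_nat)
  qed
  ultimately have b: "bij_betw h {..<K} {..<K}"
    by (simp add: bij_betw_def endo_inj_surj)
  have "(\<Sum>i<K. g (d * int i + e)) = (\<Sum>i<K. g (int (h i)))" by (simp add: ih pm)
  also have "\<dots> = (\<Sum>i<K. g (int i))" by (rule sum.reindex_bij_betw[OF b])
  finally show ?thesis .
qed

section \<open>Distributions invariant under positive scalars and the matrices acting on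
  them\<close>

context smoothing
begin

definition nonint :: "rat \<Rightarrow> rat \<Rightarrow> bool" where
  "nonint a b \<longleftrightarrow> a \<in> Z_S S \<and> b \<in> Z_S S \<and> \<not> (a \<in> \<int> \<and> b \<in> \<int>)"

text \<open>The condition inside the definite description \<open>the_dist\<close>; any witness
  evaluates it by \<open>is_dist_unique\<close>.\<close>

definition is_dist :: "(rat \<Rightarrow> rat \<Rightarrow> 'a::ab_group_add) \<Rightarrow> ((adele2 \<Rightarrow> int) \<Rightarrow> 'a) \<Rightarrow> bool" where
  "is_dist val \<mu> \<longleftrightarrow> \<mu> \<in> distributions S \<and> scalar_invariant S \<mu> \<and> has_coset_values S val \<mu>"

lemma is_dist_out: "is_dist val \<mu> \<Longrightarrow> f \<notin> schwartz' S \<Longrightarrow> \<mu> f = 0"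
  by (simp add: is_dist_def distributions_def)

lemma is_dist_plus: "is_dist val \<mu> \<Longrightarrow> f \<in> schwartz' S \<Longrightarrow> g \<in> schwartz' S \<Longrightarrow>
   \<mu> (\<lambda>v. f v + g v) = \<mu> f + \<mu> g"
  by (simp add: is_dist_def distributions_def)

lemma is_dist_0: "is_dist val \<mu> \<Longrightarrow> \<mu> (\<lambda>_. 0) = 0"
  using is_dist_plus[OF _ schwartz'_0 schwartz'_0, of val \<mu>] by simp

lemma is_dist_uminus: "is_dist val \<mu> \<Longrightarrow> f \<in> schwartz' S \<Longrightarrow> \<mu> (\<lambda>v. - f v) = - \<mu> f"
  using is_dist_plus[OF _ _ schwartz'_uminus, of val \<mu> f f] is_dist_0[of val \<mu>]
  by (simp add: eq_neg_iff_add_eq_0 add.commute)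

lemma is_dist_sum:
  assumes \<mu>: "is_dist val \<mu>" and "finite I" "\<And>i. i \<in> I \<Longrightarrow> f i \<in> schwartz' S"
  shows "\<mu> (\<lambda>v. \<Sum>i\<in>I. f i v) = (\<Sum>i\<in>I. \<mu> (f i))"
  using assms(2,3)
proof (induction rule: finite_induct)
  case (insert x F)
  then have "\<mu> (\<lambda>v. f x v + (\<Sum>i\<in>F. f i v)) = \<mu> (f x) + \<mu> (\<lambda>v. \<Sum>i\<in>F. f i v)"
    using is_dist_plus[OF \<mu>] schwartz'_sum[of F f] by simp
  then show ?case using insert by simp
qed (simp add: is_dist_0[OF \<mu>])

lemma is_dist_coset: "is_dist val \<mu> \<Longrightarrow> nonint a b \<Longrightarrow> \<mu> (coset_fun S a b) = val a b"
  by (simp add: is_dist_def has_coset_values_def nonint_def)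

lemma is_dist_scale: "is_dist val \<mu> \<Longrightarrow> f \<in> schwartz' S \<Longrightarrow> t \<in> Z_S_units S \<Longrightarrow> t > 0 \<Longrightarrow>
    \<mu> (slash S f (mat t)) = \<mu> f"
  by (simp add: is_dist_def scalar_invariant_def)

lemma nonint_coset_schwartz': "nonint a b \<Longrightarrow> coset_fun S a b \<in> schwartz' S"
  unfolding nonint_def by (intro coset_fun_schwartz') auto

lemma is_dist_scaled_coset:
  "is_dist val \<mu> \<Longrightarrow> nonint a b \<Longrightarrow> N > 0 \<Longrightarrow> coprime N c \<Longrightarrow>
    \<mu> (slash S (coset_fun S a b) (mat (of_nat N))) = val a b"
  using is_dist_scale[OF _ nonint_coset_schwartz' Z_S_units_of_nat, of val \<mu> a b N] is_dist_coset[of val \<mu> a b]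
  by simp

lemma is_dist_unique:
  assumes "is_dist val \<mu>" "is_dist val \<nu>" shows "\<mu> = \<nu>"
proof
  fix f
  show "\<mu> f = \<nu> f"
  proof (cases "f \<in> schwartz' S")
    case True
    then show ?thesis
    proof (induction rule: schwartz'_induct)
      case zero then show ?case using assms[THEN is_dist_0] by simp
    next
      case (add f g) then show ?case using assms[THEN is_dist_plus, of f g] by simp
    next
      case (minus f) then show ?case using assms[THEN is_dist_uminus, of f] by simp
    next
      case (coset a b N) then show ?case using assms[THEN is_dist_scaled_coset, of a b N] by (simp add: nonint_def)
    qed
  next
    case False then show ?thesis using assms[THEN is_dist_out] by simp
  qed
qed

lemma is_dist_Ints:
  fixes \<mu> :: "(adele2 \<Rightarrow> int) \<Rightarrow> 'a::ring_1"
  assumes \<mu>: "is_dist val \<mu>" and int: "\<And>a b. nonint a b \<Longrightarrow> val a b \<in> \<int>"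
  shows "\<mu> f \<in> \<int>"
proof (cases "f \<in> schwartz' S")
  case True
  then show ?thesis
  proof (induction rule: schwartz'_induct)
    case zero then show ?case using is_dist_0[OF \<mu>] by simp
  next
    case (add f g) then show ?case using is_dist_plus[OF \<mu>] by simp
  next
    case (minus f) then show ?case using is_dist_uminus[OF \<mu>] by simp
  next
    case (coset a b N) then show ?case using is_dist_scaled_coset[OF \<mu>, of a b N] int by (simp add: nonint_def)
  qed
qed (use is_dist_out[OF \<mu>] in simp)

lemma is_dist_cong: "is_dist val \<mu> \<Longrightarrow> (\<And>a b. nonint a b \<Longrightarrow> val a b = val' a b) \<Longrightarrow> is_dist val' \<mu>"
  unfolding is_dist_def has_coset_values_def nonint_def by simp

lemma the_dist_eq: "is_dist val \<mu> \<Longrightarrow> the_dist S val = \<mu>"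
  unfolding the_dist_def
proof (rule the_equality)
  fix \<nu> assume "is_dist val \<mu>" "\<nu> \<in> distributions S \<and> scalar_invariant S \<nu> \<and> has_coset_values S val \<nu>"
  then show "\<nu> = \<mu>" using is_dist_unique[of val] by (simp add: is_dist_def)
qed (simp add: is_dist_def)

lemma is_distI:
  assumes "\<And>f. f \<notin> schwartz' S \<Longrightarrow> \<mu> f = 0"
    "\<And>f g. f \<in> schwartz' S \<Longrightarrow> g \<in> schwartz' S \<Longrightarrow> \<mu> (\<lambda>v. f v + g v) = \<mu> f + \<mu> g"
    "\<And>f t. f \<in> schwartz' S \<Longrightarrow> t \<in> Z_S_units S \<Longrightarrow> t > 0 \<Longrightarrow> \<mu> (slash S f (mat t)) = \<mu> f"
    "\<And>a b. nonint a b \<Longrightarrow> \<mu> (coset_fun S a b) = val a b"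
  shows "is_dist val \<mu>"
  using assms unfolding is_dist_def distributions_def scalar_invariant_def has_coset_values_def nonint_def by blast

lemma is_dist_add:
  assumes "is_dist val \<mu>" "is_dist val' \<nu>"
  shows "is_dist (\<lambda>a b. val a b + val' a b) (\<lambda>f. \<mu> f + \<nu> f)"
  by (rule is_distI) (simp_all add: assms[THEN is_dist_out] assms[THEN is_dist_plus] assms[THEN is_dist_scale]
      assms[THEN is_dist_coset])

lemma is_dist_diff:
  assumes "is_dist val \<mu>" "is_dist val' \<nu>"
  shows "is_dist (\<lambda>a b. val a b - val' a b) (\<lambda>f. \<mu> f - \<nu> f)"
  by (rule is_distI) (simp_all add: assms[THEN is_dist_out] assms[THEN is_dist_plus] assms[THEN is_dist_scale]
      assms[THEN is_dist_coset])

lemma is_dist_cmult: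
  fixes val :: "rat \<Rightarrow> rat \<Rightarrow> 'a::ring_1"
  assumes "is_dist val \<mu>"
  shows "is_dist (\<lambda>a b. x * val a b) (\<lambda>f. x * \<mu> f)"
  by (rule is_distI) (simp_all add: assms[THEN is_dist_out] assms[THEN is_dist_plus] assms[THEN is_dist_scale]
      assms[THEN is_dist_coset] distrib_left)

lemma is_dist_of_rat:
  assumes "is_dist val \<mu>"
  shows "is_dist (\<lambda>a b. of_rat (val a b) :: 'a::field_char_0) (\<lambda>f. of_rat (\<mu> f))"
  by (rule is_distI) (simp_all add: assms[THEN is_dist_out] assms[THEN is_dist_plus] assms[THEN is_dist_scale]
      assms[THEN is_dist_coset] of_rat_add)

text \<open>The matrix commutes with scalars, so only the coset values change.\<close>

lemma is_dist_precompose: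
  assumes \<mu>: "is_dist val \<mu>" and g: "g \<in> G_S S"
    and co: "\<And>a b. nonint a b \<Longrightarrow> \<mu> (slash S (coset_fun S a b) g) = val' a b"
  shows "is_dist val' (\<lambda>f. if f \<in> schwartz' S then \<mu> (slash S f g) else 0)"
proof -
  have "slash S (slash S f (mat t)) g = slash S (slash S f g) (mat t)" if "t \<noteq> 0" for f t
    using slash_mult[OF det_mat_nz[OF that] G_S_det_nz[OF g]] slash_mult[OF G_S_det_nz[OF g] det_mat_nz[OF that]]
    by (simp add: mat_commute)
  then have comm: "slash S (slash S f (mat t)) g = slash S (slash S f g) (mat t)" if "t \<in> Z_S_units S" for f t
    using that unfolding Z_S_units_def by blast
  show ?thesis
  proof (rule is_distI)
    fix f h assume "f \<in> schwartz' S" "h \<in> schwartz' S"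
    then show "(if (\<lambda>v. f v + h v) \<in> schwartz' S then \<mu> (slash S (\<lambda>v. f v + h v) g) else 0) =
        (if f \<in> schwartz' S then \<mu> (slash S f g) else 0) + (if h \<in> schwartz' S then \<mu> (slash S h g) else 0)"
      using is_dist_plus[OF \<mu> slash_schwartz'[OF _ g] slash_schwartz'[OF _ g]] schwartz'_add
      by (simp add: slash_add)
  next
    fix f t assume "f \<in> schwartz' S" "t \<in> Z_S_units S" "t > 0"
    then show "(if slash S f (mat t) \<in> schwartz' S then \<mu> (slash S (slash S f (mat t)) g) else 0) =
        (if f \<in> schwartz' S then \<mu> (slash S f g) else 0)"
      using is_dist_scale[OF \<mu> slash_schwartz'[OF _ g]] slash_schwartz'[OF _ G_S_mat] by (simp add: comm)
  next
    fix a b assume "nonint a b"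
    then show "(if coset_fun S a b \<in> schwartz' S then \<mu> (slash S (coset_fun S a b) g) else 0) = val' a b"
      using co nonint_coset_schwartz' by simp
  qed simp
qed

lemma slash_coset_SL2:
  fixes p q r s :: int
  assumes "p * s - q * r = 1"
  shows "slash S (coset_fun S a b) (mat2 (of_int p) (of_int q) (of_int r) (of_int s)) =
    coset_fun S (a * of_int p + b * of_int r) (a * of_int q + b * of_int s)"
proof -
  let ?g = "mat2 (of_int p) (of_int q) (of_int r) (of_int s)"
  have ps: "(of_int p * of_int s :: rat) = 1 + of_int q * of_int r"
    using assms by (metis add.commute diff_add_cancel of_int_1 of_int_add of_int_mult)
  then have inv: "matrix_inv ?g = mat2 (of_int s) (of_int (- q)) (of_int (- r)) (of_int p)"
    using matrix_inv_mat2[OF ps] by simp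
  have "padic_abs l (mat2 (of_int p) (of_int q) (of_int r) (of_int s) $ i $ j) \<le> padic_abs l 1"
    if "l \<in> places S" for l i j and p q r s :: int
    using that places_prime[OF that] exhaust_2[of i] exhaust_2[of j] by (auto simp: padic_abs_of_int_le_1)
  from this[of _ p q r s] this[of _ s "- q" "- r" p] show ?thesis
    unfolding coset_fun_eq
    by (subst slash_adic_coset[of _ 1]) (auto simp: det_mat2 ps inv simp del: of_int_minus)
qed

lemma nonint_SL2:
  fixes p q r s :: int
  assumes "nonint a b" "p * s - q * r = 1"
  shows "nonint (a * of_int p + b * of_int r) (a * of_int q + b * of_int s)"
proof -
  let ?x = "a * of_int p + b * of_int r" and ?y = "a * of_int q + b * of_int s"
  have ps: "(of_int p * of_int s :: rat) = 1 + of_int q * of_int r"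
    using assms by (metis add.commute diff_add_cancel of_int_1 of_int_add of_int_mult)
  have "?x * of_int s - ?y * of_int r = a * (of_int p * of_int s - of_int q * of_int r)"
    "?y * of_int p - ?x * of_int q = b * (of_int p * of_int s - of_int q * of_int r)" by (simp_all add: algebra_simps)
  then have "a = ?x * of_int s - ?y * of_int r" "b = ?y * of_int p - ?x * of_int q" by (simp_all add: ps)
  then have "\<not> (?x \<in> \<int> \<and> ?y \<in> \<int>)"
    using assms(1) unfolding nonint_def by (metis Ints_diff Ints_mult Ints_of_int)
  then show ?thesis using assms(1) unfolding nonint_def
    by (intro conjI Z_S_add Z_S_mult Z_S_of_int) auto
qed

lemma G_S_SL2: "p * s - q * r = 1 \<Longrightarrow> mat2 (of_int p) (of_int q) (of_int r) (of_int s) \<in> G_S S"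
proof -
  assume "p * s - q * r = 1"
  then have "(of_int p * of_int s - of_int q * of_int r :: rat) = 1"
    by (metis of_int_1 of_int_diff of_int_mult)
  then show ?thesis by (simp add: G_S_mat2 Z_S_of_int Z_S_units_def)
qed

lemma is_dist_SL2:
  fixes p q r s :: int
  assumes \<mu>: "is_dist val \<mu>" and "p * s - q * r = 1"
  shows "is_dist (\<lambda>a b. val (a * of_int p + b * of_int r) (a * of_int q + b * of_int s))
    (\<lambda>f. if f \<in> schwartz' S then \<mu> (slash S f (mat2 (of_int p) (of_int q) (of_int r) (of_int s))) else 0)"
  by (rule is_dist_precompose[OF \<mu> G_S_SL2[OF assms(2)]])
     (simp add: slash_coset_SL2[OF assms(2)] is_dist_coset[OF \<mu> nonint_SL2[OF _ assms(2)]])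

lemma row_mult_diag:
  assumes "prime l" "v \<in> Qp l \<times> Qp l"
  shows "row_mult l v (mat2 x 0 0 1) = (padic_mult l (fst v) (padic_of_rat l x), snd v)"
proof -
  obtain y z where "y \<in> padic_Cauchy l" "z \<in> padic_Cauchy l" "v = (padic_class l y, padic_class l z)"
    using assms Qp_cases[OF assms(1)] by (metis mem_Times_iff prod.collapse)
  then show ?thesis using assms(1)
    by (simp add: row_mult_def padic_of_rat_eq padic_mult_class padic_add_class padic_Cauchy_const padic_Cauchy_mult)
qed

text \<open>Only the first coordinate is stretched, giving (na + nZ) x (b + Z). Splitting the second
  coordinate modulo \<open>n\<close> produces cosets of n times the lattice, which are scalings of
  standard cosets; hence a sum over the second variable alone.\<close>

lemma slash_coset_diag:
  assumes n: "n > 0" "coprime n c"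
  shows "slash S (coset_fun S a b) (mat2 (of_nat n) 0 0 1) =
    (\<lambda>v. \<Sum>j<n. slash S (coset_fun S a ((b + of_nat j) / of_nat n)) (mat (of_nat n)) v)"
proof
  fix v
  have rhs: "slash S (coset_fun S a ((b + of_nat j) / of_nat n)) (mat (of_nat n)) v =
      adic_coset S (of_nat n) (a * of_nat n) (b + of_nat j) v" for j
    using n by (simp add: coset_fun_eq slash_mat_adic_coset)
  show "slash S (coset_fun S a b) (mat2 (of_nat n) 0 0 1) v =
    (\<Sum>j<n. slash S (coset_fun S a ((b + of_nat j) / of_nat n)) (mat (of_nat n)) v)"
  proof (cases "v \<in> VA S")
    case v: True
    \<comment> \<open>Dividing the first coordinate by \<open>n\<close> turns the congruence modulo
      \<open>n\<close> there into one modulo 1, which no longer depends on \<open>j\<close>.\<close>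
    define w where "w = adele_mult S v (mat2 (1 / of_nat n) 0 0 1)"
    have inv: "matrix_inv (mat2 (of_nat n) 0 0 1) = mat2 (1 / of_nat n) 0 0 1"
      using matrix_inv_mat2[of "of_nat n" 1 "of_nat n" 0 0] n by simp
    have w: "w \<in> VA S" unfolding w_def using v by (rule adele_mult_in_VA)
    have wl: "w l = (padic_mult l (fst (v l)) (padic_of_rat l (1 / of_nat n)), snd (v l))" if "l \<in> places S" for l
      using that row_mult_diag[OF places_prime[OF that] VA_Times[OF v that]] by (simp add: w_def adele_mult_def)
    have d1: "padic_dist l (fst (v l)) (padic_of_rat l (a * of_nat n)) \<le> padic_abs l (of_nat n) \<longleftrightarrow>
      padic_dist l (fst (w l)) (padic_of_rat l a) \<le> 1" if l: "l \<in> places S" for l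
    proof -
      have p: "prime l" using l by (rule places_prime)
      have pos: "padic_abs l (of_nat n) > 0" using n by (intro padic_abs_pos[OF p]) auto
      have "padic_of_rat l a = padic_mult l (padic_of_rat l (a * of_nat n)) (padic_of_rat l (1 / of_nat n))"
        using n p by (simp add: padic_mult_of_rat)
      then have "padic_dist l (fst (w l)) (padic_of_rat l a) =
          padic_abs l (1 / of_nat n) * padic_dist l (fst (v l)) (padic_of_rat l (a * of_nat n))"
        using wl[OF l] VA_Times[OF v l] p by (auto simp: padic_dist_mult_rat padic_of_rat_in)
      then show ?thesis using pos by (simp add: padic_abs_divide[OF p] padic_abs_1[OF p] pos_divide_le_eq)
    qed
    have lhs: "slash S (coset_fun S a b) (mat2 (of_nat n) 0 0 1) v = adic_coset S 1 a b w"
      using v by (simp add: slash_eq inv w_def coset_fun_eq)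
    have rhs': "adele_cong S (of_nat n) v (rat_pt S (a * of_nat n) (b + of_nat j)) \<longleftrightarrow>
      (\<forall>l\<in>places S. padic_dist l (fst (w l)) (padic_of_rat l a) \<le> 1 \<and>
         padic_dist l (snd (w l)) (padic_of_rat l (b + of_nat j)) \<le> padic_abs l (of_nat n))" for j
      using d1 wl by (simp add: adele_cong_def rat_pt_def)
    show ?thesis
    proof (cases "adele_cong S 1 w (rat_pt S a b)")
      case True
      obtain i j where ij: "i < n" "j < n" "\<And>i' j'. i' < n \<Longrightarrow> j' < n \<Longrightarrow>
         adele_cong S (1 * of_nat n) w (rat_pt S (a + 1 * of_nat i') (b + 1 * of_nat j')) \<longleftrightarrow> i' = i \<and> j' = j"
        by (rule adele_cong_residue_ex1[OF w True _ n]) auto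
      have fst1: "padic_dist l (fst (w l)) (padic_of_rat l a) \<le> 1" if "l \<in> places S" for l
        using True that places_prime[OF that] by (auto simp: adele_cong_def rat_pt_def)
      have "adele_cong S (of_nat n) v (rat_pt S (a * of_nat n) (b + of_nat j')) \<longleftrightarrow> j' = j" if "j' < n" for j'
        using ij(3)[OF ij(1) that] ij(3)[OF ij(1,2)] fst1 unfolding rhs'
        by (auto simp: adele_cong_def rat_pt_def)
      then have "(\<Sum>j<n. adic_coset S (of_nat n) (a * of_nat n) (b + of_nat j) v) = (\<Sum>j'<n. if j' = j then 1 else 0)"
        using v by (intro sum.cong refl) (simp add: adic_coset_def)
      then show ?thesis using ij(2) True w by (simp add: lhs rhs adic_coset_def)
    next
      case False
      have "\<not> adele_cong S (of_nat n) v (rat_pt S (a * of_nat n) (b + of_nat j))" for j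
      proof
        assume c: "adele_cong S (of_nat n) v (rat_pt S (a * of_nat n) (b + of_nat j))"
        have "padic_dist l (snd (w l)) (padic_of_rat l b) \<le> 1" if l: "l \<in> places S" for l
        proof -
          have p: "prime l" using l by (rule places_prime)
          have "padic_dist l (snd (w l)) (padic_of_rat l (b + of_nat j)) \<le> 1"
            using c[unfolded rhs'] l padic_abs_of_nat_le_1[OF p, of n] by (meson order_trans)
          then show ?thesis using VA_D[OF w l] padic_abs_of_nat_le_1[OF p, of j]
              padic_dist_ultra[OF p, of "snd (w l)" "padic_of_rat l (b + of_nat j)" "padic_of_rat l b"]
            by (simp add: padic_dist_of_rat[OF p] padic_of_rat_in[OF p])
        qed
        then show False using False c[unfolded rhs'] by (auto simp: adele_cong_def rat_pt_def places_prime)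
      qed
      then show ?thesis using False by (simp add: lhs rhs adic_coset_def)
    qed
  qed (simp add: slash_eq)
qed

text \<open>\<open>c\<close> is a unit at every place outside \<open>S\<close>, and \<open>x\<close>
  is integral at \<open>S\<close>. Consequently the coset of (ca, cb) avoids the origin together
  with that of (a, b), as smoothing requires.\<close>

lemma int_mult_coprime:
  assumes "x \<in> Z_S S" "of_nat c * x \<in> \<int>" shows "x \<in> \<int>"
proof (rule int_if_padic_abs_le_1[OF assms(1)])
  fix l assume l: "l \<in> places S"
  have p: "prime l" using l by (rule places_prime)
  have "coprime l c" using l p by (simp add: places_iff prime_imp_coprime)
  then have "padic_abs l (of_nat c) = 1" by (rule padic_abs_of_nat_coprime[OF p])
  moreover obtain k :: int where "of_nat c * x = of_int k" using assms(2) by (rule Ints_cases)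
  ultimately show "padic_abs l x \<le> 1"
    using padic_abs_mult[OF p, of "of_nat c" x] padic_abs_of_int_le_1[OF p, of k] by simp
qed

lemma nonint_mult_c: "nonint a b \<Longrightarrow> nonint (of_nat c * a) (of_nat c * b)"
  unfolding nonint_def using int_mult_coprime[of a] int_mult_coprime[of b]
    Z_S_mult[OF Z_S_of_nat, of a c] Z_S_mult[OF Z_S_of_nat, of b c] by blast

lemma nonint_shift: "nonint a b \<Longrightarrow> nonint (a + of_int m) (b + of_int n)"
  unfolding nonint_def by (auto intro: Z_S_add Z_S_of_int)

lemma nonint_divide:
  assumes "nonint a b" "K > 0" "coprime K c"
  shows "nonint ((a + of_int i) / of_nat K) ((b + of_int j) / of_nat K)"
proof -
  have *: "x \<in> \<int>" if xi: "(x + of_int i) / of_nat K \<in> \<int>" for x :: rat and i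
  proof -
    obtain k :: int where "(x + of_int i) / of_nat K = of_int k" using xi by (rule Ints_cases)
    then have "x = of_int (k * int K - i)" using assms(2) by (simp add: field_simps)
    then show ?thesis by simp
  qed
  show ?thesis using assms * unfolding nonint_def
    by (auto intro!: Z_S_divide_nat Z_S_add Z_S_of_int)
qed

lemma is_dist_diag:
  assumes \<mu>: "is_dist val \<mu>" and n: "n > 0" "coprime n c"
  shows "is_dist (\<lambda>a b. \<Sum>j<n. val a ((b + of_nat j) / of_nat n))
    (\<lambda>f. if f \<in> schwartz' S then \<mu> (slash S f (mat2 (of_nat n) 0 0 1)) else 0)"
proof (rule is_dist_precompose[OF \<mu>])
  show "mat2 (of_nat n) 0 0 1 \<in> G_S S" using n Z_S_units_of_nat by (simp add: G_S_mat2)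
  fix a b assume ab: "nonint a b"
  have ni: "nonint a ((b + of_nat j) / of_nat n)" for j
  proof -
    have "(b + of_nat j) / of_nat n \<in> Z_S S" using ab n unfolding nonint_def
      by (auto intro!: Z_S_divide_nat Z_S_add)
    moreover have "b \<in> \<int>" if i: "(b + of_nat j) / of_nat n \<in> \<int>"
    proof -
      obtain k :: int where "(b + of_nat j) / of_nat n = of_int k" using i by (rule Ints_cases)
      then have "b = of_int (k * int n - int j)" using n by (simp add: field_simps)
      then show ?thesis by simp
    qed
    ultimately show ?thesis using ab unfolding nonint_def by blast
  qed
  show "\<mu> (slash S (coset_fun S a b) (mat2 (of_nat n) 0 0 1)) = (\<Sum>j<n. val a ((b + of_nat j) / of_nat n))"
    unfolding slash_coset_diag[OF n]
    using ni n by (subst is_dist_sum[OF \<mu>])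
      (auto intro!: slash_schwartz' nonint_coset_schwartz' G_S_mat Z_S_units_of_nat sum.cong is_dist_scaled_coset[OF \<mu>])
qed

section \<open>Existence of distributions\<close>

definition dist_rel :: "(rat \<Rightarrow> rat \<Rightarrow> 'a::comm_ring_1) \<Rightarrow> bool" where
  "dist_rel val \<longleftrightarrow> (\<forall>a b. nonint a b \<longrightarrow>
     (\<forall>m n. val (a + of_int m) (b + of_int n) = val a b) \<and>
     (\<forall>K>0. coprime K c \<longrightarrow> (\<Sum>i<K. \<Sum>j<K. val ((a + of_nat i) / of_nat K) ((b + of_nat j) / of_nat K)) = val a b))"

lemma dist_relD1: "dist_rel val \<Longrightarrow> nonint a b \<Longrightarrow> val (a + of_int m) (b + of_int n) = val a b"
  unfolding dist_rel_def by blast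

lemma dist_relD2: "dist_rel val \<Longrightarrow> nonint a b \<Longrightarrow> K > 0 \<Longrightarrow> coprime K c \<Longrightarrow>
    (\<Sum>i<K. \<Sum>j<K. val ((a + of_nat i) / of_nat K) ((b + of_nat j) / of_nat K)) = val a b"
  unfolding dist_rel_def by blast

text \<open>The value forced by \<open>level_decompose\<close>: the coset of modulus N at (i/N, j/N)
  is the scaling by N of the standard coset at (i/N^2, j/N^2).\<close>

definition level_sum :: "nat \<Rightarrow> (rat \<Rightarrow> rat \<Rightarrow> 'a::comm_ring_1) \<Rightarrow> (adele2 \<Rightarrow> int) \<Rightarrow> 'a" where
  "level_sum N val f = (\<Sum>i<N^2. \<Sum>j<N^2. of_int (f (rat_pt S (of_nat i / of_nat N) (of_nat j / of_nat N))) *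
     val (of_nat i / of_nat (N^2)) (of_nat j / of_nat (N^2)))"

text \<open>Any admissible level gives the same value, by \<open>dist_of_eq\<close>. The chosen one
  depends on \<open>f\<close> alone and not on \<open>val\<close>.\<close>

definition dist_of :: "(rat \<Rightarrow> rat \<Rightarrow> 'a::comm_ring_1) \<Rightarrow> (adele2 \<Rightarrow> int) \<Rightarrow> 'a" where
  "dist_of val f = (if f \<in> schwartz' S
     then level_sum (SOME N. N > 0 \<and> coprime N c \<and> level S N f) val f else 0)"

lemma level_support:
  assumes f: "level S N f" and N: "N > 0" and K: "K > 0" "coprime K c"
    and nz: "f (rat_pt S (of_nat i / of_nat (N * K)) (of_nat j / of_nat (N * K))) \<noteq> 0"
  shows "K dvd i" "K dvd j"
proof -
  have "adele_cong S (1 / of_nat N) (rat_pt S (of_nat i / of_nat (N * K)) (of_nat j / of_nat (N * K))) (rat_pt S 0 0)"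
    using f nz unfolding level_def VA_zero_eq by simp
  then have *: "padic_abs l (of_nat i / of_nat (N * K)) \<le> padic_abs l (1 / of_nat N) \<and>
     padic_abs l (of_nat j / of_nat (N * K)) \<le> padic_abs l (1 / of_nat N)" if "l \<in> places S" for l
    using that by (simp add: adele_cong_rat_pt)
  have "int K dvd int i" if "\<And>l. l \<in> places S \<Longrightarrow> padic_abs l (of_nat i / of_nat (N * K)) \<le> padic_abs l (1 / of_nat N)" for i
  proof (rule dvd_if_padic_abs_le[OF K(2,1)])
    fix l assume l: "l \<in> places S"
    have p: "prime l" using l by (rule places_prime)
    let ?N = "padic_abs l (of_nat N)" and ?K = "padic_abs l (of_nat K)"
    have pos: "?N > 0" "?K > 0" using N K by (auto intro!: padic_abs_pos[OF p])
    have "padic_abs l (of_nat i) / (?N * ?K) \<le> 1 / ?N"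
      using that[OF l] by (simp only: padic_abs_divide[OF p] padic_abs_mult[OF p] of_nat_mult padic_abs_1[OF p])
    then have "padic_abs l (of_nat i) / (?N * ?K) * (?N * ?K) \<le> 1 / ?N * (?N * ?K)"
      using pos by (intro mult_right_mono) auto
    then show "padic_abs l (of_int (int i)) \<le> padic_abs l (of_nat K)" using pos by simp
  qed
  then show "K dvd i" "K dvd j" using * by auto
qed

lemma level_periodic:
  assumes f: "level S N f" and N: "N > 0"
  shows "f (rat_pt S (of_nat (i + N^2 * r) / of_nat N) (of_nat (j + N^2 * s) / of_nat N)) =
    f (rat_pt S (of_nat i / of_nat N) (of_nat j / of_nat N))"
proof -
  have eq: "(of_nat (i + N^2 * r) / of_nat N :: rat) = of_nat i / of_nat N + of_nat N * of_nat r" for i r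
    using N by (simp add: field_simps power2_eq_square)
  have "adele_cong S (of_nat N) (rat_pt S (of_nat (i + N^2 * r) / of_nat N) (of_nat (j + N^2 * s) / of_nat N))
     (rat_pt S (of_nat i / of_nat N) (of_nat j / of_nat N))"
    unfolding eq adele_cong_rat_pt using padic_abs_of_nat_le_1[OF places_prime]
    by (auto simp: padic_abs_mult places_prime mult_left_le)
  then show ?thesis using f unfolding level_def by simp
qed

text \<open>In the finer sum the support condition discards the indices not divisible by
  \<open>K\<close>; the remaining ones fall into classes modulo N^2 on which \<open>f\<close> is
  constant, and the distribution relation sums \<open>val\<close> over each class.\<close>

lemma level_sum_mult:
  assumes f: "level S N f" and f0: "f (VA_zero S) = 0" and N: "N > 0" "coprime N c" and K: "K > 0" "coprime K c"
    and val: "dist_rel val"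
  shows "level_sum (N * K) val f = level_sum N val f"
proof -
  let ?F = "\<lambda>i j. of_int (f (rat_pt S (of_nat i / of_nat (N * K)) (of_nat j / of_nat (N * K)))) *
     val (of_nat i / of_nat ((N * K)^2)) (of_nat j / of_nat ((N * K)^2))"
  let ?G = "\<lambda>i j. of_int (f (rat_pt S (of_nat i / of_nat N) (of_nat j / of_nat N))) *
     val (of_nat i / of_nat (N^2 * K)) (of_nat j / of_nat (N^2 * K))"
  have sq: "(N * K)^2 = (N^2 * K) * K" by (simp add: power2_eq_square)
  have cK: "(of_nat (K * i) / of_nat (N * K) :: rat) = of_nat i / of_nat N"
    "(of_nat (K * i) / of_nat ((N * K)^2) :: rat) = of_nat i / of_nat (N^2 * K)" for i
    using K by (auto simp: power2_eq_square)
  have FG: "?F (K * i) (K * j) = ?G i j" for i j unfolding cK ..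
  have Fz: "?F i j = 0" if "\<not> (K dvd i \<and> K dvd j)" for i j
    using level_support[OF f N(1) K] that by (metis mult_zero_left of_int_0)
  have "level_sum (N * K) val f = (\<Sum>i<N^2 * K. \<Sum>j<N^2 * K * K. ?F (K * i) j)"
    unfolding level_sum_def sq
    by (rule sum_multiples[OF K(1)]) (use Fz[unfolded sq] in \<open>auto intro!: sum.neutral\<close>)
  also have "\<dots> = (\<Sum>i<N^2 * K. \<Sum>j<N^2 * K. ?F (K * i) (K * j))"
    by (intro sum.cong refl sum_multiples[OF K(1)] Fz) auto
  also have "\<dots> = (\<Sum>i<N^2 * K. \<Sum>j<N^2 * K. ?G i j)" by (simp only: FG)
  also have "\<dots> = (\<Sum>i<N^2. \<Sum>r<K. \<Sum>j<N^2. \<Sum>s<K. ?G (i + N^2 * r) (j + N^2 * s))"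
    by (simp only: sum_blocks)
  also have "\<dots> = (\<Sum>i<N^2. \<Sum>j<N^2. \<Sum>r<K. \<Sum>s<K. ?G (i + N^2 * r) (j + N^2 * s))"
    by (rule sum.cong[OF refl]) (rule sum.swap)
  also have "\<dots> = level_sum N val f" unfolding level_sum_def
  proof (intro sum.cong refl)
    fix i j assume ij: "i \<in> {..<N^2}" "j \<in> {..<N^2}"
    let ?f = "of_int (f (rat_pt S (of_nat i / of_nat N) (of_nat j / of_nat N)))"
    have arg: "(of_nat (i + N^2 * r) / of_nat (N^2 * K) :: rat) = (of_nat i / of_nat (N^2) + of_nat r) / of_nat K" for i r
      using N K by (simp add: field_simps)
    have "(\<Sum>r<K. \<Sum>s<K. ?G (i + N^2 * r) (j + N^2 * s)) =
      ?f * (\<Sum>r<K. \<Sum>s<K. val ((of_nat i / of_nat (N^2) + of_nat r) / of_nat K) ((of_nat j / of_nat (N^2) + of_nat s) / of_nat K))"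
      by (simp only: level_periodic[OF f N(1)] arg sum_distrib_left)
    also have "\<dots> = ?f * val (of_nat i / of_nat (N^2)) (of_nat j / of_nat (N^2))"
    proof (cases "i = 0 \<and> j = 0")
      case True then show ?thesis using f0 by (simp add: VA_zero_eq)
    next
      case False
      have "of_nat i / of_nat (N^2) \<in> Z_S S" for i using N by (intro Z_S_divide_nat) auto
      then have "nonint (of_nat i / of_nat (N^2)) (of_nat j / of_nat (N^2))"
        unfolding nonint_def using quotient_not_both_int[of i "N^2" j] ij False by blast
      then show ?thesis using dist_relD2[OF val _ K] by simp
    qed
    finally show "(\<Sum>r<K. \<Sum>s<K. ?G (i + N^2 * r) (j + N^2 * s)) = ?f * val (of_nat i / of_nat (N^2)) (of_nat j / of_nat (N^2))" .
  qed
  finally show ?thesis .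
qed

text \<open>Two levels are compared through their product.\<close>

lemma dist_of_eq:
  assumes "dist_rel val" "f \<in> schwartz' S" and N: "level S N f" "N > 0" "coprime N c"
  shows "dist_of val f = level_sum N val f"
proof -
  define M where "M = (SOME N. N > 0 \<and> coprime N c \<and> level S N f)"
  have M: "M > 0 \<and> coprime M c \<and> level S M f" unfolding M_def by (rule someI[of _ N]) (use N in auto)
  have f0: "f (VA_zero S) = 0" using assms(2) by (simp add: schwartz'_def)
  have "level_sum M val f = level_sum (M * N) val f"
    using level_sum_mult[of M f N val] M N f0 assms(1) by simp
  also have "\<dots> = level_sum N val f"
    using level_sum_mult[of N f M val] M N f0 assms(1) by (simp add: mult.commute)
  finally show ?thesis using assms(2) by (simp add: dist_of_def M_def)
qed

lemma dist_of_add: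
  assumes "dist_rel val" "f \<in> schwartz' S" "g \<in> schwartz' S"
  shows "dist_of val (\<lambda>v. f v + g v) = dist_of val f + dist_of val g"
proof -
  obtain N where N: "N > 0" "coprime N c" "level S N f" "level S N g"
    using schwartz'_common_level[OF assms(2,3)] .
  show ?thesis
    using dist_of_eq[OF assms(1) schwartz'_add[OF assms(2,3)] level_add[OF N(3,4)] N(1,2)]
      dist_of_eq[OF assms(1,2) N(3,1,2)] dist_of_eq[OF assms(1,3) N(4,1,2)]
    by (simp add: level_sum_def sum.distrib distrib_right)
qed

text \<open>The scaled function has level N m. In its level sum only indices divisible by m^2 meet
  the support, and these reproduce the level sum of \<open>f\<close> term by term, so the
  distribution relation enters only through independence of the level.\<close>

lemma dist_of_scale_nat:
  assumes val: "dist_rel val" and f: "f \<in> schwartz' S" and m: "m > 0" "coprime m c"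
  shows "dist_of val (slash S f (mat (of_nat m))) = dist_of val f"
proof -
  obtain N where N: "N > 0" "coprime N c" "level S N f" using f by (rule schwartz'_level)
  let ?g = "slash S f (mat (of_nat m))"
  have inv: "matrix_inv (mat (of_nat m)) = mat2 (1 / of_nat m) 0 0 (1 / of_nat m)"
    using m matrix_inv_mat[of "of_nat m"] mat_eq_mat2[of "1 / of_nat m"] by simp
  have gpt: "?g (rat_pt S a b) = f (rat_pt S (a / of_nat m) (b / of_nat m))" for a b
    by (simp add: slash_rat_pt inv)
  have gS: "?g \<in> schwartz' S" using f m by (intro slash_schwartz' G_S_mat Z_S_units_of_nat)
  have "level S (N * m) ?g" unfolding level_def
  proof (intro conjI allI ballI impI)
    show "?g v = 0" if "v \<notin> VA S" for v using that by (simp add: slash_eq)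
    have bd: "padic_abs l (mat2 (1 / of_nat m) 0 0 (1 / of_nat m) $ i $ j) \<le> padic_abs l (1 / of_nat m)"
      "padic_abs l (mat (of_nat m) $ i $ j) \<le> padic_abs l 1"
      if "l \<in> places S" for l and i j :: 2
      using exhaust_2[of i] exhaust_2[of j] padic_abs_of_nat_le_1[OF places_prime[OF that], of m] places_prime[OF that]
      by (auto simp: mat_eq_mat2)
    fix v assume v: "v \<in> VA S"
    {
      fix w assume w: "w \<in> VA S" "adele_cong S (of_nat (N * m)) v w"
      have "adele_cong S (1 / of_nat m * of_nat (N * m)) (adele_mult S v (mat2 (1 / of_nat m) 0 0 (1 / of_nat m)))
         (adele_mult S w (mat2 (1 / of_nat m) 0 0 (1 / of_nat m)))"
        by (rule adele_mult_cong[OF v w]) (rule bd)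
      then have "adele_cong S (of_nat N) (adele_mult S v (mat2 (1 / of_nat m) 0 0 (1 / of_nat m)))
         (adele_mult S w (mat2 (1 / of_nat m) 0 0 (1 / of_nat m)))" using m by simp
      then show "?g v = ?g w" using v w(1) N unfolding level_def by (simp add: slash_eq inv adele_mult_in_VA)
    next
      assume "?g v \<noteq> 0"
      then have "adele_cong S (1 / of_nat N) (adele_mult S v (matrix_inv (mat (of_nat m)))) (VA_zero S)"
        using v N unfolding level_def by (simp add: slash_eq adele_mult_in_VA)
      then have "adele_cong S (1 * (1 / of_nat N)) (adele_mult S (adele_mult S v (matrix_inv (mat (of_nat m)))) (mat (of_nat m)))
          (adele_mult S (VA_zero S) (mat (of_nat m)))"
        using bd(2) by (intro adele_mult_cong adele_mult_in_VA v) (auto simp: VA_zero_eq)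
      moreover have "adele_mult S (VA_zero S) (mat (of_nat m)) = VA_zero S" by (simp add: VA_zero_eq adele_mult_rat_pt)
      ultimately have "adele_cong S (1 / of_nat N) v (VA_zero S)"
        using v m by (simp add: adele_mult_assoc matrix_inv_mult_self det_mat_nz adele_mult_mat_1)
      then show "adele_cong S (1 / of_nat (N * m)) v (VA_zero S)"
      proof (rule adele_cong_mono)
        fix l assume l: "l \<in> places S"
        have p: "prime l" using l by (rule places_prime)
        have "padic_abs l (of_nat (N * m)) > 0" using N m by (intro padic_abs_pos[OF p]) auto
        then show "padic_abs l (1 / of_nat N) \<le> padic_abs l (1 / of_nat (N * m))"
          using padic_abs_of_nat_dvd[OF p, of N "N * m"] unfolding padic_abs_divide[OF p] padic_abs_1[OF p]
          by (intro divide_left_mono) (auto intro!: mult_pos_pos)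
      qed
    }
  qed
  then have "dist_of val ?g = level_sum (N * m) val ?g"
    using dist_of_eq[OF val gS] N m by simp
  also have "\<dots> = level_sum N val f"
  proof -
    let ?F = "\<lambda>i j. of_int (f (rat_pt S (of_nat i / of_nat (N * m^2)) (of_nat j / of_nat (N * m^2)))) *
     val (of_nat i / of_nat (N^2 * m^2)) (of_nat j / of_nat (N^2 * m^2))"
    have m2: "m^2 > 0" "coprime (m^2) c" using m by auto
    have Fz: "?F i j = 0" if "\<not> (m^2 dvd i \<and> m^2 dvd j)" for i j
      using level_support[OF N(3,1) m2] that by (metis mult_zero_left of_int_0)
    have arg: "(of_nat (m^2 * i) / of_nat (N * m^2) :: rat) = of_nat i / of_nat N"
      "(of_nat (m^2 * i) / of_nat (N^2 * m^2) :: rat) = of_nat i / of_nat (N^2)" for i using m by auto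
    have dm: "(of_nat i / of_nat (N * m) / of_nat m :: rat) = of_nat i / of_nat (N * m^2)" for i
      by (simp add: power2_eq_square)
    have "level_sum (N * m) val ?g = (\<Sum>i<N^2 * m^2. \<Sum>j<N^2 * m^2. ?F i j)"
      unfolding level_sum_def gpt dm power_mult_distrib ..
    also have "\<dots> = (\<Sum>i<N^2. \<Sum>j<N^2 * m^2. ?F (m^2 * i) j)"
      by (rule sum_multiples[OF m2(1)]) (use Fz in \<open>auto intro!: sum.neutral\<close>)
    also have "\<dots> = (\<Sum>i<N^2. \<Sum>j<N^2. ?F (m^2 * i) (m^2 * j))"
      by (intro sum.cong refl sum_multiples[OF m2(1)] Fz) auto
    also have "\<dots> = level_sum N val f" unfolding level_sum_def arg ..
    finally show ?thesis .
  qed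
  also have "\<dots> = dist_of val f" using dist_of_eq[OF val f N(3,1,2)] by simp
  finally show ?thesis .
qed

lemma Z_S_units_cases:
  assumes "t \<in> Z_S_units S" "t > 0"
  obtains m n where "m > 0" "n > 0" "coprime m c" "coprime n c" "t = of_nat m / of_nat n"
proof -
  have "t \<in> Z_S S" using assms by (simp add: Z_S_units_def)
  then obtain a N where N: "N > 0" "coprime N c" "t = of_int a / of_nat N" by (rule Z_S_cases)
  have a: "a > 0" using N assms(2) by (simp add: zero_less_divide_iff)
  have "coprime (nat a) c"
  proof (rule ccontr)
    assume "\<not> coprime (nat a) c"
    then have "gcd (nat a) c \<noteq> 1" by (simp add: coprime_iff_gcd_eq_1)
    then obtain l where l: "prime l" "l dvd gcd (nat a) c" using prime_factor_nat by blast
    then have l: "prime l" "l dvd nat a" "l dvd c" by auto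
    then have lS: "l \<in> S" by (simp add: S_eq)
    have "padic_abs l (inverse t) \<le> 1" using assms lS by (simp add: Z_S_units_def Z_S_def)
    then have "padic_abs l t \<ge> 1"
      using padic_abs_pos[OF l(1), of t] assms by (simp add: padic_abs_inverse[OF l(1)] inverse_le_1_iff)
    then have "padic_abs l (of_int a) \<ge> 1"
      using padic_abs_coprime_S[OF lS N(2)] N(3) by (simp add: padic_abs_divide[OF l(1)])
    moreover have "padic_abs l (of_int a) \<le> real l powi (- int 1)"
      unfolding padic_abs_of_int_le_iff[OF l(1)] using l a by (simp add: int_dvd_pos_iff)
    moreover have "real l powi (- int 1) < 1" using l_gt_1[OF l(1)] by (simp add: field_simps)
    ultimately show False by linarith
  qed
  then show ?thesis using that[of "nat a" N] N a by simp
qed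

lemma is_dist_dist_of:
  assumes val: "dist_rel val" shows "is_dist val (dist_of val)"
  unfolding is_dist_def
proof (intro conjI)
  show "dist_of val \<in> distributions S"
    using dist_of_add[OF val] by (simp add: distributions_def dist_of_def)
  show "scalar_invariant S (dist_of val)" unfolding scalar_invariant_def
  proof (intro ballI impI)
    fix t f assume t: "t \<in> Z_S_units S" "t > 0" and f: "f \<in> schwartz' S"
    obtain m n where mn: "m > 0" "n > 0" "coprime m c" "coprime n c" "t = of_nat m / of_nat n"
      using Z_S_units_cases[OF t] .
    let ?g = "slash S f (mat t)"
    have "?g \<in> schwartz' S" using f t by (intro slash_schwartz' G_S_mat)
    \<comment> \<open>For t = m/n a further scaling by \<open>n\<close> removes the denominator, and
      both integral scalings are known to preserve the value.\<close>
    then have "dist_of val ?g = dist_of val (slash S ?g (mat (of_nat n)))"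
      using dist_of_scale_nat[OF val _ mn(2,4)] by simp
    also have "slash S ?g (mat (of_nat n)) = slash S f (mat (of_nat m))"
      using mn t by (simp add: slash_mult det_mat_nz mat_eq_mat2 mat2_mult)
        (simp add: slash_mult det_mat2 mat2_mult)
    also have "dist_of val \<dots> = dist_of val f" by (rule dist_of_scale_nat[OF val f mn(1,3)])
    finally show "dist_of val ?g = dist_of val f" .
  qed
  show "has_coset_values S val (dist_of val)" unfolding has_coset_values_def
  proof (intro ballI impI)
    fix a b assume ab: "a \<in> Z_S S" "b \<in> Z_S S" "\<not> (a \<in> \<int> \<and> b \<in> \<int>)"
    obtain p M where M: "M > 0" "coprime M c" "a = of_int p / of_nat M" using ab(1) by (rule Z_S_cases)
    obtain q M' where M': "M' > 0" "coprime M' c" "b = of_int q / of_nat M'" using ab(2) by (rule Z_S_cases)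
    \<comment> \<open>A common denominator of \<open>a\<close> and \<open>b\<close>; it is at the
      same time a level of their coset function.\<close>
    define N where "N = M * M'"
    define p' where "p' = p * int M'"
    define q' where "q' = q * int M"
    have N: "N > 0" "coprime N c" using M M' by (auto simp: N_def)
    have a: "a = of_int p' / of_nat N" and b: "b = of_int q' / of_nat N"
      using M M' by (auto simp: N_def p'_def q'_def field_simps)
    define i0 where "i0 = nat (p' mod int N)"
    define j0 where "j0 = nat (q' mod int N)"
    have i0: "int i0 = p' mod int N" "i0 < N" and j0: "int j0 = q' mod int N" "j0 < N"
      using N unfolding i0_def j0_def by (simp_all add: nat_less_iff)
    have nat_as_int: "int i mod int N = p' mod int N \<longleftrightarrow> i mod N = i0" for i
      by (metis i0 nat_int of_nat_mod mod_less of_nat_eq_iff)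
    have sh: "of_int p' / of_nat N = (of_nat i0 / of_nat N :: rat) + of_int (p' div int N)"
      "of_int q' / of_nat N = (of_nat j0 / of_nat N :: rat) + of_int (q' div int N)"
    proof -
      have "of_int p' = (of_int (int i0 + int N * (p' div int N)) :: rat)" "of_int q' = (of_int (int j0 + int N * (q' div int N)) :: rat)"
        by (simp_all add: i0 j0)
      then show "of_int p' / of_nat N = (of_nat i0 / of_nat N :: rat) + of_int (p' div int N)"
        "of_int q' / of_nat N = (of_nat j0 / of_nat N :: rat) + of_int (q' div int N)" using N
        by (simp_all add: field_simps)
    qed
    have ni: "nonint a b" using ab by (simp add: nonint_def)
    have ni0: "nonint (of_nat i0 / of_nat N) (of_nat j0 / of_nat N)"
      using nonint_shift[OF ni, of "- (p' div int N)" "- (q' div int N)"] unfolding a b sh by simp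
    have lev: "level S N (coset_fun S a b)" unfolding level_def
    proof (intro conjI allI ballI impI)
      show "coset_fun S a b v = 0" if "v \<notin> VA S" for v using that by (simp add: coset_fun_eq adic_coset_def)
      have 1: "padic_abs l (of_nat N) \<le> padic_abs l 1" "padic_abs l 1 \<le> padic_abs l (1 / of_nat N)" if "l \<in> places S" for l
      proof -
        have p: "prime l" using that by (rule places_prime)
        have "padic_abs l (of_nat N) > 0" using N by (intro padic_abs_pos[OF p]) auto
        then show "padic_abs l (of_nat N) \<le> padic_abs l 1" "padic_abs l 1 \<le> padic_abs l (1 / of_nat N)"
          using padic_abs_of_nat_le_1[OF p, of N] by (simp_all add: padic_abs_1[OF p] padic_abs_divide[OF p])
      qed
      fix v assume v: "v \<in> VA S"
      {
        fix w assume w: "w \<in> VA S" "adele_cong S (of_nat N) v w"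
        have "adele_cong S 1 v w" by (rule adele_cong_mono[OF w(2)]) (rule 1)
        then show "coset_fun S a b v = coset_fun S a b w"
          using adele_cong_trans[of S 1 v w "rat_pt S a b"] adele_cong_trans[of S 1 w v "rat_pt S a b"] v w
            adele_cong_sym[of S 1 v w] by (auto simp: coset_fun_eq adic_coset_def)
      next
        assume "coset_fun S a b v \<noteq> 0"
        then have "adele_cong S 1 v (rat_pt S a b)" by (simp add: coset_fun_eq adic_coset_def split: if_splits)
        then have "adele_cong S (1 / of_nat N) v (rat_pt S a b)" by (rule adele_cong_mono) (rule 1)
        moreover have "adele_cong S (1 / of_nat N) (rat_pt S a b) (rat_pt S 0 0)"
          unfolding adele_cong_rat_pt a b
        proof (intro ballI conjI)
          fix l assume "l \<in> places S"
          then have p: "prime l" by (rule places_prime)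
          show "padic_abs l (of_int p' / of_nat N - 0) \<le> padic_abs l (1 / of_nat N)"
            "padic_abs l (of_int q' / of_nat N - 0) \<le> padic_abs l (1 / of_nat N)"
            using padic_abs_of_int_le_1[OF p, of p'] padic_abs_of_int_le_1[OF p, of q'] p
            by (simp_all add: padic_abs_divide padic_abs_1 divide_right_mono)
        qed
        ultimately show "adele_cong S (1 / of_nat N) v (VA_zero S)"
          using adele_cong_trans v unfolding VA_zero_eq by (meson rat_pt_in_VA)
      }
    qed
    \<comment> \<open>The coset contains (i/N, j/N) exactly when (i, j) is the residue class of (N
      a, N b) modulo \<open>N\<close>; the level sum therefore reduces to the N^2 terms of one
      distribution relation.\<close>
    have res: "coset_fun S a b (rat_pt S (of_nat i / of_nat N) (of_nat j / of_nat N)) =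
       (if i mod N = i0 \<and> j mod N = j0 then 1 else 0)" for i j
    proof -
      have *: "(\<forall>l\<in>places S. padic_abs l (of_nat i / of_nat N - of_int p / of_nat N) \<le> 1) \<longleftrightarrow> int i mod int N = p mod int N"
        for i and p :: int
      proof -
        have "padic_abs l (of_nat i / of_nat N - of_int p / of_nat N) \<le> 1 \<longleftrightarrow>
            padic_abs l (of_int (int i - p)) \<le> padic_abs l (of_nat N)" if "l \<in> places S" for l
        proof -
          have pr: "prime l" using that by (rule places_prime)
          have pos: "padic_abs l (of_nat N) > 0" using N by (intro padic_abs_pos[OF pr]) auto
          have "of_nat i / of_nat N - of_int p / of_nat N = (of_int (int i - p) / of_nat N :: rat)"
            by (simp add: diff_divide_distrib)
          then show ?thesis using pos by (simp only: padic_abs_divide[OF pr] pos_divide_le_eq mult_1)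
        qed
        moreover have "(\<forall>l\<in>places S. padic_abs l (of_int (int i - p)) \<le> padic_abs l (of_nat N)) \<longleftrightarrow> int N dvd int i - p"
        proof
          assume "int N dvd int i - p"
          then obtain k where k: "int i - p = int N * k" by blast
          show "\<forall>l\<in>places S. padic_abs l (of_int (int i - p)) \<le> padic_abs l (of_nat N)"
            unfolding k using padic_abs_of_int_le_1[OF places_prime]
            by (auto simp: padic_abs_mult places_prime mult_left_le)
        qed (use dvd_if_padic_abs_le[OF N(2,1)] in blast)
        ultimately show ?thesis by (simp add: mod_eq_dvd_iff)
      qed
      have nat_as_int': "int j mod int N = q' mod int N \<longleftrightarrow> j mod N = j0" for j
        by (metis j0 nat_int of_nat_mod mod_less of_nat_eq_iff)
      have "adele_cong S 1 (rat_pt S (of_nat i / of_nat N) (of_nat j / of_nat N)) (rat_pt S a b) \<longleftrightarrow>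
        i mod N = i0 \<and> j mod N = j0"
        unfolding adele_cong_rat_pt a b nat_as_int[symmetric] nat_as_int'[symmetric] *[symmetric]
        using places_prime by (auto simp: padic_abs_1)
      then show ?thesis by (simp add: coset_fun_eq adic_coset_def)
    qed
    have NN: "N^2 = N * N" by (simp add: power2_eq_square)
    have md: "(i + N * r) mod N = i0 \<longleftrightarrow> i = i0" "(i + N * r) mod N = j0 \<longleftrightarrow> i = j0" if "i < N" for i r using that by auto
    let ?v = "\<lambda>i j. val (of_nat i / of_nat (N * N)) (of_nat j / of_nat (N * N))"
    have "dist_of val (coset_fun S a b) = level_sum N val (coset_fun S a b)"
      using dist_of_eq[OF val nonint_coset_schwartz'[OF ni] lev N] .
    also have "\<dots> = (\<Sum>i<N. \<Sum>r<N. \<Sum>j<N. \<Sum>s<N. (if i = i0 \<and> j = j0 then 1 else 0) * ?v (i + N * r) (j + N * s))"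
      unfolding level_sum_def res NN sum_blocks
      by (intro sum.cong refl arg_cong2[where f = "(*)"]) (auto simp: md)
    also have "\<dots> = (\<Sum>i<N. \<Sum>r<N. \<Sum>j<N. if j = j0 then (if i = i0 then \<Sum>s<N. ?v (i + N * r) (j + N * s) else 0) else 0)"
      by (intro sum.cong refl) auto
    also have "\<dots> = (\<Sum>i<N. if i = i0 then \<Sum>r<N. \<Sum>s<N. ?v (i + N * r) (j0 + N * s) else 0)"
      using j0(2) by (intro sum.cong refl) auto
    also have "\<dots> = (\<Sum>r<N. \<Sum>s<N. ?v (i0 + N * r) (j0 + N * s))"
      using i0(2) by simp
    also have "\<dots> = (\<Sum>r<N. \<Sum>s<N. val ((of_nat i0 / of_nat N + of_nat r) / of_nat N) ((of_nat j0 / of_nat N + of_nat s) / of_nat N))"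
      using N by (intro sum.cong refl arg_cong2[where f = val]) (auto simp: field_simps)
    also have "\<dots> = val (of_nat i0 / of_nat N) (of_nat j0 / of_nat N)"
      by (rule dist_relD2[OF val ni0 N])
    also have "\<dots> = val a b" unfolding a b sh using dist_relD1[OF val ni0] by simp
    finally show "dist_of val (coset_fun S a b) = val a b" .
  qed
qed

lemma the_dist_eq_dist_of: "dist_rel val \<Longrightarrow> the_dist S val = dist_of val"
  by (rule the_dist_eq) (rule is_dist_dist_of)

text \<open>\<open>K\<close> is prime to \<open>c\<close>, so multiplication by \<open>c\<close>
  permutes the residues modulo \<open>K\<close>.\<close>

lemma dist_rel_mult_c:
  assumes val: "dist_rel val" shows "dist_rel (\<lambda>a b. val (of_nat c * a) (of_nat c * b))"
  unfolding dist_rel_def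
proof (intro allI impI conjI)
  fix a b assume ab: "nonint a b"
  fix m n :: int
  show "val (of_nat c * (a + of_int m)) (of_nat c * (b + of_int n)) = val (of_nat c * a) (of_nat c * b)"
    using dist_relD1[OF val nonint_mult_c[OF ab], of "int c * m" "int c * n"] by (simp add: distrib_left)
next
  fix a b and K :: nat assume ab: "nonint a b" and K: "K > 0" "coprime K c"
  define V where "V = (\<lambda>x y. val ((of_nat c * a + of_int x) / of_nat K) ((of_nat c * b + of_int y) / of_nat K))"
  have per: "V (x + int K * m) (y + int K * n) = V x y" for x y m n
  proof -
    have "(u + of_int (x + int K * m)) / of_nat K = (u + of_int x) / of_nat K + of_int m" for u :: rat and x m
      using K by (simp add: field_simps)
    then show ?thesis unfolding V_def using dist_relD1[OF val nonint_divide[OF nonint_mult_c[OF ab] K]] by simp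
  qed
  have perx: "V (x + int K) y = V x y" and pery: "V x (y + int K) = V x y" for x y
    using per[of x 1 y 0] per[of x 0 y 1] by simp_all
  have cop: "coprime (int c) (int K)" using K by (simp add: coprime_commute)
  have arg: "of_nat c * ((u + of_nat i) / of_nat K) = (of_nat c * u + of_int (int c * int i + 0)) / of_nat K" for u :: rat and i
    by (simp add: algebra_simps)
  have "(\<Sum>i<K. \<Sum>j<K. val (of_nat c * ((a + of_nat i) / of_nat K)) (of_nat c * ((b + of_nat j) / of_nat K))) =
     (\<Sum>i<K. \<Sum>j<K. V (int c * int i + 0) (int c * int j + 0))"
    unfolding arg V_def ..
  also have "\<dots> = (\<Sum>i<K. \<Sum>j<K. V (int c * int i + 0) (int j))"
    by (intro sum.cong refl sum_periodic_reindex[where g = "V x" for x] pery K(1) cop)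
  also have "\<dots> = (\<Sum>i<K. \<Sum>j<K. V (int i) (int j))"
    by (rule sum_periodic_reindex[where g = "\<lambda>x. \<Sum>j<K. V x (int j)"]) (simp only: perx, rule K(1), rule cop)
  also have "\<dots> = val (of_nat c * a) (of_nat c * b)"
    using dist_relD2[OF val nonint_mult_c[OF ab] K] by (simp add: V_def)
  finally show "(\<Sum>i<K. \<Sum>j<K. val (of_nat c * ((a + of_nat i) / of_nat K)) (of_nat c * ((b + of_nat j) / of_nat K))) =
     val (of_nat c * a) (of_nat c * b)" .
qed

lemma dist_rel_cmult: "dist_rel val \<Longrightarrow> dist_rel (\<lambda>a b. x * val a b)"
  unfolding dist_rel_def by (simp flip: sum_distrib_left)

lemma dist_rel_diff: "dist_rel val \<Longrightarrow> dist_rel val' \<Longrightarrow> dist_rel (\<lambda>a b. val a b - val' a b)"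
  unfolding dist_rel_def by (simp add: sum_subtractf)

definition smoothed :: "(rat \<Rightarrow> rat \<Rightarrow> 'a::comm_ring_1) \<Rightarrow> rat \<Rightarrow> rat \<Rightarrow> 'a" where
  "smoothed val a b = of_nat (c^2) * val a b - val (of_nat c * a) (of_nat c * b)"

lemma dist_rel_smoothed: "dist_rel val \<Longrightarrow> dist_rel (smoothed val)"
  unfolding smoothed_def[abs_def] by (intro dist_rel_diff dist_rel_cmult dist_rel_mult_c)

text \<open>\<open>smooth\<close> refers to its argument only through coset values; for
  \<open>the_dist S val\<close> these are \<open>val\<close>, at (a, b) as well as at (ca,
  cb).\<close>

lemma is_dist_smooth:
  assumes val: "dist_rel val" shows "is_dist (smoothed val) (smooth S c (the_dist S val))"
proof -
  have d: "is_dist val (the_dist S val)"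
    unfolding the_dist_eq_dist_of[OF val] by (rule is_dist_dist_of[OF val])
  have "is_dist (\<lambda>a b. of_nat (c^2) * the_dist S val (coset_fun S a b)
     - the_dist S val (coset_fun S (of_nat c * a) (of_nat c * b))) (dist_of (smoothed val))"
    by (rule is_dist_cong[OF is_dist_dist_of[OF dist_rel_smoothed[OF val]]])
       (simp add: smoothed_def is_dist_coset[OF d] nonint_mult_c)
  from the_dist_eq[OF this] show ?thesis
    unfolding smooth_def using is_dist_dist_of[OF dist_rel_smoothed[OF val]] by simp
qed

end

section \<open>The logarithmic series\<close>

lemma ee_add: "ee (z + w) = ee z * ee w"
  by (simp add: ee_def exp_add algebra_simps)

lemma ee_minus: "ee (- z) = inverse (ee z)"
  by (simp add: ee_def exp_minus)

lemma ee_nonzero [simp]: "ee z \<noteq> 0"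
  by (simp add: ee_def)

lemma ee_of_nat_mult: "ee (of_nat n * z) = ee z ^ n"
  unfolding ee_def exp_of_nat_mult[symmetric] by (simp add: mult_ac)

lemma ee_eq_1_iff: "ee z = 1 \<longleftrightarrow> z \<in> \<int>"
proof -
  have "ee z = 1 \<longleftrightarrow> Im z = 0 \<and> (\<exists>n::int. Re z = of_int n)"
    unfolding ee_def exp_eq_1 by (simp add: mult.assoc mult.commute mult.left_commute)
  also have "\<dots> \<longleftrightarrow> (\<exists>n::int. z = of_int n)" by (auto simp: complex_eq_iff)
  finally show ?thesis by (auto simp: Ints_def)
qed

lemma ee_of_int [simp]: "ee (of_int n) = 1"
  by (simp add: ee_eq_1_iff)

lemma ee_of_nat [simp]: "ee (of_nat n) = 1"
  using ee_of_int[of "int n"] by simp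

lemma ee_0 [simp]: "ee 0 = 1"
  by (simp add: ee_def)

lemma norm_ee: "norm (ee z) = exp (- 2 * pi * Im z)"
  by (simp add: ee_def)

lemma norm_ee_le_1: "Im z \<ge> 0 \<Longrightarrow> norm (ee z) \<le> 1"
  by (simp add: norm_ee mult_nonneg_nonneg)

lemma norm_ee_less_1: "Im z > 0 \<Longrightarrow> norm (ee z) < 1"
  by (simp add: norm_ee mult_pos_pos)

lemma Im_pos_notin_Ints: "Im w > 0 \<Longrightarrow> w \<notin> \<int>"
  by (auto elim!: Ints_cases)

lemma holomorphic_ee [holomorphic_intros]: "f holomorphic_on A \<Longrightarrow> (\<lambda>z. ee (f z)) holomorphic_on A"
  unfolding ee_def by (intro holomorphic_intros)

lemma continuous_on_ee [continuous_intros]: "continuous_on A f \<Longrightarrow> continuous_on A (\<lambda>z. ee (f z))"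
  unfolding ee_def by (intro continuous_intros)

lemma Re_less_1:
  assumes "norm x \<le> 1" "x \<noteq> 1" shows "Re x < 1"
proof (rule ccontr)
  assume "\<not> Re x < 1"
  moreover have "Re x \<le> 1" using complex_Re_le_cmod[of x] assms(1) by linarith
  ultimately have "Re x = 1" by simp
  moreover have "(Re x)^2 + (Im x)^2 \<le> 1"
    using assms(1) by (simp add: cmod_def)
  ultimately have "Im x = 0" by simp
  then show False using \<open>Re x = 1\<close> assms(2) by (simp add: complex_eq_iff)
qed

text \<open>The remainder of the logarithmic series after \<open>N\<close> terms is the integral of \<open>x (t x)\<^sup>N / (1 - t x)\<close>
  over \<open>0 \<le> t \<le> 1\<close>, which tends to \<open>0\<close> also on the unit circle.\<close>

lemma Ln_1_minus_sums:
  assumes "norm x \<le> 1" "x \<noteq> 1"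
  shows "(\<lambda>n. x ^ Suc n / of_nat (Suc n)) sums (- Ln (1 - x))"
proof -
  \<comment> \<open>A lower bound for the real part of 1 - t x on [0, 1]: it is affine in t, so its
    minimum is attained at an endpoint.\<close>
  define d where "d = min 1 (1 - Re x)"
  have d: "d > 0" using Re_less_1[OF assms] by (simp add: d_def)
  have Re_ge: "Re (1 - of_real t * x) \<ge> d" if "t \<in> {0..1}" for t
  proof (cases "Re x \<ge> 0")
    case True
    then have "t * Re x \<le> Re x" using that by (simp add: mult_left_le_one_le)
    then show ?thesis by (simp add: d_def)
  next
    case False
    then have "t * Re x \<le> 0" using that by (simp add: mult_nonneg_nonpos)
    then show ?thesis by (simp add: d_def)
  qed
  have bound: "norm (- Ln (1 - x) - (\<Sum>n<N. x ^ Suc n / of_nat (Suc n))) \<le> 1 / d / real (Suc N)" for N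
  proof -
    define F where "F = (\<lambda>w. - Ln (1 - w * x) - (\<Sum>n<N. (w * x) ^ Suc n / of_nat (Suc n)))"
    define F' where "F' = (\<lambda>w. x * (w * x) ^ N / (1 - w * x))"
    have D: "(F has_field_derivative F' (of_real t)) (at (of_real t))" if "t \<in> {0..1}" for t
    proof -
      have nz: "1 - of_real t * x \<noteq> 0" using Re_ge[OF that] d by (metis not_less zero_complex.simps(1))
      have np: "1 - of_real t * x \<notin> \<real>\<^sub>\<le>\<^sub>0" using Re_ge[OF that] d by (auto simp: complex_nonpos_Reals_iff)
      have "(F has_field_derivative (x / (1 - of_real t * x) - (\<Sum>n<N. x * (of_real t * x) ^ n))) (at (of_real t))"
        unfolding F_def
      proof (rule DERIV_diff)
        show "((\<lambda>w. - Ln (1 - w * x)) has_field_derivative x / (1 - of_real t * x)) (at (of_real t))"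
          using np nz by (auto intro!: derivative_eq_intros simp: divide_inverse mult.commute)
        have "((\<lambda>w. (w * x) ^ Suc n / of_nat (Suc n)) has_field_derivative
            of_nat (Suc n) * (x * (of_real t * x) ^ n) / of_nat (Suc n)) (at (of_real t))" for n
          by (rule DERIV_cdivide) (auto intro!: derivative_eq_intros simp del: power_Suc of_nat_Suc)
        then show "((\<lambda>w. \<Sum>n<N. (w * x) ^ Suc n / of_nat (Suc n)) has_field_derivative
           (\<Sum>n<N. x * (of_real t * x) ^ n)) (at (of_real t))"
          by (intro DERIV_sum) (simp del: of_nat_Suc power_Suc)
      qed
      also have "(\<Sum>n<N. x * (of_real t * x) ^ n) = x * (1 - (of_real t * x) ^ N) / (1 - of_real t * x)"
        using nz by (simp add: sum_distrib_left[symmetric] sum_gp_strict)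
      also have "x / (1 - of_real t * x) - x * (1 - (of_real t * x) ^ N) / (1 - of_real t * x) = F' (of_real t)"
        unfolding F'_def diff_divide_distrib[symmetric] by (simp add: algebra_simps)
      finally show ?thesis .
    qed
    have "((\<lambda>t. F' (of_real t)) has_integral F (of_real 1) - F (of_real 0)) {0..1}"
      by (rule fundamental_theorem_of_calculus) (auto intro!: has_vector_derivative_real_field D)
    moreover have "F (of_real 0) = 0" by (simp add: F_def)
    ultimately have FI: "((\<lambda>t. F' (of_real t)) has_integral F 1) {0..1}" by simp
    have "((\<lambda>t. t ^ N / d) has_integral 1 ^ Suc N / real (Suc N) / d - 0 ^ Suc N / real (Suc N) / d) {0..1}"
    proof (rule fundamental_theorem_of_calculus)
      fix t :: real assume "t \<in> {0..1}"
      have "((\<lambda>t. t ^ Suc N / real (Suc N) / d) has_real_derivative (t ^ N / d)) (at t within {0..1})"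
        using d by (auto intro!: derivative_eq_intros simp: field_simps simp del: power_Suc of_nat_Suc)
      then show "((\<lambda>t. t ^ Suc N / real (Suc N) / d) has_vector_derivative (t ^ N / d)) (at t within {0..1})"
        by (simp add: has_real_derivative_iff_has_vector_derivative)
    qed simp
    then have gI: "((\<lambda>t. t ^ N / d) has_integral 1 / d / real (Suc N)) {0..1}" by (simp add: mult.commute)
    have "norm (integral {0..1} (\<lambda>t. F' (of_real t))) \<le> integral {0..1} (\<lambda>t. t ^ N / d)"
    proof (rule integral_norm_bound_integral)
      fix t :: real assume t: "t \<in> {0..1}"
      have "norm (1 - of_real t * x) \<ge> d" using Re_ge[OF t] complex_Re_le_cmod order_trans by blast
      moreover have "norm x * (t * norm x) ^ N \<le> 1 * (t * 1) ^ N"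
        using assms(1) t by (intro mult_mono power_mono) (auto simp: mult_left_le)
      ultimately show "norm (F' (of_real t)) \<le> t ^ N / d"
        using d t unfolding F'_def norm_divide norm_mult norm_power norm_of_real
        by (intro frac_le) auto
    qed (use FI gI in blast)+
    then have "norm (F 1) \<le> 1 / d / real (Suc N)"
      using integral_unique[OF FI] integral_unique[OF gI] by simp
    then show ?thesis by (simp add: F_def)
  qed
  have "(\<lambda>N. - Ln (1 - x) - (\<Sum>n<N. x ^ Suc n / of_nat (Suc n))) \<longlonglongrightarrow> 0"
  proof (rule Lim_null_comparison)
    show "\<forall>\<^sub>F N in sequentially. norm (- Ln (1 - x) - (\<Sum>n<N. x ^ Suc n / of_nat (Suc n))) \<le> 1 / d / real (Suc N)"
      using bound by simp
    show "(\<lambda>N. 1 / d / real (Suc N)) \<longlonglongrightarrow> 0"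
      using LIMSEQ_Suc[OF lim_const_over_n[of "1 / d"]] by simp
  qed
  from tendsto_diff[OF tendsto_const[of "- Ln (1 - x)"] this] show ?thesis by (simp add: sums_def)
qed

text \<open>The case needed is that of the unit circle, since Clog is evaluated at roots of unity
  other than 1.\<close>

lemma log_one_minus_eq: "norm x \<le> 1 \<Longrightarrow> x \<noteq> 1 \<Longrightarrow> log_one_minus x = Ln (1 - x)"
  unfolding log_one_minus_def using sums_unique[OF Ln_1_minus_sums[of x]] by (metis minus_minus)

lemma sum_roots_of_unity:
  assumes "K > 0" shows "(\<Sum>j<K. ee (of_nat (n * j) / of_nat K)) = (if K dvd n then of_nat K else 0)"
proof -
  define z where "z = ee (of_nat n / of_nat K)"
  have "ee (of_nat (n * j) / of_nat K) = z ^ j" for j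
    unfolding z_def ee_of_nat_mult[symmetric] by (simp add: mult.commute)
  then have eq: "(\<Sum>j<K. ee (of_nat (n * j) / of_nat K)) = (\<Sum>j<K. z ^ j)" by simp
  have zK: "z ^ K = 1"
    unfolding z_def ee_of_nat_mult[symmetric] using assms ee_of_int[of "int n"] by simp
  have "z = 1 \<longleftrightarrow> K dvd n"
  proof
    assume "z = 1"
    then obtain k :: int where k: "(of_nat n / of_nat K :: complex) = of_int k"
      by (auto simp: z_def ee_eq_1_iff elim: Ints_cases)
    then have "(of_int (int n) :: complex) = of_int (k * int K)" using assms by (simp add: field_simps)
    then have "int n = k * int K" by (simp only: of_int_eq_iff)
    then have "int K dvd int n" by simp
    then show "K dvd n" by simp
  next
    assume "K dvd n"
    then obtain k where "n = K * k" by blast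
    then have "(of_nat n / of_nat K :: complex) = of_int (int k)" using assms by simp
    then show "z = 1" using ee_of_int[of "int k"] unfolding z_def by simp
  qed
  then show ?thesis unfolding eq using zK by (auto simp: sum_gp_strict)
qed

lemma sums_multiples:
  fixes f :: "nat \<Rightarrow> 'a::{comm_monoid_add, t2_space}"
  assumes "K > 0" "(\<lambda>n. if K dvd Suc n then f (Suc n div K) else 0) sums s"
  shows "(\<lambda>m. f (Suc m)) sums s"
proof -
  let ?g = "\<lambda>m. K * Suc m - 1"
  have S: "Suc (?g m) = K * Suc m" for m using assms(1) by simp
  have "strict_mono ?g"
  proof (rule strict_monoI)
    fix m n :: nat assume "m < n"
    then have "K * Suc m < K * Suc n" using assms(1) by simp
    then show "?g m < ?g n" using S[of m] S[of n] by linarith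
  qed
  moreover have "(if K dvd Suc n then f (Suc n div K) else 0) = 0" if "n \<notin> range ?g" for n
  proof -
    have "\<not> K dvd Suc n"
    proof
      assume "K dvd Suc n"
      then obtain k where k: "Suc n = K * k" by blast
      then obtain m where "k = Suc m" by (cases k) auto
      then have "n = ?g m" using k by simp
      then show False using that by blast
    qed
    then show ?thesis by simp
  qed
  ultimately have "(\<lambda>m. if K dvd Suc (?g m) then f (Suc (?g m) div K) else 0) sums s"
    using assms(2) by (subst sums_mono_reindex)
  then show ?thesis unfolding S using assms(1) by simp
qed

text \<open>The product formula for 1 - x^K over the K-th roots, without ambiguity of branch: in the
  power series of the left side the roots of unity cancel all exponents not divisible by
  \<open>K\<close>, and the others give the series on the right.\<close>

lemma Ln_1_minus_ee_mult:
  assumes K: "K > 0" and w: "Im w \<ge> 0" "w \<notin> \<int>"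
  shows "(\<Sum>j<K. Ln (1 - ee ((w + of_nat j) / of_nat K))) = Ln (1 - ee w)"
proof -
  define x where "x = (\<lambda>j. ee ((w + of_nat j) / of_nat K))"
  have xK: "x j ^ K = ee w" for j
    unfolding x_def ee_of_nat_mult[symmetric] using K ee_add[of w "of_int (int j)"] by simp
  have x1: "x j \<noteq> 1" for j using xK[of j] w(2) by (auto simp: ee_eq_1_iff)
  have xn: "norm (x j) \<le> 1" for j unfolding x_def using w(1) by (intro norm_ee_le_1) (simp add: Im_divide_of_nat)
  have "(\<lambda>n. \<Sum>j<K. x j ^ Suc n / of_nat (Suc n)) sums (\<Sum>j<K. - Ln (1 - x j))"
    by (intro sums_sum Ln_1_minus_sums xn x1)
  moreover have "(\<Sum>j<K. x j ^ Suc n / of_nat (Suc n)) =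
      (if K dvd Suc n then ee w ^ (Suc n div K) / of_nat (Suc n div K) else 0)" for n
  proof -
    have "x j ^ Suc n = ee (of_nat (Suc n) * w / of_nat K) * ee (of_nat (Suc n * j) / of_nat K)" for j
      unfolding x_def ee_of_nat_mult[symmetric] ee_add[symmetric] by (simp add: add_divide_distrib algebra_simps)
    then have "(\<Sum>j<K. x j ^ Suc n / of_nat (Suc n)) =
      ee (of_nat (Suc n) * w / of_nat K) / of_nat (Suc n) * (\<Sum>j<K. ee (of_nat (Suc n * j) / of_nat K))"
      by (simp add: sum_distrib_left)
    also have "\<dots> = (if K dvd Suc n then ee w ^ (Suc n div K) / of_nat (Suc n div K) else 0)"
    proof (cases "K dvd Suc n")
      case True
      then obtain k where k: "Suc n = K * k" by blast
      have "k > 0" using k by (cases k) auto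
      then show ?thesis using K True unfolding sum_roots_of_unity[OF K] k
        by (simp add: ee_of_nat_mult)
    next
      case False then show ?thesis unfolding sum_roots_of_unity[OF K] by simp
    qed
    finally show ?thesis .
  qed
  ultimately have "(\<lambda>n. if K dvd Suc n then ee w ^ (Suc n div K) / of_nat (Suc n div K) else 0)
      sums (\<Sum>j<K. - Ln (1 - x j))" by simp
  then have "(\<lambda>m. ee w ^ Suc m / of_nat (Suc m)) sums (\<Sum>j<K. - Ln (1 - x j))"
    by (rule sums_multiples[OF K, of "\<lambda>k. ee w ^ k / of_nat k"])
  moreover have "(\<lambda>m. ee w ^ Suc m / of_nat (Suc m)) sums (- Ln (1 - ee w))"
    using w by (intro Ln_1_minus_sums norm_ee_le_1) (auto simp: ee_eq_1_iff)
  ultimately have "(\<Sum>j<K. - Ln (1 - x j)) = - Ln (1 - ee w)" by (rule sums_unique2)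
  then show ?thesis by (simp add: x_def sum_negf)
qed

section \<open>Logarithms of partial theta products\<close>

text \<open>Expand the logarithms of 1 - e((x + n) z + b) and sum the geometric series over n; index
  m stands for the exponent m + 1.\<close>

definition theta_term :: "real \<Rightarrow> real \<Rightarrow> complex \<Rightarrow> nat \<Rightarrow> complex" where
  "theta_term x b z m = ee (of_real x * z + of_real b) ^ Suc m / (of_nat (Suc m) * (1 - ee z ^ Suc m))"

text \<open>The Lambert series of \<open>\<Sum>\<^sub>n log (1 - e((x + n) z + b))\<close>, for \<open>x > 0\<close>.\<close>

definition log_theta :: "real \<Rightarrow> real \<Rightarrow> complex \<Rightarrow> complex" where
  "log_theta x b z = - (\<Sum>m. theta_term x b z m)"

lemma norm_1_minus_ee_power: "Im z > 0 \<Longrightarrow> norm (1 - ee z ^ Suc m) \<ge> 1 - norm (ee z)"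
proof -
  assume z: "Im z > 0"
  have "norm (ee z) ^ Suc m \<le> norm (ee z)"
    using norm_ee_less_1[OF z] by (simp add: mult_left_le power_le_one)
  then show ?thesis using norm_triangle_ineq2[of 1 "ee z ^ Suc m"] by (simp add: norm_power del: power_Suc)
qed

lemma norm_theta_term:
  assumes z: "Im z > 0"
  shows "norm (theta_term x b z m) \<le> norm (ee (of_real x * z)) ^ Suc m / (1 - norm (ee z))"
proof -
  have "1 * (1 - norm (ee z)) \<le> real (Suc m) * norm (1 - ee z ^ Suc m)"
    using norm_1_minus_ee_power[OF z, of m] norm_ee_less_1[OF z] by (intro mult_mono) auto
  moreover have "norm (ee (of_real b)) = 1" by (simp add: norm_ee)
  ultimately show ?thesis
    unfolding theta_term_def norm_divide norm_mult norm_power ee_add norm_of_nat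
    using norm_ee_less_1[OF z] by (intro frac_le) auto
qed

lemma theta_term_summable:
  assumes z: "Im z > 0" and x: "x > 0"
  shows "summable (theta_term x b z)"
proof (rule summable_comparison_test')
  show "norm (theta_term x b z m) \<le> norm (ee (of_real x * z)) ^ Suc m / (1 - norm (ee z))" if "m \<ge> 0" for m
    using norm_theta_term[OF z] .
  have "norm (ee (of_real x * z)) < 1" using z x by (intro norm_ee_less_1) simp
  then show "summable (\<lambda>m. norm (ee (of_real x * z)) ^ Suc m / (1 - norm (ee z)))"
    by (intro summable_divide summable_Suc_iff[THEN iffD2] summable_geometric) simp
qed

lemma theta_term_sums: "Im z > 0 \<Longrightarrow> x > 0 \<Longrightarrow> theta_term x b z sums (- log_theta x b z)"
  using theta_term_summable[of z x b] by (simp add: log_theta_def summable_sums)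

lemma norm_log_theta:
  assumes z: "Im z > 0" and x: "x > 0"
  shows "norm (log_theta x b z) \<le>
    norm (ee (of_real x * z)) / (1 - norm (ee (of_real x * z))) / (1 - norm (ee z))"
proof -
  let ?p = "norm (ee (of_real x * z))"
  have p: "?p < 1" using z x by (intro norm_ee_less_1) simp
  have "(\<lambda>m. ?p * ?p ^ m) sums (?p * (1 / (1 - ?p)))"
    using p by (intro sums_mult geometric_sums) simp
  then have "(\<lambda>m. ?p ^ Suc m / (1 - norm (ee z))) sums (?p / (1 - ?p) / (1 - norm (ee z)))"
    by (intro sums_divide) simp
  then have s: "summable (\<lambda>m. ?p ^ Suc m / (1 - norm (ee z)))"
    "(\<Sum>m. ?p ^ Suc m / (1 - norm (ee z))) = ?p / (1 - ?p) / (1 - norm (ee z))" unfolding sums_iff by auto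
  have "norm (\<Sum>m. theta_term x b z m) \<le> ?p / (1 - ?p) / (1 - norm (ee z))"
    unfolding s(2)[symmetric] by (rule norm_suminf_le[OF norm_theta_term[OF z] s(1)])
  then show ?thesis by (simp add: log_theta_def)
qed

text \<open>The normalisation at the cusp: it singles out this logarithm as the integral of dlog
  starting at infinity.\<close>

lemma log_theta_tendsto_0:
  assumes x: "x > 0"
  shows "((\<lambda>Y. log_theta x b (Complex t Y)) \<longlongrightarrow> 0) at_top"
proof (rule Lim_null_comparison)
  let ?B = "\<lambda>Y. exp (- 2 * pi * (x * Y)) / (1 - exp (- 2 * pi * (x * Y))) / (1 - exp (- 2 * pi * Y))"
  show "\<forall>\<^sub>F Y in at_top. norm (log_theta x b (Complex t Y)) \<le> ?B Y"
    using eventually_gt_at_top[of 0]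
  proof eventually_elim
    case (elim Y)
    then show ?case using norm_log_theta[of "Complex t Y" x b] x by (simp add: norm_ee)
  qed
  have *: "((\<lambda>Y. exp (- 2 * pi * (x * Y))) \<longlongrightarrow> 0) at_top" if "x > 0" for x
  proof -
    have "filterlim (\<lambda>Y. (2 * pi * x) * Y) at_top at_top"
      using that by (intro filterlim_tendsto_pos_mult_at_top[OF tendsto_const] filterlim_ident) simp
    then have "filterlim (\<lambda>Y. - (2 * pi * x * Y)) at_bot at_top"
      by (simp add: filterlim_uminus_at_top)
    from filterlim_compose[OF exp_at_bot this] show ?thesis by (simp add: mult.assoc)
  qed
  have "(?B \<longlongrightarrow> 0 / (1 - 0) / (1 - 0)) at_top"
    using *[OF x] *[of 1] by (intro tendsto_divide tendsto_diff tendsto_const) auto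
  then show "(?B \<longlongrightarrow> 0) at_top" by simp
qed

lemma log_theta_holomorphic:
  assumes x: "x > 0" shows "(\<lambda>z. log_theta x b z) holomorphic_on {z. Im z > 0}"
proof -
  have "(\<lambda>z. \<Sum>m. theta_term x b z m) holomorphic_on {z. Im z > 0}"
  proof (rule holomorphic_uniform_sequence[where f = "\<lambda>n z. \<Sum>m<n. theta_term x b z m"])
    show "open {z. Im z > 0}" by (rule open_halfspace_Im_gt)
    fix n
    have "1 - ee z ^ Suc m \<noteq> 0" if "Im z > 0" for z m
      using norm_1_minus_ee_power[OF that, of m] norm_ee_less_1[OF that] by auto
    then show "(\<lambda>z. \<Sum>m<n. theta_term x b z m) holomorphic_on {z. Im z > 0}"
      unfolding theta_term_def by (intro holomorphic_intros) (auto simp del: power_Suc of_nat_Suc)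
  next
    fix z0 :: complex assume z0: "z0 \<in> {z. Im z > 0}"
    \<comment> \<open>On the closed disc of half the height all points have height at least
      \<open>e\<close>, which gives a summable bound for the terms.\<close>
    define e where "e = Im z0 / 2"
    have e: "e > 0" using z0 by (simp add: e_def)
    have Im_ge: "Im z \<ge> e" if "z \<in> cball z0 e" for z
    proof -
      have "\<bar>Im (z0 - z)\<bar> \<le> e" using that abs_Im_le_cmod[of "z0 - z"] by (simp add: dist_norm)
      then have "Im (z0 - z) \<le> Im z0 / 2" unfolding e_def using abs_ge_self order_trans by blast
      then have "Im z0 - Im z \<le> Im z0 / 2" by simp
      then show ?thesis unfolding e_def by linarith
    qed
    let ?r = "exp (- 2 * pi * e)" and ?p = "exp (- 2 * pi * (x * e))"
    have r: "?r < 1" "?p < 1" using e x by (auto simp: mult_pos_pos)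
    have "uniform_limit (cball z0 e) (\<lambda>n z. \<Sum>m<n. theta_term x b z m) (\<lambda>z. \<Sum>m. theta_term x b z m) sequentially"
    proof (rule Weierstrass_m_test)
      fix m z assume z: "z \<in> cball z0 e"
      have zpos: "Im z > 0" using Im_ge[OF z] e by simp
      have "norm (ee z) \<le> ?r" "norm (ee (of_real x * z)) \<le> ?p"
        using Im_ge[OF z] x by (simp_all add: norm_ee)
      then have "norm (ee (of_real x * z)) ^ Suc m / (1 - norm (ee z)) \<le> ?p ^ Suc m / (1 - ?r)"
        using r by (intro frac_le power_mono) auto
      then show "norm (theta_term x b z m) \<le> ?p ^ Suc m / (1 - ?r)"
        using norm_theta_term[OF zpos, of x b m] by linarith
    next
      show "summable (\<lambda>m. ?p ^ Suc m / (1 - ?r))"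
        using r by (intro summable_divide summable_Suc_iff[THEN iffD2] summable_geometric) simp
    qed
    then show "\<exists>d. 0 < d \<and> cball z0 d \<subseteq> {z. Im z > 0} \<and>
       uniform_limit (cball z0 d) (\<lambda>n z. \<Sum>m<n. theta_term x b z m) (\<lambda>z. \<Sum>m. theta_term x b z m) sequentially"
      using e Im_ge by (intro exI[of _ e]) force
  qed
  then show ?thesis unfolding log_theta_def by (intro holomorphic_intros)
qed

text \<open>Joint continuity in the parameters at fixed z, for the passage to integral a or b in the
  inversion formula.\<close>

lemma log_theta_continuous:
  assumes z: "Im z > 0"
  shows "continuous_on {p. fst p > 0} (\<lambda>p. log_theta (fst p) (snd p) z)"
proof -
  have "continuous_on {p. fst p > e} (\<lambda>p. \<Sum>m. theta_term (fst p) (snd p) z m)" if e: "e > 0" for e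
  proof (rule uniform_limit_theorem)
    have "1 - ee z ^ Suc m \<noteq> 0" for m
      using norm_1_minus_ee_power[OF z, of m] norm_ee_less_1[OF z] by auto
    then show "\<forall>\<^sub>F n in sequentially. continuous_on {p. fst p > e} (\<lambda>p. \<Sum>m<n. theta_term (fst p) (snd p) z m)"
      unfolding theta_term_def by (intro always_eventually allI continuous_intros) (auto simp del: power_Suc of_nat_Suc)
    let ?p = "exp (- 2 * pi * (e * Im z))"
    have p: "?p < 1" using e z by (auto simp: mult_pos_pos)
    show "uniform_limit {p. fst p > e} (\<lambda>n p. \<Sum>m<n. theta_term (fst p) (snd p) z m)
       (\<lambda>p. \<Sum>m. theta_term (fst p) (snd p) z m) sequentially"
    proof (rule Weierstrass_m_test)
      fix m and q :: "real \<times> real" assume q: "q \<in> {p. fst p > e}"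
      have "norm (ee (of_real (fst q) * z)) \<le> ?p" using q z by (simp add: norm_ee)
      then have "norm (ee (of_real (fst q) * z)) ^ Suc m / (1 - norm (ee z)) \<le> ?p ^ Suc m / (1 - norm (ee z))"
        using norm_ee_less_1[OF z] by (intro divide_right_mono power_mono) auto
      then show "norm (theta_term (fst q) (snd q) z m) \<le> ?p ^ Suc m / (1 - norm (ee z))"
        using norm_theta_term[OF z, of "fst q" "snd q" m] by linarith
    next
      show "summable (\<lambda>m. ?p ^ Suc m / (1 - norm (ee z)))"
        using p by (intro summable_divide summable_Suc_iff[THEN iffD2] summable_geometric) simp
    qed
  qed simp
  then have "isCont (\<lambda>p. \<Sum>m. theta_term (fst p) (snd p) z m) q" if "fst q > 0" for q :: "real \<times> real"
  proof -
    have "open {p :: real \<times> real. fst p > fst q / 2}"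
      by (intro open_Collect_less continuous_intros)
    moreover have "continuous_on {p. fst p > fst q / 2} (\<lambda>p. \<Sum>m. theta_term (fst p) (snd p) z m)"
      using \<open>\<And>e. e > 0 \<Longrightarrow> continuous_on {p. fst p > e} _\<close>[of "fst q / 2"] that by simp
    ultimately show ?thesis using that by (simp add: continuous_on_eq_continuous_at del: split_paired_All)
  qed
  then show ?thesis unfolding log_theta_def
    by (intro continuous_intros continuous_at_imp_continuous_on) auto
qed

lemma theta_term_shift:
  assumes z: "Im z > 0"
  shows "theta_term x b z m = ee (of_real x * z + of_real b) ^ Suc m / of_nat (Suc m) + theta_term (x + 1) b z m"
proof -
  have nz: "1 - ee z ^ Suc m \<noteq> 0"
    using norm_1_minus_ee_power[OF z, of m] norm_ee_less_1[OF z] by auto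
  have "ee (of_real (x + 1) * z + of_real b) = ee (of_real x * z + of_real b) * ee z"
    unfolding ee_add[symmetric] by (simp add: algebra_simps)
  then show ?thesis unfolding theta_term_def using nz
    by (simp add: power_mult_distrib field_simps del: power_Suc of_nat_Suc)
qed

lemma log_theta_shift:
  assumes z: "Im z > 0" and x: "x > 0"
  shows "log_theta x b z = Ln (1 - ee (of_real x * z + of_real b)) + log_theta (x + 1) b z"
proof -
  let ?p = "ee (of_real x * z + of_real b)"
  have "norm ?p < 1" using z x by (intro norm_ee_less_1) simp
  then have "(\<lambda>m. ?p ^ Suc m / of_nat (Suc m)) sums (- Ln (1 - ?p))"
    by (intro Ln_1_minus_sums) auto
  from sums_add[OF this theta_term_sums[OF z, of "x + 1" b]] x
  have "theta_term x b z sums (- Ln (1 - ?p) - log_theta (x + 1) b z)"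
    unfolding theta_term_shift[OF z, of x b, abs_def] by simp
  from sums_unique2[OF theta_term_sums[OF z x] this] show ?thesis by (simp add: algebra_simps)
qed

text \<open>The partial sums telescope by \<open>log_theta_shift\<close>, so no double series has to
  be rearranged; the remainder is a Lambert series with large first parameter and tends to
  0.\<close>

lemma log_theta_sums:
  assumes z: "Im z > 0" and x: "x > 0"
  shows "(\<lambda>n. Ln (1 - ee (of_real (x + real n) * z + of_real b))) sums log_theta x b z"
proof -
  have part: "(\<Sum>n<N. Ln (1 - ee (of_real (x + real n) * z + of_real b))) = log_theta x b z - log_theta (x + real N) b z" for N
  proof (induction N)
    case (Suc N)
    then show ?case using log_theta_shift[OF z, of "x + real N" b] x by (simp add: algebra_simps)
  qed simp
  have "(\<lambda>N. log_theta (x + real N) b z) \<longlonglongrightarrow> 0"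
  proof (rule Lim_null_comparison)
    let ?B = "\<lambda>N. norm (ee (of_real x * z)) * norm (ee z) ^ N / (1 - norm (ee (of_real x * z))) / (1 - norm (ee z))"
    have p: "norm (ee (of_real x * z)) < 1" using z x by (intro norm_ee_less_1) simp
    show "\<forall>\<^sub>F N in sequentially. norm (log_theta (x + real N) b z) \<le> ?B N"
    proof (intro always_eventually allI)
      fix N
      have eq: "norm (ee (of_real (x + real N) * z)) = norm (ee (of_real x * z)) * norm (ee z) ^ N"
        unfolding norm_power[symmetric] norm_mult[symmetric] ee_of_nat_mult[symmetric] ee_add[symmetric]
        by (simp add: algebra_simps)
      have "norm (ee (of_real (x + real N) * z)) \<le> norm (ee (of_real x * z))"
        unfolding eq using norm_ee_less_1[OF z] by (simp add: mult_left_le power_le_one)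
      then have "norm (ee (of_real (x + real N) * z)) / (1 - norm (ee (of_real (x + real N) * z))) / (1 - norm (ee z)) \<le>
         norm (ee (of_real (x + real N) * z)) / (1 - norm (ee (of_real x * z))) / (1 - norm (ee z))"
        using p norm_ee_less_1[OF z] by (intro divide_right_mono frac_le) auto
      then show "norm (log_theta (x + real N) b z) \<le> ?B N"
        using norm_log_theta[OF z, of "x + real N" b] x unfolding eq by linarith
    qed
    have "?B \<longlonglongrightarrow> norm (ee (of_real x * z)) * 0 / (1 - norm (ee (of_real x * z))) / (1 - norm (ee z))"
      using p norm_ee_less_1[OF z] by (intro tendsto_intros LIMSEQ_power_zero) auto
    then show "?B \<longlonglongrightarrow> 0" by simp
  qed
  from tendsto_diff[OF tendsto_const[of "log_theta x b z"] this]
  show ?thesis unfolding sums_def part by simp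
qed

lemma log_theta_periodic: "log_theta x (b + of_int n) z = log_theta x b z"
proof -
  have "ee (of_real x * z + of_real (b + of_int n)) = ee (of_real x * z + of_real b)"
    using ee_add[of "of_real x * z + of_real b" "of_int n"] by (simp add: add.assoc)
  then show ?thesis by (simp add: log_theta_def theta_term_def)
qed

text \<open>The relation in \<open>b\<close> alone, which needs z divided by \<open>K\<close>,
  serves the matrices diag(K, 1); the relation in both parameters is the distribution relation. Both
  apply \<open>Ln_1_minus_ee_mult\<close> termwise.\<close>

lemma log_theta_mult:
  assumes z: "Im z > 0" and x: "x > 0" and K: "K > 0"
  shows "(\<Sum>j<K. log_theta x ((b + real j) / real K) (z / of_nat K)) = log_theta x b z"
    and "(\<Sum>i<K. \<Sum>j<K. log_theta ((x + real i) / real K) ((b + real j) / real K) z) = log_theta x b z"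
proof -
  show "(\<Sum>j<K. log_theta x ((b + real j) / real K) (z / of_nat K)) = log_theta x b z"
  proof -
    have zK: "Im (z / of_nat K) > 0" using z K by (simp add: Im_divide_of_nat)
    have "(\<lambda>n. \<Sum>j<K. Ln (1 - ee (of_real (x + real n) * (z / of_nat K) + of_real ((b + real j) / real K)))) sums
       (\<Sum>j<K. log_theta x ((b + real j) / real K) (z / of_nat K))"
      by (intro sums_sum log_theta_sums zK x)
    moreover have "(\<Sum>j<K. Ln (1 - ee (of_real (x + real n) * (z / of_nat K) + of_real ((b + real j) / real K)))) =
       Ln (1 - ee (of_real (x + real n) * z + of_real b))" for n
    proof -
      let ?w = "of_real (x + real n) * z + of_real b"
      have "Im ?w > 0" using z x by simp
      then have "Im ?w \<ge> 0" "?w \<notin> \<int>" using Im_pos_notin_Ints by (simp, blast)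
      from Ln_1_minus_ee_mult[OF K this] show ?thesis
        by (simp add: add_divide_distrib add.assoc)
    qed
    ultimately show ?thesis using sums_unique2[OF _ log_theta_sums[OF z x]] by simp
  qed
  \<comment> \<open>Blocks of length \<open>K\<close>: the terms of index n K + i with i fixed make
    up, after division by \<open>K\<close>, the series with parameter (x + i) / K.\<close>
  have "(\<lambda>n. \<Sum>m = n * K..<n * K + K. Ln (1 - ee (of_real (x + real m) * z + of_real b))) sums log_theta x b z"
    by (rule sums_group[OF log_theta_sums[OF z x] K])
  moreover have "(\<Sum>m = n * K..<n * K + K. Ln (1 - ee (of_real (x + real m) * z + of_real b))) =
     (\<Sum>i<K. \<Sum>j<K. Ln (1 - ee (of_real ((x + real i) / real K + real n) * z + of_real ((b + real j) / real K))))" for n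
  proof -
    have "(\<Sum>m = n * K..<n * K + K. Ln (1 - ee (of_real (x + real m) * z + of_real b))) =
       (\<Sum>i<K. Ln (1 - ee (of_real (x + real (i + n * K)) * z + of_real b)))"
      using sum.shift_bounds_nat_ivl[of "\<lambda>m. Ln (1 - ee (of_real (x + real m) * z + of_real b))" 0 "n * K" K]
      by (simp add: atLeast0LessThan add.commute)
    also have "\<dots> = (\<Sum>i<K. \<Sum>j<K. Ln (1 - ee (of_real ((x + real i) / real K + real n) * z + of_real ((b + real j) / real K))))"
    proof (rule sum.cong[OF refl])
      fix i
      let ?w = "of_real (x + real (i + n * K)) * z + of_real b"
      have "Im ?w > 0" using z x by (simp add: add_pos_nonneg)
      then have "Im ?w \<ge> 0" "?w \<notin> \<int>" using Im_pos_notin_Ints by (simp, blast)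
      note mult = Ln_1_minus_ee_mult[OF K this]
      have "of_real ((x + real i) / real K + real n) * z + of_real ((b + real j) / real K) = (?w + of_nat j) / of_nat K" for j
        using K by (simp add: divide_simps)
      then show "Ln (1 - ee ?w) = (\<Sum>j<K. Ln (1 - ee (of_real ((x + real i) / real K + real n) * z + of_real ((b + real j) / real K))))"
        using mult by simp
    qed
    finally show ?thesis .
  qed
  ultimately have "(\<lambda>n. \<Sum>i<K. \<Sum>j<K. Ln (1 - ee (of_real ((x + real i) / real K + real n) * z + of_real ((b + real j) / real K))))
     sums log_theta x b z" by simp
  moreover have "(\<lambda>n. \<Sum>i<K. \<Sum>j<K. Ln (1 - ee (of_real ((x + real i) / real K + real n) * z + of_real ((b + real j) / real K))))
     sums (\<Sum>i<K. \<Sum>j<K. log_theta ((x + real i) / real K) ((b + real j) / real K) z)"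
    using x K by (intro sums_sum log_theta_sums z) (simp add: add_pos_nonneg)
  ultimately show "(\<Sum>i<K. \<Sum>j<K. log_theta ((x + real i) / real K) ((b + real j) / real K) z) = log_theta x b z"
    using sums_unique2 by blast
qed

section \<open>The transformation \<open>\<tau> \<mapsto> -1/\<tau>\<close>\<close>

definition lambert_kernel :: "real \<Rightarrow> complex \<Rightarrow> complex" where
  "lambert_kernel b w = ee (of_real b * w) / (1 - ee w)"

text \<open>Applied with \<open>t\<close> of either sign; the two summands on the right cover the
  two cases.\<close>

lemma exp_scale_le: "0 < b \<Longrightarrow> b < 1 \<Longrightarrow> exp (b * t) \<le> 1 + exp (t::real)"
proof (cases "t \<ge> 0")
  case True
  assume "0 < b" "b < 1"
  then have "b * t \<le> t" using True by (simp add: mult_left_le_one_le)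
  then have "exp (b * t) \<le> exp t" by simp
  then show ?thesis by (simp add: add_increasing)
next
  case False
  assume "0 < b" "b < 1"
  then have "b * t \<le> 0" using False by (simp add: mult_nonneg_nonpos)
  then have "exp (b * t) \<le> 1" by simp
  then show ?thesis by (simp add: add_increasing2)
qed

lemma ee_half_integer: "ee (of_nat N + 1 / 2) = - 1"
proof -
  have "ee (1 / 2) = - 1" by (simp add: ee_def)
  then show ?thesis by (simp add: ee_add)
qed

lemma ee_abs_half_integer:
  assumes "\<bar>Re w\<bar> = real N + 1 / 2" shows "ee w = - of_real (exp (- 2 * pi * Im w))"
proof -
  have "ee (of_real (Re w)) = - 1"
  proof (cases "Re w \<ge> 0")
    case True
    then have "of_real (Re w) = (of_nat N + 1 / 2 :: complex)" using assms by (simp add: complex_eq_iff)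
    then show ?thesis by (simp add: ee_half_integer)
  next
    case False
    then have "of_real (Re w) = - (of_nat N + 1 / 2 :: complex)" using assms by (simp add: complex_eq_iff)
    then show ?thesis by (simp only: ee_minus ee_half_integer) simp
  qed
  moreover have "ee (\<i> * of_real (Im w)) = of_real (exp (- 2 * pi * Im w))"
    unfolding ee_def exp_of_real[symmetric] by (simp add: mult.assoc mult.left_commute)
  moreover have "w = of_real (Re w) + \<i> * of_real (Im w)" by (simp add: complex_eq)
  ultimately show ?thesis by (metis ee_add mult_minus1)
qed

text \<open>On these lines e(w) is negative real, so the denominator is 1 + |e(w)| and stays away
  from the poles.\<close>

lemma norm_lambert_kernel_vertical:
  assumes "0 < b" "b < 1" "\<bar>Re w\<bar> = real N + 1 / 2"
  shows "norm (lambert_kernel b w) \<le> 1"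
proof -
  have "norm (1 - ee w) = 1 + exp (- 2 * pi * Im w)"
  proof -
    have "1 - ee w = of_real (1 + exp (- 2 * pi * Im w))" using ee_abs_half_integer[OF assms(3)] by simp
    then have "norm (1 - ee w) = \<bar>1 + exp (- 2 * pi * Im w)\<bar>" by (simp only: norm_of_real)
    then show ?thesis using exp_gt_zero[of "- 2 * pi * Im w"] by linarith
  qed
  moreover have "norm (ee (of_real b * w)) = exp (b * (- 2 * pi * Im w))" by (simp add: norm_ee mult_ac)
  moreover have "1 + exp (- 2 * pi * Im w) > 0" by (simp add: add_pos_pos)
  ultimately show ?thesis using exp_scale_le[OF assms(1,2), of "- 2 * pi * Im w"]
    unfolding lambert_kernel_def norm_divide by (simp only: divide_le_eq_1_pos)
qed

text \<open>Upwards the numerator decays at rate \<open>b\<close>; downwards the quotient is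
  rewritten with e((b - 1) w) over 1 - e(-w) and decays at rate \<open>1 - b\<close>. Both are
  positive because 0 < b < 1.\<close>

lemma norm_lambert_kernel_horizontal:
  assumes "0 < b" "b < 1" "U > 0" "\<bar>Im w\<bar> = U"
  shows "norm (lambert_kernel b w) \<le> exp (- 2 * pi * (min b (1 - b) * U)) / (1 - exp (- 2 * pi * U))"
proof -
  have E: "exp (- 2 * pi * U) < 1" using assms by (simp add: mult_pos_pos)
  show ?thesis
  proof (cases "Im w \<ge> 0")
    case True
    then have U: "Im w = U" using assms by simp
    have "norm (1 - ee w) \<ge> 1 - exp (- 2 * pi * U)"
      using norm_triangle_ineq2[of 1 "ee w"] U by (simp add: norm_ee)
    moreover have "norm (ee (of_real b * w)) \<le> exp (- 2 * pi * (min b (1 - b) * U))"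
      using U assms by (simp add: norm_ee mult_right_mono)
    ultimately show ?thesis using E unfolding lambert_kernel_def norm_divide by (intro frac_le) auto
  next
    case False
    then have U: "Im w = - U" using assms by simp
    have e: "ee w \<noteq> 0" by simp
    have "lambert_kernel b w = - (ee (of_real (b - 1) * w) / (1 - ee (- w)))"
    proof -
      have "ee (of_real b * w) = ee (of_real (b - 1) * w) * ee w"
        unfolding ee_add[symmetric] by (simp add: algebra_simps)
      moreover have "1 - ee w = - (ee w * (1 - ee (- w)))"
        by (simp add: ee_minus algebra_simps)
      ultimately have "lambert_kernel b w = (ee (of_real (b - 1) * w) * ee w) / (- (ee w * (1 - ee (- w))))"
        unfolding lambert_kernel_def by (simp only:)
      also have "\<dots> = - ((ee w * ee (of_real (b - 1) * w)) / (ee w * (1 - ee (- w))))"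
        by (simp only: minus_divide_right mult.commute)
      also have "\<dots> = - (ee (of_real (b - 1) * w) / (1 - ee (- w)))"
        by (subst mult_divide_mult_cancel_left[OF e]) (rule refl)
      finally show ?thesis .
    qed
    then have "norm (lambert_kernel b w) = norm (ee (of_real (b - 1) * w)) / norm (1 - ee (- w))"
      by (simp add: norm_divide)
    moreover have "norm (1 - ee (- w)) \<ge> 1 - exp (- 2 * pi * U)"
      using norm_triangle_ineq2[of 1 "ee (- w)"] U by (simp add: norm_ee)
    moreover have "norm (ee (of_real (b - 1) * w)) \<le> exp (- 2 * pi * (min b (1 - b) * U))"
    proof -
      have "norm (ee (of_real (b - 1) * w)) = exp (- 2 * pi * ((1 - b) * U))"
        using U by (simp add: norm_ee algebra_simps)
      moreover have "min b (1 - b) * U \<le> (1 - b) * U" using assms by (intro mult_right_mono) auto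
      ultimately show ?thesis by simp
    qed
    ultimately show ?thesis using E by (simp only:) (intro frac_le, auto)
  qed
qed

definition decay :: "real \<Rightarrow> real \<Rightarrow> real" where
  "decay b U = exp (- 2 * pi * (min b (1 - b) * U)) / (1 - exp (- 2 * pi * U))"

lemma decay_tendsto:
  assumes "0 < b'" "b' < 1" "k > 0"
  shows "(\<lambda>N. decay b' (k * (real N + 1 / 2))) \<longlonglongrightarrow> 0"
proof -
  have *: "(\<lambda>N. exp (- 2 * pi * (x * (k * (real N + 1 / 2))))) \<longlonglongrightarrow> 0" if "x > 0" for x
  proof -
    have "filterlim (\<lambda>N. 1 / 2 + real N) at_top sequentially"
      by (rule filterlim_tendsto_add_at_top[OF tendsto_const filterlim_real_sequentially])
    then have "filterlim (\<lambda>N. real N + 1 / 2) at_top sequentially" by (simp only: add.commute)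
    then have "filterlim (\<lambda>N. (2 * pi * x * k) * (real N + 1 / 2)) at_top sequentially"
      using that assms(3) by (intro filterlim_tendsto_pos_mult_at_top[OF tendsto_const]) auto
    then have "filterlim (\<lambda>N. - ((2 * pi * x * k) * (real N + 1 / 2))) at_bot sequentially"
      by (simp add: filterlim_uminus_at_top)
    from filterlim_compose[OF exp_at_bot this] show ?thesis by (simp add: mult.assoc)
  qed
  have "(\<lambda>N. decay b' (k * (real N + 1 / 2))) \<longlonglongrightarrow> 0 / (1 - 0)"
    unfolding decay_def using *[of "min b' (1 - b')"] *[of 1] assms
    by (intro tendsto_divide tendsto_diff tendsto_const) auto
  then show ?thesis by simp
qed

lemma norm_contour_integral_rectpath_le:
  assumes "X > 0" "H > 0" and f: "continuous_on (path_image (rectpath (Complex (- X) (- H)) (Complex X H))) f"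
    and v: "\<And>w. \<bar>Re w\<bar> = X \<Longrightarrow> norm (f w) \<le> V" and h: "\<And>w. \<bar>Im w\<bar> = H \<Longrightarrow> norm (f w) \<le> W"
  shows "norm (contour_integral (rectpath (Complex (- X) (- H)) (Complex X H)) f) \<le> 4 * H * V + 4 * X * W"
proof -
  let ?a1 = "Complex (- X) (- H)" and ?a2 = "Complex X (- H)" and ?a3 = "Complex X H" and ?a4 = "Complex (- X) H"
  have pth: "rectpath ?a1 ?a3 = linepath ?a1 ?a2 +++ linepath ?a2 ?a3 +++ linepath ?a3 ?a4 +++ linepath ?a4 ?a1"
    by (simp add: rectpath_def Let_def)
  have pim: "path_image (rectpath ?a1 ?a3) = closed_segment ?a1 ?a2 \<union> closed_segment ?a2 ?a3 \<union> closed_segment ?a3 ?a4 \<union> closed_segment ?a4 ?a1"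
    unfolding pth by (simp add: path_image_join Un_assoc)
  have int: "f contour_integrable_on linepath ?a1 ?a2" "f contour_integrable_on linepath ?a2 ?a3"
    "f contour_integrable_on linepath ?a3 ?a4" "f contour_integrable_on linepath ?a4 ?a1"
    using f unfolding pim by (auto intro!: contour_integrable_continuous_linepath intro: continuous_on_subset)
  have eq: "contour_integral (rectpath ?a1 ?a3) f = contour_integral (linepath ?a1 ?a2) f + (contour_integral (linepath ?a2 ?a3) f
     + (contour_integral (linepath ?a3 ?a4) f + contour_integral (linepath ?a4 ?a1) f))"
    unfolding pth using int by (simp add: contour_integral_join)
  have V0: "V \<ge> 0" using order_trans[OF norm_ge_zero v[of "Complex X 0"]] assms(1) by simp
  have W0: "W \<ge> 0" using order_trans[OF norm_ge_zero h[of "Complex 0 H"]] assms(2) by simp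
  have "norm (contour_integral (linepath ?a1 ?a2) f) \<le> W * norm (?a2 - ?a1)"
    using int W0 assms(1,2) by (intro contour_integral_bound_linepath h) (auto simp: closed_segment_same_Im)
  moreover have "norm (contour_integral (linepath ?a2 ?a3) f) \<le> V * norm (?a3 - ?a2)"
    using int V0 assms(1,2) by (intro contour_integral_bound_linepath v) (auto simp: closed_segment_same_Re)
  moreover have "norm (contour_integral (linepath ?a3 ?a4) f) \<le> W * norm (?a4 - ?a3)"
    using int W0 assms(1,2) by (intro contour_integral_bound_linepath h) (auto simp: closed_segment_same_Im)
  moreover have "norm (contour_integral (linepath ?a4 ?a1) f) \<le> V * norm (?a1 - ?a4)"
    using int V0 assms(1,2) by (intro contour_integral_bound_linepath v) (auto simp: closed_segment_same_Re)
  moreover have "norm (?a2 - ?a1) = 2 * X" "norm (?a3 - ?a2) = 2 * H" "norm (?a4 - ?a3) = 2 * X" "norm (?a1 - ?a4) = 2 * H"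
  proof -
    have "?a2 - ?a1 = of_real (2 * X)" "?a3 - ?a2 = \<i> * of_real (2 * H)"
      "?a4 - ?a3 = - of_real (2 * X)" "?a1 - ?a4 = - (\<i> * of_real (2 * H))" by (simp_all add: complex_eq_iff)
    then show "norm (?a2 - ?a1) = 2 * X" "norm (?a3 - ?a2) = 2 * H" "norm (?a4 - ?a3) = 2 * X" "norm (?a1 - ?a4) = 2 * H"
      using assms(1,2) by (simp_all only: norm_minus_cancel norm_mult norm_ii norm_of_real)
  qed
  ultimately have n: "norm (contour_integral (linepath ?a1 ?a2) f) \<le> W * (2 * X)"
     "norm (contour_integral (linepath ?a2 ?a3) f) \<le> V * (2 * H)" "norm (contour_integral (linepath ?a3 ?a4) f) \<le> W * (2 * X)"
     "norm (contour_integral (linepath ?a4 ?a1) f) \<le> V * (2 * H)" by simp_all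
  show ?thesis unfolding eq
    using norm_triangle_le[OF add_mono[OF n(1) norm_triangle_le[OF add_mono[OF n(2) norm_triangle_le[OF add_mono[OF n(3,4)]]]]]]
    by (simp add: algebra_simps)
qed

section \<open>Residues and contour integral of the kernel on the imaginary axis\<close>

context
  fixes a b y :: real
  assumes a: "0 < a" "a < 1" and b: "0 < b" "b < 1" and y: "y > 0"
begin

text \<open>For imaginary \<tau> the poles n and n/\<tau> lie on the real and the imaginary axis, so
  one rectangle with half-integral sides passes midway between consecutive poles of both
  families.\<close>

definition tau :: complex where "tau = \<i> * of_real y"

text \<open>Simple poles at the nonzero n and n/\<tau>, and a triple pole at 0, one order of which
  comes from the factor 1/w. That factor also turns the residues into Lambert terms with
  1/n.\<close>

definition kernel :: "complex \<Rightarrow> complex" where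
  "kernel w = lambert_kernel a (tau * w) * lambert_kernel b w / w"

lemma tau_nz [simp]: "tau \<noteq> 0"
  using y by (simp add: tau_def)

lemma Im_tau: "Im tau > 0" and Im_inv_tau: "Im (- 1 / tau) > 0"
proof -
  show "Im tau > 0" using y by (simp add: tau_def)
  have "- 1 / tau = \<i> * of_real (1 / y)" using y by (simp add: tau_def field_simps)
  then show "Im (- 1 / tau) > 0" using y by simp
qed

lemma tau_not_int: "n \<noteq> 0 \<Longrightarrow> tau * of_int n \<notin> \<int>" "n \<noteq> 0 \<Longrightarrow> of_int n / tau \<notin> \<int>"
proof -
  assume n: "n \<noteq> 0"
  have notin: "w \<notin> \<int>" if "Im w \<noteq> 0" for w using that by (auto elim!: Ints_cases)
  have "Im (tau * of_int n) \<noteq> 0" using n y by (simp add: tau_def)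
  then show "tau * of_int n \<notin> \<int>" by (rule notin)
  have "of_int n / tau = - \<i> * of_real (of_int n / y)" using y by (simp add: tau_def field_simps)
  then have "Im (of_int n / tau) \<noteq> 0" using n y by simp
  then show "of_int n / tau \<notin> \<int>" by (rule notin)
qed

lemma kernel_holomorphic:
  assumes "\<And>w. w \<in> A \<Longrightarrow> w \<notin> \<int> \<and> tau * w \<notin> \<int>"
  shows "kernel holomorphic_on A"
proof -
  have "0 \<notin> A" using assms[of 0] by auto
  then show ?thesis unfolding kernel_def lambert_kernel_def
    using assms by (intro holomorphic_intros) (auto simp: ee_eq_1_iff[symmetric] simp del: ee_eq_1_iff)
qed

lemma residue_quotient_ee:
  assumes "open A" "w0 \<in> A" and f: "f holomorphic_on A" and t: "t \<noteq> 0" "t * w0 \<in> \<int>"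
  shows "residue (\<lambda>w. f w / (1 - ee (t * w))) w0 = - f w0 / (2 * of_real pi * \<i> * t)"
proof -
  have D: "((\<lambda>w. 1 - ee (t * w)) has_field_derivative - (2 * of_real pi * \<i> * t)) (at w0)"
  proof -
    have "ee (t * w0) = 1" using t by (simp add: ee_eq_1_iff)
    then have "exp (2 * of_real pi * \<i> * (t * w0)) = 1" by (simp add: ee_def)
    then show ?thesis unfolding ee_def by (auto intro!: derivative_eq_intros)
  qed
  obtain r where r: "r > 0" "ball w0 r \<subseteq> A" using assms(1,2) open_contains_ball by blast
  show ?thesis
  proof (rule residue_simple')
    show "open (ball w0 (min r (1 / norm t)))" by simp
    show "w0 \<in> ball w0 (min r (1 / norm t))" using r t by simp
    \<comment> \<open>The zeros of \<open>1 - ee (t * w)\<close> are spaced by at least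
      \<open>1 / norm t\<close>, so \<open>w0\<close> is the only one in the ball.\<close>
    have "1 - ee (t * w) \<noteq> 0" if "w \<in> ball w0 (min r (1 / norm t)) - {w0}" for w
    proof
      assume "1 - ee (t * w) = 0"
      then have "t * w \<in> \<int>" by (simp add: ee_eq_1_iff[symmetric])
      then have "t * w - t * w0 \<in> \<int>" using t by simp
      then obtain n :: int where n: "t * (w - w0) = of_int n" by (auto simp: right_diff_distrib elim: Ints_cases)
      have "norm (t * (w - w0)) = norm t * dist w0 w" by (simp only: norm_mult dist_norm norm_minus_commute)
      then have "norm (t * (w - w0)) < 1" using that t by (simp add: field_simps)
      then have "\<bar>n\<bar> < 1" unfolding n by simp
      then have "n = 0" by simp
      then show False using n t that by simp
    qed
    then show "(\<lambda>w. f w / (1 - ee (t * w))) holomorphic_on ball w0 (min r (1 / norm t)) - {w0}"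
      using r by (intro holomorphic_intros holomorphic_on_subset[OF f]) auto
    have "((\<lambda>w. (1 - ee (t * w) - (1 - ee (t * w0))) / (w - w0)) \<longlongrightarrow> - (2 * of_real pi * \<i> * t)) (at w0)"
      using D unfolding has_field_derivative_iff .
    moreover have "ee (t * w0) = 1" using t by (simp add: ee_eq_1_iff)
    ultimately have "((\<lambda>w. (1 - ee (t * w)) / (w - w0)) \<longlongrightarrow> - (2 * of_real pi * \<i> * t)) (at w0)" by simp
    moreover have "(f \<longlongrightarrow> f w0) (at w0)"
      using f assms(1,2) by (meson continuous_on_eq_continuous_at holomorphic_on_imp_continuous_on isContD)
    ultimately have "((\<lambda>w. f w / ((1 - ee (t * w)) / (w - w0))) \<longlongrightarrow> f w0 / - (2 * of_real pi * \<i> * t)) (at w0)"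
      using t by (intro tendsto_divide) auto
    then show "((\<lambda>w. f w / (1 - ee (t * w)) * (w - w0)) \<longlongrightarrow> - f w0 / (2 * of_real pi * \<i> * t)) (at w0)" by simp
  qed
qed

lemma open_not_int: "open {w :: complex. t * w \<notin> \<int>}"
proof -
  have "closed ((\<lambda>w. t * w) -` (\<int> :: complex set))"
    by (intro closed_vimage closed_Ints continuous_intros)
  then show ?thesis by (simp add: closed_def vimage_def Compl_eq)
qed

text \<open>At n the residue is a Lambert term as it stands. At -n the denominator 1 - q^(-n) is
  rewritten through 1 - q^n, and the additional q^n replaces \<open>a\<close> by
  \<open>1 - a\<close>.\<close>

lemma residue_kernel_int:
  assumes "n > 0"
  shows "residue kernel (of_nat n) = - theta_term a b tau (n - 1) / (2 * of_real pi * \<i>)"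
    and "residue kernel (- of_nat n) = - theta_term (1 - a) (- b) tau (n - 1) / (2 * of_real pi * \<i>)"
proof -
  define f where "f = (\<lambda>w. lambert_kernel a (tau * w) * ee (of_real b * w) / w)"
  have kf: "kernel = (\<lambda>w. f w / (1 - ee (1 * w)))"
    by (simp add: fun_eq_iff kernel_def f_def lambert_kernel_def)
  define A where "A = {w. tau * w \<notin> \<int>}"
  have A: "open A" unfolding A_def by (rule open_not_int)
  have "0 \<notin> A" by (simp add: A_def)
  then have fA: "f holomorphic_on A" unfolding f_def lambert_kernel_def
    by (intro holomorphic_intros) (auto simp: A_def ee_eq_1_iff[symmetric] simp del: ee_eq_1_iff)
  have res: "residue kernel (of_int m) = - f (of_int m) / (2 * of_real pi * \<i>)" if "m \<noteq> 0" for m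
    unfolding kf using residue_quotient_ee[OF A _ fA, of "of_int m" 1] tau_not_int(1)[OF that] by (simp add: A_def)
  obtain k where k: "n = Suc k" using assms by (cases n) auto
  have q1: "1 - ee tau ^ n \<noteq> 0"
    using norm_1_minus_ee_power[OF Im_tau, of k] norm_ee_less_1[OF Im_tau] k by auto
  have f1: "f (of_nat n) = theta_term a b tau k"
  proof -
    have "ee (of_real a * (tau * of_nat n)) * ee (of_real b * of_nat n) = ee (of_real a * tau + of_real b) ^ n"
      unfolding ee_of_nat_mult[symmetric] ee_add[symmetric] by (simp add: algebra_simps)
    moreover have "ee (tau * of_nat n) = ee tau ^ n" by (simp add: ee_of_nat_mult[symmetric] mult.commute)
    ultimately show ?thesis unfolding f_def theta_term_def lambert_kernel_def k[symmetric] by (simp add: mult.commute)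
  qed
  have f2: "f (- of_nat n) = theta_term (1 - a) (- b) tau k"
  proof -
    have e1: "ee (of_real a * (tau * - of_nat n)) * ee (of_real b * - of_nat n) * ee tau ^ n =
        ee (of_real (1 - a) * tau + of_real (- b)) ^ n"
      unfolding ee_of_nat_mult[symmetric] ee_add[symmetric] by (simp add: algebra_simps)
    have e2: "ee (tau * - of_nat n) = inverse (ee tau ^ n)"
      by (simp add: ee_of_nat_mult[symmetric] ee_minus[symmetric] mult.commute)
    have q0: "ee tau ^ n \<noteq> 0" by simp
    have e3: "1 - inverse (ee tau ^ n) = - (1 - ee tau ^ n) / ee tau ^ n" using q0 by (simp add: field_simps)
    have "f (- of_nat n) = ee (of_real a * (tau * - of_nat n)) * ee (of_real b * - of_nat n) * ee tau ^ n /
        (of_nat n * (1 - ee tau ^ n))"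
      unfolding f_def lambert_kernel_def e2 e3 using q0 q1 k by (simp add: field_simps)
    then show ?thesis unfolding e1 theta_term_def k[symmetric] .
  qed
  show "residue kernel (of_nat n) = - theta_term a b tau (n - 1) / (2 * of_real pi * \<i>)"
    "residue kernel (- of_nat n) = - theta_term (1 - a) (- b) tau (n - 1) / (2 * of_real pi * \<i>)"
    using res[of "int n"] res[of "- int n"] assms f1 f2 k by simp_all
qed

text \<open>The same computation with the roles of \<open>a\<close> and \<open>b\<close> exchanged
  and modulus -1/\<tau>. Dividing by the derivative \<tau> and by w = n/\<tau> leaves the opposite
  sign.\<close>

lemma residue_kernel_inv_tau:
  assumes "n > 0"
  shows "residue kernel (of_nat n / tau) = theta_term (1 - b) a (- 1 / tau) (n - 1) / (2 * of_real pi * \<i>)"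
    and "residue kernel (- of_nat n / tau) = theta_term b (- a) (- 1 / tau) (n - 1) / (2 * of_real pi * \<i>)"
proof -
  let ?t = "- 1 / tau"
  define f where "f = (\<lambda>w. ee (of_real a * (tau * w)) * lambert_kernel b w / w)"
  have kf: "kernel = (\<lambda>w. f w / (1 - ee (tau * w)))"
    by (simp add: fun_eq_iff kernel_def f_def lambert_kernel_def)
  define A where "A = {w. 1 * w \<notin> (\<int> :: complex set)}"
  have A: "open A" unfolding A_def by (rule open_not_int)
  have "0 \<notin> A" by (simp add: A_def)
  then have fA: "f holomorphic_on A" unfolding f_def lambert_kernel_def
    by (intro holomorphic_intros) (auto simp: A_def ee_eq_1_iff[symmetric] simp del: ee_eq_1_iff)
  have res: "residue kernel (of_int m / tau) = - f (of_int m / tau) / (2 * of_real pi * \<i> * tau)" if "m \<noteq> 0" for m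
    unfolding kf using residue_quotient_ee[OF A _ fA, of "of_int m / tau" tau] tau_not_int(2)[OF that] by (simp add: A_def)
  obtain k where k: "n = Suc k" using assms by (cases n) auto
  have q1: "1 - ee ?t ^ n \<noteq> 0"
    using norm_1_minus_ee_power[OF Im_inv_tau, of k] norm_ee_less_1[OF Im_inv_tau] k by auto
  have q0: "ee ?t ^ n \<noteq> 0" by simp
  define T where "T = ?t"
  have nT: "of_nat n / tau = - (of_nat n * T)" "tau * (- (of_nat n * T)) = of_nat n"
    "tau * (of_nat n * T) = - of_nat n" by (simp_all add: T_def)
  have tT: "tau = - 1 / T" by (simp add: T_def)
  have T0: "T \<noteq> 0" by (simp add: T_def)
  have f1: "f (of_nat n / tau) = - tau * theta_term (1 - b) a T k"
  proof -
    have e1: "ee (of_real a * of_nat n) * ee (of_real b * - (of_nat n * T)) * ee T ^ n =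
        ee (of_real (1 - b) * T + of_real a) ^ n"
      unfolding ee_of_nat_mult[symmetric] ee_add[symmetric] by (simp add: algebra_simps)
    have e2: "ee (- (of_nat n * T)) = inverse (ee T ^ n)" by (simp add: ee_of_nat_mult ee_minus)
    have e3: "1 - inverse (ee T ^ n) = - (1 - ee T ^ n) / ee T ^ n" using q0 by (simp add: T_def field_simps)
    have "f (of_nat n / tau) = - tau * (ee (of_real a * of_nat n) * ee (of_real b * - (of_nat n * T)) * ee T ^ n /
        (of_nat n * (1 - ee T ^ n)))"
      unfolding f_def lambert_kernel_def nT e2 e3 using q0 q1 assms T0
      by (simp add: tT T_def[symmetric] divide_simps algebra_simps)
    then show ?thesis unfolding e1 theta_term_def k[symmetric] .
  qed
  have f2: "f (- of_nat n / tau) = - tau * theta_term b (- a) T k"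
  proof -
    have e1: "ee (of_real a * - of_nat n) * ee (of_real b * (of_nat n * T)) =
        ee (of_real b * T + of_real (- a)) ^ n"
      unfolding ee_of_nat_mult[symmetric] ee_add[symmetric] by (simp add: algebra_simps)
    have n': "- of_nat n / tau = of_nat n * T" by (simp add: T_def)
    have "f (- of_nat n / tau) = - tau * (ee (of_real a * - of_nat n) * ee (of_real b * (of_nat n * T)) /
        (of_nat n * (1 - ee T ^ n)))"
      unfolding f_def lambert_kernel_def n' nT ee_of_nat_mult using q1 k T0 by (simp add: tT T_def[symmetric] divide_simps)
    then show ?thesis unfolding e1 theta_term_def k[symmetric] .
  qed
  show "residue kernel (of_nat n / tau) = theta_term (1 - b) a (- 1 / tau) (n - 1) / (2 * of_real pi * \<i>)"
    "residue kernel (- of_nat n / tau) = theta_term b (- a) (- 1 / tau) (n - 1) / (2 * of_real pi * \<i>)"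
    using res[of "int n"] res[of "- int n"] assms f1 f2 k by (simp_all add: T_def)
qed


text \<open>The residue is the coefficient of w^2 in w^3 times the kernel. That function is a
  product of two generating series of Bernoulli polynomials, and its terms of degree two are B_2(a),
  B_1(a) B_1(b) and B_2(b).\<close>

lemma residue_kernel_0:
  "residue kernel 0 = tau * (of_real (a^2 - a + 1/6)) / 2 + of_real (b^2 - b + 1/6) / (2 * tau)
     + of_real ((a - 1/2) * (b - 1/2))"
proof -
  define v :: complex where "v = 2 * of_real pi * \<i>"
  define u where "u = v * tau"
  define s where "s = of_real a * u + of_real b * v"
  have v0: "v \<noteq> 0" and u0: "u \<noteq> 0" by (auto simp: v_def u_def)
  \<comment> \<open>\<open>D\<close> vanishes to order 2; the factor w^2 in \<open>F\<close> makes
    the quotient a power series.\<close>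
  define D where "D = (1 - fps_exp u) * (1 - fps_exp v)"
  define F where "F = fps_X ^ 2 * fps_exp s"
  have nth_m: "fps_nth (A * B) 2 = fps_nth A 0 * fps_nth B 2 + fps_nth A 1 * fps_nth B 1 + fps_nth A 2 * fps_nth B 0"
    "fps_nth (A * B) 3 = fps_nth A 0 * fps_nth B 3 + fps_nth A 1 * fps_nth B 2 + fps_nth A 2 * fps_nth B 1 + fps_nth A 3 * fps_nth B 0"
    "fps_nth (A * B) 4 = fps_nth A 0 * fps_nth B 4 + fps_nth A 1 * fps_nth B 3 + fps_nth A 2 * fps_nth B 2 + fps_nth A 3 * fps_nth B 1 + fps_nth A 4 * fps_nth B 0"
    "fps_nth (A * B) 0 = fps_nth A 0 * fps_nth B 0" "fps_nth (A * B) 1 = fps_nth A 0 * fps_nth B 1 + fps_nth A 1 * fps_nth B 0"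
    for A B :: "complex fps"
    by (simp_all add: fps_mult_nth numeral_eq_Suc algebra_simps)
  have D0: "fps_nth D 0 = 0" "fps_nth D 1 = 0" "fps_nth D 2 = u * v"
    "fps_nth D 3 = u * v^2 / 2 + u^2 * v / 2" "fps_nth D 4 = u * v^3 / 6 + u^2 * v^2 / 4 + u^3 * v / 6"
    unfolding D_def nth_m by (simp_all add: fps_exp_def fact_numeral power2_eq_square)
  have F0: "fps_nth F 0 = 0" "fps_nth F 1 = 0" "fps_nth F 2 = 1" "fps_nth F 3 = s" "fps_nth F 4 = s^2 / 2"
    unfolding F_def by (simp_all add: fps_X_power_mult_nth fps_exp_def)
  have less2: "n = 0 \<or> n = 1" if "n < 2" for n :: nat using that by auto
  have sD: "subdegree D = 2" using D0 u0 v0 less2 by (intro subdegreeI) auto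
  have sF: "subdegree F = 2" using F0 less2 by (intro subdegreeI) auto
  have Dnz: "D \<noteq> 0" using D0(3) u0 v0 by auto
  define Q where "Q = F / D"
  have "F \<noteq> 0" using F0(3) by auto
  then have "D dvd F" using Dnz sD sF by (simp add: fps_dvd_iff)
  then have "Q * D = F" unfolding Q_def by simp
  then have q: "fps_nth (Q * D) 2 = 1" "fps_nth (Q * D) 3 = s" "fps_nth (Q * D) 4 = s^2 / 2"
    using F0 by simp_all
  have ex: "(\<lambda>w. if w = 0 then fps_nth F (subdegree D) / fps_nth D (subdegree D)
      else w ^ 2 * exp (s * w) / ((1 - exp (u * w)) * (1 - exp (v * w)))) has_fps_expansion Q"
    unfolding Q_def
  proof (rule has_fps_expansion_divide)
    show "(\<lambda>w. w ^ 2 * exp (s * w)) has_fps_expansion F" unfolding F_def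
      by (intro fps_expansion_intros)
    show "(\<lambda>w. (1 - exp (u * w)) * (1 - exp (v * w))) has_fps_expansion D" unfolding D_def
      by (intro fps_expansion_intros)
  qed (use sD sF Dnz in auto)
  \<comment> \<open>The first three coefficients of \<open>Q\<close> are solved successively from
    \<open>Q * D = F\<close> in degrees 2, 3 and 4.\<close>
  have Q0: "fps_nth Q 0 = 1 / (u * v)"
    using q(1) D0 u0 v0 unfolding nth_m by (simp add: field_simps)
  have Q1: "fps_nth Q 1 = (s - (u + v) / 2) / (u * v)"
  proof -
    have "fps_nth Q 1 * (u * v) = s - fps_nth Q 0 * (u * v^2 / 2 + u^2 * v / 2)"
      using q(2) D0 unfolding nth_m by (simp add: algebra_simps)
    also have "fps_nth Q 0 * (u * v^2 / 2 + u^2 * v / 2) = (u + v) / 2"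
      unfolding Q0 using u0 v0 by (simp add: field_simps power2_eq_square)
    finally show ?thesis using u0 v0 by (simp add: eq_divide_eq)
  qed
  have Q2: "fps_nth Q 2 = (s^2 / 2 - s * (u + v) / 2 + u * v / 4 + (u^2 + v^2) / 12) / (u * v)"
  proof -
    have "fps_nth Q 2 * (u * v) = s^2 / 2 - fps_nth Q 1 * (u * v^2 / 2 + u^2 * v / 2) -
        fps_nth Q 0 * (u * v^3 / 6 + u^2 * v^2 / 4 + u^3 * v / 6)"
      using q(3) D0 unfolding nth_m by (simp add: algebra_simps)
    also have "fps_nth Q 1 * (u * v^2 / 2 + u^2 * v / 2) = (s - (u + v) / 2) * ((u + v) / 2)"
      unfolding Q1 using u0 v0 by (simp add: field_simps power2_eq_square)
    also have "fps_nth Q 0 * (u * v^3 / 6 + u^2 * v^2 / 4 + u^3 * v / 6) = v^2 / 6 + u * v / 4 + u^2 / 6"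
      unfolding Q0 using u0 v0 by (simp add: field_simps power2_eq_square power3_eq_cube)
    also have "s^2 / 2 - (s - (u + v) / 2) * ((u + v) / 2) - (v^2 / 6 + u * v / 4 + u^2 / 6) =
       s^2 / 2 - s * (u + v) / 2 + u * v / 4 + (u^2 + v^2) / 12"
      by (simp add: field_simps power2_eq_square)
    finally show ?thesis using u0 v0 by (simp add: field_simps)
  qed
  have "residue (\<lambda>w. (if w = 0 then fps_nth F (subdegree D) / fps_nth D (subdegree D)
      else w ^ 2 * exp (s * w) / ((1 - exp (u * w)) * (1 - exp (v * w)))) / w ^ Suc 2) 0 = fps_nth Q 2"
    by (rule residue_fps_expansion_over_power_at_0[OF ex])
  moreover have "residue (\<lambda>w. (if w = 0 then fps_nth F (subdegree D) / fps_nth D (subdegree D)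
      else w ^ 2 * exp (s * w) / ((1 - exp (u * w)) * (1 - exp (v * w)))) / w ^ Suc 2) 0 = residue kernel 0"
  proof (rule residue_cong[OF _ refl])
    have "(if w = 0 then fps_nth F (subdegree D) / fps_nth D (subdegree D)
      else w ^ 2 * exp (s * w) / ((1 - exp (u * w)) * (1 - exp (v * w)))) / w ^ Suc 2 = kernel w" if "w \<noteq> 0" for w
    proof -
      have "exp (s * w) = ee (of_real a * (tau * w)) * ee (of_real b * w)"
        unfolding ee_add[symmetric] by (simp add: ee_def s_def u_def v_def algebra_simps)
      moreover have "exp (u * w) = ee (tau * w)" "exp (v * w) = ee w"
        by (simp_all add: ee_def u_def v_def algebra_simps)
      ultimately have "w ^ 2 * exp (s * w) / ((1 - exp (u * w)) * (1 - exp (v * w))) / w ^ Suc 2 =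
          (w ^ 2 * (lambert_kernel a (tau * w) * lambert_kernel b w)) / (w ^ 2 * w)"
        by (simp add: lambert_kernel_def power2_eq_square power3_eq_cube)
      also have "\<dots> = kernel w"
        unfolding kernel_def using that by (intro mult_divide_mult_cancel_left) simp
      finally show ?thesis using that by simp
    qed
    then show "\<forall>\<^sub>F w in at 0. (if w = 0 then fps_nth F (subdegree D) / fps_nth D (subdegree D)
      else w ^ 2 * exp (s * w) / ((1 - exp (u * w)) * (1 - exp (v * w)))) / w ^ Suc 2 = kernel w"
      by (auto simp: eventually_at_filter)
  qed
  ultimately have "residue kernel 0 = fps_nth Q 2" by simp
  also have "\<dots> = (u^2 * of_real (a^2 - a + 1/6) / 2 + v^2 * of_real (b^2 - b + 1/6) / 2
      + u * v * of_real ((a - 1/2) * (b - 1/2))) / (u * v)"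
    unfolding Q2 s_def by (rule arg_cong[where f = "\<lambda>x. x / (u * v)"]) (simp add: field_simps power2_eq_square)
  also have "\<dots> = tau * (of_real (a^2 - a + 1/6)) / 2 + of_real (b^2 - b + 1/6) / (2 * tau)
     + of_real ((a - 1/2) * (b - 1/2))"
  proof -
    have *: "(u^2 * x / 2 + v^2 * y / 2 + u * v * z) / (u * v) = tau * x / 2 + y / (2 * tau) + z" for x y z
      using v0 unfolding u_def by (simp add: field_simps power2_eq_square)
    show ?thesis by (rule *)
  qed
  finally show ?thesis .
qed


text \<open>On the vertical sides the first factor sees a large imaginary part and decays while the
  second is bounded by 1; on the horizontal sides the roles are exchanged. The factor 1/w offsets
  the length of the sides.\<close>

lemma kernel_contour_integral_tendsto:
  "(\<lambda>N. contour_integral (rectpath (Complex (- (real N + 1/2)) (- ((real N + 1/2) / y)))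
      (Complex (real N + 1/2) ((real N + 1/2) / y))) kernel) \<longlonglongrightarrow> 0"
proof (rule Lim_null_comparison)
  let ?B = "\<lambda>N. 4 / y * decay a (y * (real N + 1 / 2)) + 4 * y * decay b (1 / y * (real N + 1 / 2))"
  show "?B \<longlonglongrightarrow> 0"
    using tendsto_add[OF tendsto_mult_right_zero[OF decay_tendsto[OF a y], of "4 / y"]
      tendsto_mult_right_zero[OF decay_tendsto[OF b, of "1 / y"], of "4 * y"]] y by simp
  show "\<forall>\<^sub>F N in sequentially. norm (contour_integral (rectpath (Complex (- (real N + 1/2)) (- ((real N + 1/2) / y)))
      (Complex (real N + 1/2) ((real N + 1/2) / y))) kernel) \<le> ?B N"
  proof (intro always_eventually allI)
    fix N
    define X where "X = real N + 1/2"
    have X: "X > 0" by (simp add: X_def)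
    have XI: "X \<noteq> \<bar>of_int k\<bar>" for k :: int
    proof
      assume "X = \<bar>of_int k\<bar>"
      then have "real_of_int (2 * \<bar>k\<bar>) = real_of_int (2 * int N + 1)" by (simp add: X_def)
      then have "2 * \<bar>k\<bar> = 2 * int N + 1" by (simp only: of_int_eq_iff)
      then show False by presburger
    qed
    have rt: "Re (tau * w) = - y * Im w" "Im (tau * w) = y * Re w" for w by (simp_all add: tau_def)
    have nv: "norm (kernel w) \<le> decay a (y * X) / X" if "\<bar>Re w\<bar> = X" for w
    proof -
      have "\<bar>Im (tau * w)\<bar> = y * X" using that y unfolding rt by (simp add: abs_mult)
      then have "norm (lambert_kernel a (tau * w)) \<le> decay a (y * X)"
        using norm_lambert_kernel_horizontal[OF a, of "y * X"] X y by (simp add: decay_def)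
      moreover have "norm (lambert_kernel b w) \<le> 1"
        using norm_lambert_kernel_vertical[OF b] that by (simp add: X_def)
      ultimately have "norm (lambert_kernel a (tau * w)) * norm (lambert_kernel b w) \<le> decay a (y * X) * 1"
        by (intro mult_mono) (auto intro: order_trans[OF norm_ge_zero])
      moreover have "norm w \<ge> X" using abs_Re_le_cmod[of w] that by simp
      ultimately show ?thesis unfolding kernel_def norm_divide norm_mult using X
        by (intro frac_le) (auto intro: order_trans[OF mult_nonneg_nonneg[OF norm_ge_zero norm_ge_zero]])
    qed
    have nh: "norm (kernel w) \<le> decay b (X / y) / (X / y)" if "\<bar>Im w\<bar> = X / y" for w
    proof -
      have "\<bar>Re (tau * w)\<bar> = X" using that y unfolding rt by (simp add: abs_mult)
      then have "norm (lambert_kernel a (tau * w)) \<le> 1"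
        using norm_lambert_kernel_vertical[OF a, of "tau * w" N] by (simp add: X_def)
      moreover have "norm (lambert_kernel b w) \<le> decay b (X / y)"
        using norm_lambert_kernel_horizontal[OF b, of "X / y"] that X y by (simp add: decay_def)
      ultimately have "norm (lambert_kernel a (tau * w)) * norm (lambert_kernel b w) \<le> 1 * decay b (X / y)"
        by (intro mult_mono) auto
      moreover have "norm w \<ge> X / y" using abs_Im_le_cmod[of w] that by simp
      ultimately show ?thesis unfolding kernel_def norm_divide norm_mult using X y
        by (intro frac_le) (auto intro: order_trans[OF mult_nonneg_nonneg[OF norm_ge_zero norm_ge_zero]])
    qed
    have "kernel holomorphic_on path_image (rectpath (Complex (- X) (- (X / y))) (Complex X (X / y)))"
    proof (rule kernel_holomorphic)
      fix w assume "w \<in> path_image (rectpath (Complex (- X) (- (X / y))) (Complex X (X / y)))"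
      then have w: "\<bar>Re w\<bar> = X \<or> \<bar>Im w\<bar> = X / y" using X y by (auto simp: path_image_rectpath)
      have "w \<notin> \<int>"
      proof
        assume "w \<in> \<int>"
        then obtain k :: int where "w = of_int k" by (auto elim: Ints_cases)
        then show False using w XI[of k] X y by auto
      qed
      moreover have "tau * w \<notin> \<int>"
      proof
        assume "tau * w \<in> \<int>"
        then obtain k :: int where "tau * w = of_int k" by (auto elim: Ints_cases)
        then have "Re (tau * w) = of_int k" "Im (tau * w) = 0" by simp_all
        then have "- y * Im w = of_int k" "y * Re w = 0" unfolding rt by simp_all
        then have "\<bar>- y * Im w\<bar> = \<bar>of_int k\<bar>" "Re w = 0" using y by simp_all
        then have "y * \<bar>Im w\<bar> = \<bar>of_int k\<bar>" "Re w = 0" using y by (simp_all add: abs_mult)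
        then show False using w XI[of k] X y by (auto simp: field_simps)
      qed
      ultimately show "w \<notin> \<int> \<and> tau * w \<notin> \<int>" by blast
    qed
    then have "norm (contour_integral (rectpath (Complex (- X) (- (X / y))) (Complex X (X / y))) kernel) \<le>
       4 * (X / y) * (decay a (y * X) / X) + 4 * X * (decay b (X / y) / (X / y))"
      using X y by (intro norm_contour_integral_rectpath_le nv nh holomorphic_on_imp_continuous_on) auto
    also have "\<dots> = 4 / y * decay a (y * X) + 4 * y * decay b (1 / y * X)"
      using X y by (simp add: field_simps)
    finally show "norm (contour_integral (rectpath (Complex (- (real N + 1/2)) (- ((real N + 1/2) / y)))
      (Complex (real N + 1/2) ((real N + 1/2) / y))) kernel) \<le> ?B N" unfolding X_def .
  qed
qed

text \<open>Besides the origin the rectangle contains the first N poles on each of four half-axes,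
  and each half-axis contributes a partial sum of one of the four Lambert series.\<close>

lemma kernel_residue_sum:
  "contour_integral (rectpath (Complex (- (real N + 1/2)) (- ((real N + 1/2) / y)))
      (Complex (real N + 1/2) ((real N + 1/2) / y))) kernel =
    2 * of_real pi * \<i> * residue kernel 0
    - (\<Sum>m<N. theta_term a b tau m) - (\<Sum>m<N. theta_term (1 - a) (- b) tau m)
    + (\<Sum>m<N. theta_term (1 - b) a (- 1 / tau) m) + (\<Sum>m<N. theta_term b (- a) (- 1 / tau) m)"
proof -
  let ?g = "rectpath (Complex (- (real N + 1/2)) (- ((real N + 1/2) / y))) (Complex (real N + 1/2) ((real N + 1/2) / y))"
  let ?I = "{1..N}"
  define P1 where "P1 = (\<lambda>n::nat. of_nat n :: complex) ` ?I"
  define P2 where "P2 = (\<lambda>n::nat. - of_nat n :: complex) ` ?I"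
  define P3 where "P3 = (\<lambda>n::nat. of_nat n / tau) ` ?I"
  define P4 where "P4 = (\<lambda>n::nat. - of_nat n / tau) ` ?I"
  define pts where "pts = insert 0 (P1 \<union> (P2 \<union> (P3 \<union> P4)))"
  \<comment> \<open>The number 3/4 lies strictly between 1/2 and 1, so this larger box contains the
    closed rectangle but no further pole.\<close>
  define A where "A = box (Complex (- (real N + 3/4)) (- ((real N + 3/4) / y))) (Complex (real N + 3/4) ((real N + 3/4) / y))"
  have nt: "of_nat n / tau = Complex 0 (- real n / y)" "- of_nat n / tau = Complex 0 (real n / y)" for n
  proof -
    have "of_nat n / tau = - \<i> * of_real (real n / y)" using y by (simp add: tau_def field_simps)
    then show "of_nat n / tau = Complex 0 (- real n / y)" "- of_nat n / tau = Complex 0 (real n / y)"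
      by (simp_all add: complex_eq_iff)
  qed
  have h1: "(real N + 1/2) / y > 0" and h2: "(real N + 1/2) / y < (real N + 3/4) / y"
    using y by (auto simp: divide_strict_right_mono)
  have bnd: "real n / y < (real N + 1/2) / y" if "n \<le> N" for n using that y by (intro divide_strict_right_mono) auto
  have box: "p \<in> box (Complex (- (real N + 1/2)) (- ((real N + 1/2) / y))) (Complex (real N + 1/2) ((real N + 1/2) / y))"
    if "p \<in> pts" for p
  proof -
    have "real n \<ge> 0" "real n / y \<ge> 0" for n using y by auto
    then show ?thesis using that bnd h1 y
      by (auto simp: pts_def P1_def P2_def P3_def P4_def in_box_complex_iff nt intro: le_less_trans less_le_trans)
         (smt (verit, best) divide_nonneg_pos of_nat_0_le_iff bnd)+
  qed
  have "contour_integral ?g kernel = 2 * pi * \<i> * (\<Sum>p\<in>pts. winding_number ?g p * residue kernel p)"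
  proof (rule Residue_theorem)
    show "open A" "connected A" unfolding A_def by (auto intro: convex_connected convex_box)
    show "finite pts" by (simp add: pts_def P1_def P2_def P3_def P4_def)
    show "kernel holomorphic_on A - pts"
    proof (rule kernel_holomorphic)
      fix w assume w: "w \<in> A - pts"
      then have wA: "\<bar>Re w\<bar> < real N + 3/4" "\<bar>Im w\<bar> < (real N + 3/4) / y" by (auto simp: A_def in_box_complex_iff)
      have le: "nat \<bar>k\<bar> \<le> N" if "\<bar>of_int k\<bar> < real N + 3/4" for k :: int
      proof -
        have "of_int \<bar>k\<bar> < real_of_int (int N + 1)" using that by simp
        then have "\<bar>k\<bar> < int N + 1" by (simp only: of_int_less_iff)
        then show ?thesis by simp
      qed
      have "w \<notin> \<int>"
      proof
        assume "w \<in> \<int>"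
        then obtain k :: int where k: "w = of_int k" by (auto elim: Ints_cases)
        then have kN: "nat \<bar>k\<bar> \<le> N" using wA le by simp
        consider "k = 0" | "k > 0" | "k < 0" by linarith
        then have "w \<in> pts"
        proof cases
          case 1 then show ?thesis by (simp add: k pts_def)
        next
          case 2
          then have "w = of_nat (nat k)" "nat k \<in> ?I" using k kN by auto
          then show ?thesis unfolding pts_def P1_def by blast
        next
          case 3
          then have "w = - of_nat (nat (- k))" "nat (- k) \<in> ?I" using k kN by auto
          then show ?thesis unfolding pts_def P2_def by blast
        qed
        then show False using w by blast
      qed
      moreover have "tau * w \<notin> \<int>"
      proof
        assume "tau * w \<in> \<int>"
        then obtain k :: int where k: "tau * w = of_int k" by (auto elim: Ints_cases)
        then have wk: "w = of_int k / tau" by (simp add: field_simps)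
        have "Re (tau * w) = of_int k" using k by simp
        then have "- y * Im w = of_int k" by (simp add: tau_def)
        then have "\<bar>- y * Im w\<bar> = \<bar>of_int k\<bar>" by simp
        then have "y * \<bar>Im w\<bar> = \<bar>of_int k\<bar>" using y by (simp add: abs_mult)
        moreover have "y * \<bar>Im w\<bar> < real N + 3/4" using wA(2) y by (simp add: field_simps)
        ultimately have kN: "nat \<bar>k\<bar> \<le> N" using le by simp
        consider "k = 0" | "k > 0" | "k < 0" by linarith
        then have "w \<in> pts"
        proof cases
          case 1 then show ?thesis by (simp add: wk pts_def)
        next
          case 2
          then have "w = of_nat (nat k) / tau" "nat k \<in> ?I" using wk kN by auto
          then show ?thesis unfolding pts_def P3_def by blast
        next
          case 3
          then have "w = - of_nat (nat (- k)) / tau" "nat (- k) \<in> ?I" using wk kN by auto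
          then show ?thesis unfolding pts_def P4_def by blast
        qed
        then show False using w by blast
      qed
      ultimately show "w \<notin> \<int> \<and> tau * w \<notin> \<int>" by blast
    qed
    show "valid_path ?g" "pathfinish ?g = pathstart ?g" by auto
    have sub: "path_image ?g \<subseteq> cbox (Complex (- (real N + 1/2)) (- ((real N + 1/2) / y))) (Complex (real N + 1/2) ((real N + 1/2) / y))"
      using h1 by (intro path_image_rectpath_subset_cbox) auto
    have subA: "cbox (Complex (- (real N + 1/2)) (- ((real N + 1/2) / y))) (Complex (real N + 1/2) ((real N + 1/2) / y)) \<subseteq> A"
      unfolding A_def using h2 by (auto simp: in_box_complex_iff in_cbox_complex_iff)
    have "path_image ?g \<inter> pts = {}"
      using box h1 by (auto simp: path_image_rectpath_cbox_minus_box)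
    then show "path_image ?g \<subseteq> A - pts" using sub subA by blast
    show "\<forall>z. z \<notin> A \<longrightarrow> winding_number ?g z = 0"
      using subA h1 by (intro allI impI winding_number_rectpath_outside) auto
  qed
  also have "(\<Sum>p\<in>pts. winding_number ?g p * residue kernel p) = (\<Sum>p\<in>pts. residue kernel p)"
    using winding_number_rectpath[OF box] by (intro sum.cong) auto
  also have "\<dots> = residue kernel 0 + ((\<Sum>p\<in>P1. residue kernel p) + ((\<Sum>p\<in>P2. residue kernel p) +
     ((\<Sum>p\<in>P3. residue kernel p) + (\<Sum>p\<in>P4. residue kernel p))))"
  proof -
    have fin: "finite P1" "finite P2" "finite P3" "finite P4" by (auto simp: P1_def P2_def P3_def P4_def)
    have c1: "Re p > 0" if "p \<in> P1" for p using that by (auto simp: P1_def)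
    have c2: "Re p < 0" if "p \<in> P2" for p using that by (auto simp: P2_def)
    have c3: "Re p = 0 \<and> Im p < 0" if "p \<in> P3" for p using that y by (auto simp: P3_def nt)
    have c4: "Re p = 0 \<and> Im p > 0" if "p \<in> P4" for p using that y by (auto simp: P4_def nt)
    have "P3 \<inter> P4 = {}" "P2 \<inter> (P3 \<union> P4) = {}" "P1 \<inter> (P2 \<union> (P3 \<union> P4)) = {}" "0 \<notin> P1 \<union> (P2 \<union> (P3 \<union> P4))"
      using c1 c2 c3 c4 by (fastforce+)
    then show ?thesis unfolding pts_def using fin by (simp add: sum.union_disjoint)
  qed
  also have "2 * pi * \<i> * \<dots> = 2 * of_real pi * \<i> * residue kernel 0
    - (\<Sum>m<N. theta_term a b tau m) - (\<Sum>m<N. theta_term (1 - a) (- b) tau m)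
    + (\<Sum>m<N. theta_term (1 - b) a (- 1 / tau) m) + (\<Sum>m<N. theta_term b (- a) (- 1 / tau) m)"
  proof -
    \<comment> \<open>Poles are counted from 1, the terms of the series from 0.\<close>
    have shift: "(\<Sum>n\<in>?I. g (n - 1)) = (\<Sum>m<N. g m)" for g :: "nat \<Rightarrow> complex"
      by (rule sum.reindex_bij_witness[of _ Suc "\<lambda>n. n - 1"]) auto
    have 1: "(\<Sum>p\<in>P1. residue kernel p) = (\<Sum>m<N. - theta_term a b tau m / (2 * of_real pi * \<i>))"
    proof -
      have "(\<Sum>p\<in>P1. residue kernel p) = (\<Sum>n\<in>?I. residue kernel (of_nat n))"
        unfolding P1_def by (subst sum.reindex) (auto simp: inj_on_def)
      also have "\<dots> = (\<Sum>n\<in>?I. - theta_term a b tau (n - 1) / (2 * of_real pi * \<i>))"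
        by (intro sum.cong refl residue_kernel_int) auto
      finally show ?thesis using shift[of "\<lambda>m. - theta_term a b tau m / (2 * of_real pi * \<i>)"] by simp
    qed
    have 2: "(\<Sum>p\<in>P2. residue kernel p) = (\<Sum>m<N. - theta_term (1 - a) (- b) tau m / (2 * of_real pi * \<i>))"
    proof -
      have "(\<Sum>p\<in>P2. residue kernel p) = (\<Sum>n\<in>?I. residue kernel (- of_nat n))"
        unfolding P2_def by (subst sum.reindex) (auto simp: inj_on_def)
      also have "\<dots> = (\<Sum>n\<in>?I. - theta_term (1 - a) (- b) tau (n - 1) / (2 * of_real pi * \<i>))"
        by (intro sum.cong refl residue_kernel_int) auto
      finally show ?thesis using shift[of "\<lambda>m. - theta_term (1 - a) (- b) tau m / (2 * of_real pi * \<i>)"] by simp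
    qed
    have 3: "(\<Sum>p\<in>P3. residue kernel p) = (\<Sum>m<N. theta_term (1 - b) a (- 1 / tau) m / (2 * of_real pi * \<i>))"
    proof -
      have "(\<Sum>p\<in>P3. residue kernel p) = (\<Sum>n\<in>?I. residue kernel (of_nat n / tau))"
        unfolding P3_def by (subst sum.reindex) (auto simp: inj_on_def)
      also have "\<dots> = (\<Sum>n\<in>?I. theta_term (1 - b) a (- 1 / tau) (n - 1) / (2 * of_real pi * \<i>))"
        by (intro sum.cong refl residue_kernel_inv_tau) auto
      finally show ?thesis using shift[of "\<lambda>m. theta_term (1 - b) a (- 1 / tau) m / (2 * of_real pi * \<i>)"] by simp
    qed
    have 4: "(\<Sum>p\<in>P4. residue kernel p) = (\<Sum>m<N. theta_term b (- a) (- 1 / tau) m / (2 * of_real pi * \<i>))"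
    proof -
      have "(\<Sum>p\<in>P4. residue kernel p) = (\<Sum>n\<in>?I. residue kernel (- of_nat n / tau))"
        unfolding P4_def by (subst sum.reindex) (auto simp: inj_on_def)
      also have "\<dots> = (\<Sum>n\<in>?I. theta_term b (- a) (- 1 / tau) (n - 1) / (2 * of_real pi * \<i>))"
        by (intro sum.cong refl residue_kernel_inv_tau) auto
      finally show ?thesis using shift[of "\<lambda>m. theta_term b (- a) (- 1 / tau) m / (2 * of_real pi * \<i>)"] by simp
    qed
    have *: "2 * of_real pi * \<i> * (\<Sum>m<N. g m / (2 * of_real pi * \<i>)) = (\<Sum>m<N. g m)" for g :: "nat \<Rightarrow> complex"
      by (simp add: sum_distrib_left)
    show ?thesis unfolding 1 2 3 4 distrib_left of_real_mult of_real_numeral * by (simp add: sum_negf)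
  qed
  finally show ?thesis .
qed

lemma log_theta_inversion_imaginary:
  "log_theta b (- a) (- 1 / tau) + log_theta (1 - b) a (- 1 / tau) - log_theta a b tau - log_theta (1 - a) (- b) tau =
    2 * of_real pi * \<i> * (tau * of_real (a^2 - a + 1/6) / 2 + of_real (b^2 - b + 1/6) / (2 * tau)
      + of_real ((a - 1/2) * (b - 1/2)))"
proof -
  have "(\<lambda>N. 2 * of_real pi * \<i> * residue kernel 0
    - (\<Sum>m<N. theta_term a b tau m) - (\<Sum>m<N. theta_term (1 - a) (- b) tau m)
    + (\<Sum>m<N. theta_term (1 - b) a (- 1 / tau) m) + (\<Sum>m<N. theta_term b (- a) (- 1 / tau) m)) \<longlonglongrightarrow>
    2 * of_real pi * \<i> * residue kernel 0 - - log_theta a b tau - - log_theta (1 - a) (- b) tau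
     + - log_theta (1 - b) a (- 1 / tau) + - log_theta b (- a) (- 1 / tau)"
    using a b Im_tau Im_inv_tau
    by (intro tendsto_add tendsto_diff tendsto_const theta_term_sums[unfolded sums_def]) auto
  moreover have "(\<lambda>N. 2 * of_real pi * \<i> * residue kernel 0
    - (\<Sum>m<N. theta_term a b tau m) - (\<Sum>m<N. theta_term (1 - a) (- b) tau m)
    + (\<Sum>m<N. theta_term (1 - b) a (- 1 / tau) m) + (\<Sum>m<N. theta_term b (- a) (- 1 / tau) m)) \<longlonglongrightarrow> 0"
    using kernel_contour_integral_tendsto unfolding kernel_residue_sum .
  ultimately have "2 * of_real pi * \<i> * residue kernel 0 - - log_theta a b tau - - log_theta (1 - a) (- b) tau
     + - log_theta (1 - b) a (- 1 / tau) + - log_theta b (- a) (- 1 / tau) = 0"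
    by (rule LIMSEQ_unique)
  then show ?thesis unfolding residue_kernel_0 by (simp add: algebra_simps)
qed

end

text \<open>Both sides are holomorphic in z and agree on the positive imaginary axis, which
  accumulates at i.\<close>

theorem log_theta_inversion:
  assumes a: "0 < a" "a < 1" and b: "0 < b" "b < 1" and z: "Im z > 0"
  shows "log_theta b (- a) (- 1 / z) + log_theta (1 - b) a (- 1 / z) - log_theta a b z - log_theta (1 - a) (- b) z =
    2 * of_real pi * \<i> * (z * of_real (a^2 - a + 1/6) / 2 + of_real (b^2 - b + 1/6) / (2 * z)
      + of_real ((a - 1/2) * (b - 1/2)))"
proof -
  define f where "f = (\<lambda>z. log_theta b (- a) (- 1 / z) + log_theta (1 - b) a (- 1 / z) - log_theta a b z - log_theta (1 - a) (- b) z -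
    2 * of_real pi * \<i> * (z * of_real (a^2 - a + 1/6) / 2 + of_real (b^2 - b + 1/6) / (2 * z)
      + of_real ((a - 1/2) * (b - 1/2))))"
  let ?H = "{z. Im z > 0}"
  define U where "U = {\<i> * of_real y | y. y > (0::real)}"
  have inv: "Im (- 1 / z) > 0" if "Im z > 0" for z
  proof -
    have "z \<noteq> 0" using that by auto
    then have "(Re z)^2 + (Im z)^2 > 0" by (simp add: complex_neq_0)
    then show ?thesis using that by (simp add: Im_divide)
  qed
  have hol: "(\<lambda>z. log_theta x t (- 1 / z)) holomorphic_on ?H" if "x > 0" for x t
  proof -
    have "(\<lambda>z. - 1 / z) holomorphic_on ?H" by (intro holomorphic_intros) auto
    moreover have "(\<lambda>z. - 1 / z) ` ?H \<subseteq> ?H" using inv by blast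
    ultimately show ?thesis
      using holomorphic_on_compose_gen[OF _ log_theta_holomorphic[OF that]] unfolding o_def by blast
  qed
  have "f holomorphic_on ?H" unfolding f_def
    using a b by (intro holomorphic_intros hol log_theta_holomorphic) auto
  moreover have "open ?H" by (rule open_halfspace_Im_gt)
  moreover have "connected ?H" by (intro convex_connected convex_halfspace_Im_gt)
  moreover have "U \<subseteq> ?H" by (auto simp: U_def)
  moreover have "\<i> \<in> ?H" by simp
  moreover have "\<i> islimpt U"
    unfolding islimpt_approachable
  proof (intro allI impI)
    fix e :: real assume e: "e > 0"
    have "\<i> * of_real (1 + e / 2) \<in> U" unfolding U_def using e by (intro CollectI exI[of _ "1 + e / 2"]) auto
    moreover have "\<i> * of_real (1 + e / 2) \<noteq> \<i>" using e by (simp add: complex_eq_iff)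
    moreover have "\<i> * of_real (1 + e / 2) - \<i> = \<i> * of_real (e / 2)" by (simp add: algebra_simps)
    then have "norm (\<i> * of_real (1 + e / 2) - \<i>) = norm (\<i> * of_real (e / 2))" by (rule arg_cong)
    then have "dist (\<i> * of_real (1 + e / 2)) \<i> < e"
      unfolding dist_norm norm_mult norm_ii norm_of_real using e by simp
    ultimately show "\<exists>x'\<in>U. x' \<noteq> \<i> \<and> dist x' \<i> < e" by blast
  qed
  moreover have "f w = 0" if "w \<in> U" for w
  proof -
    obtain y where y: "y > 0" "w = \<i> * of_real y" using \<open>w \<in> U\<close> by (auto simp: U_def)
    have "tau y = w" using tau_def[OF a b y(1)] y by simp
    then show ?thesis using log_theta_inversion_imaginary[OF a b y(1)] by (simp add: f_def)
  qed
  ultimately have "f z = 0" using z by (intro analytic_continuation[of f ?H U \<i> z]) auto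
  then show ?thesis by (simp add: f_def)
qed

text \<open>A logarithm of the product of a Siegel unit without its power of q. The leading factor
  is split off because \<open>log_theta a b z\<close> makes sense for positive \<open>a\<close>
  only, while this form is also continuous at a = 0 when b is not integral.\<close>

definition log_siegel :: "real \<Rightarrow> real \<Rightarrow> complex \<Rightarrow> complex" where
  "log_siegel a b z = Ln (1 - ee (of_real a * z + of_real b)) + log_theta (a + 1) b z + log_theta (1 - a) (- b) z"

lemma log_siegel_pos: "a > 0 \<Longrightarrow> Im z > 0 \<Longrightarrow> log_siegel a b z = log_theta a b z + log_theta (1 - a) (- b) z"
  by (simp add: log_siegel_def log_theta_shift[of z a b])

lemma isCont_log_theta:
  assumes z: "Im z > 0" and "isCont f t" "isCont g t" "f t > 0"
  shows "isCont (\<lambda>t. log_theta (f t) (g t) z) t"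
proof -
  have "open {p :: real \<times> real. fst p > 0}" by (intro open_Collect_less continuous_intros)
  then have "isCont (\<lambda>p. log_theta (fst p) (snd p) z) (f t, g t)"
    using log_theta_continuous[OF z] assms(4) by (simp add: continuous_on_eq_continuous_at del: split_paired_All)
  moreover have "isCont (\<lambda>t. (f t, g t)) t" using assms(2,3) by (rule isCont_Pair)
  ultimately show ?thesis using isCont_o2[where f = "\<lambda>t. (f t, g t)" and g = "\<lambda>p. log_theta (fst p) (snd p) z"]
    by simp
qed

lemma isCont_Ln_1_minus_ee:
  assumes "isCont f t" "Im (f t) \<ge> 0" "f t \<notin> \<int>"
  shows "isCont (\<lambda>t::real. Ln (1 - ee (f t))) t"
proof -
  have "Re (ee (f t)) < 1" using assms by (intro Re_less_1 norm_ee_le_1) (auto simp: ee_eq_1_iff)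
  then have "1 - ee (f t) \<notin> \<real>\<^sub>\<le>\<^sub>0" by (simp add: complex_nonpos_Reals_iff)
  then show ?thesis using assms(1) unfolding ee_def by (intro continuous_intros) auto
qed

lemma of_real_notin_Ints: "0 < b \<Longrightarrow> b < 1 \<Longrightarrow> (of_real b :: complex) \<notin> \<int>"
proof
  assume b: "0 < b" "b < 1" and "(of_real b :: complex) \<in> \<int>"
  then obtain n :: int where "(of_real b :: complex) = of_int n" by (auto elim: Ints_cases)
  then have "b = of_int n" by (simp add: complex_eq_iff)
  then show False using b by auto
qed

text \<open>Inside the open square this is \<open>log_theta_inversion\<close>. On the two edges both
  sides are continuous in the vanishing parameter; the corner is excluded since there the logarithm
  has a singularity.\<close>

theorem log_siegel_inversion:
  assumes a: "0 \<le> a" "a < 1" and b: "0 \<le> b" "b < 1" and ab: "\<not> (a = 0 \<and> b = 0)" and z: "Im z > 0"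
  shows "log_siegel b (- a) (- 1 / z) - log_siegel a b z =
    2 * of_real pi * \<i> * (z * of_real (a^2 - a + 1/6) / 2 + of_real (b^2 - b + 1/6) / (2 * z)
      + of_real ((a - 1/2) * (b - 1/2)))"
proof -
  define R where "R = (\<lambda>a b. 2 * of_real pi * \<i> * (z * of_real (a^2 - a + 1/6) / 2 + of_real (b^2 - b + 1/6) / (2 * z)
      + of_real ((a - 1/2) * (b - 1/2))))"
  define t where "t = - 1 / z"
  define L where "L = (\<lambda>a b. log_siegel b (- a) t - log_siegel a b z)"
  have z': "Im t > 0"
  proof -
    have "z \<noteq> 0" using z by auto
    then have "(Re z)^2 + (Im z)^2 > 0" by (simp add: complex_neq_0)
    then show ?thesis using z by (simp add: t_def Im_divide)
  qed
  have gen: "L a b = R a b" if "0 < a" "a < 1" "0 < b" "b < 1" for a b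
  proof -
    have "L a b = log_theta b (- a) t + log_theta (1 - b) a t - log_theta a b z - log_theta (1 - a) (- b) z"
      unfolding L_def log_siegel_pos[OF that(1) z] log_siegel_pos[OF that(3) z'] by simp
    then show ?thesis using log_theta_inversion[OF that z] unfolding R_def t_def by (simp only:)
  qed
  \<comment> \<open>Right-hand limits suffice: the formula is available only for positive
    parameters.\<close>
  have lim: "f 0 = g 0" if "isCont f 0" "isCont g 0" "\<And>t. 0 < t \<Longrightarrow> t < 1 \<Longrightarrow> f t = g t" for f g :: "real \<Rightarrow> complex"
  proof -
    have fg: "(f \<longlongrightarrow> f 0) (at_right 0)" "(g \<longlongrightarrow> g 0) (at_right 0)"
      using that(1,2) unfolding isCont_def filterlim_at_split by blast+
    have "\<forall>\<^sub>F t in at_right 0. t \<in> {0<..<1::real}" by (rule eventually_at_right_real) simp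
    then have "\<forall>\<^sub>F t in at_right 0. f t = g t" by eventually_elim (use that(3) in auto)
    then have "(g \<longlongrightarrow> f 0) (at_right 0)" using fg(1) tendsto_cong by blast
    from tendsto_unique[OF trivial_limit_at_right_real this fg(2)] show ?thesis .
  qed
  consider "a = 0" "b > 0" | "a > 0" "b = 0" | "a > 0" "b > 0" using a b ab by linarith
  then have "L a b = R a b"
  proof cases
    case 1
    have "L 0 b = R 0 b"
    proof (rule lim[of "\<lambda>a. L a b" "\<lambda>a. R a b"])
      have "isCont (\<lambda>a. log_siegel a b z) 0" unfolding log_siegel_def
        using 1 b z of_real_notin_Ints[of b]
        by (intro continuous_intros isCont_log_theta isCont_Ln_1_minus_ee) auto
      moreover have "isCont (\<lambda>a. log_siegel b (- a) t) 0" unfolding log_siegel_def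
      proof (intro isCont_add isCont_log_theta isCont_Ln_1_minus_ee)
        have "Im (of_real b * t + of_real (- 0)) > 0" using 1 z' by (simp add: mult_pos_pos)
        then show "Im (of_real b * t + of_real (- 0)) \<ge> 0" "of_real b * t + of_real (- 0) \<notin> \<int>"
          using Im_pos_notin_Ints by (simp, blast)
      qed (use 1 b z' in \<open>auto intro!: continuous_intros\<close>)
      ultimately show "isCont (\<lambda>a. L a b) 0" unfolding L_def by (intro continuous_intros)
      show "isCont (\<lambda>a. R a b) 0" unfolding R_def by (intro continuous_intros) auto
    qed (use gen 1 b in blast)
    then show ?thesis using 1 by simp
  next
    case 2
    have "L a 0 = R a 0"
    proof (rule lim[of "\<lambda>b. L a b" "\<lambda>b. R a b"])
      have "isCont (\<lambda>b. log_siegel a b z) 0" unfolding log_siegel_def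
      proof (intro isCont_add isCont_log_theta isCont_Ln_1_minus_ee)
        have "Im (of_real a * z + of_real 0) > 0" using 2 z by (simp add: mult_pos_pos)
        then show "Im (of_real a * z + of_real 0) \<ge> 0" "of_real a * z + of_real 0 \<notin> \<int>"
          using Im_pos_notin_Ints by (simp, blast)
      qed (use 2 a z in \<open>auto intro!: continuous_intros\<close>)
      moreover have "isCont (\<lambda>b. log_siegel b (- a) t) 0" unfolding log_siegel_def
      proof (intro isCont_add isCont_log_theta isCont_Ln_1_minus_ee)
        have "(of_real (- a) :: complex) \<notin> \<int>" using of_real_notin_Ints[of a] 2 a by simp
        then show "of_real 0 * t + of_real (- a) \<notin> \<int>" by simp
      qed (use 2 a z' in \<open>auto intro!: continuous_intros\<close>)
      ultimately show "isCont (\<lambda>b. L a b) 0" unfolding L_def by (intro continuous_intros)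
      show "isCont (\<lambda>b. R a b) 0" unfolding R_def using z by (intro continuous_intros) auto
    qed (use gen 2 a in blast)
    then show ?thesis using 2 by simp
  qed (use gen a b in blast)
  then show ?thesis unfolding L_def R_def t_def .
qed

section \<open>Distribution relations\<close>

lemma of_real_of_rat [simp]: "complex_of_real (of_rat x) = of_rat x"
  by (cases x rule: rat_as_quotient) (simp add: of_rat_divide)

lemma Re_of_rat [simp]: "Re (of_rat x) = of_rat x" and Im_of_rat [simp]: "Im (of_rat x) = 0"
  by (simp_all flip: of_real_of_rat)

lemma frac_add_of_int [simp]: "frac (x + of_int n) = frac (x::rat)"
  by (simp add: frac_def)

lemma Ints_add_of_int_iff: "x + of_int n \<in> \<int> \<longleftrightarrow> (x::rat) \<in> \<int>"
  by (metis Ints_add Ints_diff Ints_of_int add_diff_cancel)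

lemma sum_divide_reindex:
  fixes F :: "rat \<Rightarrow> 'a::comm_monoid_add"
  assumes per: "\<And>x n. F (x + of_int n) = F x" and K: "K > 0" and d: "coprime d (int K)"
  shows "(\<Sum>i<K. F ((x + of_int (d * int i + e)) / of_nat K)) = (\<Sum>i<K. F ((x + of_nat i) / of_nat K))"
proof -
  have "F ((x + of_int (y + int K)) / of_nat K) = F ((x + of_int y) / of_nat K)" for y
  proof -
    have "(x + of_int (y + int K)) / of_nat K = (x + of_int y) / of_nat K + of_int 1"
      using K by (simp add: field_simps)
    then show ?thesis by (simp only: per)
  qed
  from sum_periodic_reindex[of "\<lambda>y. F ((x + of_int y) / of_nat K)" K d e, OF this K d] show ?thesis by simp
qed

lemma sum_divide_mod:
  fixes F :: "rat \<Rightarrow> 'a::comm_monoid_add"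
  assumes per: "\<And>x n. F (x + of_int n) = F x" and K: "K > 0" and "x - y \<in> \<int>"
  shows "(\<Sum>i<K. F ((x + of_nat i) / of_nat K)) = (\<Sum>i<K. F ((y + of_nat i) / of_nat K))"
proof -
  obtain n where n: "x - y = of_int n" using assms(3) by (rule Ints_cases)
  then have "x + of_nat i = y + of_int (1 * int i + n)" for i by (simp add: algebra_simps)
  then show ?thesis using sum_divide_reindex[OF per K coprime_1_left, of y n] by (simp only:)
qed

lemma frac_quotient:
  fixes y :: rat assumes "0 \<le> y" "y < 1" "i < K" shows "frac ((y + of_nat i) / of_nat K) = (y + of_nat i) / of_nat K"
proof -
  have "(of_nat (Suc i) :: rat) \<le> of_nat K" using assms(3) by (simp only: of_nat_le_iff)
  then have "y + of_nat i < of_nat K" using assms by simp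
  then show ?thesis using assms by (simp add: frac_eq)
qed

lemma sum_bern1:
  assumes K: "K > 0" shows "(\<Sum>i<K. bern1 ((x + of_nat i) / of_nat K)) = bern1 x"
proof -
  have s: "(\<Sum>i<n. (y + of_nat i)) = of_nat n * y + of_nat n * (of_nat n - 1) / 2" for n and y :: rat
    by (induction n) (simp_all add: field_simps)
  have *: "(\<Sum>i<K. (frac x + of_nat i) / of_nat K - 1 / 2) = (\<Sum>i<K. frac x + of_nat i) / of_nat K - of_nat K / 2"
    by (simp add: sum_subtractf sum_divide_distrib)
  have "(\<Sum>i<K. bern1 ((x + of_nat i) / of_nat K)) = (\<Sum>i<K. bern1 ((frac x + of_nat i) / of_nat K))"
    using K by (intro sum_divide_mod) (simp_all add: bern1_def frac_def)
  also have "\<dots> = (\<Sum>i<K. (frac x + of_nat i) / of_nat K - 1 / 2)"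
    by (intro sum.cong refl) (simp add: bern1_def frac_quotient frac_lt_1)
  also have "\<dots> = bern1 x"
    using K unfolding * s by (simp add: bern1_def field_simps)
  finally show ?thesis .
qed

text \<open>The weight 1/K is compensated by the K equal terms of the constant function in the
  second variable.\<close>

lemma sum_bern2:
  assumes K: "K > 0" shows "(\<Sum>i<K. bern2 (frac ((x + of_nat i) / of_nat K))) = bern2 (frac x) / of_nat K"
proof -
  have s: "(\<Sum>i<n. bern2 ((y + of_nat i) / k)) =
     (of_nat n * y^2 + y * of_nat n * (of_nat n - 1) + of_nat n * (of_nat n - 1) * (2 * of_nat n - 1) / 6) / k^2
     - (of_nat n * y + of_nat n * (of_nat n - 1) / 2) / k + of_nat n / 6" if "k \<noteq> 0" for n and y k :: rat
  proof (induction n)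
    case (Suc n)
    show ?case unfolding sum.lessThan_Suc Suc.IH using that by (simp add: bern2_def field_simps power2_eq_square)
  qed simp
  have "(\<Sum>i<K. bern2 (frac ((x + of_nat i) / of_nat K))) = (\<Sum>i<K. bern2 (frac ((frac x + of_nat i) / of_nat K)))"
    using K by (intro sum_divide_mod[where F = "\<lambda>x. bern2 (frac x)"]) (simp_all add: frac_def)
  also have "\<dots> = (\<Sum>i<K. bern2 ((frac x + of_nat i) / of_nat K))"
    by (intro sum.cong refl) (simp add: frac_quotient frac_lt_1)
  also have "\<dots> = bern2 (frac x) / of_nat K"
    using K by (simp add: s) (simp add: bern2_def field_simps power2_eq_square)
  finally show ?thesis .
qed

lemma delta0_add_of_int: "delta0 (x + of_int n) = delta0 x"
  by (simp add: delta0_def Ints_add_of_int_iff)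

lemma quotient_in_Ints_iff:
  assumes "0 \<le> y" "y < 1" "i < K"
  shows "(y + of_nat i) / of_nat K \<in> (\<int> :: rat set) \<longleftrightarrow> y = 0 \<and> i = 0"
proof -
  have "(y + of_nat i) / of_nat K \<in> (\<int> :: rat set) \<longleftrightarrow> frac ((y + of_nat i) / of_nat K) = 0" by simp
  also have "\<dots> \<longleftrightarrow> y + of_nat i = 0" using assms by (simp add: frac_quotient)
  also have "\<dots> \<longleftrightarrow> y = 0 \<and> i = 0" using assms(1) by (simp add: add_nonneg_eq_0_iff)
  finally show ?thesis .
qed

lemma sum_delta0:
  assumes K: "K > 0" shows "(\<Sum>i<K. delta0 ((x + of_nat i) / of_nat K)) = (delta0 x :: 'a::comm_ring_1)"
proof -
  have "(\<Sum>i<K. delta0 ((x + of_nat i) / of_nat K)) = (\<Sum>i<K. delta0 ((frac x + of_nat i) / of_nat K) :: 'a)"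
    using K by (intro sum_divide_mod) (simp_all add: delta0_add_of_int frac_def)
  also have "\<dots> = (\<Sum>i<K. if i = 0 then delta0 x else 0)"
    by (intro sum.cong refl) (auto simp: delta0_def quotient_in_Ints_iff frac_lt_1)
  also have "\<dots> = delta0 x" using K by simp
  finally show ?thesis .
qed

lemma bern1'_eq: "bern1' x = bern1 x + 1 / 2 * delta0 x"
  by (simp add: bern1'_def bern1_def delta0_def)

lemma sum_bern1':
  "K > 0 \<Longrightarrow> (\<Sum>i<K. bern1' ((x + of_nat i) / of_nat K)) = bern1' x"
  by (simp add: bern1'_eq sum.distrib sum_bern1 sum_delta0 flip: sum_divide_distrib)

lemma bern1_add_of_int: "bern1 (x + of_int n) = bern1 x"
  by (simp add: bern1_def)

text \<open>Representatives modulo \<open>1\<close> are taken in \<open>(0, 1]\<close>, where the Lambert series converge.\<close>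

definition log_theta_mod :: "rat \<Rightarrow> rat \<Rightarrow> complex \<Rightarrow> complex" where
  "log_theta_mod a b z = log_theta (of_rat (1 - frac (- a))) (of_rat b) z"

lemma upfrac_pos: "(0::real) < of_rat (1 - frac (- a))"
  using frac_lt_1[of "- a"] by simp

lemma log_theta_mod_add_of_int: "log_theta_mod (a + of_int m) (b + of_int n) z = log_theta_mod a b z"
proof -
  have "frac (- (a + of_int m)) = frac (- a)" using frac_add_of_int[of "- a" "- m"] by simp
  then show ?thesis by (simp add: log_theta_mod_def of_rat_add log_theta_periodic)
qed

lemma upfrac_quotient:
  fixes y :: rat assumes "0 < y" "y \<le> 1" "i < K"
  shows "1 - frac (- ((y + of_nat i) / of_nat K)) = (y + of_nat i) / of_nat K"
proof -
  have "(of_nat (Suc i) :: rat) \<le> of_nat K" using assms(3) by (simp only: of_nat_le_iff)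
  then have le: "(y + of_nat i) / of_nat K \<le> 1" using assms by (simp add: field_simps)
  have "(y + of_nat i) / of_nat K > 0" using assms by (intro divide_pos_pos) (simp_all add: add_pos_nonneg)
  then have "frac (- ((y + of_nat i) / of_nat K)) = 1 - (y + of_nat i) / of_nat K"
    unfolding frac_unique_iff using le by simp
  then show ?thesis by simp
qed

lemma log_theta_mod_sum_fst:
  assumes K: "K > 0"
  shows "(\<Sum>i<K. \<Sum>j<K. log_theta_mod ((a + of_nat i) / of_nat K) ((b + of_nat j) / of_nat K) z) =
   (\<Sum>i<K. \<Sum>j<K. log_theta ((of_rat (1 - frac (- a)) + real i) / real K) ((of_rat b + real j) / real K) z)"
proof -
  let ?y = "1 - frac (- a)"
  have y: "0 < ?y" "?y \<le> 1" using frac_lt_1[of "- a"] by simp_all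
  have per: "log_theta_mod (a + of_int m) b z = log_theta_mod a b z" for a b m
    using log_theta_mod_add_of_int[of a m b 0] by simp
  have "a - ?y = - of_int \<lfloor>- a\<rfloor> - 1" by (simp add: frac_def)
  then have ay: "a - ?y \<in> \<int>" by (simp only:) (intro Ints_diff Ints_minus Ints_of_int Ints_1)
  have "(\<Sum>i<K. \<Sum>j<K. log_theta_mod ((a + of_nat i) / of_nat K) ((b + of_nat j) / of_nat K) z) =
    (\<Sum>i<K. \<Sum>j<K. log_theta_mod ((?y + of_nat i) / of_nat K) ((b + of_nat j) / of_nat K) z)"
    by (rule sum_divide_mod[where F = "\<lambda>x. \<Sum>j<K. log_theta_mod x ((b + of_nat j) / of_nat K) z"])
       (simp_all only: per K ay)
  also have "\<dots> = (\<Sum>i<K. \<Sum>j<K. log_theta ((of_rat ?y + real i) / real K) ((of_rat b + real j) / real K) z)"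
    unfolding log_theta_mod_def
  proof (intro sum.cong refl)
    fix i j assume "i \<in> {..<K}"
    then have "1 - frac (- ((?y + of_nat i) / of_nat K)) = (?y + of_nat i) / of_nat K"
      using upfrac_quotient[OF y] by blast
    then show "log_theta (of_rat (1 - frac (- ((?y + of_nat i) / of_nat K)))) (of_rat ((b + of_nat j) / of_nat K)) z =
      log_theta ((of_rat ?y + real i) / real K) ((of_rat b + real j) / real K) z"
      by (simp add: of_rat_add of_rat_divide)
  qed
  finally show ?thesis .
qed

lemma log_theta_mod_sum:
  assumes K: "K > 0" and z: "Im z > 0"
  shows "(\<Sum>i<K. \<Sum>j<K. log_theta_mod ((a + of_nat i) / of_nat K) ((b + of_nat j) / of_nat K) z) = log_theta_mod a b z"
  unfolding log_theta_mod_sum_fst[OF K] log_theta_mult(2)[OF z upfrac_pos K] by (simp add: log_theta_mod_def)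

text \<open>Negating the division points of (a, b) permutes those of (-a, -b).\<close>

lemma log_theta_mod_sum_uminus:
  assumes K: "K > 0" and z: "Im z > 0"
  shows "(\<Sum>i<K. \<Sum>j<K. log_theta_mod (- ((a + of_nat i) / of_nat K)) (- ((b + of_nat j) / of_nat K)) z) =
    log_theta_mod (- a) (- b) z"
proof -
  have perx: "log_theta_mod (a + of_int m) b z = log_theta_mod a b z"
    and pery: "log_theta_mod a (b + of_int m) z = log_theta_mod a b z" for a b m
    using log_theta_mod_add_of_int[of a m b 0] log_theta_mod_add_of_int[of a 0 b m] by simp_all
  have arg: "- ((x + of_nat i) / of_nat K) = (- x + of_int ((-1) * int i + 0)) / of_nat K" for x :: rat and i
    by (simp add: field_simps minus_divide_left)
  have cop: "coprime (- 1) (int K)" by simp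
  have "(\<Sum>i<K. \<Sum>j<K. log_theta_mod (- ((a + of_nat i) / of_nat K)) (- ((b + of_nat j) / of_nat K)) z) =
    (\<Sum>i<K. \<Sum>j<K. log_theta_mod (- ((a + of_nat i) / of_nat K)) ((- b + of_nat j) / of_nat K) z)"
    unfolding arg[of b]
    by (intro sum.cong refl sum_divide_reindex[where F = "\<lambda>y. log_theta_mod x y z" for x] pery K cop)
  also have "\<dots> = (\<Sum>i<K. \<Sum>j<K. log_theta_mod ((- a + of_nat i) / of_nat K) ((- b + of_nat j) / of_nat K) z)"
    unfolding arg[of a]
    by (rule sum_divide_reindex[where F = "\<lambda>x. \<Sum>j<K. log_theta_mod x ((- b + of_nat j) / of_nat K) z"])
       (simp_all only: perx K cop)
  also have "\<dots> = log_theta_mod (- a) (- b) z" by (rule log_theta_mod_sum[OF K z])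
  finally show ?thesis .
qed

definition log_u :: "rat \<Rightarrow> rat \<Rightarrow> complex \<Rightarrow> complex" where
  "log_u a b z = log_theta_mod a b z + log_theta_mod (- a) (- b) z"

lemma log_u_add_of_int: "log_u (a + of_int m) (b + of_int n) z = log_u a b z"
  using log_theta_mod_add_of_int[of a m b n z] log_theta_mod_add_of_int[of "- a" "- m" "- b" "- n" z]
  by (simp add: log_u_def)

lemma log_u_sum:
  assumes K: "K > 0" and z: "Im z > 0"
  shows "(\<Sum>i<K. \<Sum>j<K. log_u ((a + of_nat i) / of_nat K) ((b + of_nat j) / of_nat K) z) = log_u a b z"
  by (simp add: log_u_def sum.distrib log_theta_mod_sum[OF K z] log_theta_mod_sum_uminus[OF K z])

lemma upper_half_iff: "z \<in> upper_half \<longleftrightarrow> Im z > 0"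
  by (simp add: upper_half_def)

lemma log_u_holomorphic: "(\<lambda>z. log_u a b z) holomorphic_on upper_half"
  unfolding log_u_def log_theta_mod_def upper_half_def
  by (intro holomorphic_on_add log_theta_holomorphic upfrac_pos)

lemma log_u_tendsto_0: "((\<lambda>Y. log_u a b (Complex t Y)) \<longlongrightarrow> 0) at_top"
  unfolding log_u_def log_theta_mod_def
  by (rule tendsto_eq_intros log_theta_tendsto_0 upfrac_pos)+ simp

lemma log_theta_prodinf:
  assumes "Im z > 0" "x > 0"
  shows "(\<Prod>n. 1 - ee (of_real (x + real n) * z + of_real b)) = exp (log_theta x b z)"
proof -
  have s: "(\<lambda>n. Ln (1 - ee (of_real (x + real n) * z + of_real b))) sums log_theta x b z"
    using assms by (rule log_theta_sums)
  have "exp (Ln (1 - ee (of_real (x + real n) * z + of_real b))) = 1 - ee (of_real (x + real n) * z + of_real b)" for n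
  proof (rule exp_Ln)
    have "Im (of_real (x + real n) * z + of_real b) > 0" using assms by (simp add: add_pos_nonneg mult_pos_pos)
    from norm_ee_less_1[OF this] show "1 - ee (of_real (x + real n) * z + of_real b) \<noteq> 0" by auto
  qed
  then show ?thesis
    using prodinf_exp[OF sums_summable[OF s]] sums_unique[OF s] by simp
qed

text \<open>Each of the two products is the exponential of a series of principal logarithms. The
  factors with y < 0 are those of (-a, -b), whose representative in (0, 1] is 1 minus the fractional
  part of \<open>a\<close>.\<close>

lemma u_val_eq: "u_val a b z = (if z \<in> upper_half then exp (log_u a b z) else 0)"
proof (cases "z \<in> upper_half")
  case True
  then have z: "Im z > 0" by (simp add: upper_half_iff)
  let ?P = "\<lambda>n. let y = frac a + of_nat n in if y > 0 then 1 - ee (of_rat y * z + of_rat b) else 1"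
  have 1: "prodinf ?P = exp (log_theta_mod a b z)"
  proof (cases "a \<in> \<int>")
    case a: True
    then have fr: "frac a = 0" "frac (- a) = 0" by simp_all
    have Q: "?P (Suc n) = 1 - ee (of_real (1 + real n) * z + of_real (of_rat b))" for n
      by (simp add: fr of_rat_add add_pos_nonneg)
    have P0: "?P 0 = 1" by (simp add: fr)
    \<comment> \<open>For integral \<open>a\<close> the factor with y = 0 is replaced by 1, so the
      logarithms start one index later.\<close>
    define L where "L = (\<lambda>n. case n of 0 \<Rightarrow> 0 | Suc n \<Rightarrow> Ln (1 - ee (of_real (1 + real n) * z + of_real (of_rat b))))"
    have "(\<lambda>n. L (Suc n)) sums log_theta 1 (of_rat b) z" using log_theta_sums[OF z, of 1 "of_rat b"] by (simp add: L_def)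
    then have s: "L sums log_theta 1 (of_rat b) z" using sums_Suc[of L] by (simp add: L_def)
    have "exp (L n) = ?P n" for n
    proof (cases n)
      case 0 then show ?thesis using P0 by (simp add: L_def)
    next
      case (Suc m)
      have "Im (of_real (1 + real m) * z + of_real (of_rat b)) > 0" using z by (simp add: add_pos_nonneg mult_pos_pos)
      from norm_ee_less_1[OF this] have "1 - ee (of_real (1 + real m) * z + of_real (of_rat b)) \<noteq> 0" by auto
      then show ?thesis unfolding Suc Q by (simp add: L_def)
    qed
    then have "prodinf ?P = exp (log_theta 1 (of_rat b) z)"
      using prodinf_exp[OF sums_summable[OF s]] sums_unique[OF s] by (simp only:)
    then show ?thesis by (simp add: log_theta_mod_def fr)
  next
    case False
    then have fr: "frac a > 0" "1 - frac (- a) = frac a" by (simp_all add: frac_neg)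
    then have P: "?P = (\<lambda>n. 1 - ee (of_real (of_rat (frac a) + real n) * z + of_real (of_rat b)))"
      by (simp add: of_rat_add add_pos_nonneg)
    have "(0::real) < of_rat (frac a)" using fr(1) by simp
    then show ?thesis unfolding P log_theta_mod_def fr(2) by (rule log_theta_prodinf[OF z])
  qed
  let ?Q = "\<lambda>n. let y = frac a - 1 - of_nat n in 1 - ee (- of_rat y * z - of_rat b)"
  have Q: "?Q = (\<lambda>n. 1 - ee (of_real (of_rat (1 - frac (- (- a))) + real n) * z + of_real (of_rat (- b))))"
    by (simp add: of_rat_diff of_rat_minus of_rat_add algebra_simps)
  have 2: "prodinf ?Q = exp (log_theta_mod (- a) (- b) z)"
    unfolding Q log_theta_mod_def by (rule log_theta_prodinf[OF z upfrac_pos])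
  show ?thesis using True unfolding u_val_def 1 2 by (simp add: log_u_def exp_add)
qed (simp add: u_val_def)

section \<open>Relations in one variable, multiplicative distributions and the integral of
  dlog\<close>

context smoothing
begin

text \<open>A distribution relation in one variable with weight \<open>w\<close>; two such functions
  of reciprocal weights multiply to a solution of \<open>dist_rel\<close>.\<close>

definition mult_rel :: "(nat \<Rightarrow> 'a) \<Rightarrow> (rat \<Rightarrow> 'a::comm_ring_1) \<Rightarrow> bool" where
  "mult_rel w F \<longleftrightarrow> (\<forall>x n. F (x + of_int n) = F x) \<and>
     (\<forall>x K. K > 0 \<longrightarrow> coprime K c \<longrightarrow> (\<Sum>i<K. F ((x + of_nat i) / of_nat K)) = w K * F x)"

lemma mult_rel_per: "mult_rel w F \<Longrightarrow> F (x + of_int n) = F x"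
  by (simp add: mult_rel_def)

lemma mult_rel_sum: "mult_rel w F \<Longrightarrow> K > 0 \<Longrightarrow> coprime K c \<Longrightarrow>
   (\<Sum>i<K. F ((x + of_nat i) / of_nat K)) = w K * F x"
  by (simp add: mult_rel_def)

lemma mult_rel_mult_c:
  assumes "mult_rel w F" shows "mult_rel w (\<lambda>x. F (x * of_nat c))"
  unfolding mult_rel_def
proof (intro conjI allI impI)
  fix x and n :: int
  show "F ((x + of_int n) * of_nat c) = F (x * of_nat c)"
    using mult_rel_per[OF assms, of "x * of_nat c" "n * int c"] by (simp add: distrib_right)
next
  fix x :: rat and K :: nat assume K: "K > 0" "coprime K c"
  have cop: "coprime (int c) (int K)" using K by (simp add: coprime_commute)
  have arg: "(x + of_nat i) / of_nat K * of_nat c = (x * of_nat c + of_int (int c * int i + 0)) / of_nat K" for i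
    by (simp add: algebra_simps)
  show "(\<Sum>i<K. F ((x + of_nat i) / of_nat K * of_nat c)) = w K * F (x * of_nat c)"
    unfolding arg sum_divide_reindex[where F = F, OF mult_rel_per[OF assms] K(1) cop] by (rule mult_rel_sum[OF assms K])
qed

lemma mult_rel_cmult: "mult_rel w F \<Longrightarrow> mult_rel w (\<lambda>x. k * F x)"
  by (simp add: mult_rel_def mult.left_commute flip: sum_distrib_left)

lemma mult_rel_diff: "mult_rel w F \<Longrightarrow> mult_rel w G \<Longrightarrow> mult_rel w (\<lambda>x. F x - G x)"
  by (simp add: mult_rel_def sum_subtractf right_diff_distrib)

lemma dist_rel_prod:
  assumes F: "mult_rel w F" and G: "mult_rel w' G" and w: "\<And>K. K > 0 \<Longrightarrow> w K * w' K = 1"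
  shows "dist_rel (\<lambda>a b. F a * G b)"
  unfolding dist_rel_def
proof (intro conjI allI impI)
  fix a b and m n :: int
  show "F (a + of_int m) * G (b + of_int n) = F a * G b" by (simp only: mult_rel_per[OF F] mult_rel_per[OF G])
next
  fix a b and K :: nat assume K: "K > 0" "coprime K c"
  have "(\<Sum>i<K. \<Sum>j<K. F ((a + of_nat i) / of_nat K) * G ((b + of_nat j) / of_nat K)) =
    (\<Sum>i<K. F ((a + of_nat i) / of_nat K)) * (\<Sum>j<K. G ((b + of_nat j) / of_nat K))"
    by (rule sum_product[symmetric])
  also have "\<dots> = (w K * w' K) * (F a * G b)"
    unfolding mult_rel_sum[OF F K] mult_rel_sum[OF G K] by (simp only: mult_ac)
  finally show "(\<Sum>i<K. \<Sum>j<K. F ((a + of_nat i) / of_nat K) * G ((b + of_nat j) / of_nat K)) = F a * G b"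
    using w[OF K(1)] by simp
qed

lemma mult_rel_bern1: "mult_rel (\<lambda>_. 1) bern1"
  by (simp add: mult_rel_def sum_bern1 bern1_add_of_int)

lemma mult_rel_bern1': "mult_rel (\<lambda>_. 1) bern1'"
  by (simp add: mult_rel_def sum_bern1') (simp add: bern1'_eq bern1_add_of_int delta0_add_of_int)

lemma mult_rel_bern2: "mult_rel (\<lambda>K. 1 / of_nat K) (\<lambda>x. bern2 (frac x))"
  by (simp add: mult_rel_def sum_bern2)

lemma mult_rel_delta0: "mult_rel (\<lambda>_. 1) delta0"
  by (simp add: mult_rel_def sum_delta0 delta0_add_of_int)

lemma mult_rel_1: "mult_rel of_nat (\<lambda>_. 1)"
  by (simp add: mult_rel_def)

lemma dist_rel_B2: "dist_rel (\<lambda>a b. bern2 (frac a))"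
  using dist_rel_prod[OF mult_rel_bern2 mult_rel_1] by simp

lemma dist_rel_B1_B1: "dist_rel (\<lambda>a b. bern1' a * bern1' b)"
  using dist_rel_prod[OF mult_rel_bern1' mult_rel_bern1'] by simp

lemma dist_rel_delta0_B1: "dist_rel (\<lambda>a b. delta0 a * bern1' b)"
  using dist_rel_prod[OF mult_rel_delta0 mult_rel_bern1'] by simp

definition pi_val :: "rat \<Rightarrow> rat \<Rightarrow> rat" where
  "pi_val a b = bern1 (b * of_nat c) * (of_nat c * bern1 a - bern1 (a * of_nat c))"

lemma dist_rel_pi: "dist_rel pi_val"
proof -
  have "dist_rel (\<lambda>a b. (of_nat c * bern1 a - bern1 (a * of_nat c)) * bern1 (b * of_nat c))"
    by (rule dist_rel_prod[OF mult_rel_diff[OF mult_rel_cmult[OF mult_rel_bern1] mult_rel_mult_c[OF mult_rel_bern1]]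
          mult_rel_mult_c[OF mult_rel_bern1]]) simp
  then show ?thesis by (simp add: pi_val_def[abs_def] mult.commute)
qed

lemma is_dist_pi: "is_dist pi_val (pi_c S c)"
  unfolding pi_c_def pi_val_def[symmetric] the_dist_eq_dist_of[OF dist_rel_pi]
  by (rule is_dist_dist_of[OF dist_rel_pi])

lemma of_rat_in_Ints_iff: "(of_rat x :: complex) \<in> \<int> \<longleftrightarrow> x \<in> \<int>"
proof
  assume "(of_rat x :: complex) \<in> \<int>"
  then obtain n where "(of_rat x :: complex) = of_int n" by (rule Ints_cases)
  then have "(of_rat x :: complex) = of_rat (of_int n)" by simp
  then have "x = of_int n" by (simp only: of_rat_eq_iff)
  then show "x \<in> \<int>" by simp
qed (auto elim: Ints_cases)

definition clog :: "rat \<Rightarrow> rat \<Rightarrow> complex" where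
  "clog a b = delta0 a * log_one_minus (ee (of_rat b))"

lemma clog_eq: "b \<notin> \<int> \<Longrightarrow> clog a b = delta0 a * Ln (1 - ee (of_rat b))"
  unfolding clog_def by (subst log_one_minus_eq) (simp_all add: ee_eq_1_iff of_rat_in_Ints_iff norm_ee)

lemma quotient_notin_Ints: "x \<notin> \<int> \<Longrightarrow> K > 0 \<Longrightarrow> (x + of_nat i) / of_nat K \<notin> (\<int> :: rat set)"
proof
  assume "x \<notin> \<int>" "K > 0" "(x + of_nat i) / of_nat K \<in> (\<int> :: rat set)"
  then obtain n where "(x + of_nat i) / of_nat K = of_int n" using Ints_cases by blast
  then have "x = of_int (n * int K - int i)" using \<open>K > 0\<close> by (simp add: field_simps)
  then show False using \<open>x \<notin> \<int>\<close> by simp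
qed

lemma clog_add_of_int: "clog (a + of_int m) (b + of_int n) = clog a b"
  by (simp add: clog_def delta0_add_of_int of_rat_add ee_add)

text \<open>When \<open>a\<close> is integral, \<open>b\<close> is not, so the logarithms are
  finite; otherwise both sides vanish.\<close>

lemma clog_sum_snd:
  assumes "nonint a b" and K: "K > 0"
  shows "(\<Sum>j<K. clog a ((b + of_nat j) / of_nat K)) = clog a b"
proof (cases "a \<in> \<int>")
  case True
  then have b: "b \<notin> \<int>" using assms(1) by (simp add: nonint_def)
  show ?thesis
    using Ln_1_minus_ee_mult[OF K, of "of_rat b"] True b quotient_notin_Ints[OF b K]
    by (simp add: clog_eq delta0_def of_rat_in_Ints_iff of_rat_divide of_rat_add)
qed (simp add: clog_def delta0_def)

lemma dist_rel_clog: "dist_rel clog"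
  unfolding dist_rel_def
proof (intro conjI allI impI)
  fix a b and K :: nat assume ab: "nonint a b" and K: "K > 0" "coprime K c"
  have d: "(\<Sum>i<K. \<Sum>j<K. clog ((a + of_nat i) / of_nat K) ((b + of_nat j) / of_nat K)) =
      (\<Sum>i<K. delta0 ((a + of_nat i) / of_nat K)) * (\<Sum>j<K. log_one_minus (ee (of_rat ((b + of_nat j) / of_nat K))))"
    unfolding clog_def by (rule sum_product[symmetric])
  show "(\<Sum>i<K. \<Sum>j<K. clog ((a + of_nat i) / of_nat K) ((b + of_nat j) / of_nat K)) = clog a b"
    using clog_sum_snd[OF ab K(1)] unfolding d sum_delta0[OF K(1)] by (simp add: clog_def sum_distrib_left)
qed (rule clog_add_of_int)

lemma dist_rel_log_u: "z \<in> upper_half \<Longrightarrow> dist_rel (\<lambda>a b. log_u a b z)"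
  unfolding dist_rel_def by (simp add: log_u_add_of_int log_u_sum upper_half_iff)

text \<open>The level in \<open>dist_of\<close> depends on \<open>f\<close> alone, so this is one
  fixed finite sum for all z.\<close>

lemma dist_of_holomorphic:
  assumes "\<And>a b. (L a b) holomorphic_on A"
  shows "(\<lambda>z. dist_of (\<lambda>a b. L a b z) f) holomorphic_on A"
  unfolding dist_of_def level_sum_def by (cases "f \<in> schwartz' S") (auto intro!: holomorphic_intros assms)

text \<open>The induction over generators again. Inverses are available pointwise on the upper half
  plane; off it all values on test functions are 0.\<close>

lemma mult_distributions_unique:
  assumes \<mu>: "\<mu> \<in> mult_distributions S" "scalar_invariant S \<mu>" "has_coset_values S val \<mu>"
    and \<nu>: "\<nu> \<in> mult_distributions S" "scalar_invariant S \<nu>" "has_coset_values S val \<nu>"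
  shows "\<mu> = \<nu>"
proof
  fix f
  have unit: "\<rho> f z \<noteq> 0 \<longleftrightarrow> z \<in> upper_half" if "\<rho> \<in> mult_distributions S" "f \<in> schwartz' S" for \<rho> f z
    using that by (auto simp: mult_distributions_def O_units_def)
  have plus: "\<rho> (\<lambda>v. f v + g v) z = \<rho> f z * \<rho> g z"
    if "\<rho> \<in> mult_distributions S" "f \<in> schwartz' S" "g \<in> schwartz' S" for \<rho> f g z
    using that by (simp add: mult_distributions_def)
  \<comment> \<open>The value is idempotent at each point: a unit on the upper half plane, hence 1,
    and 0 elsewhere by the convention of extension.\<close>
  have null: "\<rho> (\<lambda>_. 0) z = (if z \<in> upper_half then 1 else 0)" if "\<rho> \<in> mult_distributions S" for \<rho> z
    using plus[OF that schwartz'_0 schwartz'_0, of z] unit[OF that schwartz'_0, of z] by auto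
  have neg: "\<rho> (\<lambda>v. - f v) z = (if z \<in> upper_half then 1 else 0) / \<rho> f z"
    if "\<rho> \<in> mult_distributions S" "f \<in> schwartz' S" for \<rho> f z
    using plus[OF that schwartz'_uminus[OF that(2)], of z] unit[OF that, of z] null[OF that(1), of z]
      unit[OF that(1) schwartz'_uminus[OF that(2)], of z]
    by (cases "z \<in> upper_half") (simp_all add: field_simps)
  show "\<mu> f = \<nu> f"
  proof (cases "f \<in> schwartz' S")
    case True
    then show ?thesis
    proof (induction rule: schwartz'_induct)
      case zero show ?case by (rule ext) (simp only: null[OF \<mu>(1)] null[OF \<nu>(1)])
    next
      case (add f g)
      show ?case by (rule ext) (simp only: plus[OF \<mu>(1) add(1,2)] plus[OF \<nu>(1) add(1,2)] add(3,4))
    next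
      case (minus f)
      show ?case by (rule ext) (simp only: neg[OF \<mu>(1) minus(1)] neg[OF \<nu>(1) minus(1)] minus(2))
    next
      case (coset a b N)
      have t: "of_nat N \<in> Z_S_units S" "(of_nat N :: rat) > 0" using coset Z_S_units_of_nat by simp_all
      have f: "coset_fun S a b \<in> schwartz' S" using coset(1-3) by (rule coset_fun_schwartz')
      have "\<rho> (slash S (coset_fun S a b) (mat (of_nat N))) = val a b"
        if "scalar_invariant S \<rho>" "has_coset_values S val \<rho>" for \<rho>
      proof -
        have "\<rho> (slash S (coset_fun S a b) (mat (of_nat N))) = \<rho> (coset_fun S a b)"
          using that(1) t f unfolding scalar_invariant_def by blast
        then show ?thesis using that(2) coset(1-3) unfolding has_coset_values_def by simp
      qed
      then show ?case using \<mu>(2,3) \<nu>(2,3) by simp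
    qed
  next
    case False then show ?thesis using \<mu>(1) \<nu>(1) by (simp add: mult_distributions_def)
  qed
qed

text \<open>Exponentiating an additive distribution of logarithms gives the multiplicative one.
  Since the logarithms satisfy the relation exactly, this yields a logarithm on all test functions
  at once, as the integral of dlog requires.\<close>

lemma the_mult_dist_eq:
  assumes rel: "\<And>z. z \<in> upper_half \<Longrightarrow> dist_rel (\<lambda>a b. L a b z)"
    and hol: "\<And>a b. (L a b) holomorphic_on upper_half"
    and val: "\<And>a b. nonint a b \<Longrightarrow> val a b = (\<lambda>z. if z \<in> upper_half then exp (L a b z) else 0)"
  shows "the_mult_dist S val = (\<lambda>f. if f \<in> schwartz' S
     then (\<lambda>z. if z \<in> upper_half then exp (dist_of (\<lambda>a b. L a b z) f) else 0) else (\<lambda>_. 1))"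
    (is "_ = ?\<mu>")
proof -
  have d: "is_dist (\<lambda>a b. L a b z) (dist_of (\<lambda>a b. L a b z))" if "z \<in> upper_half" for z
    by (rule is_dist_dist_of[OF rel[OF that]])
  have 1: "?\<mu> \<in> mult_distributions S"
    unfolding mult_distributions_def
  proof (intro CollectI conjI allI ballI impI)
    fix f assume f: "f \<in> schwartz' S"
    have "(\<lambda>z. exp (dist_of (\<lambda>a b. L a b z) f)) holomorphic_on upper_half"
      by (intro holomorphic_intros dist_of_holomorphic hol)
    then have "(\<lambda>z. if z \<in> upper_half then exp (dist_of (\<lambda>a b. L a b z) f) else 0) holomorphic_on upper_half"
      by (rule holomorphic_transform) simp
    then show "?\<mu> f \<in> O_units" using f by (simp add: O_units_def)
  next
    fix f g assume fg: "f \<in> schwartz' S" "g \<in> schwartz' S"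
    show "?\<mu> (\<lambda>v. f v + g v) = (\<lambda>z. ?\<mu> f z * ?\<mu> g z)"
      using fg schwartz'_add[OF fg] by (simp add: fun_eq_iff is_dist_plus[OF d fg] exp_add)
  qed simp
  have 2: "scalar_invariant S ?\<mu>"
    unfolding scalar_invariant_def
  proof (intro ballI impI)
    fix t f assume tf: "t \<in> Z_S_units S" "t > 0" "f \<in> schwartz' S"
    show "?\<mu> (slash S f (mat t)) = ?\<mu> f"
      using tf slash_schwartz'[OF tf(3) G_S_mat[OF tf(1)]] is_dist_scale[OF d tf(3,1,2)] by (simp add: fun_eq_iff)
  qed
  have 3: "has_coset_values S val ?\<mu>"
    unfolding has_coset_values_def
  proof (intro ballI impI)
    fix a b assume "a \<in> Z_S S" "b \<in> Z_S S" "\<not> (a \<in> \<int> \<and> b \<in> \<int>)"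
    then have "nonint a b" by (simp add: nonint_def)
    then show "?\<mu> (coset_fun S a b) = val a b"
      using nonint_coset_schwartz' is_dist_coset[OF d] val by (simp add: fun_eq_iff)
  qed
  show ?thesis unfolding the_mult_dist_def
  proof (rule the_equality)
    show "?\<mu> \<in> mult_distributions S \<and> scalar_invariant S ?\<mu> \<and> has_coset_values S val ?\<mu>"
      using 1 2 3 by blast
    fix \<nu> assume "\<nu> \<in> mult_distributions S \<and> scalar_invariant S \<nu> \<and> has_coset_values S val \<nu>"
    then show "\<nu> = ?\<mu>" using mult_distributions_unique[OF _ _ _ 1 2 3] by blast
  qed
qed

lemma mult_smooth_u_dist:
  assumes "f \<in> schwartz' S" "z \<in> upper_half"
  shows "mult_smooth S c (u_dist S) f z = exp (dist_of (smoothed (\<lambda>a b. log_u a b z)) f)"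
proof -
  have u: "u_dist S (coset_fun S a b) z = (if z \<in> upper_half then exp (log_u a b z) else 0)"
    if ab: "nonint a b" for a b z
  proof -
    have "u_dist S = (\<lambda>f. if f \<in> schwartz' S
       then (\<lambda>z. if z \<in> upper_half then exp (dist_of (\<lambda>a b. log_u a b z) f) else 0) else (\<lambda>_. 1))"
      unfolding u_dist_def
      by (rule the_mult_dist_eq[OF dist_rel_log_u log_u_holomorphic]) (simp_all add: u_val_eq fun_eq_iff)
    then show ?thesis
      using nonint_coset_schwartz'[OF ab] is_dist_coset[OF is_dist_dist_of[OF dist_rel_log_u] ab] by simp
  qed
  have "mult_smooth S c (u_dist S) = (\<lambda>f. if f \<in> schwartz' S
     then (\<lambda>z. if z \<in> upper_half then exp (dist_of (\<lambda>a b. smoothed (\<lambda>a b. log_u a b z) a b) f) else 0) else (\<lambda>_. 1))"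
    unfolding mult_smooth_def
  proof (rule the_mult_dist_eq)
    show "dist_rel (\<lambda>a b. smoothed (\<lambda>a b. log_u a b z) a b)" if "z \<in> upper_half" for z
      using dist_rel_smoothed[OF dist_rel_log_u[OF that]] .
    show "(\<lambda>z. smoothed (\<lambda>a b. log_u a b z) a b) holomorphic_on upper_half" for a b
      unfolding smoothed_def by (intro holomorphic_intros log_u_holomorphic)
    fix a b assume ab: "nonint a b"
    show "(\<lambda>z. u_dist S (coset_fun S a b) z ^ c\<^sup>2 / u_dist S (coset_fun S (of_nat c * a) (of_nat c * b)) z) =
      (\<lambda>z. if z \<in> upper_half then exp (smoothed (\<lambda>a b. log_u a b z) a b) else 0)"
      using c_gt_1 by (simp add: fun_eq_iff u[OF ab] u[OF nonint_mult_c[OF ab]] smoothed_def exp_diff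
          exp_of_nat_mult[symmetric] del: of_nat_power)
  qed
  then show ?thesis using assms by simp
qed

end

text \<open>Any logarithm is a primitive of dlog; the integral from the cusp is the logarithm that
  tends to 0 there.\<close>

lemma dlog_integral_exp:
  assumes hol: "\<Lambda> holomorphic_on upper_half" and F: "\<And>z. z \<in> upper_half \<Longrightarrow> F z = exp (\<Lambda> z)"
    and lim: "((\<lambda>Y. \<Lambda> (Complex (Re z) Y)) \<longlongrightarrow> 0) at_top" and z: "z \<in> upper_half"
  shows "dlog_integral F z = \<Lambda> z"
proof -
  have op: "open upper_half" unfolding upper_half_def by (rule open_halfspace_Im_gt)
  have conv: "convex upper_half" unfolding upper_half_def by (rule convex_halfspace_Im_gt)
  have D: "(\<Lambda> has_field_derivative deriv \<Lambda> w) (at w)" if "w \<in> upper_half" for w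
    using holomorphic_derivI[OF hol op that] .
  have q: "deriv F w / F w = deriv \<Lambda> w" if w: "w \<in> upper_half" for w
  proof -
    have "((\<lambda>z. exp (\<Lambda> z)) has_field_derivative exp (\<Lambda> w) * deriv \<Lambda> w) (at w)"
      using D[OF w] by (auto intro!: derivative_eq_intros)
    then have "(F has_field_derivative exp (\<Lambda> w) * deriv \<Lambda> w) (at w)"
      by (rule has_field_derivative_transform_within_open[OF _ op w]) (simp add: F)
    then show ?thesis by (simp add: DERIV_imp_deriv F[OF w])
  qed
  have "contour_integral (linepath (Complex (Re z) Y) z) (\<lambda>w. deriv F w / F w) = \<Lambda> z - \<Lambda> (Complex (Re z) Y)"
    if Y: "Y > 0" for Y
  proof -
    have "closed_segment (Complex (Re z) Y) z \<subseteq> upper_half"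
      by (rule closed_segment_subset[OF _ z conv]) (use Y in \<open>simp add: upper_half_def\<close>)
    then have "((\<lambda>w. deriv F w / F w) has_contour_integral
       \<Lambda> (pathfinish (linepath (Complex (Re z) Y) z)) - \<Lambda> (pathstart (linepath (Complex (Re z) Y) z)))
       (linepath (Complex (Re z) Y) z)"
      using D q by (intro contour_integral_primitive[of upper_half \<Lambda>]) (auto intro: has_field_derivative_at_within)
    then show ?thesis using contour_integral_unique by fastforce
  qed
  then have "\<forall>\<^sub>F Y in at_top. \<Lambda> z - \<Lambda> (Complex (Re z) Y) =
      contour_integral (linepath (Complex (Re z) Y) z) (\<lambda>w. deriv F w / F w)"
    by (intro eventually_mono[OF eventually_gt_at_top[of 0]]) simp
  moreover have "((\<lambda>Y. \<Lambda> z - \<Lambda> (Complex (Re z) Y)) \<longlongrightarrow> \<Lambda> z) at_top"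
    using tendsto_diff[OF tendsto_const lim, of "\<Lambda> z"] by simp
  ultimately have "((\<lambda>Y. contour_integral (linepath (Complex (Re z) Y) z) (\<lambda>w. deriv F w / F w)) \<longlongrightarrow> \<Lambda> z) at_top"
    by (rule Lim_transform_eventually[rotated])
  then show ?thesis unfolding dlog_integral_def by (intro tendsto_Lim) auto
qed

context smoothing
begin

text \<open>The value before smoothing. By \<open>is_dist_E\<close> the values of E are its
  smoothing plus \<open>pi_val\<close>, so each transformation law is proved once for
  \<open>E_log\<close> and then smoothed.\<close>

definition E_log :: "complex \<Rightarrow> rat \<Rightarrow> rat \<Rightarrow> complex" where
  "E_log z a b = z / 2 * of_rat (bern2 (frac a)) + 1 / (2 * of_real pi * \<i>) * (clog a b + log_u a b z)"

lemma dlog_integral_u: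
  assumes f: "f \<in> schwartz' S" and z: "z \<in> upper_half"
  shows "dlog_integral (mult_smooth S c (u_dist S) f) z = dist_of (smoothed (\<lambda>a b. log_u a b z)) f"
proof (rule dlog_integral_exp[where \<Lambda> = "\<lambda>z. dist_of (smoothed (\<lambda>a b. log_u a b z)) f"])
  show "(\<lambda>z. dist_of (smoothed (\<lambda>a b. log_u a b z)) f) holomorphic_on upper_half"
    by (rule dist_of_holomorphic) (auto simp: smoothed_def intro!: holomorphic_intros log_u_holomorphic)
  have s: "((\<lambda>Y. smoothed (\<lambda>a b. log_u a b (Complex (Re z) Y)) a b) \<longlongrightarrow> 0) at_top" for a b
    unfolding smoothed_def by (rule tendsto_eq_intros log_u_tendsto_0 refl)+ simp
  have "((\<lambda>Y. dist_of (smoothed (\<lambda>a b. log_u a b (Complex (Re z) Y))) f) \<longlongrightarrow>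
     (\<Sum>i<N^2. \<Sum>j<N^2. of_int (f (rat_pt S (of_nat i / of_nat N) (of_nat j / of_nat N))) * 0)) at_top"
    if "N = (SOME N. N > 0 \<and> coprime N c \<and> level S N f)" for N
    unfolding dist_of_def level_sum_def that[symmetric] if_P[OF f] by (intro tendsto_sum tendsto_mult tendsto_const s)
  then show "((\<lambda>Y. dist_of (smoothed (\<lambda>a b. log_u a b (Complex (Re z) Y))) f) \<longlongrightarrow> 0) at_top" by simp
qed (simp_all add: mult_smooth_u_dist[OF f] z)

lemma is_dist_E:
  assumes z: "z \<in> upper_half"
  shows "is_dist (\<lambda>a b. smoothed (E_log z) a b + of_rat (pi_val a b)) (\<lambda>f. E_tilde S c f z)"
proof -
  let ?k = "1 / (2 * of_real pi * \<i>) :: complex"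
  have eq: "(\<lambda>f. E_tilde S c f z) = (\<lambda>f. z / 2 * of_rat (smooth S c (B2_B0 S) f) + of_rat (pi_c S c f)
     + ?k * smooth S c (delta0_Clog S) f + ?k * dist_of (smoothed (\<lambda>a b. log_u a b z)) f)"
  proof
    fix f
    show "E_tilde S c f z = z / 2 * of_rat (smooth S c (B2_B0 S) f) + of_rat (pi_c S c f)
     + ?k * smooth S c (delta0_Clog S) f + ?k * dist_of (smoothed (\<lambda>a b. log_u a b z)) f"
    proof (cases "f \<in> schwartz' S")
      case True then show ?thesis using z by (simp add: E_tilde_def dlog_integral_u)
    next
      case False
      then show ?thesis
        using is_dist_out[OF is_dist_smooth[OF dist_rel_B2] False] is_dist_out[OF is_dist_pi False]
          is_dist_out[OF is_dist_smooth[OF dist_rel_clog] False]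
        by (simp add: E_tilde_def B2_B0_def delta0_Clog_def dist_of_def clog_def[abs_def])
    qed
  qed
  have "is_dist (\<lambda>a b. z / 2 * of_rat (smoothed (\<lambda>a b. bern2 (frac a)) a b) + of_rat (pi_val a b)
     + ?k * smoothed clog a b + ?k * smoothed (\<lambda>a b. log_u a b z) a b) (\<lambda>f. E_tilde S c f z)"
    unfolding eq B2_B0_def delta0_Clog_def clog_def[symmetric]
    by (intro is_dist_add is_dist_cmult is_dist_of_rat is_dist_smooth is_dist_pi is_dist_dist_of
        dist_rel_smoothed dist_rel_B2 dist_rel_clog dist_rel_log_u z)
  then show ?thesis
    by (rule is_dist_cong) (simp add: smoothed_def E_log_def of_rat_diff of_rat_mult of_rat_power algebra_simps add_divide_distrib diff_divide_distrib)
qed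

end

section \<open>The action of generators on \<open>E\<close>\<close>

text \<open>Translation of z contributes e(-x), which the shift of \<open>b\<close> by
  \<open>t\<close> undoes when t and x differ by an integer.\<close>

lemma log_theta_translate:
  assumes "t - x \<in> \<int>" shows "log_theta x (b + t) (z - 1) = log_theta x b z"
proof -
  obtain n where n: "t - x = of_int n" using assms by (rule Ints_cases)
  have "of_real x * (z - 1) + of_real (b + t) = of_real x * z + of_real b + of_real (t - x)"
    by (simp add: algebra_simps)
  then have "of_real x * (z - 1) + of_real (b + t) = of_real x * z + of_real b + of_int n"
    by (simp only: n of_real_of_int_eq)
  then have 1: "ee (of_real x * (z - 1) + of_real (b + t)) = ee (of_real x * z + of_real b)"
    by (simp only: ee_add[of _ "of_int n"]) simp
  have 2: "ee (z - 1) = ee z" using ee_add[of "z - 1" 1] ee_of_nat[of 1] by simp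
  show ?thesis unfolding log_theta_def theta_term_def 1 2 ..
qed

lemma log_theta_mod_translate: "log_theta_mod a (b + a) (z - 1) = log_theta_mod a b z"
proof -
  have "real_of_rat a - of_rat (1 - frac (- a)) = of_int (- \<lfloor>- a\<rfloor> - 1)"
    by (simp add: frac_def of_rat_diff of_rat_add of_rat_minus)
  then have "real_of_rat a - of_rat (1 - frac (- a)) \<in> \<int>" by (simp only: Ints_of_int)
  from log_theta_translate[OF this] show ?thesis by (simp add: log_theta_mod_def of_rat_add)
qed

lemma log_u_translate: "log_u a (a + b) (z - 1) = log_u a b z"
  using log_theta_mod_translate[of a b z] log_theta_mod_translate[of "- a" "- b" z] by (simp add: log_u_def add.commute)

lemma log_theta_mod_sum_snd:
  assumes K: "K > 0" and z: "Im z > 0"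
  shows "(\<Sum>j<K. log_theta_mod a ((b + of_nat j) / of_nat K) (z / of_nat K)) = log_theta_mod a b z"
  using log_theta_mult(1)[OF z upfrac_pos[of a] K, of "of_rat b"]
  by (simp add: log_theta_mod_def of_rat_divide of_rat_add)

lemma log_u_sum_snd:
  assumes K: "K > 0" and z: "Im z > 0"
  shows "(\<Sum>j<K. log_u a ((b + of_nat j) / of_nat K) (z / of_nat K)) = log_u a b z"
proof -
  have pery: "log_theta_mod a (b + of_int m) z = log_theta_mod a b z" for a b m z
    using log_theta_mod_add_of_int[of a 0 b m] by simp
  have arg: "- ((x + of_nat i) / of_nat K) = (- x + of_int ((-1) * int i + 0)) / of_nat K" for x :: rat and i
    by (simp add: field_simps minus_divide_left)
  have cop: "coprime (- 1) (int K)" by simp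
  have "(\<Sum>j<K. log_theta_mod (- a) (- ((b + of_nat j) / of_nat K)) (z / of_nat K)) = log_theta_mod (- a) (- b) z"
    unfolding arg sum_divide_reindex[where F = "\<lambda>y. log_theta_mod (- a) y (z / of_nat K)", OF pery K cop]
    by (rule log_theta_mod_sum_snd[OF K z])
  then show ?thesis by (simp add: log_u_def sum.distrib log_theta_mod_sum_snd[OF K z])
qed

lemma of_rat_frac_bounds: "0 \<le> real_of_rat (frac x)" "real_of_rat (frac x) < 1"
  using frac_lt_1[of x] by simp_all

lemma bern1_uminus: "bern1 (- x) = - bern1 x - delta0 x"
  by (simp add: bern1_def delta0_def frac_neg)

lemma minus_inverse_upper_half: "z \<in> upper_half \<Longrightarrow> - 1 / z \<in> upper_half"
proof -
  assume "z \<in> upper_half"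
  then have z: "Im z > 0" by (simp add: upper_half_iff)
  then have "(Re z)\<^sup>2 + (Im z)\<^sup>2 > 0" by (intro add_nonneg_pos) simp_all
  then show ?thesis using z by (simp add: upper_half_iff Im_divide)
qed

section \<open>Changes of E under T, S and diagonal matrices, and their integrality\<close>

context smoothing
begin

text \<open>Compares the change of E, a complex number, with the rational formula of the theorem
  once both have the same coset values.\<close>

lemma is_dist_of_rat_eq:
  assumes "is_dist (\<lambda>a b. of_rat (val a b)) \<mu>" "is_dist val \<nu>"
  shows "\<mu> f = (of_rat (\<nu> f) :: complex)"
  using is_dist_unique[OF assms(1) is_dist_of_rat[OF assms(2)]] by simp

definition Psi_val :: "rat \<Rightarrow> rat \<Rightarrow> rat" where
  "Psi_val a b = pi_val a b + 1 / 2 * smoothed (\<lambda>a b. delta0 a * bern1' b) a b"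

lemma is_dist_Psi: "is_dist Psi_val (Psi S c)"
  unfolding Psi_val_def[abs_def] Psi_def[abs_def] delta0_B1_def
  by (intro is_dist_add is_dist_cmult is_dist_pi is_dist_smooth dist_rel_delta0_B1)

text \<open>The integer through which all half-integral and fractional contributions are expressed;
  see \<open>Kc_Ints\<close>.\<close>

definition Kc :: "rat \<Rightarrow> rat" where
  "Kc a = of_nat c * bern1 a - bern1 (a * of_nat c)"

lemma pi_val_eq: "pi_val a b = bern1 (b * of_nat c) * Kc a"
  by (simp add: pi_val_def Kc_def)

lemma c_odd: "odd c"
  using c_coprime_6 by (metis coprime_common_divisor dvd_triv_left even_numeral odd_one)

text \<open>With c = 6q + 1 or 6q - 1 the quotient is 3q^2 + q or 3q^2 - q.\<close>

lemma twelve_dvd: "(12::int) dvd int c ^ 2 - 1"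
proof -
  have c3: "\<not> 3 dvd c"
  proof
    assume "3 dvd c"
    then have "(3::nat) dvd 1" using coprime_common_divisor[OF c_coprime_6, of 3] by simp
    then show False by simp
  qed
  have "c mod 6 = 1 \<or> c mod 6 = 5" using c3 c_odd by presburger
  then have "\<exists>q. int c = 6 * q + 1 \<or> int c = 6 * q - 1" by presburger
  then obtain q where "int c = 6 * q + 1 \<or> int c = 6 * q - 1" by blast
  then show ?thesis
  proof
    assume "int c = 6 * q + 1"
    then have "int c ^ 2 - 1 = 12 * (3 * q ^ 2 + q)" by (simp add: power2_eq_square algebra_simps)
    then show ?thesis by simp
  next
    assume "int c = 6 * q - 1"
    then have "int c ^ 2 - 1 = 12 * (3 * q ^ 2 - q)" by (simp only: power2_eq_square) (simp add: algebra_simps)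
    then show ?thesis by simp
  qed
qed

lemma c_half: obtains h where "(of_nat c :: rat) = 2 * of_int h + 1" "int c = 2 * h + 1"
proof -
  obtain h where "c = 2 * h + 1" using c_odd by (rule oddE)
  then show ?thesis by (intro that[of "int h"]) simp_all
qed

lemma Kc_cases:
  obtains k where "of_nat c * frac a = of_int k + frac (a * of_nat c)" "Kc a = of_int k - (of_nat c - 1) / 2"
proof -
  let ?k = "\<lfloor>a * of_nat c\<rfloor> - int c * \<lfloor>a\<rfloor>"
  have "of_nat c * frac a = of_int ?k + frac (a * of_nat c)" by (simp add: frac_def algebra_simps)
  moreover from this have "Kc a = of_int ?k - (of_nat c - 1) / 2" by (simp add: Kc_def bern1_def algebra_simps diff_divide_distrib)
  ultimately show ?thesis by (rule that)
qed

lemma Kc_Ints: "Kc a \<in> \<int>"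
proof -
  obtain k where "Kc a = of_int k - (of_nat c - 1) / 2" by (rule Kc_cases)
  moreover obtain h where "(of_nat c :: rat) = 2 * of_int h + 1" by (rule c_half)
  ultimately have "Kc a = of_int (k - h)" by simp
  then show ?thesis by simp
qed

text \<open>The coset value of the change under T. The terms with \<open>delta0\<close> do not
  appear: for integral \<open>a\<close> the shift of \<open>b\<close> by \<open>a\<close> is
  invisible to them.\<close>

definition T_val :: "rat \<Rightarrow> rat \<Rightarrow> rat" where
  "T_val a b = - (1 / 2) * smoothed (\<lambda>a b. bern2 (frac a)) a b + pi_val a (a + b) - pi_val a b"

text \<open>Put c{a} = k + w with w = {ca}. All terms in w cancel, and there remains k(c - k)/2 -
  (c^2 - 1)/12 minus an integer; k(c - k) is even since c is odd, and 12 divides c^2 - 1.\<close>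

lemma T_val_Ints: "T_val a b \<in> \<int>"
proof -
  define x where "x = frac a"
  define w where "w = frac (a * of_nat c)"
  obtain k where k: "of_nat c * x = of_int k + w" "Kc a = of_int k - (of_nat c - 1) / 2"
    unfolding x_def w_def by (rule Kc_cases)
  obtain h where h: "(of_nat c :: rat) = 2 * of_int h + 1" "int c = 2 * h + 1" by (rule c_half)
  obtain m where m: "int c ^ 2 - 1 = 12 * m" using twelve_dvd by blast
  have m': "(of_nat c :: rat) ^ 2 = 12 * of_int m + 1"
  proof -
    have "int c ^ 2 = 12 * m + 1" using m by simp
    then have "(of_int (int c ^ 2) :: rat) = of_int (12 * m + 1)" by (simp only:)
    then show ?thesis by simp
  qed
  \<comment> \<open>The carry in adding the fractional parts of ac and bc.\<close>
  obtain e where e: "frac ((a + b) * of_nat c) = w + frac (b * of_nat c) - of_int e"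
  proof
    show "frac ((a + b) * of_nat c) = w + frac (b * of_nat c) -
       of_int (\<lfloor>(a + b) * of_nat c\<rfloor> - \<lfloor>a * of_nat c\<rfloor> - \<lfloor>b * of_nat c\<rfloor>)"
      by (simp add: w_def frac_def algebra_simps)
  qed
  have pi: "pi_val a (a + b) - pi_val a b = (w - of_int e) * (of_int k - (of_nat c - 1) / 2)"
    unfolding pi_val_eq k(2) by (simp only: bern1_def e left_diff_distrib[symmetric]) simp
  have "smoothed (\<lambda>a b. bern2 (frac a)) a b = of_nat c ^ 2 * (x^2 - x + 1/6) - (w^2 - w + 1/6)"
    by (simp add: smoothed_def bern2_def x_def w_def mult.commute)
  also have "\<dots> = (of_nat c * x)^2 - of_nat c * (of_nat c * x) + of_nat c ^ 2 / 6 - (w^2 - w + 1/6)"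
    by (simp add: power2_eq_square algebra_simps)
  finally have "T_val a b = - (1 / 2) * ((of_int k + w)^2 - of_nat c * (of_int k + w) + of_nat c ^ 2 / 6 - (w^2 - w + 1/6))
     + (w - of_int e) * (of_int k - (of_nat c - 1) / 2)"
    unfolding T_val_def k(1) using pi by simp
  also have "\<dots> = of_int k * (of_nat c - of_int k) / 2 - (of_nat c ^ 2 - 1) / 12 - of_int e * (of_int k - (of_nat c - 1) / 2)"
    by (simp add: power2_eq_square field_simps)
  also have "\<dots> = of_int k * (of_nat c - of_int k) / 2 - of_int m - of_int e * (of_int k - of_int h)"
    unfolding m' by (simp add: h)
  also have "of_int k * (of_nat c - of_int k) / 2 = (of_int (k * (int c - k) div 2) :: rat)"
  proof -
    have "even (k * (int c - k))" using h(2) by auto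
    then obtain j where j: "k * (int c - k) = 2 * j" by blast
    then have "(of_int (k * (int c - k)) :: rat) = of_int (2 * j)" by (simp only:)
    then have "(of_int k * (of_nat c - of_int k) :: rat) = 2 * of_int j" by simp
    then show ?thesis unfolding j by simp
  qed
  finally show ?thesis by simp
qed

lemma delta0_bern1'_translate: "delta0 a * bern1' (a + b) = delta0 a * bern1' b"
proof (cases "a \<in> \<int>")
  case True
  then obtain n where "a = of_int n" by (rule Ints_cases)
  then show ?thesis using mult_rel_per[OF mult_rel_bern1', of b n] by (simp add: add.commute)
qed (simp add: delta0_def)

lemma clog_translate: "clog a (a + b) = clog a b"
proof (cases "a \<in> \<int>")
  case True
  then obtain n where "a = of_int n" by (rule Ints_cases)
  then show ?thesis using clog_add_of_int[of a 0 b n] by (simp add: add.commute)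
qed (simp add: clog_def delta0_def)

lemma E_log_translate: "E_log (z - 1) a (a + b) = E_log z a b - 1 / 2 * of_rat (bern2 (frac a))"
  by (simp add: E_log_def clog_translate log_u_translate algebra_simps diff_divide_distrib)

lemma is_dist_T:
  assumes "is_dist val \<mu>"
  shows "is_dist (\<lambda>a b. val a (a + b)) (\<lambda>f. if f \<in> schwartz' S then \<mu> (slash S f mat_T) else 0)"
  using is_dist_SL2[OF assms, of 1 1 1 0] by (simp add: mat_T_eq cong: if_cong)

lemma is_dist_S:
  assumes "is_dist val \<mu>"
  shows "is_dist (\<lambda>a b. val b (- a)) (\<lambda>f. if f \<in> schwartz' S then \<mu> (slash S f mat_S) else 0)"
  using is_dist_SL2[OF assms, of 0 0 "-1" 1] by (simp add: mat_S_eq cong: if_cong)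

text \<open>The formula prescribed by the theorem, recognised by its coset values;
  \<open>is_dist_T_E\<close> finds the same values for the change of E.\<close>

lemma is_dist_T_formula:
  "is_dist T_val (\<lambda>f. if f \<in> schwartz' S then - (1 / 2) * smooth S c (B2_B0 S) (slash S f mat_T)
     + Psi S c (slash S f mat_T) - Psi S c f else 0)"
proof -
  let ?B = "\<lambda>a (b::rat). bern2 (frac a)"
  have "is_dist (\<lambda>a b. (- (1 / 2) * smoothed ?B a (a + b) + Psi_val a (a + b)) - Psi_val a b)
    (\<lambda>f. (if f \<in> schwartz' S then - (1 / 2) * smooth S c (B2_B0 S) (slash S f mat_T)
     + Psi S c (slash S f mat_T) else 0) - Psi S c f)"
    unfolding B2_B0_def
    by (rule is_dist_diff[OF is_dist_T[OF is_dist_add[OF is_dist_cmult[OF is_dist_smooth[OF dist_rel_B2]] is_dist_Psi]] is_dist_Psi])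
  also have "(\<lambda>f. (if f \<in> schwartz' S then - (1 / 2) * smooth S c (B2_B0 S) (slash S f mat_T)
     + Psi S c (slash S f mat_T) else 0) - Psi S c f) = (\<lambda>f. if f \<in> schwartz' S then - (1 / 2) * smooth S c (B2_B0 S) (slash S f mat_T)
     + Psi S c (slash S f mat_T) - Psi S c f else 0)"
    by (simp add: fun_eq_iff is_dist_out[OF is_dist_Psi])
  finally show ?thesis
    by (rule is_dist_cong)
       (simp add: T_val_def Psi_val_def smoothed_def delta0_bern1'_translate distrib_left[of "of_nat c"])
qed

lemma is_dist_T_E:
  assumes z: "z \<in> upper_half"
  shows "is_dist (\<lambda>a b. of_rat (T_val a b))
    (\<lambda>f. (if f \<in> schwartz' S then E_tilde S c (slash S f mat_T) (z - 1) else 0) - E_tilde S c f z)"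
proof -
  have z1: "z - 1 \<in> upper_half" using z by (simp add: upper_half_iff)
  show ?thesis
    by (rule is_dist_cong[OF is_dist_diff[OF is_dist_T[OF is_dist_E[OF z1]] is_dist_E[OF z]]])
       (simp add: smoothed_def T_val_def distrib_left[of "of_nat c"] E_log_translate of_rat_diff of_rat_add of_rat_mult
          of_rat_minus of_rat_power of_rat_divide algebra_simps diff_divide_distrib)
qed

lemma E_T:
  assumes f: "f \<in> schwartz' S" and z: "z \<in> upper_half"
  shows "E_tilde S c (slash S f mat_T) (z - 1) - E_tilde S c f z =
    of_rat (- (1 / 2) * smooth S c (B2_B0 S) (slash S f mat_T) + Psi S c (slash S f mat_T) - Psi S c f)"
  using is_dist_of_rat_eq[OF is_dist_T_E[OF z] is_dist_T_formula, of f] f by simp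

lemma T_formula_Ints: "f \<in> schwartz' S \<Longrightarrow>
    - (1 / 2) * smooth S c (B2_B0 S) (slash S f mat_T) + Psi S c (slash S f mat_T) - Psi S c f \<in> \<int>"
  using is_dist_Ints[OF is_dist_T_formula T_val_Ints, of f] by simp

text \<open>The product uses \<open>bern1\<close>, with value -1/2 at integers, because that is what
  inversion produces with fractional parts as parameters; \<open>bern1_prod\<close> passes to the
  odd version.\<close>

definition S_val :: "rat \<Rightarrow> rat \<Rightarrow> rat" where
  "S_val a b = smoothed (\<lambda>a b. bern1 a * bern1 b) a b + pi_val b (- a) - pi_val a b"

text \<open>Substituting c B_1(x) = Kc(x) + B_1(cx) leaves Kc(a) Kc(b), up to a multiple of Kc(b)
  that comes from \<open>bern1\<close> failing to be odd at integers.\<close>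

lemma S_val_Ints: "S_val a b \<in> \<int>"
proof -
  have ca: "of_nat c * bern1 x = Kc x + bern1 (x * of_nat c)" for x by (simp add: Kc_def)
  have "S_val a b = (of_nat c * bern1 a) * (of_nat c * bern1 b) - bern1 (a * of_nat c) * bern1 (b * of_nat c)
     + (- bern1 (a * of_nat c) - delta0 (a * of_nat c)) * Kc b - bern1 (b * of_nat c) * Kc a"
    unfolding S_val_def smoothed_def pi_val_eq bern1_uminus[symmetric]
    by (simp add: power2_eq_square mult_ac)
  also have "\<dots> = Kc a * Kc b - delta0 (a * of_nat c) * Kc b"
    unfolding ca by (simp add: algebra_simps)
  also have "\<dots> \<in> \<int>" by (intro Ints_diff Ints_mult Kc_Ints) (simp add: delta0_def)
  finally show ?thesis .
qed

text \<open>The two corrections are the values of delta_0 tensor B_1 at S(a, b) and at (a, b), which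
  explains the half multiple of that distribution in \<open>Psi\<close>. Were both arguments
  integral, 1/4 would be missing.\<close>

lemma bern1_prod:
  assumes "nonint a b"
  shows "bern1 a * bern1 b = bern1' a * bern1' b + 1 / 2 * (delta0 b * bern1' (- a)) - 1 / 2 * (delta0 a * bern1' b)"
  using assms unfolding nonint_def
  by (cases "a \<in> \<int>"; cases "b \<in> \<int>") (simp_all add: bern1'_def bern1_def delta0_def frac_neg field_simps)

lemma is_dist_S_formula:
  "is_dist S_val (\<lambda>f. if f \<in> schwartz' S then smooth S c (B1_B1 S) f + Psi S c (slash S f mat_S) - Psi S c f else 0)"
proof -
  let ?B = "\<lambda>a b. bern1' a * bern1' b"
  have "is_dist (\<lambda>a b. (smoothed ?B a b + Psi_val b (- a)) - Psi_val a b)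
    (\<lambda>f. (smooth S c (B1_B1 S) f + (if f \<in> schwartz' S then Psi S c (slash S f mat_S) else 0)) - Psi S c f)"
    unfolding B1_B1_def
    by (rule is_dist_diff[OF is_dist_add[OF is_dist_smooth[OF dist_rel_B1_B1] is_dist_S[OF is_dist_Psi]] is_dist_Psi])
  also have "(\<lambda>f. (smooth S c (B1_B1 S) f + (if f \<in> schwartz' S then Psi S c (slash S f mat_S) else 0)) - Psi S c f) =
     (\<lambda>f. if f \<in> schwartz' S then smooth S c (B1_B1 S) f + Psi S c (slash S f mat_S) - Psi S c f else 0)"
    unfolding B1_B1_def
    by (simp add: fun_eq_iff is_dist_out[OF is_dist_Psi] is_dist_out[OF is_dist_smooth[OF dist_rel_B1_B1]])
  finally show ?thesis
  proof (rule is_dist_cong)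
    fix a b assume ab: "nonint a b"
    show "(smoothed ?B a b + Psi_val b (- a)) - Psi_val a b = S_val a b"
      unfolding S_val_def Psi_val_def smoothed_def bern1_prod[OF ab] bern1_prod[OF nonint_mult_c[OF ab]]
      by (simp add: algebra_simps)
  qed
qed

text \<open>For integral \<open>a\<close>, Clog restores the factor with y = 0 that
  \<open>log_u\<close> omits. The free integer \<open>n\<close> lets the second parameter be any
  representative, as inversion uses {b} on one side and -{a} on the other.\<close>

lemma clog_log_u:
  assumes ab: "nonint a b" and z: "Im z > 0"
  shows "clog a b + log_u a b z = log_siegel (of_rat (frac a)) (of_rat (b + of_int n)) z"
proof -
  have p: "log_theta x (of_rat (b + of_int n)) z = log_theta x (of_rat b) z"
    "log_theta x (- of_rat (b + of_int n)) z = log_theta x (of_rat (- b)) z" for x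
    using log_theta_periodic[of x "of_rat b" n z] log_theta_periodic[of x "of_rat (- b)" "- n" z]
    by (simp_all add: of_rat_add of_rat_minus)
  show ?thesis
  proof (cases "a \<in> \<int>")
    case True
    then have b: "b \<notin> \<int>" and fr: "frac a = 0" "frac (- a) = 0" using ab by (simp_all add: nonint_def)
    have "ee (of_rat (b + of_int n)) = ee (of_rat b)" by (simp add: of_rat_add ee_add)
    then show ?thesis
      using p[of 1] True unfolding log_siegel_def log_u_def log_theta_mod_def fr clog_eq[OF b]
      by (simp add: fr delta0_def)
  next
    case False
    then have fr: "1 - frac (- a) = frac a" and pos: "0 < real_of_rat (frac a)" by (simp_all add: frac_neg)
    show ?thesis
      unfolding log_siegel_pos[OF pos z] p log_u_def log_theta_mod_def fr
      using False by (simp add: clog_def delta0_def of_rat_diff)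
  qed
qed

lemma nonint_S: "nonint a b \<Longrightarrow> nonint b (- a)"
  using nonint_SL2[of a b 0 0 "- 1" 1] by simp

text \<open>The B_2 terms in the residue at 0 are exactly those carried by \<open>E_log\<close> at z
  and at -1/z, so only the constant survives.\<close>

lemma E_log_inversion:
  assumes ab: "nonint a b" and z: "z \<in> upper_half"
  shows "E_log (- 1 / z) b (- a) - E_log z a b = of_rat (bern1 a * bern1 b)"
proof -
  define t where "t = - 1 / z"
  define al be where "al = real_of_rat (frac a)" and "be = real_of_rat (frac b)"
  have z0: "Im z > 0" "z \<noteq> 0" using z by (auto simp: upper_half_iff)
  have t: "Im t > 0" using minus_inverse_upper_half[OF z] by (simp only: t_def upper_half_iff)
  have nz: "\<not> (al = 0 \<and> be = 0)" using ab by (simp add: al_def be_def nonint_def)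
  have fb: "b + of_int (- \<lfloor>b\<rfloor>) = frac b" and fa: "- a + of_int \<lfloor>a\<rfloor> = - frac a" by (simp_all add: frac_def)
  have 1: "clog a b + log_u a b z = log_siegel al be z"
    using clog_log_u[OF ab z0(1), of "- \<lfloor>b\<rfloor>"] unfolding fb al_def be_def .
  have 2: "clog b (- a) + log_u b (- a) t = log_siegel be (- al) t"
    using clog_log_u[OF nonint_S[OF ab] t, of "\<lfloor>a\<rfloor>"] unfolding fa al_def be_def by (simp add: of_rat_minus)
  have d: "log_siegel be (- al) t - log_siegel al be z =
    2 * of_real pi * \<i> * (z * of_real (al^2 - al + 1/6) / 2 + of_real (be^2 - be + 1/6) / (2 * z) + of_real ((al - 1/2) * (be - 1/2)))"
    unfolding t_def by (rule log_siegel_inversion) (use of_rat_frac_bounds nz z0 in \<open>auto simp: al_def be_def\<close>)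
  have b2: "of_rat (bern2 (frac a)) = (of_real (al^2 - al + 1/6) :: complex)"
    "of_rat (bern2 (frac b)) = (of_real (be^2 - be + 1/6) :: complex)"
    by (simp_all add: bern2_def al_def be_def of_rat_add of_rat_diff of_rat_power of_rat_divide)
  have b1: "of_rat (bern1 a * bern1 b) = (of_real ((al - 1/2) * (be - 1/2)) :: complex)"
    by (simp add: bern1_def al_def be_def of_rat_mult of_rat_diff of_rat_divide)
  have "E_log t b (- a) - E_log z a b = t / 2 * of_real (be^2 - be + 1/6) - z / 2 * of_real (al^2 - al + 1/6)
     + 1 / (2 * of_real pi * \<i>) * (log_siegel be (- al) t - log_siegel al be z)"
    unfolding E_log_def 1 2 b2 by (simp only: right_diff_distrib) simp
  also have "1 / (2 * of_real pi * \<i>) * (log_siegel be (- al) t - log_siegel al be z) =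
    z * of_real (al^2 - al + 1/6) / 2 + of_real (be^2 - be + 1/6) / (2 * z) + of_real ((al - 1/2) * (be - 1/2))"
    unfolding d by (simp del: of_real_add of_real_diff of_real_mult of_real_divide)
  also have "t / 2 * of_real (be^2 - be + 1/6) = - (of_real (be^2 - be + 1/6) / (2 * z))"
    by (simp add: t_def)
  finally show ?thesis unfolding b1 t_def by simp
qed

lemma is_dist_S_E:
  assumes z: "z \<in> upper_half"
  shows "is_dist (\<lambda>a b. of_rat (S_val a b))
    (\<lambda>f. (if f \<in> schwartz' S then E_tilde S c (slash S f mat_S) (- 1 / z) else 0) - E_tilde S c f z)"
proof (rule is_dist_cong[OF is_dist_diff[OF is_dist_S[OF is_dist_E[OF minus_inverse_upper_half[OF z]]] is_dist_E[OF z]]])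
  fix a b assume ab: "nonint a b"
  have "of_rat (S_val a b) = of_nat (c^2) * of_rat (bern1 a * bern1 b) - of_rat (bern1 (of_nat c * a) * bern1 (of_nat c * b))
     + of_rat (pi_val b (- a)) - (of_rat (pi_val a b) :: complex)"
    by (simp add: S_val_def smoothed_def of_rat_add of_rat_diff of_rat_mult of_rat_power)
  then show "smoothed (E_log (- 1 / z)) b (- a) + of_rat (pi_val b (- a)) - (smoothed (E_log z) a b + of_rat (pi_val a b)) =
    of_rat (S_val a b)"
    unfolding E_log_inversion[OF ab z, symmetric] E_log_inversion[OF nonint_mult_c[OF ab] z, symmetric] smoothed_def
    by (simp only: mult_minus_right) (simp add: algebra_simps)
qed

lemma E_S:
  assumes f: "f \<in> schwartz' S" and z: "z \<in> upper_half"
  shows "E_tilde S c (slash S f mat_S) (- 1 / z) - E_tilde S c f z =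
    of_rat (smooth S c (B1_B1 S) f + Psi S c (slash S f mat_S) - Psi S c f)"
  using is_dist_of_rat_eq[OF is_dist_S_E[OF z] is_dist_S_formula, of f] f by simp

lemma S_formula_Ints: "f \<in> schwartz' S \<Longrightarrow>
    smooth S c (B1_B1 S) f + Psi S c (slash S f mat_S) - Psi S c f \<in> \<int>"
  using is_dist_Ints[OF is_dist_S_formula S_val_Ints, of f] by simp

text \<open>In the B_2 part the K equal terms absorb the division of z by \<open>K\<close>; the
  logarithms obey the relation in the second variable.\<close>

lemma E_log_sum_snd:
  assumes ab: "nonint a b" and K: "K > 0" and z: "z \<in> upper_half"
  shows "(\<Sum>j<K. E_log (z / of_nat K) a ((b + of_nat j) / of_nat K)) = E_log z a b"
proof -
  have "(\<Sum>j<K. E_log (z / of_nat K) a ((b + of_nat j) / of_nat K)) = of_nat K * (z / of_nat K / 2 * of_rat (bern2 (frac a)))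
    + 1 / (2 * of_real pi * \<i>) * ((\<Sum>j<K. clog a ((b + of_nat j) / of_nat K))
       + (\<Sum>j<K. log_u a ((b + of_nat j) / of_nat K) (z / of_nat K)))"
    unfolding E_log_def sum.distrib sum_distrib_left[symmetric] by simp
  then show ?thesis
    using K z by (simp add: E_log_def clog_sum_snd[OF ab K] log_u_sum_snd[OF K] upper_half_iff)
qed

text \<open>By \<open>slash_coset_diag\<close> this is a sum over the second variable at z/n. The
  part evaluated at (ca, cb) is reordered using that \<open>c\<close> is a unit modulo
  \<open>n\<close>, and \<open>pi_c\<close> obeys the one-variable relation in
  \<open>b\<close>.\<close>

lemma E_diag:
  assumes f: "f \<in> schwartz' S" and z: "z \<in> upper_half" and n: "n > 0" "coprime n c"
  shows "E_tilde S c (slash S f (mat2 (of_nat n) 0 0 1)) (z / of_nat n) = E_tilde S c f z"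
proof -
  have zn: "z / of_nat n \<in> upper_half" using z n by (simp add: upper_half_iff)
  have "is_dist (\<lambda>a b. smoothed (E_log z) a b + of_rat (pi_val a b))
     (\<lambda>f. if f \<in> schwartz' S then E_tilde S c (slash S f (mat2 (of_nat n) 0 0 1)) (z / of_nat n) else 0)"
  proof (rule is_dist_cong[OF is_dist_diag[OF is_dist_E[OF zn] n]])
    fix a b assume ab: "nonint a b"
    have per: "E_log w a (b + of_int m) = E_log w a b" for w a b m
      using clog_add_of_int[of a 0 b m] log_u_add_of_int[of a 0 b m] by (simp add: E_log_def)
    have cop: "coprime (int c) (int n)" using n by (simp add: coprime_commute)
    have arg: "of_nat c * ((b + of_nat j) / of_nat n) = (of_nat c * b + of_int (int c * int j + 0)) / of_nat n" for j
      by (simp add: algebra_simps)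
    have 2: "(\<Sum>j<n. E_log (z / of_nat n) (of_nat c * a) (of_nat c * ((b + of_nat j) / of_nat n))) = E_log z (of_nat c * a) (of_nat c * b)"
      unfolding arg sum_divide_reindex[where F = "\<lambda>y. E_log (z / of_nat n) (of_nat c * a) y", OF per n(1) cop]
      by (rule E_log_sum_snd[OF nonint_mult_c[OF ab] n(1) z])
    have 1: "(\<Sum>j<n. smoothed (E_log (z / of_nat n)) a ((b + of_nat j) / of_nat n)) = smoothed (E_log z) a b"
      unfolding smoothed_def sum_subtractf sum_distrib_left[symmetric] 2 E_log_sum_snd[OF ab n(1) z] ..
    have 3: "(\<Sum>j<n. pi_val a ((b + of_nat j) / of_nat n)) = pi_val a b"
      using mult_rel_sum[OF mult_rel_mult_c[OF mult_rel_bern1] n, of b]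
      unfolding pi_val_eq sum_distrib_right[symmetric] by simp
    show "(\<Sum>j<n. smoothed (E_log (z / of_nat n)) a ((b + of_nat j) / of_nat n) + of_rat (pi_val a ((b + of_nat j) / of_nat n))) =
      smoothed (E_log z) a b + of_rat (pi_val a b)"
      unfolding sum.distrib 1 3[symmetric] by (simp add: of_rat_sum)
  qed
  from is_dist_unique[OF this is_dist_E[OF z]] have "(if f \<in> schwartz' S then E_tilde S c (slash S f (mat2 (of_nat n) 0 0 1)) (z / of_nat n) else 0) = E_tilde S c f z"
    by (simp only: fun_eq_iff)
  then show ?thesis using f by simp
qed

end

section \<open>Generators of \<open>G\<^sub>S\<close>\<close>

lemma moebius_mat2: "moebius (mat2 p q r s) z = (of_rat p * z + of_rat q) / (of_rat r * z + of_rat s)"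
  by (simp add: moebius_def)

lemma moebius_denominator_nonzero:
  assumes "p * s - q * r \<noteq> 0" "z \<in> upper_half" shows "of_rat r * z + of_rat s \<noteq> 0"
proof
  assume eq: "of_rat r * z + of_rat s = 0"
  have "Im (of_rat r * z + of_rat s) = of_rat r * Im z" by simp
  then have "of_rat r * Im z = 0" using eq by simp
  then have "r = 0" using assms(2) by (auto simp: upper_half_iff)
  moreover from this eq have "s = 0" by simp
  ultimately show False using assms(1) by simp
qed

lemma moebius_upper_half:
  assumes "det g > 0" "z \<in> upper_half" shows "moebius g z \<in> upper_half"
proof -
  obtain p q r s where g: "g = mat2 p q r s" by (rule mat2_cases)
  have d: "p * s - q * r > 0" using assms(1) by (simp add: g det_mat2)
  have "Im ((of_rat p * z + of_rat q) * cnj (of_rat r * z + of_rat s)) = of_rat (p * s - q * r) * Im z"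
    by (simp add: of_rat_diff of_rat_mult algebra_simps)
  also have "\<dots> > 0" using d assms(2) by (simp add: upper_half_iff)
  finally show ?thesis unfolding g upper_half_iff moebius_mat2 Im_complex_div_gt_0 .
qed

lemma moebius_mult:
  assumes "det h \<noteq> 0" "z \<in> upper_half"
  shows "moebius (g ** h) z = moebius g (moebius h z)"
proof -
  obtain p q r s where g: "g = mat2 p q r s" by (rule mat2_cases)
  obtain p' q' r' s' where h: "h = mat2 p' q' r' s'" by (rule mat2_cases)
  define N where "N = of_rat r' * z + of_rat s'"
  define M where "M = of_rat p' * z + of_rat q'"
  have N: "N \<noteq> 0" unfolding N_def
    by (rule moebius_denominator_nonzero[of p' _ q']) (use assms in \<open>simp_all add: h det_mat2\<close>)
  have "of_rat p * (M / N) + of_rat q = (of_rat p * M + of_rat q * N) / N"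
    "of_rat r * (M / N) + of_rat s = (of_rat r * M + of_rat s * N) / N" using N by (simp_all add: add_divide_distrib)
  then have "moebius g (moebius h z) = (of_rat p * M + of_rat q * N) / (of_rat r * M + of_rat s * N)"
    unfolding g h moebius_mat2 M_def[symmetric] N_def[symmetric] using N by simp
  then show ?thesis
    unfolding g h mat2_mult moebius_mat2 M_def N_def by (simp add: of_rat_add of_rat_mult algebra_simps)
qed

lemma moebius_1: "moebius (mat 1) z = z"
  by (simp add: mat_eq_mat2 moebius_mat2)

lemma det_inv_pos:
  fixes g :: "rat^2^2" assumes "det g > 0" shows "det (matrix_inv g) > 0"
proof -
  have "det g * det (matrix_inv g) = 1" using assms det_mul[of g "matrix_inv g"] matrix_inv_mult_self[of g] by simp
  then show ?thesis using assms by (metis zero_less_mult_pos zero_less_one)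
qed

context smoothing
begin

lemma S_prime: "l \<in> S \<Longrightarrow> prime l"
  by (simp add: S_eq)

lemma S_nonempty: "\<exists>l. l \<in> S"
  using prime_factor_nat[of c] c_gt_1 by (auto simp: S_eq)

lemma finite_S: "finite S"
  using c_gt_1 finite_divisors_nat[of c] by (auto simp: S_eq elim: finite_subset[rotated])

lemma Z_S_units_iff: "x \<in> Z_S_units S \<longleftrightarrow> (\<forall>l\<in>S. padic_abs l x = 1)"
proof
  assume x: "x \<in> Z_S_units S"
  show "\<forall>l\<in>S. padic_abs l x = 1"
  proof
    fix l assume l: "l \<in> S"
    have "padic_abs l x \<le> 1" "padic_abs l (inverse x) \<le> 1" "x \<noteq> 0" using x l by (auto simp: Z_S_units_def Z_S_def)
    then show "padic_abs l x = 1"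
      using padic_abs_inverse[OF S_prime[OF l], of x] padic_abs_pos[OF S_prime[OF l], of x]
      by (simp add: inverse_le_1_iff)
  qed
next
  assume x: "\<forall>l\<in>S. padic_abs l x = 1"
  obtain l where "l \<in> S" using S_nonempty by blast
  then have "x \<noteq> 0" using x by auto
  moreover have "padic_abs l (inverse x) = 1" if "l \<in> S" for l using x that padic_abs_inverse[OF S_prime[OF that], of x] by simp
  ultimately show "x \<in> Z_S_units S" using x by (simp add: Z_S_units_def Z_S_def)
qed

lemma padic_abs_add_eq_1:
  assumes l: "l \<in> S" and "padic_abs l x = 1" "padic_abs l y < 1" shows "padic_abs l (x + y) = 1"
proof (rule antisym)
  note p = S_prime[OF l]
  show "padic_abs l (x + y) \<le> 1" using padic_abs_add[OF p, of x y] assms by simp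
  show "1 \<le> padic_abs l (x + y)" using padic_abs_diff[OF p, of "x + y" y] assms by (simp add: max_def split: if_splits)
qed

lemma padic_abs_less_1_dvd:
  assumes l: "l \<in> S" "l dvd k" shows "padic_abs l (of_nat k) < 1"
proof -
  have "padic_abs l (of_int (int k)) \<le> real l powi (- int 1)"
    using assms by (subst padic_abs_of_int_le_iff[OF S_prime]) auto
  also have "\<dots> < 1" using prime_gt_1_nat[OF S_prime[OF l(1)]] by (simp add: power_int_minus inverse_less_1_iff)
  finally show ?thesis by simp
qed

text \<open>The shift is the product of the primes in \<open>S\<close> at which \<open>p\<close> is already a unit.\<close>

lemma unit_shift:
  assumes p: "p \<in> Z_S S" and r: "r \<in> Z_S S" and q: "q \<in> Z_S S" and s: "s \<in> Z_S S"
    and d: "p * s - q * r \<in> Z_S_units S"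
  obtains k :: nat where "p + of_nat k * r \<in> Z_S_units S"
proof -
  define k where "k = (\<Prod>l\<in>{l \<in> S. padic_abs l p = 1}. l)"
  have fin: "finite {l \<in> S. padic_abs l p = 1}" using finite_S by simp
  have "padic_abs l (p + of_nat k * r) = 1" if l: "l \<in> S" for l
  proof -
    note pr = S_prime[OF l]
    have le: "padic_abs l p \<le> 1" "padic_abs l r \<le> 1" "padic_abs l q \<le> 1" "padic_abs l s \<le> 1"
      using p q r s l by (auto simp: Z_S_def)
    show ?thesis
    proof (cases "padic_abs l p = 1")
      case True
      then have "l dvd k" unfolding k_def using l fin by (intro dvd_prodI) auto
      then have "padic_abs l (of_nat k) < 1" by (rule padic_abs_less_1_dvd[OF l])
      then have "padic_abs l (of_nat k * r) < 1"
        using le(2) mult_left_le[of "padic_abs l r" "padic_abs l (of_nat k)"] by (simp add: padic_abs_mult[OF pr])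
      then show ?thesis by (rule padic_abs_add_eq_1[OF l True])
    next
      case False
      then have p1: "padic_abs l p < 1" using le by simp
      have cop: "coprime l k" unfolding k_def
      proof (rule prod_coprime_right)
        fix l' assume l': "l' \<in> {l \<in> S. padic_abs l p = 1}"
        then have "l \<noteq> l'" using False by auto
        then show "coprime l l'" using l' pr S_prime[of l'] by (intro primes_coprime) auto
      qed
      have "padic_abs l r = 1"
      proof (rule ccontr)
        assume "padic_abs l r \<noteq> 1"
        then have r1: "padic_abs l r < 1" using le by simp
        have "padic_abs l (p * s) < 1" "padic_abs l (q * r) < 1"
          using p1 r1 le mult_left_le[of "padic_abs l s" "padic_abs l p"] mult_left_le_one_le[of "padic_abs l r" "padic_abs l q"]
          by (simp_all add: padic_abs_mult[OF pr])
        then have "padic_abs l (p * s - q * r) < 1" using padic_abs_diff[OF pr, of "p * s" "q * r"] by simp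
        then show False using d l unfolding Z_S_units_iff by auto
      qed
      then have "padic_abs l (of_nat k * r) = 1" using padic_abs_of_nat_coprime[OF pr cop] by (simp add: padic_abs_mult[OF pr])
      then show ?thesis using padic_abs_add_eq_1[OF l _ p1, of "of_nat k * r"] by (simp add: add.commute)
    qed
  qed
  then show ?thesis by (intro that[of k]) (simp add: Z_S_units_iff)
qed

lemma Z_S_units_in: "x \<in> Z_S_units S \<Longrightarrow> x \<in> Z_S S"
  by (simp add: Z_S_units_def)

lemma Z_S_units_divide: "x \<in> Z_S_units S \<Longrightarrow> y \<in> Z_S_units S \<Longrightarrow> x / y \<in> Z_S_units S"
  unfolding divide_inverse by (intro Z_S_units_mult Z_S_units_inverse)

lemma Z_S_divide_unit: "x \<in> Z_S S \<Longrightarrow> y \<in> Z_S_units S \<Longrightarrow> x / y \<in> Z_S S"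
  unfolding divide_inverse by (intro Z_S_mult Z_S_units_in[OF Z_S_units_inverse])

lemma Z_S_units_minus: "x \<in> Z_S_units S \<Longrightarrow> - x \<in> Z_S_units S"
  unfolding Z_S_units_iff using S_prime by simp

lemma Z_S_units_1 [simp]: "1 \<in> Z_S_units S"
  by (simp add: Z_S_units_def)

lemma G_S_S: "mat_S \<in> G_S S" and G_S_T: "mat_T \<in> G_S S"
  by (simp_all add: mat_S_eq mat_T_eq G_S_mat2 Z_S_minus)

text \<open>A matrix with unit upper left entry is lower unipotent times diagonal times upper
  unipotent. A negative entry is corrected by -1 = S^2, and \<open>unit_shift\<close> supplies a
  unit in general, by a shear that is undone at the end.\<close>

lemma G_S_induct [consumes 1, case_names S T diag mult inv]:
  assumes g: "g \<in> G_S S"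
    and PS: "P mat_S" and PT: "P mat_T"
    and diag: "\<And>x y. x \<in> Z_S_units S \<Longrightarrow> y \<in> Z_S_units S \<Longrightarrow> x > 0 \<Longrightarrow> y > 0 \<Longrightarrow> P (mat2 x 0 0 y)"
    and mult: "\<And>g h. g \<in> G_S S \<Longrightarrow> h \<in> G_S S \<Longrightarrow> P g \<Longrightarrow> P h \<Longrightarrow> P (g ** h)"
    and inv: "\<And>g. g \<in> G_S S \<Longrightarrow> P g \<Longrightarrow> P (matrix_inv g)"
  shows "P g"
proof -
  define Q where "Q = (\<lambda>g. g \<in> G_S S \<and> P g)"
  have Qm: "Q (g ** h)" if "Q g" "Q h" for g h using that mult G_S_mult unfolding Q_def by blast
  have Qi: "Q (matrix_inv g)" if "Q g" for g using that inv G_S_inv unfolding Q_def by blast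
  have QS: "Q mat_S" and QT: "Q mat_T" using PS PT G_S_S G_S_T by (simp_all add: Q_def)
  have Qd: "Q (mat2 x 0 0 y)" if "x \<in> Z_S_units S" "y \<in> Z_S_units S" "x > 0" "y > 0" for x y
    using that diag Z_S_units_mult by (simp add: Q_def G_S_mat2 Z_S_units_in)
  have Un: "Q (mat2 1 (of_nat n) 0 1)" for n
  proof (induction n)
    case 0 then show ?case using Qd[of 1 1] by simp
  next
    case (Suc n)
    have "mat2 1 (of_nat (Suc n)) 0 1 = mat2 1 (of_nat n) 0 1 ** mat_T" by (simp add: mat_T_eq mat2_mult)
    then show ?case using Qm[OF Suc QT] by simp
  qed
  have Uz: "Q (mat2 1 (of_int m) 0 1)" for m
  proof (cases "m \<ge> 0")
    case True then show ?thesis using Un[of "nat m"] by simp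
  next
    case False
    have "matrix_inv (mat2 1 (of_nat (nat (- m))) 0 1) = mat2 1 (of_int m) 0 1"
      using matrix_inv_mat2[of 1 1 1 "of_nat (nat (- m))" 0] False by simp
    then show ?thesis using Qi[OF Un[of "nat (- m)"]] by simp
  qed
  have U: "Q (mat2 1 x 0 1)" if x: "x \<in> Z_S S" for x
  proof -
    obtain a N where N: "N > 0" "coprime N c" "x = of_int a / of_nat N" using x by (rule Z_S_cases)
    have u: "of_nat N \<in> Z_S_units S" "1 / of_nat N \<in> Z_S_units S"
      using Z_S_units_of_nat[OF N(1,2)] Z_S_units_divide[OF Z_S_units_1] by simp_all
    \<comment> \<open>Conjugation by diag(N, 1) divides the off-diagonal entry by \<open>N\<close>,
      which is a unit in \<open>Z_S\<close>.\<close>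
    have "mat2 1 x 0 1 = mat2 (1 / of_nat N) 0 0 1 ** mat2 1 (of_int a) 0 1 ** mat2 (of_nat N) 0 0 1"
      using N by (simp add: mat2_mult)
    then show ?thesis using Qm[OF Qm[OF Qd[of "1 / of_nat N" 1] Uz[of a]] Qd[of "of_nat N" 1]] u N by simp
  qed
  have Sinv: "matrix_inv mat_S = mat2 0 1 (- 1) 0"
    using matrix_inv_mat2[of 0 0 1 "- 1" 1] by (simp add: mat_S_eq)
  have L: "Q (mat2 1 0 x 1)" if "x \<in> Z_S S" for x
  proof -
    have "mat2 1 0 x 1 = mat_S ** mat2 1 (- x) 0 1 ** matrix_inv mat_S"
      unfolding Sinv by (simp add: mat_S_eq mat2_mult)
    then show ?thesis using Qm[OF Qm[OF QS U[OF Z_S_minus[OF that]]] Qi[OF QS]] by simp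
  qed
  have pos: "Q (mat2 p q r s)" if p: "p \<in> Z_S_units S" "p > 0" and G: "mat2 p q r s \<in> G_S S" for p q r s
  proof -
    define d where "d = p * s - q * r"
    have d: "d \<in> Z_S_units S" "d > 0" "q \<in> Z_S S" "r \<in> Z_S S" using G by (simp_all add: G_S_mat2 d_def)
    have "mat2 p q r s = mat2 1 0 (r / p) 1 ** mat2 p 0 0 (d / p) ** mat2 1 (q / p) 0 1"
      using p by (simp add: mat2_mult mat2_eq_iff d_def field_simps)
    then show ?thesis
      using Qm[OF Qm[OF L[of "r / p"] Qd[of p "d / p"]] U[of "q / p"]] p d
      by (simp add: Z_S_divide_unit Z_S_units_divide)
  qed
  have unit: "Q (mat2 p q r s)" if p: "p \<in> Z_S_units S" and G: "mat2 p q r s \<in> G_S S" for p q r s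
  proof (cases "p > 0")
    case True then show ?thesis using pos p G by blast
  next
    case False
    have p0: "- p > 0" using False p by (auto simp: Z_S_units_def)
    have "mat2 (- p) (- q) (- r) (- s) \<in> G_S S" using G by (simp add: G_S_mat2 Z_S_minus)
    then have "Q (mat2 (- p) (- q) (- r) (- s))" using pos[OF Z_S_units_minus[OF p] p0] by blast
    moreover have "mat2 p q r s = mat_S ** mat_S ** mat2 (- p) (- q) (- r) (- s)"
      by (simp add: mat_S_eq mat2_mult)
    ultimately show ?thesis using Qm[OF Qm[OF QS QS]] by simp
  qed
  obtain p q r s where eq: "g = mat2 p q r s" by (rule mat2_cases)
  have a: "p \<in> Z_S S" "q \<in> Z_S S" "r \<in> Z_S S" "s \<in> Z_S S" "p * s - q * r \<in> Z_S_units S"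
    using g by (simp_all add: eq G_S_mat2)
  obtain k where k: "p + of_nat k * r \<in> Z_S_units S" using unit_shift[OF a(1,3,2,4,5)] by blast
  have U': "mat2 1 (of_nat k) 0 1 \<in> G_S S" using Un by (simp add: Q_def)
  have e: "mat2 (p + of_nat k * r) (q + of_nat k * s) r s = mat2 1 (of_nat k) 0 1 ** g"
    by (simp add: eq mat2_mult)
  then have "mat2 (p + of_nat k * r) (q + of_nat k * s) r s \<in> G_S S" using G_S_mult[OF U' g] by simp
  from unit[OF k this] have "Q (mat2 1 (of_nat k) 0 1 ** g)" unfolding e .
  then have "Q (matrix_inv (mat2 1 (of_nat k) 0 1) ** (mat2 1 (of_nat k) 0 1 ** g))" using Qm Qi Un by blast
  also have "matrix_inv (mat2 1 (of_nat k) 0 1) ** (mat2 1 (of_nat k) 0 1 ** g) = g"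
    using matrix_inv_mult_self(2)[OF G_S_det_nz[OF U']] by (simp add: matrix_mul_assoc)
  finally show ?thesis by (simp add: Q_def)
qed

section \<open>The cocycle\<close>

definition E_act :: "rat^2^2 \<Rightarrow> (adele2 \<Rightarrow> int) \<Rightarrow> complex \<Rightarrow> complex" where
  "E_act g f z = E_tilde S c (slash S f g) (moebius (matrix_inv g) z)"

lemma G_S_det_pos: "g \<in> G_S S \<Longrightarrow> det g > 0"
  by (simp add: G_S_def)

lemma moebius_inv_upper_half: "g \<in> G_S S \<Longrightarrow> z \<in> upper_half \<Longrightarrow> moebius (matrix_inv g) z \<in> upper_half"
  by (intro moebius_upper_half det_inv_pos G_S_det_pos)

lemma DR_eq:
  assumes "f \<in> schwartz' S" "z \<in> upper_half"
  shows "DR S c g0 g1 f z = E_act g1 f z - E_act g0 f z"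
  using assms by (simp add: DR_def dist_act_def O_slash_def E_act_def)

lemma E_act_1: "f \<in> schwartz' S \<Longrightarrow> E_act (mat 1) f z = E_tilde S c f z"
  by (simp add: E_act_def slash_1 moebius_1)

lemma E_act_mult:
  assumes g: "g \<in> G_S S" and h: "h \<in> G_S S" and z: "z \<in> upper_half"
  shows "E_act (g ** h) f z = E_act h (slash S f g) (moebius (matrix_inv g) z)"
proof -
  have "matrix_inv (g ** h) = matrix_inv h ** matrix_inv g"
    using g h by (intro matrix_inv_mult G_S_det_nz)
  moreover have "slash S (slash S f g) h = slash S f (g ** h)" using g h by (intro slash_mult G_S_det_nz)
  moreover have "det (matrix_inv g) \<noteq> 0" using G_S_det_nz[OF G_S_inv[OF g]] .
  ultimately show ?thesis using z by (simp add: E_act_def moebius_mult)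
qed

text \<open>Turns the change under the inverse of g at (f, z) into minus the change under g at a
  translated pair (f', z'), so that closure under inverses needs no separate computation.\<close>

lemma E_act_inv:
  assumes g: "g \<in> G_S S" and f: "f \<in> schwartz' S" and z: "z \<in> upper_half"
  obtains f' z' where "f' \<in> schwartz' S" "z' \<in> upper_half" "f' = slash S f (matrix_inv g)"
    "E_act (matrix_inv g) f z = E_tilde S c f' z'" "E_act g f' z' = E_tilde S c f z"
proof
  note i = G_S_inv[OF g]
  let ?f = "slash S f (matrix_inv g)" and ?z = "moebius (matrix_inv (matrix_inv g)) z"
  show "?f \<in> schwartz' S" "?z \<in> upper_half" using slash_schwartz'[OF f i] moebius_inv_upper_half[OF i z] .
  show "E_act (matrix_inv g) f z = E_tilde S c ?f ?z" by (simp add: E_act_def)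
  have "E_act g ?f ?z = E_act (matrix_inv g ** g) f z" by (rule E_act_mult[OF i g z, symmetric])
  then show "E_act g ?f ?z = E_tilde S c f z"
    using matrix_inv_mult_self(2)[OF G_S_det_nz[OF g]] E_act_1[OF f] by simp
qed simp

definition E_fixed :: "rat^2^2 \<Rightarrow> bool" where
  "E_fixed g \<longleftrightarrow> (\<forall>f\<in>schwartz' S. \<forall>z\<in>upper_half. E_act g f z = E_tilde S c f z)"

lemma E_fixed_mult: "g \<in> G_S S \<Longrightarrow> h \<in> G_S S \<Longrightarrow> E_fixed g \<Longrightarrow> E_fixed h \<Longrightarrow> E_fixed (g ** h)"
  unfolding E_fixed_def
proof (intro ballI)
  fix f z assume g: "g \<in> G_S S" and h: "h \<in> G_S S" and f: "f \<in> schwartz' S" and z: "z \<in> upper_half"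
    and 1: "\<forall>f\<in>schwartz' S. \<forall>z\<in>upper_half. E_act g f z = E_tilde S c f z"
    and 2: "\<forall>f\<in>schwartz' S. \<forall>z\<in>upper_half. E_act h f z = E_tilde S c f z"
  have "E_act (g ** h) f z = E_tilde S c (slash S f g) (moebius (matrix_inv g) z)"
    unfolding E_act_mult[OF g h z] using 2 slash_schwartz'[OF f g] moebius_inv_upper_half[OF g z] by blast
  also have "\<dots> = E_tilde S c f z" using 1 f z by (simp add: E_act_def)
  finally show "E_act (g ** h) f z = E_tilde S c f z" .
qed

lemma E_fixed_inv: "g \<in> G_S S \<Longrightarrow> E_fixed g \<Longrightarrow> E_fixed (matrix_inv g)"
  unfolding E_fixed_def
proof (intro ballI)
  fix f z assume g: "g \<in> G_S S" and f: "f \<in> schwartz' S" and z: "z \<in> upper_half"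
    and 1: "\<forall>f\<in>schwartz' S. \<forall>z\<in>upper_half. E_act g f z = E_tilde S c f z"
  obtain f' z' where "f' \<in> schwartz' S" "z' \<in> upper_half" "E_act (matrix_inv g) f z = E_tilde S c f' z'"
    "E_act g f' z' = E_tilde S c f z" by (rule E_act_inv[OF g f z])
  then show "E_act (matrix_inv g) f z = E_tilde S c f z" using 1 by simp
qed

lemma G_S_diag: "x \<in> Z_S_units S \<Longrightarrow> y \<in> Z_S_units S \<Longrightarrow> x > 0 \<Longrightarrow> y > 0 \<Longrightarrow> mat2 x 0 0 y \<in> G_S S"
  using Z_S_units_mult by (simp add: G_S_mat2 Z_S_units_in)

text \<open>With x/y = m/n the matrix is diag(m, 1) times the inverse of diag(n, 1) times the scalar
  y: \<open>E_diag\<close> treats the first two, scalar invariance the third.\<close>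

lemma E_fixed_diag:
  assumes x: "x \<in> Z_S_units S" "x > 0" and y: "y \<in> Z_S_units S" "y > 0"
  shows "E_fixed (mat2 x 0 0 y)"
proof -
  have nat: "E_fixed (mat2 (of_nat n) 0 0 1)" if n: "n > 0" "coprime n c" for n
    unfolding E_fixed_def
  proof (intro ballI)
    fix f z assume "f \<in> schwartz' S" "z \<in> upper_half"
    moreover have "matrix_inv (mat2 (of_nat n) 0 0 1) = mat2 (1 / of_nat n) 0 0 1"
      using matrix_inv_mat2[of "of_nat n" 1 "of_nat n" 0 0] n by simp
    ultimately show "E_act (mat2 (of_nat n) 0 0 1) f z = E_tilde S c f z"
      using E_diag[OF _ _ n] by (simp add: E_act_def moebius_mat2 of_rat_divide)
  qed
  have scal: "E_fixed (mat y)"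
    unfolding E_fixed_def
  proof (intro ballI)
    fix f z assume f: "f \<in> schwartz' S" and z: "z \<in> upper_half"
    have "moebius (matrix_inv (mat y)) z = z"
      using y matrix_inv_mat[of y] by (simp add: mat_eq_mat2 moebius_mat2)
    then show "E_act (mat y) f z = E_tilde S c f z"
      using is_dist_scale[OF is_dist_E[OF z] f y] by (simp add: E_act_def)
  qed
  have "x / y > 0" using x y by simp
  then obtain m n where mn: "m > 0" "n > 0" "coprime m c" "coprime n c" "x / y = of_nat m / of_nat n"
    using Z_S_units_cases[OF Z_S_units_divide[OF x(1) y(1)]] by blast
  have G: "mat2 (of_nat n) 0 0 1 \<in> G_S S" if "n > 0" "coprime n c" for n
    using that Z_S_units_of_nat by (intro G_S_diag) simp_all
  have inv: "matrix_inv (mat2 (of_nat n) 0 0 1) = mat2 (1 / of_nat n) 0 0 1"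
    using matrix_inv_mat2[of "of_nat n" 1 "of_nat n" 0 0] mn by simp
  have x': "x = of_nat m / of_nat n * y" using mn(5) y by (simp add: field_simps)
  have "mat2 x 0 0 y = mat2 (of_nat m) 0 0 1 ** matrix_inv (mat2 (of_nat n) 0 0 1) ** mat y"
    unfolding inv by (simp add: mat_eq_mat2 mat2_mult x')
  also have "E_fixed \<dots>"
    by (intro E_fixed_mult E_fixed_inv nat scal G_S_mult G_S_inv G G_S_mat mn y)
  finally show ?thesis .
qed

text \<open>The order of quantifiers matters: the integer may depend on \<open>f\<close> but not on
  z, so it is unchanged when z is moved by a Moebius map in a product of matrices.\<close>

definition E_shift :: "rat^2^2 \<Rightarrow> bool" where
  "E_shift g \<longleftrightarrow> (\<forall>f\<in>schwartz' S. \<exists>k::int. \<forall>z\<in>upper_half. E_act g f z - E_tilde S c f z = of_int k)"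

lemma moebius_inv_T: "moebius (matrix_inv mat_T) z = z - 1"
  using matrix_inv_mat2[of 1 1 1 1 0] by (simp add: mat_T_eq moebius_mat2 of_rat_minus)

lemma moebius_inv_S: "moebius (matrix_inv mat_S) z = - 1 / z"
  using matrix_inv_mat2[of 0 0 1 "- 1" 1] by (simp add: mat_S_eq moebius_mat2 of_rat_minus)

lemma E_shift_G_S: "g \<in> G_S S \<Longrightarrow> E_shift g"
proof (induction rule: G_S_induct)
  case S
  show ?case unfolding E_shift_def
  proof
    fix f assume f: "f \<in> schwartz' S"
    obtain k where k: "smooth S c (B1_B1 S) f + Psi S c (slash S f mat_S) - Psi S c f = of_int k"
      using S_formula_Ints[OF f] by (rule Ints_cases)
    show "\<exists>k::int. \<forall>z\<in>upper_half. E_act mat_S f z - E_tilde S c f z = of_int k"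
      by (rule exI[of _ k], rule ballI)
         (simp only: E_act_def moebius_inv_S E_S[OF f] k of_rat_of_int_eq)
  qed
next
  case T
  show ?case unfolding E_shift_def
  proof
    fix f assume f: "f \<in> schwartz' S"
    obtain k where k: "- (1 / 2) * smooth S c (B2_B0 S) (slash S f mat_T) + Psi S c (slash S f mat_T) - Psi S c f = of_int k"
      using T_formula_Ints[OF f] by (rule Ints_cases)
    show "\<exists>k::int. \<forall>z\<in>upper_half. E_act mat_T f z - E_tilde S c f z = of_int k"
      by (rule exI[of _ k], rule ballI)
         (simp only: E_act_def moebius_inv_T E_T[OF f] k of_rat_of_int_eq)
  qed
next
  case (diag x y)
  then show ?case using E_fixed_diag[of x y] unfolding E_shift_def E_fixed_def by (auto intro!: exI[of _ 0])
next
  case (mult g h)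
  show ?case unfolding E_shift_def
  proof
    fix f assume f: "f \<in> schwartz' S"
    obtain j where j: "\<forall>z\<in>upper_half. E_act g f z - E_tilde S c f z = of_int j"
      using mult(3) f unfolding E_shift_def by blast
    obtain k where k: "\<forall>z\<in>upper_half. E_act h (slash S f g) z - E_tilde S c (slash S f g) z = of_int k"
      using mult(4) slash_schwartz'[OF f mult(1)] unfolding E_shift_def by blast
    show "\<exists>k::int. \<forall>z\<in>upper_half. E_act (g ** h) f z - E_tilde S c f z = of_int k"
    proof (intro exI ballI)
      fix z assume z: "z \<in> upper_half"
      have "E_act h (slash S f g) (moebius (matrix_inv g) z) - E_act g f z = of_int k"
        using k moebius_inv_upper_half[OF mult(1) z] by (simp add: E_act_def[of g])
      moreover have "E_act g f z - E_tilde S c f z = of_int j" using j z by blast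
      ultimately show "E_act (g ** h) f z - E_tilde S c f z = of_int (k + j)"
        unfolding E_act_mult[OF mult(1,2) z] of_int_add by (metis diff_add_cancel add_diff_eq diff_add_eq)
    qed
  qed
next
  case (inv g)
  show ?case unfolding E_shift_def
  proof
    fix f assume f: "f \<in> schwartz' S"
    obtain k where k: "\<forall>z\<in>upper_half. E_act g (slash S f (matrix_inv g)) z - E_tilde S c (slash S f (matrix_inv g)) z = of_int k"
      using inv(2) slash_schwartz'[OF f G_S_inv[OF inv(1)]] unfolding E_shift_def by blast
    show "\<exists>k::int. \<forall>z\<in>upper_half. E_act (matrix_inv g) f z - E_tilde S c f z = of_int k"
    proof (intro exI ballI)
      fix z assume z: "z \<in> upper_half"
      obtain f' z' where 1: "f' \<in> schwartz' S" "z' \<in> upper_half" "f' = slash S f (matrix_inv g)"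
        "E_act (matrix_inv g) f z = E_tilde S c f' z'" "E_act g f' z' = E_tilde S c f z" by (rule E_act_inv[OF inv(1) f z])
      have "E_act g f' z' - E_tilde S c f' z' = of_int k" using k 1(2) unfolding 1(3) by blast
      then show "E_act (matrix_inv g) f z - E_tilde S c f z = of_int (- k)"
        unfolding 1(4,5) of_int_minus by (metis minus_diff_eq)
    qed
  qed
qed

text \<open>The value of \<open>DR\<close> is an integer constant on the upper half plane; it is
  read off at i.\<close>

definition DR_int :: "rat^2^2 \<Rightarrow> rat^2^2 \<Rightarrow> (adele2 \<Rightarrow> int) \<Rightarrow> int" where
  "DR_int g0 g1 f = (if g0 \<in> G_S S \<and> g1 \<in> G_S S \<and> f \<in> schwartz' S then \<lfloor>Re (DR S c g0 g1 f \<i>)\<rfloor> else 0)"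

lemma DR_eq_DR_int:
  assumes "g0 \<in> G_S S" "g1 \<in> G_S S" "f \<in> schwartz' S" "z \<in> upper_half"
  shows "DR S c g0 g1 f z = of_int (DR_int g0 g1 f)"
proof -
  obtain j where j: "\<forall>z\<in>upper_half. E_act g0 f z - E_tilde S c f z = of_int j"
    using E_shift_G_S[OF assms(1)] assms(3) unfolding E_shift_def by blast
  obtain k where k: "\<forall>z\<in>upper_half. E_act g1 f z - E_tilde S c f z = of_int k"
    using E_shift_G_S[OF assms(2)] assms(3) unfolding E_shift_def by blast
  have D: "DR S c g0 g1 f z = of_int (k - j)" if z: "z \<in> upper_half" for z
  proof -
    have "DR S c g0 g1 f z = (E_act g1 f z - E_tilde S c f z) - (E_act g0 f z - E_tilde S c f z)"
      unfolding DR_eq[OF assms(3) z] by simp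
    also have "\<dots> = of_int (k - j)" using j k z by (simp only: of_int_diff)
    finally show ?thesis .
  qed
  have "\<i> \<in> upper_half" by (simp add: upper_half_iff)
  from D[OF this] have "DR_int g0 g1 f = k - j" using assms by (simp add: DR_int_def del: of_int_diff)
  then show ?thesis using D[OF assms(4)] by simp
qed

text \<open>A single point z suffices, and it may be chosen freely; equivariance uses this by
  comparing different points.\<close>

lemma DR_int_eqI:
  assumes "g0 \<in> G_S S" "g1 \<in> G_S S" "f \<in> schwartz' S" "z \<in> upper_half" "E_act g1 f z - E_act g0 f z = of_int k"
  shows "DR_int g0 g1 f = k"
proof -
  have "(of_int (DR_int g0 g1 f) :: complex) = of_int k"
    using DR_eq_DR_int[OF assms(1-4)] assms(5) unfolding DR_eq[OF assms(3,4)] by simp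
  then show ?thesis by (simp only: of_int_eq_iff)
qed

lemma E_act_diff_DR_int:
  assumes "g0 \<in> G_S S" "g1 \<in> G_S S" "f \<in> schwartz' S" "z \<in> upper_half"
  shows "E_act g1 f z - E_act g0 f z = of_int (DR_int g0 g1 f)"
  using DR_eq_DR_int[OF assms] unfolding DR_eq[OF assms(3,4)] .

lemma i_upper_half: "\<i> \<in> upper_half"
  by (simp add: upper_half_iff)

lemma DR_int_Z1: "DR_int \<in> Z1 S"
  unfolding Z1_def
proof (intro CollectI conjI allI ballI impI)
  fix g0 g1 assume "\<not> (g0 \<in> G_S S \<and> g1 \<in> G_S S)"
  then show "DR_int g0 g1 = (\<lambda>_. 0)" by (auto simp: DR_int_def)
next
  fix g0 g1 assume g: "g0 \<in> G_S S" "g1 \<in> G_S S"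
  show "DR_int g0 g1 \<in> distributions S"
    unfolding distributions_def
  proof (intro CollectI conjI allI ballI impI)
    fix f h assume fh: "f \<in> schwartz' S" "h \<in> schwartz' S"
    have A: "E_act g (\<lambda>v. f v + h v) \<i> = E_act g f \<i> + E_act g h \<i>" if "g \<in> G_S S" for g
      unfolding E_act_def slash_add
      by (rule is_dist_plus[OF is_dist_E]) (intro moebius_inv_upper_half slash_schwartz' that i_upper_half fh)+
    show "DR_int g0 g1 (\<lambda>v. f v + h v) = DR_int g0 g1 f + DR_int g0 g1 h"
      by (rule DR_int_eqI[OF g schwartz'_add[OF fh] i_upper_half])
         (simp add: A g E_act_diff_DR_int[OF g fh(1) i_upper_half, symmetric] E_act_diff_DR_int[OF g fh(2) i_upper_half, symmetric])
  qed (simp add: DR_int_def)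
next
  fix g g0 g1 assume g: "g \<in> G_S S" "g0 \<in> G_S S" "g1 \<in> G_S S"
  show "DR_int (g ** g0) (g ** g1) = dist_act S (\<lambda>x _. x) g (DR_int g0 g1)"
  proof
    fix f
    show "DR_int (g ** g0) (g ** g1) f = dist_act S (\<lambda>x _. x) g (DR_int g0 g1) f"
    proof (cases "f \<in> schwartz' S")
      case True
      have "DR_int (g ** g0) (g ** g1) f = DR_int g0 g1 (slash S f g)"
        by (rule DR_int_eqI[OF G_S_mult[OF g(1,2)] G_S_mult[OF g(1,3)] True i_upper_half])
           (simp only: E_act_mult[OF g(1,2) i_upper_half] E_act_mult[OF g(1,3) i_upper_half]
             E_act_diff_DR_int[OF g(2,3) slash_schwartz'[OF True g(1)] moebius_inv_upper_half[OF g(1) i_upper_half]])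
      then show ?thesis using True by (simp add: dist_act_def)
    qed (simp add: dist_act_def DR_int_def)
  qed
next
  fix g0 g1 g2 f assume g: "g0 \<in> G_S S" "g1 \<in> G_S S" "g2 \<in> G_S S"
  show "DR_int g1 g2 f - DR_int g0 g2 f + DR_int g0 g1 f = 0"
  proof (cases "f \<in> schwartz' S")
    case True
    have "DR_int g0 g2 f = DR_int g1 g2 f + DR_int g0 g1 f"
      by (rule DR_int_eqI[OF g(1,3) True i_upper_half])
         (simp add: E_act_diff_DR_int[OF g(2,3) True i_upper_half, symmetric] E_act_diff_DR_int[OF g(1,2) True i_upper_half, symmetric])
    then show ?thesis by simp
  qed (simp add: DR_int_def)
qed

section \<open>A cocycle is determined by its values on generators\<close>

lemma Z1_0: "\<Phi> \<in> Z1 S \<Longrightarrow> \<not> (g0 \<in> G_S S \<and> g1 \<in> G_S S \<and> f \<in> schwartz' S) \<Longrightarrow> \<Phi> g0 g1 f = 0"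
  unfolding Z1_def distributions_def by (cases "g0 \<in> G_S S \<and> g1 \<in> G_S S") auto

lemma Z1_left:
  assumes "\<Phi> \<in> Z1 S" "g \<in> G_S S" "h \<in> G_S S" "f \<in> schwartz' S"
  shows "\<Phi> g (g ** h) f = \<Phi> (mat 1) h (slash S f g)"
proof -
  have "\<Phi> (g ** mat 1) (g ** h) = dist_act S (\<lambda>x _. x) g (\<Phi> (mat 1) h)"
    using assms(1-3) G_S_1 unfolding Z1_def by blast
  then show ?thesis using assms(4) by (simp add: dist_act_def)
qed

lemma Z1_cocycle:
  assumes "\<Phi> \<in> Z1 S" "g0 \<in> G_S S" "g1 \<in> G_S S" "g2 \<in> G_S S"
  shows "\<Phi> g0 g2 f = \<Phi> g0 g1 f + \<Phi> g1 g2 f"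
proof -
  have "\<Phi> g1 g2 f - \<Phi> g0 g2 f + \<Phi> g0 g1 f = 0" using assms unfolding Z1_def by blast
  then show ?thesis by simp
qed

text \<open>With the first argument fixed at 1 a homogeneous cocycle becomes a crossed homomorphism,
  so agreement passes from factors to products.\<close>

lemma Z1_mult:
  assumes "\<Phi> \<in> Z1 S" "g \<in> G_S S" "h \<in> G_S S" "f \<in> schwartz' S"
  shows "\<Phi> (mat 1) (g ** h) f = \<Phi> (mat 1) g f + \<Phi> (mat 1) h (slash S f g)"
  using Z1_cocycle[OF assms(1) G_S_1 assms(2) G_S_mult[OF assms(2,3)], of f] Z1_left[OF assms] by simp

lemma Z1_inv:
  assumes "\<Phi> \<in> Z1 S" "g \<in> G_S S" "f \<in> schwartz' S"
  shows "\<Phi> (mat 1) (matrix_inv g) f = - \<Phi> (mat 1) g (slash S f (matrix_inv g))"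
proof -
  have "\<Phi> (mat 1) (matrix_inv g ** g) f = 0"
    using Z1_cocycle[OF assms(1) G_S_1 G_S_1 G_S_1, of f] matrix_inv_mult_self(2)[OF G_S_det_nz[OF assms(2)]] by simp
  then show ?thesis using Z1_mult[OF assms(1) G_S_inv[OF assms(2)] assms(2,3)] by simp
qed

text \<open>The induction treats all test functions simultaneously, since the second factor of a
  product is evaluated at a translated function; equivariance then reaches an arbitrary first
  argument.\<close>

lemma Z1_eqI:
  assumes Z: "\<Phi> \<in> Z1 S" "\<Phi>' \<in> Z1 S"
    and S: "\<And>f. f \<in> schwartz' S \<Longrightarrow> \<Phi> (mat 1) mat_S f = \<Phi>' (mat 1) mat_S f"
    and T: "\<And>f. f \<in> schwartz' S \<Longrightarrow> \<Phi> (mat 1) mat_T f = \<Phi>' (mat 1) mat_T f"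
    and diag: "\<And>x y f. x \<in> Z_S_units S \<Longrightarrow> y \<in> Z_S_units S \<Longrightarrow> x > 0 \<Longrightarrow> y > 0 \<Longrightarrow> f \<in> schwartz' S \<Longrightarrow>
      \<Phi> (mat 1) (mat2 x 0 0 y) f = \<Phi>' (mat 1) (mat2 x 0 0 y) f"
  shows "\<Phi> = \<Phi>'"
proof (intro ext)
  have eq: "\<forall>f\<in>schwartz' S. \<Phi> (mat 1) g f = \<Phi>' (mat 1) g f" if "g \<in> G_S S" for g
    using that
  proof (induction rule: G_S_induct)
    case (mult g h)
    then show ?case using Z1_mult[OF Z(1) mult(1,2)] Z1_mult[OF Z(2) mult(1,2)] slash_schwartz'[OF _ mult(1)] by simp
  next
    case (inv g)
    then show ?case using Z1_inv[OF Z(1) inv(1)] Z1_inv[OF Z(2) inv(1)] slash_schwartz'[OF _ G_S_inv[OF inv(1)]] by simp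
  qed (use S T diag in auto)
  fix g0 g1 f
  show "\<Phi> g0 g1 f = \<Phi>' g0 g1 f"
  proof (cases "g0 \<in> G_S S \<and> g1 \<in> G_S S \<and> f \<in> schwartz' S")
    case True
    then have g: "g0 \<in> G_S S" "g1 \<in> G_S S" "f \<in> schwartz' S" by simp_all
    let ?h = "matrix_inv g0 ** g1"
    have h: "?h \<in> G_S S" using g by (intro G_S_mult G_S_inv)
    have "g0 ** ?h = g1" using matrix_inv_mult_self(1)[OF G_S_det_nz[OF g(1)]] by (simp add: matrix_mul_assoc)
    then show ?thesis
      using Z1_left[OF Z(1) g(1) h g(3)] Z1_left[OF Z(2) g(1) h g(3)] eq[OF h] slash_schwartz'[OF g(3,1)] by simp
  qed (use Z1_0[OF Z(1)] Z1_0[OF Z(2)] in simp)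
qed

lemma DR_int_diag:
  assumes "x \<in> Z_S_units S" "y \<in> Z_S_units S" "x > 0" "y > 0" "f \<in> schwartz' S"
  shows "DR_int (mat 1) (mat2 x 0 0 y) f = 0"
  using E_fixed_diag[OF assms(1,3,2,4)] assms(5) i_upper_half
  by (intro DR_int_eqI[OF G_S_1 G_S_diag[OF assms(1-4)] assms(5) i_upper_half]) (simp add: E_fixed_def E_act_1)

lemma DR_int_rat:
  assumes "g \<in> G_S S" "f \<in> schwartz' S" "E_act g f \<i> - E_tilde S c f \<i> = of_rat x"
  shows "of_int (DR_int (mat 1) g f) = x"
proof -
  have "(of_rat (of_int (DR_int (mat 1) g f)) :: complex) = of_rat x"
    using E_act_diff_DR_int[OF G_S_1 assms(1,2) i_upper_half] assms(3) E_act_1[OF assms(2)] by simp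
  then show ?thesis by (simp only: of_rat_eq_iff)
qed

text \<open>Both entries are integral at \<open>S\<close> and their product is a unit, so each of
  them is a unit.\<close>

lemma T_S_cases:
  assumes "g \<in> T_S S" "g $ 1 $ 1 > 0" "g $ 2 $ 2 > 0"
  obtains x y where "g = mat2 x 0 0 y" "x \<in> Z_S_units S" "y \<in> Z_S_units S" "x > 0" "y > 0"
proof -
  obtain x q r y where eq: "g = mat2 x q r y" by (rule mat2_cases)
  have g: "q = 0" "r = 0" "x > 0" "y > 0" "x \<in> Z_S S" "y \<in> Z_S S" "x * y \<in> Z_S_units S"
    using assms by (auto simp: T_S_def eq G_S_mat2)
  have "inverse x = y * inverse (x * y)" "inverse y = x * inverse (x * y)" using g by (simp_all add: field_simps)
  then have "inverse x \<in> Z_S S" "inverse y \<in> Z_S S"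
    using g Z_S_mult Z_S_units_in[OF Z_S_units_inverse[OF g(7)]] by metis+
  then show ?thesis using g by (intro that[of x y]) (auto simp: eq Z_S_units_def)
qed

end

text \<open>\<open>DR\<close> has values in functions of \<tau> and a member of \<open>Z1\<close> in
  integers; the equation with \<open>of_int\<close> identifies the two. The torus condition does not
  reach -1, but -1 = S^2, so the condition on S fixes the value there.\<close>

theorem mainTheorem2:
  fixes c :: nat and S :: "nat set"
    and properties :: "(rat^2^2 \<Rightarrow> rat^2^2 \<Rightarrow> (adele2 \<Rightarrow> int) \<Rightarrow> int) \<Rightarrow> bool"
  assumes "c > 1" and "coprime c 6"
  defines "S \<equiv> {l. prime l \<and> l dvd c}"
  defines "properties \<equiv> (\<lambda>\<Phi>.
     (\<forall>\<gamma>\<in>T_S S. \<gamma> $ 1 $ 1 > 0 \<and> \<gamma> $ 2 $ 2 > 0 \<longrightarrow> (\<forall>f\<in>schwartz' S. \<Phi> (mat 1) \<gamma> f = 0)) \<and>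
     (\<forall>f\<in>schwartz' S. of_int (\<Phi> (mat 1) mat_T f) =
        - (1 / 2) * smooth S c (B2_B0 S) (slash S f mat_T)
        + Psi S c (slash S f mat_T) - Psi S c f) \<and>
     (\<forall>f\<in>schwartz' S. of_int (\<Phi> (mat 1) mat_S f) =
        smooth S c (B1_B1 S) f
        + Psi S c (slash S f mat_S) - Psi S c f))"
  shows "\<exists>\<Phi>\<in>Z1 S.
     (\<forall>\<gamma>0\<in>G_S S. \<forall>\<gamma>1\<in>G_S S. \<forall>f\<in>schwartz' S. \<forall>\<tau>\<in>upper_half.
        DR S c \<gamma>0 \<gamma>1 f \<tau> = of_int (\<Phi> \<gamma>0 \<gamma>1 f)) \<and>
     properties \<Phi> \<and>
     (\<forall>\<Phi>'\<in>Z1 S. properties \<Phi>' \<longrightarrow> \<Phi>' = \<Phi>)"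
proof -
  interpret smoothing c S by unfold_locales (use assms(1,2) in \<open>auto simp: S_def\<close>)
  have diag0: "\<Phi> (mat 1) (mat2 x 0 0 y) f = 0"
    if "properties \<Phi>" "x \<in> Z_S_units S" "y \<in> Z_S_units S" "x > 0" "y > 0" "f \<in> schwartz' S" for \<Phi> x y f
  proof -
    have "mat2 x 0 0 y \<in> T_S S" using G_S_diag[OF that(2-5)] by (simp add: T_S_def)
    then show ?thesis using that(1,4-6) unfolding properties_def by (metis mat2_nth(1,4))
  qed
  have TS: "of_int (\<Phi> (mat 1) mat_T f) = - (1 / 2) * smooth S c (B2_B0 S) (slash S f mat_T)
        + Psi S c (slash S f mat_T) - Psi S c f"
    "of_int (\<Phi> (mat 1) mat_S f) = smooth S c (B1_B1 S) f + Psi S c (slash S f mat_S) - Psi S c f"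
    if "properties \<Phi>" "f \<in> schwartz' S" for \<Phi> f
    using that unfolding properties_def by blast+
  have P: "properties DR_int"
    unfolding properties_def
  proof (intro conjI ballI impI)
    fix \<gamma> f assume "\<gamma> \<in> T_S S" "0 < \<gamma> $ 1 $ 1 \<and> 0 < \<gamma> $ 2 $ 2" and f: "f \<in> schwartz' S"
    then obtain x y where "\<gamma> = mat2 x 0 0 y" "x \<in> Z_S_units S" "y \<in> Z_S_units S" "x > 0" "y > 0"
      using T_S_cases by blast
    then show "DR_int (mat 1) \<gamma> f = 0" using DR_int_diag f by simp
  next
    fix f assume f: "f \<in> schwartz' S"
    show "of_int (DR_int (mat 1) mat_T f) = - (1 / 2) * smooth S c (B2_B0 S) (slash S f mat_T)
        + Psi S c (slash S f mat_T) - Psi S c f"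
      by (rule DR_int_rat[OF G_S_T f]) (simp only: E_act_def moebius_inv_T E_T[OF f i_upper_half])
    show "of_int (DR_int (mat 1) mat_S f) = smooth S c (B1_B1 S) f + Psi S c (slash S f mat_S) - Psi S c f"
      by (rule DR_int_rat[OF G_S_S f]) (simp only: E_act_def moebius_inv_S E_S[OF f i_upper_half])
  qed
  have U: "\<Phi> = DR_int" if \<Phi>: "\<Phi> \<in> Z1 S" "properties \<Phi>" for \<Phi>
  proof (rule Z1_eqI[OF \<Phi>(1) DR_int_Z1])
    fix f assume f: "f \<in> schwartz' S"
    have "(of_int (\<Phi> (mat 1) mat_T f) :: rat) = of_int (DR_int (mat 1) mat_T f)"
      unfolding TS(1)[OF \<Phi>(2) f] TS(1)[OF P f] ..
    then show "\<Phi> (mat 1) mat_T f = DR_int (mat 1) mat_T f" by (simp only: of_int_eq_iff)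
    have "(of_int (\<Phi> (mat 1) mat_S f) :: rat) = of_int (DR_int (mat 1) mat_S f)"
      unfolding TS(2)[OF \<Phi>(2) f] TS(2)[OF P f] ..
    then show "\<Phi> (mat 1) mat_S f = DR_int (mat 1) mat_S f" by (simp only: of_int_eq_iff)
  next
    fix x y f assume a: "x \<in> Z_S_units S" "y \<in> Z_S_units S" "x > 0" "y > 0" "f \<in> schwartz' S"
    show "\<Phi> (mat 1) (mat2 x 0 0 y) f = DR_int (mat 1) (mat2 x 0 0 y) f"
      unfolding diag0[OF \<Phi>(2) a] diag0[OF P a] ..
  qed
  show ?thesis
  proof (intro bexI[of _ DR_int] conjI ballI impI)
    show "DR S c \<gamma>0 \<gamma>1 f \<tau> = of_int (DR_int \<gamma>0 \<gamma>1 f)"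
      if "\<gamma>0 \<in> G_S S" "\<gamma>1 \<in> G_S S" "f \<in> schwartz' S" "\<tau> \<in> upper_half" for \<gamma>0 \<gamma>1 f \<tau>
      using that by (rule DR_eq_DR_int)
    show "\<Phi>' = DR_int" if "\<Phi>' \<in> Z1 S" "properties \<Phi>'" for \<Phi>'
      using that by (rule U)
  qed (rule P, rule DR_int_Z1)
qed

end
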